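(* Let $\Lambda\subset\mathbb R^2$ be a two-dimensional lattice, let $\mathbb T=\mathbb R^2/\Lambda$, let $1<p<\infty$, and let $\mathbb E_1$ be the first eigenspace of $-\Delta$ on mean-zero functions on $\mathbb T$. Then every $\bar\omega\in\mathbb E_1$ is stable up to translations in the following sense: for any $\varepsilon>0$ there exists $\delta>0$ such that for any $L^p$-admissible map $\zeta$, if $$\|\zeta(0)-\bar\omega\|_{L^p(\mathbb T)}<\delta,$$ then for any $t\in\mathbb R$ there exists $\boldsymbol p\in\mathbb R^2$ such that $$\|\zeta(t)-\bar\omega(\cdot-\boldsymbol p)\|_{L^p(\mathbb T)}<\varepsilon.$$
   Context: A two-dimensional lattice is $\Lambda=\{m\boldsymbol\xi+n\boldsymbol\eta\mid m,n\in\mathbb Z\}$ with $\boldsymbol\xi,\boldsymbol\eta\in\mathbb R^2$ linearly independent. $\mathbb T=\mathbb R^2/\Lambda$ is the flat 2-torus with the Euclidean metric and Lebesgue measure $|\cdot|$; functions on $\mathbb T$ are $\Lambda$-periodic functions on $\mathbb R^2$, real-valued, identified when equal a.e. A small circle denotes the mean-zero subspace: $\mathring L^p(\mathbb T)=\{f\in L^p(\mathbb T)\mid\int_{\mathbb T}f\,d\boldsymbol x=0\}$, and similarly $\mathring W^{2,p}(\mathbb T)$. First eigenspace: $\lambda_1>0$ is the smallest eigenvalue of $-\Delta u=\lambda u$ on $\mathbb T$, $\int_{\mathbb T}u\,d\boldsymbol x=0$, and $\mathbb E_1$ is the corresponding eigenspace of real-valued functions. Explicitly, with the dual lattice $\Lambda^*=\{\boldsymbol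 k\in\mathbb R^2\mid \boldsymbol k\cdot\boldsymbol\xi\in\mathbb Z,\ \boldsymbol k\cdot\boldsymbol\eta\in\mathbb Z\}$, $\rho(\Lambda^* )=\min_{\boldsymbol k\in\Lambda^*\setminus\{0\}}|\boldsymbol k|$ and $S(\Lambda^* )=\{\boldsymbol k\in\Lambda^*\mid|\boldsymbol k|=\rho(\Lambda^* )\}$, one has $\lambda_1=4\pi^2\rho(\Lambda^* )^2$ and $\mathbb E_1$ is the real span of $\cos(2\pi\boldsymbol k\cdot\boldsymbol x),\sin(2\pi\boldsymbol k\cdot\boldsymbol x)$, $\boldsymbol k\in S(\Lambda^* )$. Energy: for $f\in\mathring L^p(\mathbb T)$, $\mathsf Gf\in\mathring W^{2,p}(\mathbb T)$ is the unique mean-zero solution $u$ of $-\Delta u=f$ on $\mathbb T$, and $E(f)=\frac12\int_{\mathbb T}f\,\mathsf Gf\,d\boldsymbol x$. Rearrangement class: for measurable $f:\mathbb T\to\mathbb R$, $\mathcal R_f$ is the set of measurable $g:\mathbb T\to\mathbb R$ with $|\{g>s\}|=|\{f>s\}|$ for all $s\in\mathbb R$. $L^p$-admissible map: $\zeta\in C(\mathbb R;\mathring L^p(\mathbb T))$ such that $E(\zeta(t))=E(\zeta(0))$ and $\zeta(t)\in\mathcal R_{\zeta(0)}$ for all $t\in\mathbb R$. *)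

theory Defs
  imports "HOL-Analysis.Analysis"
begin

definition period_lattice :: "real^2 \<Rightarrow> real^2 \<Rightarrow> (real^2) set" where
  "period_lattice \<xi> \<eta> = {of_int m *\<^sub>R \<xi> + of_int n *\<^sub>R \<eta> |m n :: int. True}"

text \<open>
  A function on the torus is represented by a lattice-periodic function on the plane, and an
  integral over the torus is an integral over the half-open fundamental parallelogram.
  Equality almost everywhere is not quotiented out.
\<close>

definition periodic :: "real^2 \<Rightarrow> real^2 \<Rightarrow> (real^2 \<Rightarrow> real) \<Rightarrow> bool" where
  "periodic \<xi> \<eta> f \<longleftrightarrow> (\<forall>v \<in> period_lattice \<xi> \<eta>. \<forall>x. f (x + v) = f x)"

definition fundamental_cell :: "real^2 \<Rightarrow> real^2 \<Rightarrow> (real^2) set" where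
  "fundamental_cell \<xi> \<eta> = {s *\<^sub>R \<xi> + t *\<^sub>R \<eta> |s t :: real. 0 \<le> s \<and> s < 1 \<and> 0 \<le> t \<and> t < 1}"

definition torus :: "real^2 \<Rightarrow> real^2 \<Rightarrow> (real^2) measure" where
  "torus \<xi> \<eta> = lebesgue_on (fundamental_cell \<xi> \<eta>)"

definition torus_measurable :: "real^2 \<Rightarrow> real^2 \<Rightarrow> (real^2 \<Rightarrow> real) set" where
  "torus_measurable \<xi> \<eta> = {f. periodic \<xi> \<eta> f \<and> f \<in> borel_measurable (torus \<xi> \<eta>)}"

definition Lp :: "real^2 \<Rightarrow> real^2 \<Rightarrow> real \<Rightarrow> (real^2 \<Rightarrow> real) set" where
  "Lp \<xi> \<eta> p = {f \<in> torus_measurable \<xi> \<eta>. integrable (torus \<xi> \<eta>) (\<lambda>x. \<bar>f x\<bar> powr p)}"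

definition Lp_norm :: "real^2 \<Rightarrow> real^2 \<Rightarrow> real \<Rightarrow> (real^2 \<Rightarrow> real) \<Rightarrow> real" where
  "Lp_norm \<xi> \<eta> p f = (\<integral>x. \<bar>f x\<bar> powr p \<partial>torus \<xi> \<eta>) powr (1 / p)"

definition mean_zero :: "real^2 \<Rightarrow> real^2 \<Rightarrow> (real^2 \<Rightarrow> real) set" where
  "mean_zero \<xi> \<eta> = {f. (\<integral>x. f x \<partial>torus \<xi> \<eta>) = 0}"

definition Lp0 :: "real^2 \<Rightarrow> real^2 \<Rightarrow> real \<Rightarrow> (real^2 \<Rightarrow> real) set" where
  "Lp0 \<xi> \<eta> p = Lp \<xi> \<eta> p \<inter> mean_zero \<xi> \<eta>"

definition partial_deriv :: "2 \<Rightarrow> (real^2 \<Rightarrow> real) \<Rightarrow> real^2 \<Rightarrow> real" where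
  "partial_deriv i f x = frechet_derivative f (at x) (axis i 1)"

text \<open>
  Being infinitely differentiable: every iterated partial derivative, including the function
  itself (the empty list), is differentiable everywhere.
\<close>

definition smooth :: "(real^2 \<Rightarrow> real) \<Rightarrow> bool" where
  "smooth f \<longleftrightarrow> (\<forall>is. foldr partial_deriv is f differentiable_on UNIV)"

text \<open>
  Weak derivatives on the closed manifold \<open>\<real>\<^sup>2/\<Lambda>\<close>: the test functions are all smooth periodic
  functions, with no support condition, and there are no boundary terms.
\<close>

definition weak_partial_deriv ::
    "real^2 \<Rightarrow> real^2 \<Rightarrow> 2 \<Rightarrow> (real^2 \<Rightarrow> real) \<Rightarrow> (real^2 \<Rightarrow> real) \<Rightarrow> bool" where
  "weak_partial_deriv \<xi> \<eta> i u v \<longleftrightarrow>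
     (\<forall>\<phi>. smooth \<phi> \<and> periodic \<xi> \<eta> \<phi> \<longrightarrow>
        (\<integral>x. u x * partial_deriv i \<phi> x \<partial>torus \<xi> \<eta>) = - (\<integral>x. v x * \<phi> x \<partial>torus \<xi> \<eta>))"

definition weak_derivs_Lp ::
    "real^2 \<Rightarrow> real^2 \<Rightarrow> real \<Rightarrow> (real^2 \<Rightarrow> real) \<Rightarrow>
       (2 \<Rightarrow> real^2 \<Rightarrow> real) \<Rightarrow> (2 \<Rightarrow> 2 \<Rightarrow> real^2 \<Rightarrow> real) \<Rightarrow> bool" where
  "weak_derivs_Lp \<xi> \<eta> p u D H \<longleftrightarrow>
     (\<forall>i. D i \<in> Lp \<xi> \<eta> p \<and> weak_partial_deriv \<xi> \<eta> i u (D i)) \<and>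
     (\<forall>i j. H i j \<in> Lp \<xi> \<eta> p \<and> weak_partial_deriv \<xi> \<eta> j (D i) (H i j))"

definition W2p :: "real^2 \<Rightarrow> real^2 \<Rightarrow> real \<Rightarrow> (real^2 \<Rightarrow> real) set" where
  "W2p \<xi> \<eta> p = {u \<in> Lp \<xi> \<eta> p. \<exists>D H. weak_derivs_Lp \<xi> \<eta> p u D H}"

definition W2p0 :: "real^2 \<Rightarrow> real^2 \<Rightarrow> real \<Rightarrow> (real^2 \<Rightarrow> real) set" where
  "W2p0 \<xi> \<eta> p = W2p \<xi> \<eta> p \<inter> mean_zero \<xi> \<eta>"

text \<open>\<open>u \<in> W2p0\<close> solves \<open>- \<Delta>u = f\<close>, where \<open>\<Delta>u\<close> is the trace of the weak Hessian.\<close>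

definition poisson_solution ::
    "real^2 \<Rightarrow> real^2 \<Rightarrow> real \<Rightarrow> (real^2 \<Rightarrow> real) \<Rightarrow> (real^2 \<Rightarrow> real) \<Rightarrow> bool" where
  "poisson_solution \<xi> \<eta> p f u \<longleftrightarrow>
     u \<in> W2p0 \<xi> \<eta> p \<and>
     (\<exists>D H. weak_derivs_Lp \<xi> \<eta> p u D H \<and> (AE x in torus \<xi> \<eta>. - (\<Sum>i\<in>UNIV. H i i x) = f x))"

text \<open>
  The solution is unique only up to equality almost everywhere, hence the choice of a
  representative; the energy does not depend on it.
\<close>

definition G :: "real^2 \<Rightarrow> real^2 \<Rightarrow> real \<Rightarrow> (real^2 \<Rightarrow> real) \<Rightarrow> real^2 \<Rightarrow> real" where
  "G \<xi> \<eta> p f = (SOME u. poisson_solution \<xi> \<eta> p f u)"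

definition energy :: "real^2 \<Rightarrow> real^2 \<Rightarrow> real \<Rightarrow> (real^2 \<Rightarrow> real) \<Rightarrow> real" where
  "energy \<xi> \<eta> p f = 1 / 2 * (\<integral>x. f x * G \<xi> \<eta> p f x \<partial>torus \<xi> \<eta>)"

text \<open>
  The spectrum of \<open>- \<Delta>\<close> on mean-zero functions, with eigenfunctions taken in the \<open>L\<^sup>2\<close> Sobolev
  space of order two, the domain of the self-adjoint operator.
\<close>

definition laplace_eigenvalue :: "real^2 \<Rightarrow> real^2 \<Rightarrow> real \<Rightarrow> bool" where
  "laplace_eigenvalue \<xi> \<eta> c \<longleftrightarrow>
     (\<exists>u. poisson_solution \<xi> \<eta> 2 (\<lambda>x. c * u x) u \<and> \<not> (AE x in torus \<xi> \<eta>. u x = 0))"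

definition first_eigenvalue :: "real^2 \<Rightarrow> real^2 \<Rightarrow> real" where
  "first_eigenvalue \<xi> \<eta> = (LEAST c. laplace_eigenvalue \<xi> \<eta> c)"

definition first_eigenspace :: "real^2 \<Rightarrow> real^2 \<Rightarrow> (real^2 \<Rightarrow> real) set" where
  "first_eigenspace \<xi> \<eta> = {u. poisson_solution \<xi> \<eta> 2 (\<lambda>x. first_eigenvalue \<xi> \<eta> * u x) u}"

definition rearrangements :: "real^2 \<Rightarrow> real^2 \<Rightarrow> (real^2 \<Rightarrow> real) \<Rightarrow> (real^2 \<Rightarrow> real) set" where
  "rearrangements \<xi> \<eta> f =
     {g \<in> torus_measurable \<xi> \<eta>. \<forall>s. measure (torus \<xi> \<eta>) {x \<in> space (torus \<xi> \<eta>). g x > s} =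
                                    measure (torus \<xi> \<eta>) {x \<in> space (torus \<xi> \<eta>). f x > s}}"

definition Lp_continuous :: "real^2 \<Rightarrow> real^2 \<Rightarrow> real \<Rightarrow> (real \<Rightarrow> real^2 \<Rightarrow> real) \<Rightarrow> bool" where
  "Lp_continuous \<xi> \<eta> p \<zeta> \<longleftrightarrow>
     (\<forall>t0. ((\<lambda>t. Lp_norm \<xi> \<eta> p (\<lambda>x. \<zeta> t x - \<zeta> t0 x)) \<longlongrightarrow> 0) (at t0))"

definition admissible_map :: "real^2 \<Rightarrow> real^2 \<Rightarrow> real \<Rightarrow> (real \<Rightarrow> real^2 \<Rightarrow> real) \<Rightarrow> bool" where
  "admissible_map \<xi> \<eta> p \<zeta> \<longleftrightarrow>
     (\<forall>t. \<zeta> t \<in> Lp0 \<xi> \<eta> p) \<and> Lp_continuous \<xi> \<eta> p \<zeta> \<and>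
     (\<forall>t. energy \<xi> \<eta> p (\<zeta> t) = energy \<xi> \<eta> p (\<zeta> 0)) \<and>
     (\<forall>t. \<zeta> t \<in> rearrangements \<xi> \<eta> (\<zeta> 0))"

end

theory Submission imports Defs
begin

text \<open>
  On Fourier coefficients the energy is the quadratic form \<open>\<Sum>k. \<bar>f\<^sub>k\<bar>\<^sup>2 / (2 \<lambda>\<^sub>k)\<close>, so
  \<open>2 E f \<le> \<parallel>f\<parallel>\<^sup>2 / \<lambda>\<^sub>1\<close> with equality exactly on the first eigenspace, and by the spectral gap near-equality
  forces closeness to it. If \<open>\<zeta> 0\<close> is close to an eigenfunction \<open>\<omega>\<close>, then \<open>\<zeta> t\<close>, truncated at the height of
  \<open>\<omega>\<close>, has nearly the same \<open>L\<^sup>2\<close> norm and energy as \<open>\<omega>\<close>; so \<open>\<zeta> t\<close> is close to some eigenfunction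
  \<open>2 Re (\<Sum>j. v\<^sub>j exp (2 \<pi> i k\<^sub>j \<bullet> x))\<close>, \<open>k\<^sub>1 + k\<^sub>2 + k\<^sub>3 = 0\<close>, nearly equimeasurable with \<open>\<omega>\<close>. The moments of
  order 2, 3, 4 and 6 determine the amplitudes \<open>\<bar>v\<^sub>j\<bar>\<close> and the phase \<open>v\<^sub>1 v\<^sub>2 v\<^sub>3\<close> up to finitely many
  possibilities, so the translation orbit of \<open>\<omega>\<close> is isolated among the equimeasurable eigenfunctions, and
  continuity in \<open>t\<close> keeps the path near this orbit.

  The energy is defined through solutions in \<open>W2p\<close>. They exist by a Calderon--Zygmund inequality for
  trigonometric polynomials, which follows from the monotonicity of a Bellman function along the heat flow.
\<close>

text \<open>Equal energy and equal distribution do not single out the orbit of \<omega>: reflecting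
  \<omega> conjugates the phase, and permuting the amplitudes changes no moment. Finitely many
  orbits remain, so closeness at time \<open>t\<close> can only come from following the path. Three
  phases face a two-parameter group of translations, which leaves one phase invariant, the argument
  of the product of the three coefficients. The moments of order 2, 3, 4 do not determine the
  modulus of this product; the fifth is a multiple of the product of the second and third, so the
  sixth is the next one to help.

  For \<open>p < 2\<close> the functions on the path need not lie in L2, where the spectral gap
  lives; hence the truncation. It commutes with rearrangement but spoils zero mean and conservation
  of energy; both are recovered in the limit from a Lipschitz bound of the energy in the L1 distance
  on sets bounded in Lp. That bound needs bounded potentials, hence two derivatives in Lp; the same
  estimate makes the choice in \<open>G\<close> denote a solution.\<close>

lemma abs_powr_le:
  fixes a e p :: real
  assumes "1 \<le> p" "0 < e"
  shows "\<bar>a\<bar> \<le> e + e powr (1 - p) * \<bar>a\<bar> powr p"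
proof (cases "\<bar>a\<bar> \<le> e")
  case True
  then show ?thesis using powr_ge_zero[of e "1-p"] powr_ge_zero[of "\<bar>a\<bar>" p]
    by (simp add: add_increasing2)
next
  case False
  then have a: "\<bar>a\<bar> > e" by simp
  have "\<bar>a\<bar> = \<bar>a\<bar> powr (1 - p) * \<bar>a\<bar> powr p"
    using a assms by (simp add: powr_add[symmetric])
  also have "\<dots> \<le> e powr (1 - p) * \<bar>a\<bar> powr p"
    using a assms by (intro mult_right_mono powr_mono2') auto
  finally show ?thesis using assms by simp
qed

text \<open>A substitute for Minkowski's inequality on the level of \<open>p\<close>-th powers. The
  constant is crude because only finite constants and convergence to zero are drawn from it.\<close>

lemma abs_add_powr_le:
  fixes a b p :: real
  assumes "0 \<le> p"
  shows "\<bar>a + b\<bar> powr p \<le> 2 powr p * (\<bar>a\<bar> powr p + \<bar>b\<bar> powr p)"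
proof -
  have "\<bar>a + b\<bar> powr p \<le> (2 * max \<bar>a\<bar> \<bar>b\<bar>) powr p"
    using assms by (intro powr_mono2) auto
  also have "\<dots> = 2 powr p * max \<bar>a\<bar> \<bar>b\<bar> powr p"
    by (simp add: powr_mult)
  also have "\<dots> \<le> 2 powr p * (\<bar>a\<bar> powr p + \<bar>b\<bar> powr p)"
    by (intro mult_left_mono) (auto simp: max_def)
  finally show ?thesis .
qed

lemma abs_powr_le_bounded:
  fixes a C p :: real
  assumes "1 \<le> p" "\<bar>a\<bar> \<le> C"
  shows "\<bar>a\<bar> powr p \<le> C powr (p - 1) * \<bar>a\<bar>"
proof (cases "a = 0")
  case False
  have "\<bar>a\<bar> powr p = \<bar>a\<bar> powr (p - 1) * \<bar>a\<bar> powr 1"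
    by (simp only: powr_add[symmetric]) simp
  also have "\<dots> \<le> C powr (p - 1) * \<bar>a\<bar> powr 1"
    using assms by (intro mult_right_mono powr_mono2) auto
  finally show ?thesis using False by simp
qed simp

section \<open>The fundamental cell\<close>

locale lattice2 =
  fixes \<xi> \<eta> :: "real^2"
  assumes neq: "\<xi> \<noteq> \<eta>" and indep: "independent {\<xi>, \<eta>}"
begin

abbreviation "T \<equiv> torus \<xi> \<eta>"
abbreviation "cell \<equiv> fundamental_cell \<xi> \<eta>"
abbreviation "per \<equiv> periodic \<xi> \<eta>"

definition dl :: "(real^2) set" where
  "dl = {k. k \<bullet> \<xi> \<in> \<int> \<and> k \<bullet> \<eta> \<in> \<int>}"

lemma combination_zeroD:
  assumes "a *\<^sub>R \<xi> + b *\<^sub>R \<eta> = 0" shows "a = 0" "b = 0"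
proof -
  have e: "\<eta> \<notin> span {\<xi>}" "\<xi> \<noteq> 0"
    using indep neq by (auto simp: independent_insert insert_commute dependent_zero)
  show "b = 0"
  proof (rule ccontr)
    assume b: "b \<noteq> 0"
    have "b *\<^sub>R \<eta> = (- a) *\<^sub>R \<xi>" using assms by (simp add: eq_neg_iff_add_eq_0 add.commute)
    then have "(1/b) *\<^sub>R (b *\<^sub>R \<eta>) = (1/b) *\<^sub>R ((- a) *\<^sub>R \<xi>)" by simp
    then have "\<eta> = (- a / b) *\<^sub>R \<xi>" using b by simp
    then show False using e(1) by (metis span_base span_scale singletonI)
  qed
  then show "a = 0" using assms e(2) by simp
qed

definition "dt = \<xi>$1 * \<eta>$2 - \<xi>$2 * \<eta>$1"

lemma dt_nonzero: "dt \<noteq> 0"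
proof
  assume d: "dt = 0"
  have "\<eta>$1 *\<^sub>R \<xi> + (- \<xi>$1) *\<^sub>R \<eta> = 0" "\<eta>$2 *\<^sub>R \<xi> + (- \<xi>$2) *\<^sub>R \<eta> = 0"
    using d by (auto simp: vec_eq_iff dt_def forall_2 algebra_simps)
  from combination_zeroD(2)[OF this(1)] combination_zeroD(2)[OF this(2)]
  have "\<xi> = 0" by (simp add: vec_eq_iff forall_2)
  then have "1 *\<^sub>R \<xi> + 0 *\<^sub>R \<eta> = 0" by simp
  from combination_zeroD(1)[OF this] show False by simp
qed

text \<open>\<open>xs\<close> and \<open>ys\<close> are the rows of the inverse of the matrix with
  columns \<xi> and \<eta>: the dual basis. Hence \<open>xs \<bullet> x\<close> and
  \<open>ys \<bullet> x\<close> are the lattice coordinates of \<open>x\<close>.\<close>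

definition xs :: "real^2" where "xs = vector [\<eta>$2 / dt, - \<eta>$1 / dt]"
definition ys :: "real^2" where "ys = vector [- \<xi>$2 / dt, \<xi>$1 / dt]"

lemma dual_basis [simp]:
  "xs \<bullet> \<xi> = 1" "xs \<bullet> \<eta> = 0" "ys \<bullet> \<xi> = 0" "ys \<bullet> \<eta> = 1"
  using dt_nonzero
  by (simp_all add: xs_def ys_def inner_vec_def sum_2 dt_def[symmetric] field_simps)
     (simp_all add: dt_def algebra_simps)

lemma decompose: "x = (xs \<bullet> x) *\<^sub>R \<xi> + (ys \<bullet> x) *\<^sub>R \<eta>"
proof -
  have "dt * x$1 = dt * ((xs \<bullet> x) *\<^sub>R \<xi> + (ys \<bullet> x) *\<^sub>R \<eta>)$1"
       "dt * x$2 = dt * ((xs \<bullet> x) *\<^sub>R \<xi> + (ys \<bullet> x) *\<^sub>R \<eta>)$2"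
    using dt_nonzero
    by (simp_all add: xs_def ys_def inner_vec_def sum_2 field_simps) (simp_all add: dt_def algebra_simps)
  then show ?thesis using dt_nonzero by (simp add: vec_eq_iff forall_2)
qed

lemma decompose_dual: "k = (k \<bullet> \<xi>) *\<^sub>R xs + (k \<bullet> \<eta>) *\<^sub>R ys"
proof -
  have "(k - ((k \<bullet> \<xi>) *\<^sub>R xs + (k \<bullet> \<eta>) *\<^sub>R ys)) \<bullet> x = 0" for x
  proof -
    obtain s t where "x = s *\<^sub>R \<xi> + t *\<^sub>R \<eta>" using decompose by blast
    then show ?thesis by (simp add: inner_add_left inner_add_right inner_diff_left algebra_simps)
  qed
  then show ?thesis by (metis inner_eq_zero_iff right_minus_eq)
qed

lemma cell_eq: "cell = {x. 0 \<le> xs \<bullet> x \<and> xs \<bullet> x < 1 \<and> 0 \<le> ys \<bullet> x \<and> ys \<bullet> x < 1}"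
proof (intro set_eqI iffI)
  fix x assume "x \<in> cell"
  then obtain s t where "x = s *\<^sub>R \<xi> + t *\<^sub>R \<eta>" "0 \<le> s" "s < 1" "0 \<le> t" "t < 1"
    by (auto simp: fundamental_cell_def)
  then show "x \<in> {x. 0 \<le> xs \<bullet> x \<and> xs \<bullet> x < 1 \<and> 0 \<le> ys \<bullet> x \<and> ys \<bullet> x < 1}"
    by (simp add: inner_add_right)
next
  fix x assume "x \<in> {x. 0 \<le> xs \<bullet> x \<and> xs \<bullet> x < 1 \<and> 0 \<le> ys \<bullet> x \<and> ys \<bullet> x < 1}"
  then show "x \<in> cell" using decompose[of x] by (auto simp: fundamental_cell_def)
qed

lemma lattice_eq: "period_lattice \<xi> \<eta> = {v. xs \<bullet> v \<in> \<int> \<and> ys \<bullet> v \<in> \<int>}"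
proof (intro set_eqI iffI)
  fix x assume "x \<in> {v. xs \<bullet> v \<in> \<int> \<and> ys \<bullet> v \<in> \<int>}"
  then obtain m n where "xs \<bullet> x = of_int m" "ys \<bullet> x = of_int n" by (auto elim!: Ints_cases)
  then show "x \<in> period_lattice \<xi> \<eta>" using decompose[of x] by (auto simp: period_lattice_def)
qed (auto simp: period_lattice_def inner_add_right)

lemma xi_lattice: "\<xi> \<in> period_lattice \<xi> \<eta>" and eta_lattice: "\<eta> \<in> period_lattice \<xi> \<eta>"
  by (auto simp: lattice_eq)

lemma period_shift: "per f \<Longrightarrow> f (x + \<xi>) = f x" "per f \<Longrightarrow> f (x + \<eta>) = f x"
  "per f \<Longrightarrow> f (x - \<xi>) = f x" "per f \<Longrightarrow> f (x - \<eta>) = f x"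
  using xi_lattice eta_lattice unfolding periodic_def
  by (metis, metis, metis diff_add_cancel, metis diff_add_cancel)

definition red :: "real^2 \<Rightarrow> real^2" where
  "red x = frac (xs \<bullet> x) *\<^sub>R \<xi> + frac (ys \<bullet> x) *\<^sub>R \<eta>"

lemma red_cell: "red x \<in> cell"
  by (simp add: red_def cell_eq inner_add_right frac_lt_1)

lemma red_diff: "x - red x \<in> period_lattice \<xi> \<eta>"
  by (simp add: red_def lattice_eq inner_add_right inner_diff_right frac_def)

lemma per_red: "per f \<Longrightarrow> f (red x) = f x"
  using red_diff[of x] unfolding periodic_def by (metis add.commute diff_add_cancel)

lemma red_id: "x \<in> cell \<Longrightarrow> red x = x"
  using decompose[of x] by (simp add: red_def cell_eq frac_eq)

lemma norm_cell: "x \<in> cell \<Longrightarrow> norm x \<le> norm \<xi> + norm \<eta>"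
proof -
  assume "x \<in> cell"
  then obtain s t where "x = s *\<^sub>R \<xi> + t *\<^sub>R \<eta>" "0 \<le> s" "s < 1" "0 \<le> t" "t < 1"
    by (auto simp: fundamental_cell_def)
  then have "norm x \<le> \<bar>s\<bar> * norm \<xi> + \<bar>t\<bar> * norm \<eta>" by (metis norm_scaleR norm_triangle_ineq)
  also have "\<dots> \<le> 1 * norm \<xi> + 1 * norm \<eta>"
    using \<open>0 \<le> s\<close> \<open>s < 1\<close> \<open>0 \<le> t\<close> \<open>t < 1\<close> by (intro add_mono mult_right_mono) auto
  finally show ?thesis by simp
qed

lemma bounded_cell: "bounded cell"
  using norm_cell bounded_iff by blast

lemma cell_borel: "cell \<in> sets borel"
proof -
  have "cell = {x. 0 \<le> xs \<bullet> x} \<inter> {x. xs \<bullet> x < 1} \<inter> ({x. 0 \<le> ys \<bullet> x} \<inter> {x. ys \<bullet> x < 1})"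
    by (auto simp: cell_eq)
  also have "\<dots> \<in> sets borel"
    by (intro sets.Int borel_open borel_closed open_Collect_less closed_Collect_le continuous_intros)
  finally show ?thesis .
qed

lemma cell_lmeasurable: "cell \<in> lmeasurable"
  using bounded_cell cell_borel
  by (intro bounded_set_imp_lmeasurable) auto

lemma cell_lebesgue [measurable]: "cell \<in> sets lebesgue"
  using cell_lmeasurable by blast

lemma space_T [simp]: "space T = cell"
  by (simp add: torus_def space_restrict_space)

sublocale T: finite_measure T
proof
  show "emeasure T (space T) \<noteq> \<infinity>"
    using cell_lmeasurable cell_lebesgue
    by (simp add: torus_def emeasure_restrict_space space_restrict_space fmeasurable_def less_top)
qed

definition "V = measure T cell"

lemma V_pos: "V > 0"
proof -
  let ?O = "{x. 0 < xs \<bullet> x} \<inter> {x. xs \<bullet> x < 1} \<inter> ({x. 0 < ys \<bullet> x} \<inter> {x. ys \<bullet> x < 1})"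
  have o: "open ?O"
    by (intro open_Int open_Collect_less continuous_intros)
  have "(1/2) *\<^sub>R \<xi> + (1/2) *\<^sub>R \<eta> \<in> ?O" by (simp add: inner_add_right)
  then have "\<not> negligible ?O" using open_not_negligible[OF o] by blast
  moreover have "?O \<subseteq> cell" by (auto simp: cell_eq)
  ultimately have "\<not> negligible cell" using negligible_subset by blast
  then have "measure lebesgue cell \<noteq> 0"
    using cell_lmeasurable by (simp add: negligible_iff_measure)
  moreover have "V = measure lebesgue cell"
    unfolding V_def torus_def by (intro measure_restrict_space) (auto simp: space_restrict_space)
  ultimately show ?thesis by (simp add: zero_less_measure_iff)
qed

lemma V_nz [simp]: "V \<noteq> 0" using V_pos by simp

lemma lborel_measurable_T: "f \<in> borel_measurable borel \<Longrightarrow> f \<in> borel_measurable T"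
  by (simp add: torus_def measurable_restrict_space1 measurable_completion)

lemma cont_measurable_T [intro]: "continuous_on UNIV (f::real^2 \<Rightarrow> real) \<Longrightarrow> f \<in> borel_measurable T"
  by (intro lborel_measurable_T borel_measurable_continuous_onI)

lemma cont_bounded_cell:
  fixes f :: "real^2 \<Rightarrow> real"
  assumes "continuous_on UNIV f" obtains B where "B > 0" "\<And>x. x \<in> cell \<Longrightarrow> \<bar>f x\<bar> \<le> B"
proof -
  have "compact (f ` cball 0 (norm \<xi> + norm \<eta>))"
    by (intro compact_continuous_image continuous_on_subset[OF assms]) auto
  then have "bounded (f ` cball 0 (norm \<xi> + norm \<eta>))" by (rule compact_imp_bounded)
  then obtain B where "B > 0" "\<forall>y \<in> f ` cball 0 (norm \<xi> + norm \<eta>). norm y \<le> B"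
    by (auto simp: bounded_pos)
  then show ?thesis using norm_cell that by (auto simp: image_iff)
qed

lemma integrable_bounded_T:
  fixes f :: "real^2 \<Rightarrow> real"
  assumes "f \<in> borel_measurable T" "\<And>x. x \<in> cell \<Longrightarrow> \<bar>f x\<bar> \<le> B"
  shows "integrable T f"
  by (rule T.integrable_const_bound[of _ B]) (use assms in auto)

lemma integrable_cont [intro]:
  fixes f :: "real^2 \<Rightarrow> real"
  assumes "continuous_on UNIV f" shows "integrable T f"
proof -
  obtain B where "B > 0" "\<And>x. x \<in> cell \<Longrightarrow> \<bar>f x\<bar> \<le> B" using cont_bounded_cell assms(1) by blast
  then show ?thesis by (intro integrable_bounded_T) (use assms in auto)
qed

end

section \<open>Trigonometric polynomials\<close>

text \<open>
  \<open>wave c k\<close> and \<open>tp A c\<close> are the real parts of \<open>c e\<^sub>k\<close> and \<open>\<Sum>k\<in>A. c k e\<^sub>k\<close> with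
  \<open>e\<^sub>k x = exp (2 \<pi> i k \<bullet> x)\<close>; since only real parts occur, \<open>A\<close> need not be symmetric.
\<close>

definition wave :: "complex \<Rightarrow> real^2 \<Rightarrow> real^2 \<Rightarrow> real" where
  "wave c k x = Re (c * cis (2 * pi * (k \<bullet> x)))"

definition tp :: "(real^2) set \<Rightarrow> (real^2 \<Rightarrow> complex) \<Rightarrow> real^2 \<Rightarrow> real" where
  "tp A c x = (\<Sum>k\<in>A. wave (c k) k x)"

lemma wave_zero [simp]: "wave 0 k x = 0" and wave_zero_freq: "wave c 0 x = Re c"
  by (simp_all add: wave_def)

lemma wave_add: "wave (c + d) k x = wave c k x + wave d k x"
  by (simp add: wave_def algebra_simps)

lemma wave_scale: "wave (of_real r * c) k x = r * wave c k x"
  by (simp add: wave_def algebra_simps)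

lemma wave_mult: "wave c k x * wave d l x = wave (c * d / 2) (k + l) x + wave (c * cnj d / 2) (k - l) x"
proof -
  define a b where "a = 2 * pi * (k \<bullet> x)" and "b = 2 * pi * (l \<bullet> x)"
  have "2 * pi * ((k + l) \<bullet> x) = a + b" "2 * pi * ((k - l) \<bullet> x) = a - b"
    by (simp_all add: a_def b_def inner_add_left inner_diff_left algebra_simps)
  then show ?thesis
    unfolding wave_def a_def[symmetric] b_def[symmetric]
    by (simp only:) (simp add: cos_add sin_add cos_diff sin_diff field_simps)
qed

lemma abs_wave_le: "\<bar>wave c k x\<bar> \<le> cmod c"
proof -
  have "\<bar>wave c k x\<bar> \<le> cmod (c * cis (2 * pi * (k \<bullet> x)))" unfolding wave_def by (rule abs_Re_le_cmod)
  then show ?thesis by (simp add: norm_mult)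
qed

lemma wave_shift: "wave c k (x + y) = wave (c * cis (2 * pi * (k \<bullet> y))) k x"
  by (simp add: wave_def inner_add_right distrib_left cis_mult[symmetric] mult_ac)

lemma continuous_wave [continuous_intros]: "continuous_on S (wave c k)"
  unfolding wave_def by (intro continuous_intros)

lemma continuous_tp [continuous_intros]: "continuous_on S (tp A c)"
  unfolding tp_def[abs_def] by (intro continuous_intros)

lemma tp_mono:
  assumes "finite B" "A \<subseteq> B"
  shows "tp A c = tp B (\<lambda>k. if k \<in> A then c k else 0)"
proof
  fix x
  have "tp B (\<lambda>k. if k \<in> A then c k else 0) x = (\<Sum>k\<in>B. if k \<in> A then wave (c k) k x else 0)"
    unfolding tp_def by (intro sum.cong) auto
  also have "\<dots> = (\<Sum>k\<in>B \<inter> A. wave (c k) k x)"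
    by (subst sum.inter_restrict) (use assms in auto)
  also have "B \<inter> A = A" using assms by auto
  finally show "tp A c x = tp B (\<lambda>k. if k \<in> A then c k else 0) x" by (simp add: tp_def)
qed

lemma tp_add: "tp A c x + tp A d x = tp A (\<lambda>k. c k + d k) x"
  by (simp add: tp_def wave_add sum.distrib)

lemma tp_scale: "r * tp A c x = tp A (\<lambda>k. of_real r * c k) x"
  by (simp add: tp_def wave_scale sum_distrib_left)

lemma tp_diff: "tp A c x - tp A d x = tp A (\<lambda>k. c k - d k) x"
  using tp_add[of A c x "\<lambda>k. - d k"] tp_scale[of "-1" A d x] by simp

lemma tp_cong: "(\<And>k. k \<in> A \<Longrightarrow> c k = d k) \<Longrightarrow> tp A c = tp A d"
  by (simp add: tp_def fun_eq_iff)

lemma abs_tp_le: "\<bar>tp A c x\<bar> \<le> (\<Sum>k\<in>A. cmod (c k))"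
  unfolding tp_def by (intro order.trans[OF sum_abs] sum_mono abs_wave_le)

context lattice2
begin

lemma dl_add: "k \<in> dl \<Longrightarrow> l \<in> dl \<Longrightarrow> k + l \<in> dl" and dl_minus: "k \<in> dl \<Longrightarrow> - k \<in> dl"
  and dl_diff: "k \<in> dl \<Longrightarrow> l \<in> dl \<Longrightarrow> k - l \<in> dl" and dl_zero: "0 \<in> dl"
  by (auto simp: dl_def inner_add_left inner_diff_left)

lemma dl_xs: "xs \<in> dl" and dl_ys: "ys \<in> dl" by (auto simp: dl_def)

lemma dl_lattice_int: "k \<in> dl \<Longrightarrow> v \<in> period_lattice \<xi> \<eta> \<Longrightarrow> k \<bullet> v \<in> \<int>"
  by (auto simp: dl_def period_lattice_def inner_add_right)

lemma per_wave: "k \<in> dl \<Longrightarrow> per (wave c k)"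
proof -
  assume k: "k \<in> dl"
  have "wave c k (x + v) = wave c k x" if v: "v \<in> period_lattice \<xi> \<eta>" for x v
  proof -
    obtain n where "k \<bullet> v = of_int n" by (rule Ints_cases[OF dl_lattice_int[OF k v]])
    then have "cis (2 * pi * (k \<bullet> v)) = 1"
      using cis_multiple_2pi[of "of_int n"] by simp
    then show ?thesis by (simp add: wave_shift)
  qed
  then show ?thesis by (simp add: periodic_def)
qed

lemma per_tp: "A \<subseteq> dl \<Longrightarrow> per (tp A c)"
  using per_wave unfolding periodic_def tp_def by (auto intro!: sum.cong)

definition trig :: "(real^2 \<Rightarrow> real) set" where
  "trig = {tp A c |A c. finite A \<and> A \<subseteq> dl}"

lemma trigI: "finite A \<Longrightarrow> A \<subseteq> dl \<Longrightarrow> tp A c \<in> trig" by (auto simp: trig_def)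

lemma trigE: assumes "f \<in> trig" obtains A c where "finite A" "A \<subseteq> dl" "f = tp A c"
  using assms by (auto simp: trig_def)

lemma trig_wave: "k \<in> dl \<Longrightarrow> wave c k \<in> trig"
  using trigI[of "{k}" "\<lambda>_. c"] by (simp add: tp_def[abs_def])

lemma trig_const: "(\<lambda>x. r) \<in> trig"
  using trig_wave[OF dl_zero, of "of_real r"] by (simp add: wave_zero_freq[abs_def])

lemma trig_cont: "f \<in> trig \<Longrightarrow> continuous_on S f" and trig_per: "f \<in> trig \<Longrightarrow> per f"
  by (auto elim!: trigE intro: continuous_tp per_tp)

lemma trig_add: assumes "f \<in> trig" "g \<in> trig" shows "(\<lambda>x. f x + g x) \<in> trig"
proof -
  obtain A c B d where "finite A" "A \<subseteq> dl" "f = tp A c" "finite B" "B \<subseteq> dl" "g = tp B d"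
    using assms by (meson trigE)
  then show ?thesis
    using tp_mono[of "A \<union> B" A c] tp_mono[of "A \<union> B" B d] by (auto simp: tp_add intro!: trigI)
qed

lemma trig_sum: "finite I \<Longrightarrow> (\<And>i. i \<in> I \<Longrightarrow> f i \<in> trig) \<Longrightarrow> (\<lambda>x. \<Sum>i\<in>I. f i x) \<in> trig"
  by (induction I rule: finite_induct) (auto intro: trig_add trig_const)

lemma trig_mult: assumes "f \<in> trig" "g \<in> trig" shows "(\<lambda>x. f x * g x) \<in> trig"
proof -
  obtain A c B d where *: "finite A" "A \<subseteq> dl" "f = tp A c" "finite B" "B \<subseteq> dl" "g = tp B d"
    using assms by (meson trigE)
  have "(\<lambda>x. \<Sum>k\<in>A. \<Sum>l\<in>B. wave (c k * d l / 2) (k + l) x + wave (c k * cnj (d l) / 2) (k - l) x) \<in> trig"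
    using * by (intro trig_sum trig_add trig_wave dl_add dl_diff) auto
  moreover have "(\<lambda>x. \<Sum>k\<in>A. \<Sum>l\<in>B. wave (c k * d l / 2) (k + l) x + wave (c k * cnj (d l) / 2) (k - l) x)
      = (\<lambda>x. f x * g x)"
    by (simp add: * tp_def sum_product wave_mult)
  ultimately show ?thesis by simp
qed

lemma trig_scale: "f \<in> trig \<Longrightarrow> (\<lambda>x. r * f x) \<in> trig"
  using trig_mult[OF trig_const] .

section \<open>Integrals of waves over the cell\<close>

lemma integral_T_lborel:
  fixes F :: "real^2 \<Rightarrow> real"
  assumes "F \<in> borel_measurable borel"
  shows "(\<integral>x. F x \<partial>T) = (\<integral>x. indicator cell x * F x \<partial>lborel)"
proof -
  have "(\<integral>x. F x \<partial>T) = (\<integral>x. indicator cell x *\<^sub>R F x \<partial>lebesgue)"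
    unfolding torus_def by (subst integral_restrict_space) auto
  also have "\<dots> = (\<integral>x. indicator cell x * F x \<partial>lborel)"
    using assms cell_borel by (subst integral_completion) auto
  finally show ?thesis .
qed

lemma lborel_translate:
  fixes F :: "real^2 \<Rightarrow> real"
  assumes "F \<in> borel_measurable borel"
  shows "(\<integral>x. F (x + c) \<partial>lborel) = (\<integral>x. F x \<partial>lborel)"
proof -
  have "(\<integral>x. F x \<partial>lborel) = (\<integral>x. F x \<partial>distr lborel borel ((+) c))"
    by (simp add: lborel_distr_plus)
  also have "\<dots> = (\<integral>x. F (c + x) \<partial>lborel)"
    using assms by (subst integral_distr) auto
  finally show ?thesis by (simp add: add.commute)
qed

text \<open>A shift by a fraction of a period cuts the cell into two slabs, one of which is moved
  back by a full period. \<open>zs\<close> and \<open>os\<close> stand for \<open>xs\<close> and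
  \<open>ys\<close> in either order, so that one proof serves both directions.\<close>

lemma torus_translate_aux:
  fixes F :: "real^2 \<Rightarrow> real"
  assumes F: "continuous_on UNIV F" and per: "\<And>x. F (x - \<zeta>) = F x"
    and cl: "cell = {x. 0 \<le> zs \<bullet> x \<and> zs \<bullet> x < 1 \<and> 0 \<le> os \<bullet> x \<and> os \<bullet> x < 1}"
    and z: "zs \<bullet> \<zeta> = 1" "os \<bullet> \<zeta> = 0" and a: "0 < a" "a < 1"
  shows "(\<integral>x. F (x + a *\<^sub>R \<zeta>) \<partial>T) = (\<integral>x. F x \<partial>T)"
proof -
  have Fb [measurable]: "F \<in> borel_measurable borel" using F by (rule borel_measurable_continuous_onI)
  let ?A = "{x. 0 \<le> zs \<bullet> x \<and> zs \<bullet> x < a \<and> 0 \<le> os \<bullet> x \<and> os \<bullet> x < 1}"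
  let ?B = "{x. a \<le> zs \<bullet> x \<and> zs \<bullet> x < 1 \<and> 0 \<le> os \<bullet> x \<and> os \<bullet> x < 1}"
  have F': "(\<lambda>x. F (x + y)) \<in> borel_measurable borel" for y by measurable
  have AB [measurable]: "?A \<in> sets borel" "?B \<in> sets borel" by measurable
  have bnd: "integrable lborel (\<lambda>x. indicator C x * F x)" if "C \<subseteq> cell" "C \<in> sets borel" for C
  proof -
    obtain K where K: "\<And>x. x \<in> cell \<Longrightarrow> \<bar>F x\<bar> \<le> K" using cont_bounded_cell[OF F] by blast
    have "emeasure lborel cell < \<infinity>" using bounded_cell by (rule emeasure_bounded_finite)
    then have "integrable lborel (\<lambda>x. indicator cell x * K)" using cell_borel by auto
    then show ?thesis
      by (rule Bochner_Integration.integrable_bound) (use that K in \<open>auto simp: indicator_def intro!: AE_I2 order.trans[OF K abs_ge_self]\<close>)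
  qed
  have t1: "(\<integral>x. indicator ?B (x + a *\<^sub>R \<zeta>) * F (x + a *\<^sub>R \<zeta>) \<partial>lborel) = (\<integral>x. indicator ?B x * F x \<partial>lborel)"
    by (rule lborel_translate[where F = "\<lambda>x. indicator ?B x * F x"]) measurable
  have t2: "(\<integral>x. indicator ?A (x + (a - 1) *\<^sub>R \<zeta>) * F (x + (a - 1) *\<^sub>R \<zeta>) \<partial>lborel) = (\<integral>x. indicator ?A x * F x \<partial>lborel)"
    by (rule lborel_translate[where F = "\<lambda>x. indicator ?A x * F x"]) measurable
  have ib: "integrable lborel (\<lambda>x. indicator ?B x * F x)" "integrable lborel (\<lambda>x. indicator ?A x * F x)"
    using a by (auto intro!: bnd simp: cl)
  have tr: "integrable lborel (\<lambda>x. H (x + c))" if "integrable lborel H" for H :: "real^2 \<Rightarrow> real" and c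
  proof -
    have "integrable (distr lborel borel ((+) c)) H" using that by (simp add: lborel_distr_plus)
    then show ?thesis by (subst (asm) integrable_distr_eq) (use that in \<open>auto simp: add.commute\<close>)
  qed
  have sh: "F (x + (a - 1) *\<^sub>R \<zeta>) = F (x + a *\<^sub>R \<zeta>)" for x
    using per[of "x + a *\<^sub>R \<zeta>"] by (simp add: algebra_simps)
  have "(\<integral>x. F (x + a *\<^sub>R \<zeta>) \<partial>T) = (\<integral>x. indicator cell x * F (x + a *\<^sub>R \<zeta>) \<partial>lborel)"
    by (rule integral_T_lborel) (rule F')
  \<comment> \<open>A point of the cell either stays in it after the shift and lands in
    \<open>?B\<close>, or leaves it and lands in \<open>?A\<close> after one period has been
    subtracted.\<close>
  also have "\<dots> = (\<integral>x. indicator ?B (x + a *\<^sub>R \<zeta>) * F (x + a *\<^sub>R \<zeta>) + indicator ?A (x + (a - 1) *\<^sub>R \<zeta>) * F (x + (a - 1) *\<^sub>R \<zeta>) \<partial>lborel)"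
    using a unfolding sh by (intro Bochner_Integration.integral_cong) (auto simp: indicator_def cl inner_add_right z)
  also have "\<dots> = (\<integral>x. indicator ?B x * F x \<partial>lborel) + (\<integral>x. indicator ?A x * F x \<partial>lborel)"
    using t1 t2 by (subst Bochner_Integration.integral_add) (use tr[OF ib(1)] tr[OF ib(2)] in auto)
  also have "\<dots> = (\<integral>x. indicator ?B x * F x + indicator ?A x * F x \<partial>lborel)"
    using ib by simp
  also have "\<dots> = (\<integral>x. indicator cell x * F x \<partial>lborel)"
    using a by (intro Bochner_Integration.integral_cong) (auto simp: indicator_def cl)
  also have "\<dots> = (\<integral>x. F x \<partial>T)"
    by (rule integral_T_lborel[symmetric]) measurable
  finally show ?thesis .
qed

text \<open>A shift by half a wavelength changes the sign of the wave but not its integral. This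
  settles nonzero frequencies without iterated integrals.\<close>

lemma integral_wave:
  assumes k: "k \<in> dl"
  shows "(\<integral>x. wave c k x \<partial>T) = (if k = 0 then V * Re c else 0)"
proof (cases "k = 0")
  case True
  then show ?thesis by (simp add: wave_zero_freq V_def)
next
  case False
  have key: "(\<integral>x. wave c k x \<partial>T) = 0" if tr: "\<And>a. 0 < a \<Longrightarrow> a < 1 \<Longrightarrow> (\<integral>x. wave c k (x + a *\<^sub>R \<zeta>) \<partial>T) = (\<integral>x. wave c k x \<partial>T)"
    and kz: "k \<bullet> \<zeta> \<in> \<int>" "k \<bullet> \<zeta> \<noteq> 0" for \<zeta>
  proof -
    obtain m where m: "k \<bullet> \<zeta> = of_int m" using kz(1) by (auto elim: Ints_cases)
    then have "m \<noteq> 0" using kz by simp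
    then have m1: "\<bar>k \<bullet> \<zeta>\<bar> \<ge> 1" using m by linarith
    \<comment> \<open>Half a wavelength in the direction \<zeta>, so that the phase advances by
      \<pi> up to sign; \<open>a < 1\<close> holds because \<open>k \<bullet> \<zeta>\<close> is a
      nonzero integer.\<close>
    define a where "a = 1 / (2 * \<bar>k \<bullet> \<zeta>\<bar>)"
    have a: "0 < a" "a < 1" using m1 by (auto simp: a_def divide_simps)
    have "2 * pi * (k \<bullet> (a *\<^sub>R \<zeta>)) = pi * sgn (k \<bullet> \<zeta>)"
      using kz(2) by (auto simp: a_def sgn_if)
    then have "cis (2 * pi * (k \<bullet> (a *\<^sub>R \<zeta>))) = -1"
      using kz(2) by (simp only:) (auto simp: sgn_if complex_eq_iff)
    then have "wave c k (x + a *\<^sub>R \<zeta>) = - wave c k x" for x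
      by (simp only: wave_shift) (simp add: wave_def)
    then show ?thesis using tr[OF a] by simp
  qed
  have "k \<bullet> \<xi> \<noteq> 0 \<or> k \<bullet> \<eta> \<noteq> 0" using False decompose_dual[of k] by auto
  moreover have "(\<integral>x. wave c k (x + a *\<^sub>R \<xi>) \<partial>T) = (\<integral>x. wave c k x \<partial>T)" if "0 < a" "a < 1" for a
    by (rule torus_translate_aux[where zs=xs and os=ys])
      (use that k in \<open>auto simp: cell_eq intro!: continuous_intros period_shift per_wave\<close>)
  moreover have "(\<integral>x. wave c k (x + a *\<^sub>R \<eta>) \<partial>T) = (\<integral>x. wave c k x \<partial>T)" if "0 < a" "a < 1" for a
    by (rule torus_translate_aux[where zs=ys and os=xs])
      (use that k in \<open>auto simp: cell_eq intro!: continuous_intros period_shift per_wave\<close>)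
  ultimately have "(\<integral>x. wave c k x \<partial>T) = 0" using key k unfolding dl_def by blast
  then show ?thesis using False by simp
qed

lemma integral_tp:
  assumes "finite A" "A \<subseteq> dl"
  shows "(\<integral>x. tp A c x \<partial>T) = (if 0 \<in> A then V * Re (c 0) else 0)"
proof -
  have "(\<integral>x. tp A c x \<partial>T) = (\<Sum>k\<in>A. \<integral>x. wave (c k) k x \<partial>T)"
    unfolding tp_def by (intro Bochner_Integration.integral_sum integrable_cont continuous_intros)
  also have "\<dots> = (\<Sum>k\<in>A. if k = 0 then V * Re (c k) else 0)"
    using assms by (intro sum.cong refl integral_wave) auto
  also have "\<dots> = (if 0 \<in> A then V * Re (c 0) else 0)" using assms by simp
  finally show ?thesis .
qed

section \<open>Uniform density of trigonometric polynomials\<close>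

lemma cis_eq_iff_Ints: "cis (2 * pi * a) = cis (2 * pi * b) \<longleftrightarrow> a - b \<in> \<int>"
proof -
  have "cis (2 * pi * a) = cis (2 * pi * b) \<longleftrightarrow> cis (2 * pi * a) / cis (2 * pi * b) = 1" by simp
  also have "\<dots> \<longleftrightarrow> cis (2 * pi * (a - b)) = 1" by (simp add: cis_divide right_diff_distrib)
  also have "\<dots> \<longleftrightarrow> cos (2 * pi * (a - b)) = 1"
    by (auto simp: complex_eq_iff cos_one_sin_zero)
  also have "\<dots> \<longleftrightarrow> a - b \<in> \<int>"
    unfolding cos_one_2pi_int by (auto elim!: Ints_cases)
  finally show ?thesis .
qed

text \<open>
  The map embeds the torus into a compact subset of \<open>\<complex>\<^sup>2\<close>, so the Stone--Weierstrass theorem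
  for polynomials makes trigonometric polynomials uniformly dense in the continuous periodic functions.
\<close>

definition torus_map :: "real^2 \<Rightarrow> complex \<times> complex" where
  "torus_map x = (cis (2 * pi * (xs \<bullet> x)), cis (2 * pi * (ys \<bullet> x)))"

lemma continuous_torus_map: "continuous_on S torus_map"
  unfolding torus_map_def by (intro continuous_intros)

lemma torus_map_eq_iff: "torus_map x = torus_map y \<longleftrightarrow> x - y \<in> period_lattice \<xi> \<eta>"
  by (simp add: torus_map_def lattice_eq cis_eq_iff_Ints inner_diff_right)

lemma per_torus_map: assumes "per f" "torus_map x = torus_map y" shows "f x = f y"
  using assms unfolding torus_map_eq_iff periodic_def by (metis add.commute diff_add_cancel)

abbreviation (input) "cl_cell \<equiv> cball (0::real^2) (norm \<xi> + norm \<eta>)"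

lemma torus_map_red: "torus_map (red x) = torus_map x"
  using red_diff[of x] torus_map_eq_iff by metis

lemma torus_map_onto: "torus_map ` UNIV = torus_map ` cl_cell"
proof -
  have "torus_map x \<in> torus_map ` cl_cell" for x
    using norm_cell[OF red_cell] torus_map_red[of x] by (metis image_eqI mem_cball_0)
  then show ?thesis by auto
qed

text \<open>The four real coordinates of \<complex>\<times>\<complex> pull back to the cosine and
  sine of the two basic frequencies, and \<open>trig\<close> is closed under products. Real
  polynomials thus take care of conjugates by themselves.\<close>

lemma trig_poly_function:
  assumes "real_polynomial_function h"
  shows "(\<lambda>x. h (torus_map x)) \<in> trig"
  using assms
proof induction
  case (linear h)
  interpret h: bounded_linear h by fact
  have dec: "h (z, w) = Re z * h (1, 0) + Im z * h (\<i>, 0) + Re w * h (0, 1) + Im w * h (0, \<i>)" for z w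
  proof -
    have "(z, w) = Re z *\<^sub>R (1, 0) + Im z *\<^sub>R (\<i>, 0) + Re w *\<^sub>R (0, 1) + Im w *\<^sub>R (0, \<i>)"
      by (simp add: complex_eq_iff)
    then show ?thesis by (metis h.add h.scaleR real_scaleR_def)
  qed
  have "(\<lambda>x. h (1, 0) * wave 1 xs x + h (\<i>, 0) * wave (-\<i>) xs x + h (0, 1) * wave 1 ys x + h (0, \<i>) * wave (-\<i>) ys x) \<in> trig"
    by (intro trig_add trig_scale trig_wave dl_xs dl_ys)
  then show ?case
    unfolding torus_map_def by (subst dec) (simp add: wave_def mult.commute)
qed (auto intro: trig_const trig_add trig_mult)

proposition trig_dense:
  assumes f: "continuous_on UNIV f" "per f" and e: "e > 0"
  obtains g where "g \<in> trig" "\<And>x. \<bar>f x - g x\<bar> < e"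
proof -
  let ?S = "torus_map ` UNIV"
  have comp: "compact ?S"
    unfolding torus_map_onto by (intro compact_continuous_image continuous_torus_map) auto
  define F where "F z = f (SOME x. torus_map x = z)" for z
  have F: "F (torus_map x) = f x" for x
  proof -
    have "torus_map (SOME y. torus_map y = torus_map x) = torus_map x" by (rule someI) simp
    then show ?thesis unfolding F_def by (rule per_torus_map[OF f(2)])
  qed
  \<comment> \<open>\<open>torus_map\<close> behaves like a quotient map: each point of the image
    has a preimage in a fixed compact ball. A sequence that violates continuity lifts there, and a
    convergent subsequence of preimages contradicts the continuity of \<open>f\<close>.\<close>
  have "continuous_on ?S F"
    unfolding continuous_on_sequentially
  proof (intro allI ballI impI)
    fix z a assume z: "a \<in> ?S" "(\<forall>n. z n \<in> ?S) \<and> z \<longlonglongrightarrow> a"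
    show "(F \<circ> z) \<longlonglongrightarrow> F a"
    proof (rule ccontr)
      assume "\<not> (F \<circ> z) \<longlonglongrightarrow> F a"
      then obtain d where d: "d > 0" and inf: "\<forall>N. \<exists>n\<ge>N. dist (F (z n)) (F a) \<ge> d"
        unfolding lim_sequentially by (auto simp: not_less)
      have "infinite {n. dist (F (z n)) (F a) \<ge> d}"
        using inf by (auto simp: infinite_nat_iff_unbounded_le)
      then obtain r :: "nat \<Rightarrow> nat" where r: "strict_mono r" "\<And>n. dist (F (z (r n))) (F a) \<ge> d"
        using infinite_enumerate by (metis mem_Collect_eq)
      have "\<forall>n. \<exists>x\<in>cl_cell. torus_map x = z (r n)"
        using z(2) torus_map_onto by (metis imageE)
      then obtain x where x: "\<And>n. x n \<in> cl_cell" "\<And>n. torus_map (x n) = z (r n)" by metis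
      have "seq_compact cl_cell" by (simp add: compact_imp_seq_compact)
      then obtain l s where s: "strict_mono s" "(x \<circ> s) \<longlonglongrightarrow> l"
        using x(1) unfolding seq_compact_def by metis
      have "(\<lambda>n. torus_map (x (s n))) \<longlonglongrightarrow> torus_map l"
        using continuous_on_tendsto_compose[OF continuous_torus_map[of UNIV] s(2)] by (simp add: o_def)
      moreover have "(\<lambda>n. z (r (s n))) \<longlonglongrightarrow> a"
        using z(2) r(1) s(1) by (metis (no_types, lifting) LIMSEQ_subseq_LIMSEQ comp_def ext strict_mono_o)
      ultimately have "torus_map l = a" using x(2) LIMSEQ_unique by simp
      moreover have "(\<lambda>n. f (x (s n))) \<longlonglongrightarrow> f l"
        using continuous_on_tendsto_compose[OF f(1) s(2)] by (simp add: o_def)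
      ultimately have "(\<lambda>n. F (z (r (s n)))) \<longlonglongrightarrow> F a" using F x(2) by (metis (no_types, lifting) ext)
      then have "eventually (\<lambda>n. dist (F (z (r (s n)))) (F a) < d) sequentially" using d by (rule tendstoD)
      then show False using r(2) by (auto simp: eventually_sequentially not_less[symmetric])
    qed
  qed
  from Stone_Weierstrass_polynomial_function[OF comp this e]
  obtain g where g: "polynomial_function g" "\<forall>z\<in>?S. norm (F z - g z) < e" by blast
  then have "real_polynomial_function g" by (simp add: real_polynomial_function_eq)
  then have "(\<lambda>x. g (torus_map x)) \<in> trig" by (rule trig_poly_function)
  moreover have "\<bar>f x - g (torus_map x)\<bar> < e" for x using g(2) F by auto
  ultimately show ?thesis using that by blast
qed

end

section \<open>Approximation in Lebesgue spaces\<close>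

definition clamp_abs :: "real \<Rightarrow> real \<Rightarrow> real" where
  "clamp_abs M y = max (- M) (min M y)"

lemma clamp_abs_bound: "0 \<le> M \<Longrightarrow> \<bar>clamp_abs M y\<bar> \<le> M"
  and clamp_abs_id: "\<bar>y\<bar> \<le> M \<Longrightarrow> clamp_abs M y = y"
  and clamp_abs_lipschitz: "\<bar>clamp_abs M y - clamp_abs M z\<bar> \<le> \<bar>y - z\<bar>"
  and clamp_abs_diff_le: "0 \<le> M \<Longrightarrow> \<bar>y - clamp_abs M y\<bar> \<le> \<bar>y\<bar>"
  and clamp_abs_dist: "\<bar>z\<bar> \<le> M \<Longrightarrow> \<bar>y - clamp_abs M y\<bar> \<le> \<bar>y - z\<bar>"
  by (auto simp: clamp_abs_def max_def min_def)

lemma measurable_clamp_abs [measurable]: "clamp_abs M \<in> borel_measurable borel"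
  unfolding clamp_abs_def by measurable

lemma tendsto_clamp_abs: "(f \<longlongrightarrow> l) F \<Longrightarrow> ((\<lambda>x. clamp_abs M (f x)) \<longlongrightarrow> clamp_abs M l) F"
  unfolding clamp_abs_def by (intro tendsto_intros)

context lattice2
begin

lemma AE_T_iff: "(AE x in T. P x) \<longleftrightarrow> (AE x in lebesgue. x \<in> cell \<longrightarrow> P x)"
  unfolding torus_def by (subst AE_restrict_space_iff) simp_all
lemma AE_T_I:
  assumes "negligible N" "\<And>x. x \<in> cell \<Longrightarrow> x \<notin> N \<Longrightarrow> P x" shows "AE x in T. P x"
proof -
  have "N \<in> null_sets lebesgue" using assms(1) by (simp add: negligible_iff_null_sets)
  moreover have "{x. \<not> (x \<in> cell \<longrightarrow> P x)} \<subseteq> N"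
    using assms(2) by blast
  ultimately show ?thesis unfolding AE_T_iff unfolding eventually_ae_filter by (intro bexI[of _ N]) simp_all
qed
lemma AE_T_D:
  assumes "AE x in T. P x" shows "negligible {x \<in> cell. \<not> P x}"
proof -
  have "AE x in lebesgue. x \<in> cell \<longrightarrow> P x"
    using assms unfolding AE_T_iff .
  from this[unfolded eventually_ae_filter]
  obtain N where N: "N \<in> null_sets lebesgue" "{x \<in> space lebesgue. \<not> (x \<in> cell \<longrightarrow> P x)} \<subseteq> N"
    by blast
  have "negligible N" using N(1) by (simp add: negligible_iff_null_sets)
  moreover have "{x \<in> cell. \<not> P x} \<subseteq> N" using N(2) by simp
  ultimately show ?thesis by (rule negligible_subset)
qed

lemma red_shift: "v \<in> period_lattice \<xi> \<eta> \<Longrightarrow> red (x + v) = red x"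
  by (auto simp: red_def lattice_eq inner_add_right frac_add_int_right)

lemma isCont_red: assumes "xs \<bullet> x \<notin> \<int>" "ys \<bullet> x \<notin> \<int>" shows "isCont red x"
proof -
  have "isCont (\<lambda>y. xs \<bullet> y) x" "isCont (\<lambda>y. ys \<bullet> y) x" by (intro continuous_intros)+
  then have "isCont (\<lambda>y. frac (xs \<bullet> y)) x" "isCont (\<lambda>y. frac (ys \<bullet> y)) x"
    using assms isCont_o2 continuous_frac by blast+
  then show ?thesis unfolding red_def[abs_def] by (intro continuous_intros)
qed

text \<open>Measurable functions are almost everywhere limits of continuous functions on the plane.
  These are made periodic by composing with \<open>red\<close> and bounded by truncation; a cutoff
  near the edges of the cell removes the jumps of \<open>red\<close>, after which uniform
  approximation applies.\<close>

lemma bounded_trig_approx: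
  assumes f: "f \<in> borel_measurable T" and M: "\<And>x. x \<in> cell \<Longrightarrow> \<bar>f x\<bar> \<le> M"
  obtains \<phi> :: "nat \<Rightarrow> real^2 \<Rightarrow> real" where "\<And>n. \<phi> n \<in> trig" "\<And>n x. \<bar>\<phi> n x\<bar> \<le> M + 1"
    "AE x in T. (\<lambda>n. \<phi> n x) \<longlonglongrightarrow> f x"
proof -
  have M0: "M \<ge> 0" using M[OF red_cell[of 0]] by linarith
  have "f measurable_on cell"
    using f unfolding torus_def by (subst measurable_on_iff_borel_measurable) auto
  then obtain N g where N: "negligible N" and g: "\<And>n. continuous_on UNIV (g n)"
    and lim: "\<And>x. x \<notin> N \<Longrightarrow> (\<lambda>n. g n x) \<longlonglongrightarrow> (if x \<in> cell then f x else 0)"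
    unfolding measurable_on_def by blast
  \<comment> \<open>A nonnegative periodic function that vanishes exactly on the lattice translates
    of the cell edges, the only places where \<open>red\<close> can jump. The factor
    \<open>min 1 (n * \<sigma> x)\<close> kills the jump and is eventually 1 at every other
    point.\<close>
  define \<sigma> where "\<sigma> x = (1 - wave 1 xs x) * (1 - wave 1 ys x)" for x
  have s1: "1 - wave 1 k x \<ge> 0" for k x using abs_wave_le[of 1 k x] by simp
  have s0: "\<sigma> x \<ge> 0" for x unfolding \<sigma>_def by (intro mult_nonneg_nonneg s1)
  have sz: "\<sigma> x = 0 \<longleftrightarrow> xs \<bullet> x \<in> \<int> \<or> ys \<bullet> x \<in> \<int>" for x
  proof -
    have "1 - wave 1 k x = 0 \<longleftrightarrow> k \<bullet> x \<in> \<int>" for k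
    proof -
      have "1 - wave 1 k x = 0 \<longleftrightarrow> cos (2 * pi * (k \<bullet> x)) = 1" by (auto simp: wave_def)
      also have "\<dots> \<longleftrightarrow> k \<bullet> x \<in> \<int>" unfolding cos_one_2pi_int by (auto elim!: Ints_cases)
      finally show ?thesis .
    qed
    then show ?thesis by (simp add: \<sigma>_def)
  qed
  have sc: "continuous_on UNIV \<sigma>" unfolding \<sigma>_def by (intro continuous_intros)
  have sper: "\<sigma> (x + v) = \<sigma> x" if "v \<in> period_lattice \<xi> \<eta>" for x v
    using per_wave[OF dl_xs] per_wave[OF dl_ys] that unfolding periodic_def \<sigma>_def by simp
  define \<psi> where "\<psi> n x = clamp_abs M (g n (red x)) * min 1 (real n * \<sigma> x)" for n x
  have pb: "\<bar>\<psi> n x\<bar> \<le> M" for n x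
  proof -
    have "\<bar>\<psi> n x\<bar> \<le> M * 1"
      unfolding \<psi>_def abs_mult by (intro mult_mono clamp_abs_bound M0) (use s0[of x] in auto)
    then show ?thesis by simp
  qed
  have pper: "per (\<psi> n)" for n
    unfolding periodic_def \<psi>_def by (simp add: sper red_shift)
  have pc: "continuous_on UNIV (\<psi> n)" for n
  proof -
    have "isCont (\<psi> n) x" for x
    proof (cases "\<sigma> x = 0")
      case False
      then have r: "isCont red x" using sz isCont_red by blast
      have "isCont (\<lambda>y. g n (red y)) x"
        by (rule isCont_o2[OF r, where g = "g n"]) (use g[of n] in \<open>auto simp: continuous_on_eq_continuous_at\<close>)
      moreover have "isCont \<sigma> x" using sc by (auto simp: continuous_on_eq_continuous_at)
      ultimately show ?thesis unfolding \<psi>_def isCont_def by (intro tendsto_intros tendsto_clamp_abs)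
    next
      case True
      have "((\<lambda>y. M * (real n * \<sigma> y)) \<longlongrightarrow> M * (real n * \<sigma> x)) (at x)"
        using sc by (intro tendsto_intros) (auto simp: continuous_on_eq_continuous_at isCont_def)
      then have "((\<lambda>y. M * (real n * \<sigma> y)) \<longlongrightarrow> 0) (at x)" using True by simp
      moreover have "norm (\<psi> n y) \<le> M * (real n * \<sigma> y)" for y
        unfolding \<psi>_def real_norm_def abs_mult
        by (intro mult_mono clamp_abs_bound M0) (use s0[of y] M0 in auto)
      ultimately have "(\<psi> n \<longlongrightarrow> 0) (at x)" by (intro Lim_null_comparison[where f = "\<psi> n"]) auto
      then show ?thesis using True by (simp add: isCont_def \<psi>_def)
    qed
    then show ?thesis by (simp add: continuous_on_eq_continuous_at)
  qed
  have "\<exists>\<phi>. \<phi> \<in> trig \<and> (\<forall>x. \<bar>\<psi> n x - \<phi> x\<bar> < 1 / Suc n)" for n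
    using trig_dense[OF pc pper, of "1 / Suc n" n] by (metis of_nat_0_less_iff zero_less_Suc zero_less_divide_1_iff)
  then obtain \<phi> where \<phi>: "\<And>n. \<phi> n \<in> trig" "\<And>n x. \<bar>\<psi> n x - \<phi> n x\<bar> < 1 / Suc n" by metis
  have "\<bar>\<phi> n x\<bar> \<le> M + 1" for n x
  proof -
    have "1 / real (Suc n) \<le> 1" by simp
    then show ?thesis using \<phi>(2)[of n x] pb[of n x] by linarith
  qed
  moreover have "AE x in T. (\<lambda>n. \<phi> n x) \<longlonglongrightarrow> f x"
  proof (rule AE_T_I[where N = "N \<union> ({x. xs \<bullet> x = 0} \<union> {x. ys \<bullet> x = 0})"])
    have "xs \<noteq> 0" "ys \<noteq> 0" using dual_basis(1,4) by force+
    then show "negligible (N \<union> ({x. xs \<bullet> x = 0} \<union> {x. ys \<bullet> x = 0}))"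
      using N by (intro negligible_Un negligible_hyperplane) auto
    fix x assume x: "x \<in> cell" "x \<notin> N \<union> ({x. xs \<bullet> x = 0} \<union> {x. ys \<bullet> x = 0})"
    have gl: "(\<lambda>n. g n x) \<longlonglongrightarrow> f x" using lim[of x] x by simp
    have "xs \<bullet> x \<notin> \<int>" "ys \<bullet> x \<notin> \<int>" using x by (auto simp: cell_eq elim!: Ints_cases)
    then have sp: "\<sigma> x > 0" using sz[of x] s0[of x] by (simp add: order_less_le)
    obtain n0 :: nat where n0: "1 / \<sigma> x < real n0" using reals_Archimedean2 by blast
    have "eventually (\<lambda>n. min 1 (real n * \<sigma> x) = 1) sequentially"
    proof (rule eventually_sequentiallyI[of n0])
      fix n assume "n0 \<le> n"
      then have "1 / \<sigma> x \<le> real n" using n0 by linarith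
      then show "min 1 (real n * \<sigma> x) = 1" using sp by (simp add: field_simps)
    qed
    then have "(\<lambda>n. min 1 (real n * \<sigma> x)) \<longlonglongrightarrow> 1" by (rule tendsto_eventually)
    then have "(\<lambda>n. \<psi> n x) \<longlonglongrightarrow> clamp_abs M (f x) * 1"
      unfolding \<psi>_def red_id[OF x(1)] by (intro tendsto_intros tendsto_clamp_abs gl)
    then have 1: "(\<lambda>n. \<psi> n x) \<longlonglongrightarrow> f x" using M[OF x(1)] by (simp add: clamp_abs_id)
    have "(\<lambda>n. \<psi> n x - \<phi> n x) \<longlonglongrightarrow> 0"
    proof (rule Lim_null_comparison)
      show "\<forall>\<^sub>F n in sequentially. norm (\<psi> n x - \<phi> n x) \<le> 1 / Suc n"
        using \<phi>(2)[of _ x] by (auto intro!: always_eventually less_imp_le)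
      show "(\<lambda>n. 1 / real (Suc n)) \<longlonglongrightarrow> 0" using LIMSEQ_Suc[OF lim_1_over_n] by simp
    qed
    from tendsto_diff[OF 1 this] show "(\<lambda>n. \<phi> n x) \<longlonglongrightarrow> f x" by simp
  qed
  ultimately show ?thesis using that \<phi>(1) by blast
qed

text \<open>Testing against bounded approximations of \<open>sgn h\<close> yields that the integral
  of \<open>\<bar>h\<bar>\<close> is zero. Integrability of \<open>h\<close> suffices for the
  passage to the limit, so one statement serves all exponents.\<close>

lemma fourier_unique:
  assumes h: "integrable T h" and z: "\<And>g. g \<in> trig \<Longrightarrow> (\<integral>x. h x * g x \<partial>T) = 0"
  shows "AE x in T. h x = 0"
proof -
  have hm [measurable]: "h \<in> borel_measurable T" using h by auto
  have sm: "(\<lambda>x. sgn (h x)) \<in> borel_measurable T" by measurable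
  obtain \<phi> where \<phi>: "\<And>n. \<phi> n \<in> trig" "\<And>n x. \<bar>\<phi> n x\<bar> \<le> 1 + 1"
    "AE x in T. (\<lambda>n. \<phi> n x) \<longlonglongrightarrow> sgn (h x)"
    by (rule bounded_trig_approx[OF sm, of 1]) (auto simp: abs_sgn_eq)
  have [measurable]: "\<phi> n \<in> borel_measurable T" for n
    using trig_cont[OF \<phi>(1)] by blast
  have "(\<lambda>n. \<integral>x. h x * \<phi> n x \<partial>T) \<longlonglongrightarrow> (\<integral>x. h x * sgn (h x) \<partial>T)"
  proof (rule integral_dominated_convergence[where w = "\<lambda>x. 2 * \<bar>h x\<bar>"])
    show "integrable T (\<lambda>x. 2 * \<bar>h x\<bar>)" using h by auto
    show "AE x in T. (\<lambda>n. h x * \<phi> n x) \<longlonglongrightarrow> h x * sgn (h x)"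
      using \<phi>(3) by eventually_elim (intro tendsto_intros)
    show "AE x in T. norm (h x * \<phi> n x) \<le> 2 * \<bar>h x\<bar>" for n
      using mult_left_mono[OF \<phi>(2)[of n], of "\<bar>h _\<bar>"] by (auto simp: abs_mult mult.commute)
  qed measurable
  moreover have "h x * sgn (h x) = \<bar>h x\<bar>" for x by (simp add: abs_sgn)
  ultimately have "(\<integral>x. \<bar>h x\<bar> \<partial>T) = 0"
    by (simp add: z[OF \<phi>(1)] LIMSEQ_const_iff)
  then show ?thesis using h by (subst (asm) integral_nonneg_eq_0_iff_AE) auto
qed

text \<open>
  \<open>N p f\<close> is the \<open>p\<close>-th power of the norm, and \<open>mLp p\<close> is \<open>Lp\<close> without the periodicity requirement.
\<close>

definition N :: "real \<Rightarrow> (real^2 \<Rightarrow> real) \<Rightarrow> real" where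
  "N p f = (\<integral>x. \<bar>f x\<bar> powr p \<partial>T)"

definition mLp :: "real \<Rightarrow> (real^2 \<Rightarrow> real) set" where
  "mLp p = {f \<in> borel_measurable T. integrable T (\<lambda>x. \<bar>f x\<bar> powr p)}"

lemma mLp_measurable: "f \<in> mLp p \<Longrightarrow> f \<in> borel_measurable T" by (simp add: mLp_def)

lemma N_nonneg [simp]: "N p f \<ge> 0" unfolding N_def by (intro integral_nonneg_AE) auto

lemma Lp_iff: "f \<in> Lp \<xi> \<eta> p \<longleftrightarrow> per f \<and> f \<in> mLp p"
  by (auto simp: Lp_def torus_measurable_def mLp_def)

lemma mLp_dominated:
  assumes "g \<in> mLp p" "f \<in> borel_measurable T" "AE x in T. \<bar>f x\<bar> \<le> \<bar>g x\<bar>" "0 \<le> p"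
  shows "f \<in> mLp p"
proof -
  note [measurable] = assms(2)
  have ae: "AE x in T. norm (\<bar>f x\<bar> powr p) \<le> norm (\<bar>g x\<bar> powr p)"
    using assms(3) by eventually_elim (use assms(4) in \<open>auto intro: powr_mono2\<close>)
  have "integrable T (\<lambda>x. \<bar>f x\<bar> powr p)"
    by (rule Bochner_Integration.integrable_bound[OF _ _ ae]) (use assms(1) in \<open>auto simp: mLp_def\<close>)
  then show ?thesis using assms by (simp add: mLp_def)
qed

lemma mLp_bounded:
  assumes "f \<in> borel_measurable T" "\<And>x. x \<in> cell \<Longrightarrow> \<bar>f x\<bar> \<le> M" "0 \<le> p"
  shows "f \<in> mLp p"
proof -
  note [measurable] = assms(1)
  have "integrable T (\<lambda>x. \<bar>f x\<bar> powr p)"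
    by (rule integrable_bounded_T[of _ "M powr p"]) (use assms in \<open>auto intro: powr_mono2\<close>)
  then show ?thesis using assms by (simp add: mLp_def)
qed

lemma mLp_cont: assumes "continuous_on UNIV f" "0 \<le> p" shows "f \<in> mLp p"
proof -
  obtain B where B: "\<And>x. x \<in> cell \<Longrightarrow> \<bar>f x\<bar> \<le> B" using cont_bounded_cell[OF assms(1)] by metis
  show ?thesis by (rule mLp_bounded[OF cont_measurable_T[OF assms(1)] B assms(2)])
qed

lemma mLp_add:
  assumes "f \<in> mLp p" "g \<in> mLp p" "0 \<le> p"
  shows "(\<lambda>x. f x + g x) \<in> mLp p" "N p (\<lambda>x. f x + g x) \<le> 2 powr p * (N p f + N p g)"
proof -
  have [measurable]: "f \<in> borel_measurable T" "g \<in> borel_measurable T" using assms by (auto simp: mLp_def)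
  have i: "integrable T (\<lambda>x. \<bar>f x\<bar> powr p)" "integrable T (\<lambda>x. \<bar>g x\<bar> powr p)" using assms by (auto simp: mLp_def)
  have ii: "integrable T (\<lambda>x. 2 powr p * (\<bar>f x\<bar> powr p + \<bar>g x\<bar> powr p))" using i by auto
  have "integrable T (\<lambda>x. \<bar>f x + g x\<bar> powr p)"
    by (rule Bochner_Integration.integrable_bound[OF ii]) (use abs_add_powr_le[OF assms(3)] in \<open>auto intro!: AE_I2\<close>)
  then show "(\<lambda>x. f x + g x) \<in> mLp p" by (auto simp: mLp_def)
  have "N p (\<lambda>x. f x + g x) \<le> (\<integral>x. 2 powr p * (\<bar>f x\<bar> powr p + \<bar>g x\<bar> powr p) \<partial>T)"
    unfolding N_def by (intro integral_mono abs_add_powr_le assms ii) fact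
  also have "\<dots> = 2 powr p * (N p f + N p g)" using i by (simp add: N_def)
  finally show "N p (\<lambda>x. f x + g x) \<le> 2 powr p * (N p f + N p g)" .
qed

lemma mLp_scale: assumes "f \<in> mLp p" shows "(\<lambda>x. r * f x) \<in> mLp p" "N p (\<lambda>x. r * f x) = \<bar>r\<bar> powr p * N p f"
  using assms by (auto simp: mLp_def N_def abs_mult powr_mult)

lemma mLp_minus: "f \<in> mLp p \<Longrightarrow> (\<lambda>x. - f x) \<in> mLp p" "N p (\<lambda>x. - f x) = N p f"
  by (auto simp: mLp_def N_def)

lemma mLp_diff:
  assumes "f \<in> mLp p" "g \<in> mLp p" "0 \<le> p"
  shows "(\<lambda>x. f x - g x) \<in> mLp p" "N p (\<lambda>x. f x - g x) \<le> 2 powr p * (N p f + N p g)"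
  using mLp_add[OF assms(1) mLp_minus(1)[OF assms(2)] assms(3)] by (simp_all add: mLp_minus(2))

lemma N_mono:
  assumes "g \<in> mLp p" "f \<in> borel_measurable T" "AE x in T. \<bar>f x\<bar> \<le> \<bar>g x\<bar>" "0 \<le> p"
  shows "N p f \<le> N p g"
proof -
  have f: "f \<in> mLp p" using mLp_dominated assms by blast
  have ae: "AE x in T. \<bar>f x\<bar> powr p \<le> \<bar>g x\<bar> powr p"
    using assms(3) by eventually_elim (use assms(4) in \<open>auto intro: powr_mono2\<close>)
  show ?thesis unfolding N_def
    by (rule integral_mono_AE[OF _ _ ae]) (use assms(1) f in \<open>auto simp: mLp_def\<close>)
qed

text \<open>Integrating \<open>abs_powr_le\<close> replaces Hoelder's inequality. The free parameter
  \<open>e\<close> is chosen small before \<open>N p f\<close> is, which turns smallness of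
  \<open>N p f\<close> into smallness in L1.\<close>

lemma mLp_L1:
  assumes "f \<in> mLp p" "1 \<le> p"
  shows "integrable T f" "0 < e \<Longrightarrow> (\<integral>x. \<bar>f x\<bar> \<partial>T) \<le> e * V + e powr (1 - p) * N p f"
proof -
  have [measurable]: "f \<in> borel_measurable T" using assms by (auto simp: mLp_def)
  have i: "integrable T (\<lambda>x. \<bar>f x\<bar> powr p)" using assms by (auto simp: mLp_def)
  have ii: "integrable T (\<lambda>x. e + e powr (1 - p) * \<bar>f x\<bar> powr p)" for e using i by auto
  show f: "integrable T f"
    by (rule Bochner_Integration.integrable_bound[OF ii[of 1]])
      (use abs_powr_le[OF assms(2), of 1] in \<open>auto intro!: AE_I2\<close>)
  assume "0 < e"
  then have "(\<integral>x. \<bar>f x\<bar> \<partial>T) \<le> (\<integral>x. e + e powr (1 - p) * \<bar>f x\<bar> powr p \<partial>T)"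
    using f by (intro integral_mono ii abs_powr_le assms) auto
  also have "\<dots> = e * V + e powr (1 - p) * N p f" using i by (simp add: N_def V_def)
  finally show "(\<integral>x. \<bar>f x\<bar> \<partial>T) \<le> e * V + e powr (1 - p) * N p f" .
qed

lemma N_tendsto_L1:
  assumes "\<And>n. f n \<in> mLp p" "1 \<le> p" "((\<lambda>n. N p (f n)) \<longlongrightarrow> 0) F"
  shows "((\<lambda>n. \<integral>x. \<bar>f n x\<bar> \<partial>T) \<longlongrightarrow> 0) F"
proof (rule tendstoI)
  fix e :: real assume e: "e > 0"
  define d where "d = e / (2 * V)"
  have d: "d > 0" using e V_pos by (simp add: d_def)
  have "eventually (\<lambda>n. N p (f n) < e / (2 * d powr (1 - p))) F"
    by (rule order_tendstoD(2)[OF assms(3)]) (use e d in auto)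
  then show "eventually (\<lambda>n. dist (\<integral>x. \<bar>f n x\<bar> \<partial>T) 0 < e) F"
  proof eventually_elim
    case (elim n)
    have "(\<integral>x. \<bar>f n x\<bar> \<partial>T) \<le> d * V + d powr (1 - p) * N p (f n)" by (rule mLp_L1(2)[OF assms(1,2) d])
    also have "d * V = e / 2" using V_pos by (simp add: d_def)
    also have "d powr (1 - p) * N p (f n) < e / 2" using elim d by (simp add: field_simps)
    finally show ?case by (simp add: integral_nonneg_AE)
  qed
qed

text \<open>Under a uniform bound the converse passage holds as well, so that for truncated
  functions convergence to zero in one exponent is convergence in every exponent.\<close>

lemma L1_tendsto_N:
  assumes "\<And>n. f n \<in> borel_measurable T" "\<And>n x. x \<in> cell \<Longrightarrow> \<bar>f n x\<bar> \<le> C" "1 \<le> p"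
    "((\<lambda>n. \<integral>x. \<bar>f n x\<bar> \<partial>T) \<longlongrightarrow> 0) F"
  shows "((\<lambda>n. N p (f n)) \<longlongrightarrow> 0) F"
proof (rule Lim_null_comparison)
  show "((\<lambda>n. C powr (p - 1) * (\<integral>x. \<bar>f n x\<bar> \<partial>T)) \<longlongrightarrow> 0) F"
    using tendsto_mult_left[OF assms(4), of "C powr (p - 1)"] by simp
  have i: "integrable T (f n)" for n by (rule integrable_bounded_T[OF assms(1,2)])
  have "N p (f n) \<le> (\<integral>x. C powr (p - 1) * \<bar>f n x\<bar> \<partial>T)" for n
    unfolding N_def
  proof (rule integral_mono)
    show "integrable T (\<lambda>x. \<bar>f n x\<bar> powr p)" using mLp_bounded[OF assms(1,2), of p] assms(3) by (simp add: mLp_def)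
    show "integrable T (\<lambda>x. C powr (p - 1) * \<bar>f n x\<bar>)" using i by auto
  qed (use assms in \<open>auto intro: abs_powr_le_bounded\<close>)
  then show "eventually (\<lambda>n. norm (N p (f n)) \<le> C powr (p - 1) * (\<integral>x. \<bar>f n x\<bar> \<partial>T)) F"
    by (simp add: N_nonneg)
qed

lemma trig_mLp: "f \<in> trig \<Longrightarrow> 0 \<le> p \<Longrightarrow> f \<in> mLp p"
  by (intro mLp_cont trig_cont)

lemma AE_tendsto_N:
  assumes "\<And>n. f n \<in> borel_measurable T" "g \<in> mLp p" "\<And>n. AE x in T. \<bar>f n x\<bar> \<le> \<bar>g x\<bar>"
    "AE x in T. (\<lambda>n. f n x) \<longlonglongrightarrow> 0" "0 < p"
  shows "(\<lambda>n. N p (f n)) \<longlonglongrightarrow> 0"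
proof -
  note [measurable] = assms(1)
  have "(\<lambda>n. \<integral>x. \<bar>f n x\<bar> powr p \<partial>T) \<longlonglongrightarrow> (\<integral>x. 0 \<partial>T)"
  proof (rule integral_dominated_convergence[where w = "\<lambda>x. \<bar>g x\<bar> powr p"])
    show "AE x in T. (\<lambda>n. \<bar>f n x\<bar> powr p) \<longlonglongrightarrow> 0"
      using assms(4)
    proof eventually_elim
      case (elim x)
      have "(\<lambda>n. \<bar>f n x\<bar>) \<longlonglongrightarrow> 0" using elim by (rule tendsto_rabs_zero)
      then show ?case using assms(5) by (intro tendsto_zero_powrI[where b = p]) auto
    qed
    show "AE x in T. norm (\<bar>f n x\<bar> powr p) \<le> \<bar>g x\<bar> powr p" for n
      using assms(3)[of n] by eventually_elim (use assms(5) in \<open>auto intro: powr_mono2\<close>)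
  qed (use assms(2) in \<open>auto simp: mLp_def\<close>)
  then show ?thesis by (simp add: N_def)
qed

text \<open>Truncation at growing height converges by dominated convergence with \<open>f\<close>
  itself as majorant; the bounded truncation is then within reach of
  \<open>bounded_trig_approx\<close>, again by domination.\<close>

lemma trig_dense_Lp:
  assumes f: "f \<in> mLp p" and p: "1 \<le> p"
  obtains \<phi> :: "nat \<Rightarrow> real^2 \<Rightarrow> real" where "\<And>n. \<phi> n \<in> trig" "(\<lambda>n. N p (\<lambda>x. f x - \<phi> n x)) \<longlonglongrightarrow> 0"
proof -
  note [measurable] = mLp_measurable[OF f]
  have "\<exists>\<phi>\<in>trig. N p (\<lambda>x. f x - \<phi> x) < e" if e: "e > 0" for e
  proof -
    define d where "d = e / (2 powr p * 2)"
    have d: "d > 0" using e by (simp add: d_def)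
    have "(\<lambda>m. N p (\<lambda>x. f x - clamp_abs (real m) (f x))) \<longlonglongrightarrow> 0"
    proof (rule AE_tendsto_N[OF _ f])
      show "AE x in T. (\<lambda>m. f x - clamp_abs (real m) (f x)) \<longlonglongrightarrow> 0"
      proof (rule AE_I2)
        fix x
        obtain m0 :: nat where m0: "\<bar>f x\<bar> < real m0" using reals_Archimedean2 by blast
        have "eventually (\<lambda>m. f x - clamp_abs (real m) (f x) = 0) sequentially"
          by (rule eventually_sequentiallyI[of m0]) (use m0 in \<open>auto simp: clamp_abs_id\<close>)
        then show "(\<lambda>m. f x - clamp_abs (real m) (f x)) \<longlonglongrightarrow> 0" by (rule tendsto_eventually)
      qed
    qed (use p clamp_abs_diff_le in auto)
    then obtain m where m: "N p (\<lambda>x. f x - clamp_abs (real m) (f x)) < d"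
      using d order_tendstoD(2) eventually_happens sequentially_bot by blast
    let ?h = "\<lambda>x. clamp_abs (real m) (f x)"
    have hm [measurable]: "?h \<in> borel_measurable T" by measurable
    obtain \<phi> where \<phi>: "\<And>n. \<phi> n \<in> trig" "\<And>n x. \<bar>\<phi> n x\<bar> \<le> real m + 1" "AE x in T. (\<lambda>n. \<phi> n x) \<longlonglongrightarrow> ?h x"
      by (rule bounded_trig_approx[OF hm, of "real m"]) (simp add: clamp_abs_bound, blast)
    have [measurable]: "\<phi> n \<in> borel_measurable T" for n using trig_cont[OF \<phi>(1)] by blast
    have "(\<lambda>n. N p (\<lambda>x. ?h x - \<phi> n x)) \<longlonglongrightarrow> 0"
    proof (rule AE_tendsto_N[where g = "\<lambda>x. 2 * real m + 1"])
      show "AE x in T. \<bar>?h x - \<phi> n x\<bar> \<le> \<bar>2 * real m + 1\<bar>" for n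
      proof (rule AE_I2)
        fix x show "\<bar>?h x - \<phi> n x\<bar> \<le> \<bar>2 * real m + 1\<bar>"
          using \<phi>(2)[of n x] clamp_abs_bound[of "real m" "f x"] by simp
      qed
      show "AE x in T. (\<lambda>n. ?h x - \<phi> n x) \<longlonglongrightarrow> 0"
        using \<phi>(3)
      proof eventually_elim
        case (elim x)
        from tendsto_diff[OF tendsto_const[of "?h x"] elim] show ?case by simp
      qed
    qed (use p mLp_cont[OF continuous_on_const] in auto)
    then obtain n where n: "N p (\<lambda>x. ?h x - \<phi> n x) < d"
      using d order_tendstoD(2) eventually_happens sequentially_bot by blast
    have hL: "?h \<in> mLp p" using p by (intro mLp_bounded[of _ "real m"]) (auto simp: clamp_abs_bound)
    have "N p (\<lambda>x. f x - \<phi> n x) = N p (\<lambda>x. (f x - ?h x) + (?h x - \<phi> n x))" by simp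
    also have "\<dots> \<le> 2 powr p * (N p (\<lambda>x. f x - ?h x) + N p (\<lambda>x. ?h x - \<phi> n x))"
      using p by (intro mLp_add mLp_diff f hL trig_mLp \<phi>) auto
    also have "\<dots> < 2 powr p * (d + d)" using m n by (intro mult_strict_left_mono) auto
    also have "\<dots> = e" by (simp add: d_def)
    finally show ?thesis using \<phi>(1) by blast
  qed
  then have "\<forall>n. \<exists>\<phi>\<in>trig. N p (\<lambda>x. f x - \<phi> x) < 1 / Suc n" by simp
  then obtain \<phi> where \<phi>: "\<And>n. \<phi> n \<in> trig" "\<And>n. N p (\<lambda>x. f x - \<phi> n x) < 1 / Suc n" by metis
  have "(\<lambda>n. N p (\<lambda>x. f x - \<phi> n x)) \<longlonglongrightarrow> 0"
  proof (rule Lim_null_comparison)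
    show "\<forall>\<^sub>F n in sequentially. norm (N p (\<lambda>x. f x - \<phi> n x)) \<le> 1 / Suc n"
      using \<phi>(2) by (auto intro!: always_eventually less_imp_le simp: N_nonneg)
    show "(\<lambda>n. 1 / real (Suc n)) \<longlonglongrightarrow> 0" using LIMSEQ_Suc[OF lim_1_over_n] by simp
  qed
  then show ?thesis using that \<phi>(1) by blast
qed

end

section \<open>Fourier multipliers\<close>

text \<open>
  Fourier multipliers act on coefficients: \<open>dco a\<close> is the derivative in direction \<open>a\<close>, \<open>gco\<close> is
  \<open>(- \<Delta>)\<^sup>-\<^sup>1\<close> (which annihilates the frequency zero, as \<open>1 / 0 = 0\<close>), and \<open>hco t\<close> is \<open>exp (t \<Delta>)\<close>.
\<close>

definition dco :: "real^2 \<Rightarrow> (real^2 \<Rightarrow> complex) \<Rightarrow> real^2 \<Rightarrow> complex" where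
  "dco a c k = of_real (2 * pi * (k \<bullet> a)) * \<i> * c k"

lemma wave_has_derivative: "(wave c k has_derivative (\<lambda>h. wave (of_real (2 * pi * (k \<bullet> h)) * \<i> * c) k x)) (at x)"
proof -
  have w: "wave c k = (\<lambda>x. Re c * cos (2 * pi * (k \<bullet> x)) - Im c * sin (2 * pi * (k \<bullet> x)))"
    by (simp add: wave_def fun_eq_iff)
  show ?thesis unfolding w
    by (auto intro!: derivative_eq_intros simp: wave_def fun_eq_iff algebra_simps)
qed

lemma tp_has_derivative: "(tp A c has_derivative (\<lambda>h. tp A (dco h c) x)) (at x)"
  unfolding tp_def[abs_def] dco_def by (intro has_derivative_sum wave_has_derivative)

lemma has_derivative_line:
  fixes f :: "real^2 \<Rightarrow> real"
  assumes "(f has_derivative D) (at (x + s *\<^sub>R a))"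
  shows "((\<lambda>s. f (x + s *\<^sub>R a)) has_real_derivative D a) (at s)"
proof -
  have "((\<lambda>s. x + s *\<^sub>R a) has_derivative (\<lambda>h. h *\<^sub>R a)) (at s)"
    by (auto intro!: derivative_eq_intros)
  from has_derivative_compose[OF this assms]
  have "((\<lambda>s. f (x + s *\<^sub>R a)) has_derivative (\<lambda>h. D (h *\<^sub>R a))) (at s)" .
  moreover have "D (h *\<^sub>R a) = D a * h" for h
    using linear_cmul[OF has_derivative_linear[OF assms]] by (simp add: mult.commute)
  ultimately show ?thesis by (simp add: has_field_derivative_def)
qed

lemma tp_deriv: "((\<lambda>s. tp A c (x + s *\<^sub>R a)) has_real_derivative tp A (dco a c) (x + s *\<^sub>R a)) (at s)"
  by (rule has_derivative_line[OF tp_has_derivative])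

lemma partial_deriv_tp: "partial_deriv i (tp A c) = tp A (dco (axis i 1) c)"
proof
  fix x
  show "partial_deriv i (tp A c) x = tp A (dco (axis i 1) c) x"
    unfolding partial_deriv_def
    by (subst frechet_derivative_at[OF tp_has_derivative, symmetric]) simp
qed

lemma smooth_tp: "smooth (tp A c)"
proof -
  have "\<exists>d. foldr partial_deriv is (tp A c) = tp A d" for "is"
    by (induction "is") (auto simp: partial_deriv_tp)
  moreover have "tp A d differentiable_on UNIV" for d
    unfolding differentiable_on_def differentiable_def using tp_has_derivative by blast
  ultimately show ?thesis unfolding smooth_def by metis
qed

lemma smooth_cont: assumes "smooth \<phi>"
  shows "continuous_on UNIV \<phi>" "continuous_on UNIV (partial_deriv i \<phi>)"
    "((\<lambda>s. \<phi> (x + s *\<^sub>R axis i 1)) has_real_derivative partial_deriv i \<phi> (x + s *\<^sub>R axis i 1)) (at s)"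
proof -
  have a: "foldr partial_deriv [] \<phi> differentiable_on UNIV" "foldr partial_deriv [i] \<phi> differentiable_on UNIV"
    using assms unfolding smooth_def by blast+
  then show "continuous_on UNIV \<phi>" "continuous_on UNIV (partial_deriv i \<phi>)"
    by (auto intro: differentiable_imp_continuous_on)
  have "\<phi> differentiable (at (x + s *\<^sub>R axis i 1))" using a(1) by (simp add: differentiable_on_def)
  then have "(\<phi> has_derivative frechet_derivative \<phi> (at (x + s *\<^sub>R axis i 1))) (at (x + s *\<^sub>R axis i 1))"
    by (simp add: frechet_derivative_works)
  from has_derivative_line[OF this]
  show "((\<lambda>s. \<phi> (x + s *\<^sub>R axis i 1)) has_real_derivative partial_deriv i \<phi> (x + s *\<^sub>R axis i 1)) (at s)"
    by (simp add: partial_deriv_def)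
qed

definition lam :: "real^2 \<Rightarrow> real" where "lam k = 4 * pi\<^sup>2 * (k \<bullet> k)"

definition gco :: "(real^2 \<Rightarrow> complex) \<Rightarrow> real^2 \<Rightarrow> complex" where
  "gco c k = of_real (1 / lam k) * c k"

lemma lam_pos: "k \<noteq> 0 \<Longrightarrow> lam k > 0" by (simp add: lam_def)

lemma tp_laplacian: "(\<Sum>i\<in>UNIV. tp A (dco (axis i 1) (dco (axis i 1) c)) x) = - tp A (\<lambda>k. of_real (lam k) * c k) x"
proof -
  have "wave (dco (axis i 1) (dco (axis i 1) c) k) k x = - (4 * pi\<^sup>2 * (k$i * k$i)) * wave (c k) k x" for k and i :: 2
    by (simp add: dco_def inner_axis wave_scale[symmetric] power2_eq_square algebra_simps) (simp add: wave_def algebra_simps)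
  then have "(\<Sum>i\<in>UNIV. wave (dco (axis i 1) (dco (axis i 1) c) k) k x) = - wave (of_real (lam k) * c k) k x" for k
    by (simp only: wave_scale sum_distrib_right[symmetric] sum_negf sum_distrib_left[symmetric] lam_def inner_vec_def inner_real_def) simp
  then have "(\<Sum>k\<in>A. \<Sum>i\<in>UNIV. wave (dco (axis i 1) (dco (axis i 1) c) k) k x) = - tp A (\<lambda>k. of_real (lam k) * c k) x"
    by (simp add: tp_def sum_negf)
  then show ?thesis unfolding tp_def by (subst sum.swap)
qed

context lattice2
begin

section \<open>Differentiation under the integral and integration by parts\<close>

lemma leibniz_T:
  fixes F F' :: "real \<Rightarrow> real^2 \<Rightarrow> real"
  assumes D: "\<And>t x. ((\<lambda>t. F t x) has_real_derivative F' t x) (at t)"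
    and Fc: "\<And>t. continuous_on UNIV (F t)"
    and F'c: "continuous_on UNIV (\<lambda>z. F' (fst z) (snd z))"
  shows "((\<lambda>t. \<integral>x. F t x \<partial>T) has_real_derivative (\<integral>x. F' t x \<partial>T)) (at t)"
proof -
  let ?K = "cball t 1 \<times> cball (0::real^2) (norm \<xi> + norm \<eta>)"
  have "compact ((\<lambda>z. F' (fst z) (snd z)) ` ?K)"
    by (intro compact_continuous_image continuous_on_subset[OF F'c] compact_Times) auto
  then have "bounded ((\<lambda>z. F' (fst z) (snd z)) ` ?K)" by (rule compact_imp_bounded)
  then obtain B where "\<forall>y \<in> (\<lambda>z. F' (fst z) (snd z)) ` ?K. norm y \<le> B" unfolding bounded_iff ..
  then have B: "\<bar>F' (fst z) (snd z)\<bar> \<le> B" if "z \<in> ?K" for z using that by auto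
  have F'1: "continuous_on UNIV (F' t)"
    using continuous_on_compose2[OF F'c, of UNIV "\<lambda>x. (t, x)"] by (simp add: continuous_on_Pair)
  \<comment> \<open>The mean value inequality on the compact set \<open>?K\<close> makes the
    difference quotients uniformly bounded, which supplies the constant majorant for dominated
    convergence.\<close>
  have lip: "\<bar>F (t + h) x - F t x\<bar> \<le> B * \<bar>h\<bar>" if "\<bar>h\<bar> \<le> 1" "x \<in> cell" for h x
  proof -
    have "norm (F (t + h) x - F t x) \<le> B * norm (t + h - t)"
    proof (rule field_differentiable_bound[of "cball t 1"])
      show "((\<lambda>s. F s x) has_field_derivative F' s x) (at s within cball t 1)" for s
        using D by (rule has_field_derivative_at_within)
      show "norm (F' s x) \<le> B" if "s \<in> cball t 1" for s
        using B[of "(s, x)"] that norm_cell[OF \<open>x \<in> cell\<close>] by simp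
    qed (use that in \<open>auto simp: dist_real_def\<close>)
    then show ?thesis by simp
  qed
  have "((\<lambda>h. ((\<integral>x. F (t + h) x \<partial>T) - (\<integral>x. F t x \<partial>T)) / h) \<longlongrightarrow> (\<integral>x. F' t x \<partial>T)) (at 0)"
    unfolding tendsto_at_iff_sequentially
  proof (intro allI impI)
    fix X :: "nat \<Rightarrow> real" assume X: "\<forall>i. X i \<in> UNIV - {0}" "X \<longlonglongrightarrow> 0"
    have "eventually (\<lambda>n. \<bar>X n\<bar> < 1) sequentially"
      using tendstoD[OF X(2), of 1] by simp
    then obtain n0 where n0: "\<And>n. n \<ge> n0 \<Longrightarrow> \<bar>X n\<bar> < 1" by (auto simp: eventually_sequentially)
    let ?Y = "\<lambda>n. X (n + n0)"
    have Y: "?Y n \<noteq> 0" "\<bar>?Y n\<bar> \<le> 1" for n using X(1) n0[of "n + n0"] by auto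
    have Yl: "?Y \<longlonglongrightarrow> 0" using X(2) by (rule LIMSEQ_ignore_initial_segment)
    have "(\<lambda>n. \<integral>x. (F (t + ?Y n) x - F t x) / ?Y n \<partial>T) \<longlonglongrightarrow> (\<integral>x. F' t x \<partial>T)"
    proof (rule integral_dominated_convergence[where w = "\<lambda>_. B"])
      show "F' t \<in> borel_measurable T" using F'1 by blast
      show "(\<lambda>x. (F (t + ?Y n) x - F t x) / ?Y n) \<in> borel_measurable T" for n
        by (intro cont_measurable_T continuous_intros Fc) (use Y in auto)
      show "AE x in T. (\<lambda>n. (F (t + ?Y n) x - F t x) / ?Y n) \<longlonglongrightarrow> F' t x"
      proof (rule AE_I2)
        fix x
        have "((\<lambda>h. (F (t + h) x - F t x) / h) \<longlongrightarrow> F' t x) (at 0)"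
          using D[of x t] by (simp add: DERIV_def)
        then show "(\<lambda>n. (F (t + ?Y n) x - F t x) / ?Y n) \<longlonglongrightarrow> F' t x"
          unfolding tendsto_at_iff_sequentially using Y(1) Yl by (auto simp: o_def)
      qed
      show "AE x in T. norm ((F (t + ?Y n) x - F t x) / ?Y n) \<le> B" for n
      proof (rule AE_I2)
        fix x assume "x \<in> space T"
        then have "\<bar>F (t + ?Y n) x - F t x\<bar> \<le> B * \<bar>?Y n\<bar>" using lip[OF Y(2)] by simp
        then show "norm ((F (t + ?Y n) x - F t x) / ?Y n) \<le> B" using Y(1)[of n] by (simp add: divide_le_eq)
      qed
    qed auto
    also have "(\<lambda>n. \<integral>x. (F (t + ?Y n) x - F t x) / ?Y n \<partial>T) = (\<lambda>n. ((\<integral>x. F (t + ?Y n) x \<partial>T) - (\<integral>x. F t x \<partial>T)) / ?Y n)"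
      using integrable_cont[OF Fc] by simp
    finally show "((\<lambda>h. ((\<integral>x. F (t + h) x \<partial>T) - (\<integral>x. F t x \<partial>T)) / h) \<circ> X) \<longlonglongrightarrow> (\<integral>x. F' t x \<partial>T)"
      by (simp add: o_def LIMSEQ_offset[of _ n0])
  qed
  then show ?thesis by (simp add: DERIV_def)
qed

lemma abs_integral_le_bound:
  assumes "integrable T f" "\<And>x. x \<in> cell \<Longrightarrow> \<bar>f x\<bar> \<le> e"
  shows "\<bar>\<integral>x. f x \<partial>T\<bar> \<le> e * V"
proof -
  have "\<bar>\<integral>x. f x \<partial>T\<bar> \<le> (\<integral>x. \<bar>f x\<bar> \<partial>T)" by (rule integral_abs_bound)
  also have "\<dots> \<le> (\<integral>x. e \<partial>T)" by (rule integral_mono) (use assms in auto)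
  finally show ?thesis by (simp add: V_def mult.commute)
qed

lemma eq_by_approx:
  fixes a b C :: real
  assumes "\<And>e. e > 0 \<Longrightarrow> \<bar>a - b\<bar> \<le> C * e"
  shows "a = b"
proof (rule ccontr)
  assume "a \<noteq> b"
  then have d: "\<bar>a - b\<bar> > 0" by simp
  have "\<bar>a - b\<bar> \<le> C * (\<bar>a - b\<bar> / (2 * (\<bar>C\<bar> + 1)))" using d by (intro assms) auto
  also have "\<dots> \<le> \<bar>C\<bar> * (\<bar>a - b\<bar> / (2 * (\<bar>C\<bar> + 1)))" using d by (intro mult_right_mono) auto
  also have "\<dots> = \<bar>a - b\<bar> * (\<bar>C\<bar> / (2 * (\<bar>C\<bar> + 1)))" by simp
  also have "\<dots> < \<bar>a - b\<bar> * 1" by (intro mult_strict_left_mono d) (simp add: field_simps)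
  finally show False by simp
qed

text \<open>A shift multiplies the coefficients of a trigonometric polynomial by phases and fixes
  the one at frequency zero, which alone enters the integral. Uniform density extends this to
  continuous periodic functions.\<close>

lemma integral_translate:
  assumes f: "continuous_on UNIV f" "per f"
  shows "(\<integral>x. f (x + y) \<partial>T) = (\<integral>x. f x \<partial>T)"
proof (rule eq_by_approx)
  fix e :: real assume e: "e > 0"
  obtain g where g: "g \<in> trig" "\<And>x. \<bar>f x - g x\<bar> < e" using trig_dense[OF f e] by metis
  obtain A c where A: "finite A" "A \<subseteq> dl" "g = tp A c" using g(1) by (rule trigE)
  have "tp A c (x + y) = tp A (\<lambda>k. c k * cis (2 * pi * (k \<bullet> y))) x" for x
    by (simp add: tp_def wave_shift)
  then have gs: "(\<integral>x. g (x + y) \<partial>T) = (\<integral>x. g x \<partial>T)"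
    using A by (simp add: integral_tp)
  have sc: "continuous_on UNIV (\<lambda>x. h (x + y))" if "continuous_on UNIV h" for h :: "real^2 \<Rightarrow> real"
    by (rule continuous_on_compose2[OF that]) (auto intro: continuous_intros)
  have gc: "continuous_on UNIV g" using g(1) trig_cont by blast
  have "\<bar>\<integral>x. f (x + y) - g (x + y) \<partial>T\<bar> \<le> e * V" "\<bar>\<integral>x. f x - g x \<partial>T\<bar> \<le> e * V"
    using g(2) f(1) gc sc less_imp_le by (auto intro!: abs_integral_le_bound integrable_cont continuous_intros)
  moreover have "(\<integral>x. f (x + y) - g (x + y) \<partial>T) = (\<integral>x. f (x + y) \<partial>T) - (\<integral>x. g (x + y) \<partial>T)"
    "(\<integral>x. f x - g x \<partial>T) = (\<integral>x. f x \<partial>T) - (\<integral>x. g x \<partial>T)"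
    using f(1) gc sc by (auto intro!: Bochner_Integration.integral_diff)
  ultimately have "\<bar>(\<integral>x. f (x + y) \<partial>T) - (\<integral>x. f x \<partial>T)\<bar> \<le> e * V + e * V" using gs by linarith
  then show "\<bar>(\<integral>x. f (x + y) \<partial>T) - (\<integral>x. f x \<partial>T)\<bar> \<le> (2 * V) * e" by (simp add: algebra_simps)
qed

text \<open>The integral of the translate by \<open>s *\<^sub>R a\<close> does not depend on
  \<open>s\<close>; its derivative at zero is the claimed integral. No boundary of the cell
  enters.\<close>

lemma integral_deriv_zero:
  assumes f: "continuous_on UNIV f" "per f" and f': "continuous_on UNIV f'"
    and D: "\<And>x s. ((\<lambda>s. f (x + s *\<^sub>R a)) has_real_derivative f' (x + s *\<^sub>R a)) (at s)"
  shows "(\<integral>x. f' x \<partial>T) = 0"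
proof -
  have "((\<lambda>s. \<integral>x. f (x + s *\<^sub>R a) \<partial>T) has_real_derivative (\<integral>x. f' (x + 0 *\<^sub>R a) \<partial>T)) (at 0)"
  proof (rule leibniz_T)
    show "continuous_on UNIV (\<lambda>x. f (x + t *\<^sub>R a))" for t
      by (rule continuous_on_compose2[OF f(1)]) (auto intro: continuous_intros)
    show "continuous_on UNIV (\<lambda>z. f' (snd z + fst z *\<^sub>R a))"
      by (rule continuous_on_compose2[OF f']) (auto intro!: continuous_intros)
  qed (rule D)
  moreover have "(\<lambda>s. \<integral>x. f (x + s *\<^sub>R a) \<partial>T) = (\<lambda>s. \<integral>x. f x \<partial>T)"
    by (simp add: integral_translate[OF f])
  ultimately have "((\<lambda>s::real. \<integral>x. f x \<partial>T) has_real_derivative (\<integral>x. f' x \<partial>T)) (at 0)" by simp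
  then show ?thesis using DERIV_unique DERIV_const by blast
qed

lemma per_mult: "per f \<Longrightarrow> per g \<Longrightarrow> per (\<lambda>x. f x * g x)" by (simp add: periodic_def)

lemma integral_by_parts:
  assumes f: "continuous_on UNIV f" "per f" "continuous_on UNIV f'"
    and g: "continuous_on UNIV g" "per g" "continuous_on UNIV g'"
    and Df: "\<And>x s. ((\<lambda>s. f (x + s *\<^sub>R a)) has_real_derivative f' (x + s *\<^sub>R a)) (at s)"
    and Dg: "\<And>x s. ((\<lambda>s. g (x + s *\<^sub>R a)) has_real_derivative g' (x + s *\<^sub>R a)) (at s)"
  shows "(\<integral>x. f x * g' x \<partial>T) = - (\<integral>x. f' x * g x \<partial>T)"
proof -
  have "(\<integral>x. f x * g' x + f' x * g x \<partial>T) = 0"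
  proof (rule integral_deriv_zero[where f = "\<lambda>x. f x * g x" and a = a])
    show "((\<lambda>s. f (x + s *\<^sub>R a) * g (x + s *\<^sub>R a)) has_real_derivative
        f (x + s *\<^sub>R a) * g' (x + s *\<^sub>R a) + f' (x + s *\<^sub>R a) * g (x + s *\<^sub>R a)) (at s)" for x s
      using DERIV_mult[OF Df Dg] by (simp add: algebra_simps)
  qed (use f g in \<open>auto intro: continuous_intros per_mult\<close>)
  moreover have "integrable T (\<lambda>x. f x * g' x)" "integrable T (\<lambda>x. f' x * g x)"
    using f g by (auto intro!: integrable_cont continuous_intros)
  ultimately show ?thesis by simp
qed

lemma tp_by_parts:
  assumes "A \<subseteq> dl" "B \<subseteq> dl"
  shows "(\<integral>x. tp A c x * tp B (dco a d) x \<partial>T) = - (\<integral>x. tp A (dco a c) x * tp B d x \<partial>T)"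
  by (rule integral_by_parts) (use assms in \<open>auto intro: continuous_tp per_tp tp_deriv\<close>)

lemma weak_partial_tp:
  assumes "A \<subseteq> dl" shows "weak_partial_deriv \<xi> \<eta> i (tp A c) (tp A (dco (axis i 1) c))"
  unfolding weak_partial_deriv_def
proof (intro allI impI)
  fix \<phi> assume "smooth \<phi> \<and> per \<phi>"
  then show "(\<integral>x. tp A c x * partial_deriv i \<phi> x \<partial>T) = - (\<integral>x. tp A (dco (axis i 1) c) x * \<phi> x \<partial>T)"
    using assms by (intro integral_by_parts[where a = "axis i 1"] continuous_tp per_tp tp_deriv smooth_cont) auto
qed

lemma tp_Lp: "finite A \<Longrightarrow> A \<subseteq> dl \<Longrightarrow> 0 \<le> p \<Longrightarrow> tp A c \<in> Lp \<xi> \<eta> p"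
  unfolding Lp_iff by (intro conjI per_tp trig_mLp trigI)

lemma tp_poisson:
  assumes A: "finite A" "A \<subseteq> dl" "0 \<notin> A" and p: "0 \<le> p"
  shows "poisson_solution \<xi> \<eta> p (tp A c) (tp A (gco c))"
proof -
  define D where "D i = tp A (dco (axis i 1) (gco c))" for i :: 2
  define H where "H i j = tp A (dco (axis j 1) (dco (axis i 1) (gco c)))" for i j :: 2
  have w: "weak_derivs_Lp \<xi> \<eta> p (tp A (gco c)) D H"
    unfolding weak_derivs_Lp_def D_def H_def using A p by (intro allI conjI tp_Lp weak_partial_tp) auto
  have "tp A (\<lambda>k. of_real (lam k) * gco c k) = tp A c"
  proof (rule tp_cong)
    fix k assume "k \<in> A"
    then have "lam k > 0" using A(3) lam_pos by metis
    then show "of_real (lam k) * gco c k = c k" by (simp add: gco_def)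
  qed
  then have "- (\<Sum>i\<in>UNIV. H i i x) = tp A c x" for x
    unfolding H_def tp_laplacian by simp
  moreover have "tp A (gco c) \<in> W2p0 \<xi> \<eta> p"
    unfolding W2p0_def W2p_def mean_zero_def using w A p by (auto intro: tp_Lp simp: integral_tp)
  ultimately show ?thesis unfolding poisson_solution_def using w by (intro conjI exI[of _ D] exI[of _ H]) auto
qed

lemma integral_wave_mult:
  assumes "k \<in> dl" "l \<in> dl"
  shows "(\<integral>x. wave c k x * wave d l x \<partial>T) =
    (if k + l = 0 then V * Re (c * d) / 2 else 0) + (if k = l then V * Re (c * cnj d) / 2 else 0)"
proof -
  have "(\<integral>x. wave c k x * wave d l x \<partial>T) = (\<integral>x. wave (c * d / 2) (k + l) x \<partial>T) + (\<integral>x. wave (c * cnj d / 2) (k - l) x \<partial>T)"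
    unfolding wave_mult by (intro Bochner_Integration.integral_add integrable_cont continuous_wave)
  then show ?thesis using integral_wave[OF dl_add[OF assms]] integral_wave[OF dl_diff[OF assms]] by simp
qed

text \<open>Since \<open>A\<close> may contain both \<open>k\<close> and \<open>- k\<close>, the
  waves are not orthogonal and Parseval's formula has cross terms. These join only frequencies of
  equal length, so a multiplier that depends on the length alone can be shared out as
  \<open>sqrt (m k)\<close> on both factors, and the integral becomes that of a square.\<close>

lemma multiplier_nonneg:
  assumes A: "finite A" "A \<subseteq> dl" and m: "\<And>k. k \<in> A \<Longrightarrow> m k \<ge> 0"
    "\<And>k l. k \<in> A \<Longrightarrow> l \<in> A \<Longrightarrow> k \<bullet> k = l \<bullet> l \<Longrightarrow> m k = m l"
  shows "(\<integral>x. tp A c x * tp A (\<lambda>k. of_real (m k) * c k) x \<partial>T) \<ge> 0"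
proof -
  have e: "(\<integral>x. tp A c x * tp A d x \<partial>T) = (\<Sum>k\<in>A. \<Sum>l\<in>A. \<integral>x. wave (c k) k x * wave (d l) l x \<partial>T)" for c d
    unfolding tp_def sum_product by (simp add: Bochner_Integration.integral_sum integrable_cont continuous_intros)
  have "(\<integral>x. wave (c k) k x * wave (of_real (m l) * c l) l x \<partial>T)
      = (\<integral>x. wave (of_real (sqrt (m k)) * c k) k x * wave (of_real (sqrt (m l)) * c l) l x \<partial>T)" (is "?L = ?R")
    if "k \<in> A" "l \<in> A" for k l
  proof (cases "k \<bullet> k = l \<bullet> l")
    case True
    have ml: "sqrt (m k) * sqrt (m l) = m l" using m(1)[of l] m(2)[OF that True] that by simp
    have "a * (m l * b) = (sqrt (m k) * a) * (sqrt (m l) * b)" for a b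
    proof -
      have "(sqrt (m k) * a) * (sqrt (m l) * b) = (sqrt (m k) * sqrt (m l)) * (a * b)" by (simp only: mult_ac)
      then show ?thesis by (simp only: ml mult_ac)
    qed
    then show ?thesis unfolding wave_scale by (intro Bochner_Integration.integral_cong refl)
  next
    case False
    then have "k + l \<noteq> 0" "k \<noteq> l" by (auto simp: add_eq_0_iff)
    then show ?thesis using that A by (subst (1 2) integral_wave_mult) auto
  qed
  then have "(\<integral>x. tp A c x * tp A (\<lambda>k. of_real (m k) * c k) x \<partial>T)
    = (\<integral>x. tp A (\<lambda>k. of_real (sqrt (m k)) * c k) x * tp A (\<lambda>k. of_real (sqrt (m k)) * c k) x \<partial>T)"
    unfolding e by (intro sum.cong refl)
  then show ?thesis by (simp add: integral_nonneg_AE)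
qed

text \<open>Only pairs with \<open>k = l\<close> or \<open>k = - l\<close> contribute, and both have
  equal lengths; agreement of \<open>m\<close> and \<open>n\<close> on such pairs is what lets the
  multiplier change sides.\<close>

lemma multiplier_symmetric:
  assumes A: "finite A" "A \<subseteq> dl" "finite B" "B \<subseteq> dl" and m: "\<And>k l. k \<in> A \<Longrightarrow> l \<in> B \<Longrightarrow> k \<bullet> k = l \<bullet> l \<Longrightarrow> m k = (n l :: real)"
  shows "(\<integral>x. tp A (\<lambda>k. of_real (m k) * c k) x * tp B d x \<partial>T) = (\<integral>x. tp A c x * tp B (\<lambda>k. of_real (n k) * d k) x \<partial>T)"
proof -
  have e: "(\<integral>x. tp A c x * tp B d x \<partial>T) = (\<Sum>k\<in>A. \<Sum>l\<in>B. \<integral>x. wave (c k) k x * wave (d l) l x \<partial>T)" for c d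
    unfolding tp_def sum_product by (simp add: Bochner_Integration.integral_sum integrable_cont continuous_intros)
  have "(\<integral>x. wave (of_real (m k) * c k) k x * wave (d l) l x \<partial>T)
      = (\<integral>x. wave (c k) k x * wave (of_real (n l) * d l) l x \<partial>T)"
    if "k \<in> A" "l \<in> B" for k l
  proof (cases "k \<bullet> k = l \<bullet> l")
    case True
    then show ?thesis using m[OF that True] unfolding wave_scale by (simp add: mult_ac)
  next
    case False
    then have "k + l \<noteq> 0" "k \<noteq> l" by (auto simp: add_eq_0_iff)
    then show ?thesis using that A by (subst (1 2) integral_wave_mult) auto
  qed
  then show ?thesis unfolding e by (intro sum.cong refl)
qed

end

section \<open>The heat flow and the Bellman function argument\<close>

definition hco :: "real \<Rightarrow> (real^2 \<Rightarrow> complex) \<Rightarrow> real^2 \<Rightarrow> complex" where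
  "hco t c k = of_real (exp (- lam k * t)) * c k"

lemma hco_zero [simp]: "hco 0 c = c" by (simp add: hco_def fun_eq_iff)

lemma dco_hco: "dco a (hco t c) = hco t (dco a c)"
  by (simp add: hco_def dco_def fun_eq_iff)

lemma hco_deriv: "((\<lambda>t. tp A (hco t c) x) has_real_derivative tp A (hco t (\<lambda>k. of_real (- lam k) * c k)) x) (at t)"
proof -
  have "tp A (hco t c) x = (\<Sum>k\<in>A. exp (- lam k * t) * wave (c k) k x)" for t and c
    unfolding tp_def hco_def wave_scale ..
  then show ?thesis
    by (simp only: wave_scale) (auto intro!: derivative_eq_intros sum.cong)
qed

lemma continuous_hco [continuous_intros]: "continuous_on S (\<lambda>z. tp A (hco (fst z) c) (snd z))"
  unfolding tp_def hco_def wave_scale unfolding wave_def by (intro continuous_intros)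

lemma heat_eq: "tp A (hco t (\<lambda>k. of_real (- lam k) * c k)) x = (\<Sum>i\<in>UNIV. tp A (hco t (dco (axis i 1) (dco (axis i 1) c))) x)"
proof -
  have "tp A (hco t (\<lambda>k. of_real (- lam k) * c k)) x = - tp A (\<lambda>k. of_real (lam k) * hco t c k) x"
    by (simp add: tp_def hco_def wave_def sum_negf[symmetric] mult_ac)
  then show ?thesis by (simp add: tp_laplacian[symmetric] dco_hco)
qed

lemma tp_hco_tendsto:
  assumes "finite A" "0 \<notin> A"
  shows "((\<lambda>t. \<Sum>k\<in>A. cmod (hco t c k)) \<longlongrightarrow> 0) at_top"
proof (rule tendsto_null_sum)
  fix k assume "k \<in> A"
  then have "lam k > 0" using assms lam_pos by metis
  then have "filterlim (\<lambda>t. lam k * t) at_top at_top"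
    by (intro filterlim_tendsto_pos_mult_at_top[OF tendsto_const] filterlim_ident) auto
  then have "((\<lambda>t. exp (- (lam k * t))) \<longlongrightarrow> 0) at_top"
    by (intro filterlim_compose[OF exp_at_bot]) (simp add: filterlim_uminus_at_top[symmetric])
  from tendsto_mult_left_zero[OF this, of "cmod (c k)"]
  show "((\<lambda>t. cmod (hco t c k)) \<longlongrightarrow> 0) at_top"
    by (simp add: hco_def norm_mult mult.commute)
qed

context lattice2
begin

text \<open>
  The heat flow argument: along \<open>u = exp (t \<Delta>) f\<close> and \<open>v = exp (t \<Delta>) g\<close> the integral of \<open>Q u v\<close>
  decreases at least as fast as the pairing of \<open>\<partial>\<^sub>j \<partial>\<^sub>i G u\<close> with \<open>v\<close> can change; the pairing tends to
  zero as \<open>t\<close> tends to infinity, while the integral stays nonnegative.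
\<close>

lemma bellman_bilinear:
  fixes Q Qx Qy Qxx Qxy Qyy a b :: "real \<Rightarrow> real \<Rightarrow> real" and i j :: 2
  assumes DQ: "\<And>X Y X' Y' t. (X has_real_derivative X') (at t) \<Longrightarrow> (Y has_real_derivative Y') (at t) \<Longrightarrow>
      ((\<lambda>t. Q (X t) (Y t)) has_real_derivative (Qx (X t) (Y t) * X' + Qy (X t) (Y t) * Y')) (at t)"
    and DQx: "\<And>X Y X' Y' t. (X has_real_derivative X') (at t) \<Longrightarrow> (Y has_real_derivative Y') (at t) \<Longrightarrow>
      ((\<lambda>t. Qx (X t) (Y t)) has_real_derivative (Qxx (X t) (Y t) * X' + Qxy (X t) (Y t) * Y')) (at t)"
    and DQy: "\<And>X Y X' Y' t. (X has_real_derivative X') (at t) \<Longrightarrow> (Y has_real_derivative Y') (at t) \<Longrightarrow>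
      ((\<lambda>t. Qy (X t) (Y t)) has_real_derivative (Qxy (X t) (Y t) * X' + Qyy (X t) (Y t) * Y')) (at t)"
    and c0: "continuous_on UNIV (\<lambda>z. Q (fst z) (snd z))"
    and c1: "continuous_on UNIV (\<lambda>z. Qx (fst z) (snd z))" "continuous_on UNIV (\<lambda>z. Qy (fst z) (snd z))"
    and c2: "continuous_on UNIV (\<lambda>z. Qxx (fst z) (snd z))" "continuous_on UNIV (\<lambda>z. Qxy (fst z) (snd z))"
      "continuous_on UNIV (\<lambda>z. Qyy (fst z) (snd z))"
    and hess: "\<And>x y \<alpha> \<beta>. Qxx x y * \<alpha>\<^sup>2 + 2 * Qxy x y * \<alpha> * \<beta> + Qyy x y * \<beta>\<^sup>2 \<ge> a x y * \<alpha>\<^sup>2 + b x y * \<beta>\<^sup>2"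
    and ab: "\<And>x y. a x y \<ge> 0" "\<And>x y. b x y \<ge> 0" "\<And>x y. a x y * b x y \<ge> 1"
    and Q0: "\<And>x y. Q x y \<ge> 0"
    and A: "finite A" "A \<subseteq> dl" "0 \<notin> A" and B: "finite B" "B \<subseteq> dl"
  shows "\<bar>\<integral>x. tp A (dco (axis j 1) (dco (axis i 1) (gco c))) x * tp B d x \<partial>T\<bar> \<le> (\<integral>x. Q (tp A c x) (tp B d x) \<partial>T)"
proof -
  let ?e = "\<lambda>i::2. axis i (1::real)"
  define u where "u t = tp A (hco t c)" for t
  define v where "v t = tp B (hco t d)" for t
  define ud where "ud i t = tp A (hco t (dco (?e i) c))" for i t
  define vd where "vd i t = tp B (hco t (dco (?e i) d))" for i t
  define udd where "udd i t = tp A (hco t (dco (?e i) (dco (?e i) c)))" for i t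
  define vdd where "vdd i t = tp B (hco t (dco (?e i) (dco (?e i) d)))" for i t
  have cu: "continuous_on S (u t)" "continuous_on S (v t)" "continuous_on S (ud i t)" "continuous_on S (vd i t)"
    "continuous_on S (udd i t)" "continuous_on S (vdd i t)" for S i t
    unfolding u_def v_def ud_def vd_def udd_def vdd_def by (rule continuous_tp)+
  have pu: "per (u t)" "per (v t)" "per (ud i t)" "per (vd i t)" for i t
    unfolding u_def v_def ud_def vd_def using A B by (auto intro: per_tp)
  have cq: "continuous_on UNIV (\<lambda>x. q (u t x) (v t x))" if "continuous_on UNIV (\<lambda>z. q (fst z) (snd z))" for q :: "real \<Rightarrow> real \<Rightarrow> real" and t
    using continuous_on_compose2[OF that, of UNIV "\<lambda>x. (u t x, v t x)"] cu by (simp add: continuous_on_Pair)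
  have cqj: "continuous_on UNIV (\<lambda>z. q (u (fst z) (snd z)) (v (fst z) (snd z)))"
    if "continuous_on UNIV (\<lambda>z. q (fst z) (snd z))" for q :: "real \<Rightarrow> real \<Rightarrow> real"
  proof -
    have "continuous_on UNIV (\<lambda>z. (u (fst z) (snd z), v (fst z) (snd z)))"
      unfolding u_def v_def by (intro continuous_on_Pair continuous_hco)
    from continuous_on_compose2[OF that this] show ?thesis by simp
  qed
  have pq: "per (\<lambda>x. q (u t x) (v t x))" for q :: "real \<Rightarrow> real \<Rightarrow> real" and t
    using pu(1,2) by (simp add: periodic_def)
  have dx: "((\<lambda>s. u t (x + s *\<^sub>R ?e i)) has_real_derivative ud i t (x + s *\<^sub>R ?e i)) (at s)"
    "((\<lambda>s. v t (x + s *\<^sub>R ?e i)) has_real_derivative vd i t (x + s *\<^sub>R ?e i)) (at s)"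
    "((\<lambda>s. ud i t (x + s *\<^sub>R ?e i)) has_real_derivative udd i t (x + s *\<^sub>R ?e i)) (at s)"
    "((\<lambda>s. vd i t (x + s *\<^sub>R ?e i)) has_real_derivative vdd i t (x + s *\<^sub>R ?e i)) (at s)" for i t x s
    unfolding u_def v_def ud_def vd_def udd_def vdd_def dco_hco[symmetric] by (rule tp_deriv)+
  define ut where "ut t x = (\<Sum>i\<in>UNIV. udd i t x)" for t x
  define vt where "vt t x = (\<Sum>i\<in>UNIV. vdd i t x)" for t x
  have dt: "((\<lambda>t. u t x) has_real_derivative ut t x) (at t)" "((\<lambda>t. v t x) has_real_derivative vt t x) (at t)" for t x
    using hco_deriv[of A c x t] hco_deriv[of B d x t]
    unfolding u_def v_def ut_def vt_def udd_def vdd_def heat_eq by auto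
  define \<Phi> where "\<Phi> t = (\<integral>x. Q (u t x) (v t x) \<partial>T)" for t
  define H where "H i t x = Qxx (u t x) (v t x) * (ud i t x)\<^sup>2 + 2 * Qxy (u t x) (v t x) * ud i t x * vd i t x
      + Qyy (u t x) (v t x) * (vd i t x)\<^sup>2" for i t x
  \<comment> \<open>Integration by parts in direction \<open>i\<close>: the terms with second
    derivatives of \<open>u\<close> and \<open>v\<close> equal minus the Hessian form of
    \<open>Q\<close>, evaluated at the \<open>i\<close>-th partial derivatives.\<close>
  have H: "(\<integral>x. Qx (u t x) (v t x) * udd i t x + Qy (u t x) (v t x) * vdd i t x \<partial>T) = - (\<integral>x. H i t x \<partial>T)" for i t
  proof -
    have "(\<integral>x. H i t x + (Qx (u t x) (v t x) * udd i t x + Qy (u t x) (v t x) * vdd i t x) \<partial>T) = 0"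
    proof (rule integral_deriv_zero[where a = "?e i" and f = "\<lambda>x. Qx (u t x) (v t x) * ud i t x + Qy (u t x) (v t x) * vd i t x"])
      fix x s
      let ?y = "x + s *\<^sub>R ?e i"
      have "((\<lambda>s. Qx (u t (x + s *\<^sub>R ?e i)) (v t (x + s *\<^sub>R ?e i)) * ud i t (x + s *\<^sub>R ?e i) + Qy (u t (x + s *\<^sub>R ?e i)) (v t (x + s *\<^sub>R ?e i)) * vd i t (x + s *\<^sub>R ?e i))
        has_real_derivative ((Qxx (u t ?y) (v t ?y) * ud i t ?y + Qxy (u t ?y) (v t ?y) * vd i t ?y) * ud i t ?y + udd i t ?y * Qx (u t ?y) (v t ?y)
           + ((Qxy (u t ?y) (v t ?y) * ud i t ?y + Qyy (u t ?y) (v t ?y) * vd i t ?y) * vd i t ?y + vdd i t ?y * Qy (u t ?y) (v t ?y)))) (at s)"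
        by (intro DERIV_add DERIV_mult DQx DQy dx)
      then show "((\<lambda>s. Qx (u t (x + s *\<^sub>R ?e i)) (v t (x + s *\<^sub>R ?e i)) * ud i t (x + s *\<^sub>R ?e i) + Qy (u t (x + s *\<^sub>R ?e i)) (v t (x + s *\<^sub>R ?e i)) * vd i t (x + s *\<^sub>R ?e i))
        has_real_derivative H i t ?y + (Qx (u t ?y) (v t ?y) * udd i t ?y + Qy (u t ?y) (v t ?y) * vdd i t ?y)) (at s)"
        by (rule DERIV_cong) (simp add: H_def algebra_simps power2_eq_square)
    next
      show "per (\<lambda>x. Qx (u t x) (v t x) * ud i t x + Qy (u t x) (v t x) * vd i t x)"
        using pu by (simp add: periodic_def)
    qed (unfold H_def, (intro continuous_intros cq c1 c2 cu)+)
    then show ?thesis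
      by (subst (asm) Bochner_Integration.integral_add)
        (unfold H_def, (intro integrable_cont continuous_intros cq c1 c2 cu)+, simp)
  qed
  define \<Phi>' where "\<Phi>' t = - (\<Sum>i\<in>UNIV. \<integral>x. H i t x \<partial>T)" for t
  have D\<Phi>: "(\<Phi> has_real_derivative \<Phi>' t) (at t)" for t
  proof -
    have "(\<Phi> has_real_derivative (\<integral>x. Qx (u t x) (v t x) * ut t x + Qy (u t x) (v t x) * vt t x \<partial>T)) (at t)"
      unfolding \<Phi>_def[abs_def]
    proof (rule leibniz_T)
      show "continuous_on UNIV (\<lambda>z. Qx (u (fst z) (snd z)) (v (fst z) (snd z)) * ut (fst z) (snd z) + Qy (u (fst z) (snd z)) (v (fst z) (snd z)) * vt (fst z) (snd z))"
        unfolding ut_def vt_def udd_def vdd_def by (intro continuous_intros cqj c1)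
    qed (intro DQ dt cq c0)+
    also have "(\<integral>x. Qx (u t x) (v t x) * ut t x + Qy (u t x) (v t x) * vt t x \<partial>T)
      = (\<integral>x. (\<Sum>i\<in>UNIV. Qx (u t x) (v t x) * udd i t x + Qy (u t x) (v t x) * vdd i t x) \<partial>T)"
      by (simp add: ut_def vt_def sum_distrib_left sum.distrib)
    also have "\<dots> = (\<Sum>i\<in>UNIV. (\<integral>x. Qx (u t x) (v t x) * udd i t x + Qy (u t x) (v t x) * vdd i t x \<partial>T))"
      by (intro Bochner_Integration.integral_sum integrable_cont continuous_intros cq c1 cu)
    also have "\<dots> = \<Phi>' t" by (simp add: H \<Phi>'_def sum_negf)
    finally show ?thesis .
  qed
  \<comment> \<open>By the arithmetic-geometric mean inequality and \<open>a * b \<ge> 1\<close> the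
    two weights drop out of the product. The free indices \<open>i\<close> and \<open>j\<close> are
    absorbed by summing over all directions.\<close>
  have Hbound: "2 * \<bar>ud i t x * vd j t x\<bar> \<le> (\<Sum>i\<in>UNIV. H i t x)" for t x
  proof -
    let ?a = "a (u t x) (v t x)" and ?b = "b (u t x) (v t x)"
    have "(ud i t x)\<^sup>2 \<le> (\<Sum>i\<in>UNIV. (ud i t x)\<^sup>2)" "(vd j t x)\<^sup>2 \<le> (\<Sum>j\<in>UNIV. (vd j t x)\<^sup>2)"
      by (intro member_le_sum; simp)+
    then have "?a * (ud i t x)\<^sup>2 + ?b * (vd j t x)\<^sup>2 \<le> ?a * (\<Sum>i\<in>UNIV. (ud i t x)\<^sup>2) + ?b * (\<Sum>i\<in>UNIV. (vd i t x)\<^sup>2)"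
      using ab by (intro add_mono mult_left_mono) auto
    also have "\<dots> = (\<Sum>i\<in>UNIV. ?a * (ud i t x)\<^sup>2 + ?b * (vd i t x)\<^sup>2)"
      by (simp add: sum.distrib sum_distrib_left)
    also have "\<dots> \<le> (\<Sum>i\<in>UNIV. H i t x)" unfolding H_def by (intro sum_mono hess)
    finally have 1: "?a * (ud i t x)\<^sup>2 + ?b * (vd j t x)\<^sup>2 \<le> (\<Sum>i\<in>UNIV. H i t x)" .
    have "1 * \<bar>ud i t x * vd j t x\<bar> \<le> sqrt (?a * ?b) * \<bar>ud i t x * vd j t x\<bar>"
      using ab(3) by (intro mult_right_mono) auto
    also have "\<dots> = (sqrt ?a * \<bar>ud i t x\<bar>) * (sqrt ?b * \<bar>vd j t x\<bar>)" by (simp add: real_sqrt_mult abs_mult)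
    finally have "2 * \<bar>ud i t x * vd j t x\<bar> \<le> 2 * (sqrt ?a * \<bar>ud i t x\<bar>) * (sqrt ?b * \<bar>vd j t x\<bar>)" by simp
    also have "\<dots> \<le> (sqrt ?a * \<bar>ud i t x\<bar>)\<^sup>2 + (sqrt ?b * \<bar>vd j t x\<bar>)\<^sup>2"
      using sum_squares_bound[of "sqrt ?a * \<bar>ud i t x\<bar>" "sqrt ?b * \<bar>vd j t x\<bar>"] by simp
    also have "\<dots> = ?a * (ud i t x)\<^sup>2 + ?b * (vd j t x)\<^sup>2" using ab by (simp add: power_mult_distrib)
    finally show ?thesis using 1 by linarith
  qed
  define m where "m = dco (?e j) (dco (?e i) (gco c))"
  define X where "X t = (\<integral>x. tp A (hco t m) x * v t x \<partial>T)" for t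
  \<comment> \<open>Both factors of the pairing evolve, and by self-adjointness they contribute
    equally: this is the factor 2, which matches the one in \<open>Hbound\<close>. The eigenvalue
    produced by the time derivative cancels the one divided out in \<open>gco\<close>, leaving one
    derivative for each factor.\<close>
  define X' where "X' t = 2 * (\<integral>x. ud i t x * vd j t x \<partial>T)" for t
  have DX: "(X has_real_derivative X' t) (at t)" for t
  proof -
    let ?l = "\<lambda>c k. of_real (- lam k) * (c k :: complex)"
    have "(X has_real_derivative (\<integral>x. tp A (hco t (?l m)) x * v t x + tp B (hco t (?l d)) x * tp A (hco t m) x \<partial>T)) (at t)"
      unfolding X_def[abs_def] v_def
      by (rule leibniz_T) (intro DERIV_mult hco_deriv continuous_intros)+
    also have "(\<integral>x. tp A (hco t (?l m)) x * v t x + tp B (hco t (?l d)) x * tp A (hco t m) x \<partial>T)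
       = (\<integral>x. tp A (hco t (?l m)) x * v t x \<partial>T) + (\<integral>x. tp A (hco t m) x * tp B (hco t (?l d)) x \<partial>T)"
      unfolding mult.commute[of "tp B (hco t (?l d)) _"]
      by (rule Bochner_Integration.integral_add) (intro integrable_cont continuous_intros cu)+
    also have "(\<integral>x. tp A (hco t m) x * tp B (hco t (?l d)) x \<partial>T) = (\<integral>x. tp A (hco t (?l m)) x * v t x \<partial>T)"
      using multiplier_symmetric[OF A(1,2) B, of "\<lambda>k. - lam k" "\<lambda>k. - lam k" "hco t m" "hco t d"]
      by (simp add: lam_def v_def hco_def[abs_def] mult_ac)
    also have "tp A (hco t (?l m)) = tp A (\<lambda>k. - dco (?e j) (hco t (dco (?e i) c)) k)"
    proof (rule tp_cong)
      fix k assume "k \<in> A"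
      then have "lam k > 0" using A(3) lam_pos by metis
      then show "hco t (?l m) k = - dco (?e j) (hco t (dco (?e i) c)) k"
        by (simp add: m_def hco_def dco_def gco_def)
    qed
    also have "\<dots> = (\<lambda>x. - tp A (dco (?e j) (hco t (dco (?e i) c))) x)"
      using tp_scale[of "-1"] by (simp add: fun_eq_iff)
    also have "(\<integral>x. - tp A (dco (?e j) (hco t (dco (?e i) c))) x * v t x \<partial>T) = (\<integral>x. ud i t x * vd j t x \<partial>T)"
      using tp_by_parts[OF A(2) B(2), of "hco t (dco (?e i) c)" "?e j" "hco t d"]
      by (simp add: ud_def vd_def v_def dco_hco)
    finally show ?thesis by (simp add: X'_def)
  qed
  have XP: "\<bar>X' t\<bar> \<le> - \<Phi>' t" for t
  proof -
    have ic: "continuous_on UNIV (H i t)" for i unfolding H_def[abs_def] by (intro continuous_intros cq c2 cu)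
    have "\<bar>X' t\<bar> = \<bar>\<integral>x. 2 * (ud i t x * vd j t x) \<partial>T\<bar>" by (simp add: X'_def)
    also have "\<dots> \<le> (\<integral>x. \<bar>2 * (ud i t x * vd j t x)\<bar> \<partial>T)" by (rule integral_abs_bound)
    also have "\<dots> \<le> (\<integral>x. (\<Sum>i\<in>UNIV. H i t x) \<partial>T)"
      using Hbound by (intro integral_mono integrable_cont continuous_intros cu ic) (simp add: abs_mult)
    also have "\<dots> = - \<Phi>' t" unfolding \<Phi>'_def
      by (subst Bochner_Integration.integral_sum) (auto intro: integrable_cont ic)
    finally show ?thesis .
  qed
  have \<Phi>0: "\<Phi> t \<ge> 0" for t unfolding \<Phi>_def by (intro integral_nonneg_AE AE_I2 Q0)
  \<comment> \<open>With \<open>s = 1\<close> and \<open>s = -1\<close> the monotone quantity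
    \<open>\<Phi> t + s * X t\<close> gives both halves of the bound on
    \<open>\<bar>X 0\<bar>\<close>.\<close>
  have mono: "\<Phi> 0 + s * X 0 \<ge> s * X t" if "t \<ge> 0" "\<bar>s\<bar> = 1" for s t
  proof -
    have "\<Phi> t + s * X t \<le> \<Phi> 0 + s * X 0"
    proof (rule DERIV_nonpos_imp_nonincreasing[OF that(1)])
      fix r
      have "((\<lambda>t. \<Phi> t + s * X t) has_real_derivative (\<Phi>' r + s * X' r)) (at r)"
        by (intro DERIV_add DERIV_cmult D\<Phi> DX)
      moreover have "s * X' r \<le> \<bar>X' r\<bar>" using that(2) abs_ge_self[of "s * X' r"] by (simp add: abs_mult)
      ultimately show "\<exists>y. ((\<lambda>t. \<Phi> t + s * X t) has_real_derivative y) (at r) \<and> y \<le> 0"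
        using XP[of r] by (intro exI[of _ "\<Phi>' r + s * X' r"]) auto
    qed
    then show ?thesis using \<Phi>0[of t] by linarith
  qed
  have Xlim: "(X \<longlongrightarrow> 0) at_top"
  proof (rule Lim_null_comparison)
    show "((\<lambda>t. (\<Sum>k\<in>A. cmod (hco t m k)) * ((\<Sum>k\<in>B. cmod (d k)) * V)) \<longlongrightarrow> 0) at_top"
      by (intro tendsto_mult_left_zero tp_hco_tendsto A)
    show "\<forall>\<^sub>F t in at_top. norm (X t) \<le> (\<Sum>k\<in>A. cmod (hco t m k)) * ((\<Sum>k\<in>B. cmod (d k)) * V)"
      using eventually_ge_at_top[of 0]
    proof eventually_elim
      case (elim t)
      have "\<bar>X t\<bar> \<le> ((\<Sum>k\<in>A. cmod (hco t m k)) * (\<Sum>k\<in>B. cmod (d k))) * V"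
        unfolding X_def
      proof (rule abs_integral_le_bound)
        show "integrable T (\<lambda>x. tp A (hco t m) x * v t x)" by (intro integrable_cont continuous_intros cu)
        fix x
        have "cmod (hco t d k) \<le> cmod (d k)" for k
        proof -
          have "exp (- (lam k * t)) \<le> 1" using elim by (simp add: lam_def)
          then show ?thesis by (simp add: hco_def norm_mult mult_left_le_one_le)
        qed
        then have "\<bar>v t x\<bar> \<le> (\<Sum>k\<in>B. cmod (d k))"
          unfolding v_def by (intro order.trans[OF abs_tp_le] sum_mono)
        then show "\<bar>tp A (hco t m) x * v t x\<bar> \<le> (\<Sum>k\<in>A. cmod (hco t m k)) * (\<Sum>k\<in>B. cmod (d k))"
          unfolding abs_mult by (intro mult_mono abs_tp_le sum_nonneg) auto
      qed
      then show ?case by simp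
    qed
  qed
  have "\<Phi> 0 + s * X 0 \<ge> s * 0" if "\<bar>s\<bar> = 1" for s
  proof (rule tendsto_upperbound)
    show "((\<lambda>t. s * X t) \<longlongrightarrow> s * 0) at_top" by (intro tendsto_intros Xlim)
    show "\<forall>\<^sub>F t in at_top. s * X t \<le> \<Phi> 0 + s * X 0"
      using eventually_ge_at_top[of 0] by eventually_elim (rule mono[OF _ that])
  qed simp
  from this[of 1] this[of "-1"] have "\<bar>X 0\<bar> \<le> \<Phi> 0" by simp
  then show ?thesis by (simp add: X_def \<Phi>_def m_def u_def v_def)
qed

end

section \<open>The Calderon--Zygmund inequality\<close>

lemma DERIV_powr_chain:
  assumes "(f has_real_derivative f') (at t)" "f t > 0"
  shows "((\<lambda>t. f t powr r) has_real_derivative r * f t powr (r - 1) * f') (at t)"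
  using DERIV_fun_powr[OF assms, of r] by simp

lemma psd_form:
  fixes m n c \<alpha> \<beta> :: real
  assumes "m \<ge> 0" "n \<ge> 0" "c\<^sup>2 \<le> m * n"
  shows "m * \<alpha>\<^sup>2 + 2 * c * \<alpha> * \<beta> + n * \<beta>\<^sup>2 \<ge> 0"
proof (cases "m = 0")
  case True
  then have "c = 0" using assms by simp
  then show ?thesis using True assms by simp
next
  case False
  then have m: "m > 0" using assms by simp
  have "m * (m * \<alpha>\<^sup>2 + 2 * c * \<alpha> * \<beta> + n * \<beta>\<^sup>2) = (m * \<alpha> + c * \<beta>)\<^sup>2 + (m * n - c\<^sup>2) * \<beta>\<^sup>2"
    by (simp add: power2_eq_square algebra_simps)
  also have "\<dots> \<ge> 0" using assms by simp
  finally show ?thesis using m by (simp add: zero_le_mult_iff)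
qed

text \<open>
  A smooth variant of the Nazarov--Treil Bellman function for \<open>2 \<le> p\<close> and the conjugate
  exponent \<open>q\<close>; the parameter \<open>\<kappa> > 0\<close> removes the singularities at the axes.
\<close>

locale bellman =
  fixes p q \<kappa> :: real
  assumes p2: "2 \<le> p" and q_def: "q = p / (p - 1)" and \<kappa>: "\<kappa> > 0"
begin

text \<open>\<open>sqrt (w x)\<close> is a smooth substitute for \<open>\<bar>x\<bar>\<close>, so
  \<open>W r\<close> is one for \<open>\<bar>x\<bar> powr r\<close>; \<open>W1 r\<close> and
  \<open>W2 r\<close> are its first two derivatives.\<close>

definition w :: "real \<Rightarrow> real" where "w x = x\<^sup>2 + \<kappa>\<^sup>2"
definition W :: "real \<Rightarrow> real \<Rightarrow> real" where "W r x = w x powr (r / 2)"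
definition W1 :: "real \<Rightarrow> real \<Rightarrow> real" where "W1 r x = r * x * w x powr (r / 2 - 1)"
definition W2 :: "real \<Rightarrow> real \<Rightarrow> real" where
  "W2 r x = r * w x powr (r / 2 - 1) + r * (r - 2) * x\<^sup>2 * w x powr (r / 2 - 2)"
definition S :: "real \<Rightarrow> real \<Rightarrow> real" where "S x y = W p x + W q y"
definition \<theta> :: real where "\<theta> = 1 - 2 / p"
text \<open>The value makes \<open>K * W2 q y\<close> at least \<open>5 * q\<^sup>2 + 1\<close>
  times the weight \<open>w y powr (q / 2 - 1)\<close>. Of this, \<open>q\<^sup>2\<close> pays for
  the concavity of \<open>S powr \<theta>\<close>, \<open>4 * q\<^sup>2\<close> for the mixed
  derivative, and 1 is left over. It does not depend on \<kappa>, which later tends to zero.\<close>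

definition K :: real where "K = (5 * q\<^sup>2 + 1) / (q * (q - 1))"
text \<open>For \<kappa> = 0 this is \<open>K \<bar>y\<bar>^q + x^2 (\<bar>x\<bar>^p +
  \<bar>y\<bar>^q)^(1 - 2/p)\<close>. The second term looks like \<open>\<bar>x\<bar>^p\<close>
  where \<open>x\<close> dominates and like \<open>x^2 \<bar>y\<bar>^(2 - q)\<close> where
  \<open>y\<close> dominates; the power of the sum joins the two regimes smoothly.\<close>

definition Q where "Q x y = K * W q y + x\<^sup>2 * S x y powr \<theta>"
definition Qx where "Qx x y = 2 * x * S x y powr \<theta> + x\<^sup>2 * (\<theta> * S x y powr (\<theta> - 1) * W1 p x)"
definition Qy where "Qy x y = K * W1 q y + x\<^sup>2 * (\<theta> * S x y powr (\<theta> - 1) * W1 q y)"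
definition Qxx where "Qxx x y = 2 * S x y powr \<theta> + 4 * x * (\<theta> * S x y powr (\<theta> - 1) * W1 p x)
  + x\<^sup>2 * (\<theta> * ((\<theta> - 1) * S x y powr (\<theta> - 2) * (W1 p x)\<^sup>2 + S x y powr (\<theta> - 1) * W2 p x))"
definition Qxy where "Qxy x y = 2 * x * (\<theta> * S x y powr (\<theta> - 1) * W1 q y)
  + x\<^sup>2 * (\<theta> * (\<theta> - 1) * S x y powr (\<theta> - 2) * W1 p x * W1 q y)"
definition Qyy where "Qyy x y = K * W2 q y
  + x\<^sup>2 * (\<theta> * ((\<theta> - 1) * S x y powr (\<theta> - 2) * (W1 q y)\<^sup>2 + S x y powr (\<theta> - 1) * W2 q y))"

lemma q_bounds: "1 < q" "q \<le> 2" using p2 by (auto simp: q_def field_simps)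
lemma w_pos: "w x > 0" using \<kappa> by (simp add: w_def add_nonneg_pos)
lemma W_pos: "W r x > 0" using w_pos[of x] by (simp add: W_def)
lemma S_pos: "S x y > 0" using W_pos by (simp add: S_def add_pos_pos)
lemma \<theta>_bounds: "0 \<le> \<theta>" "\<theta> < 1" and \<theta>_p: "(1 - \<theta>) * p = 2" using p2 by (auto simp: \<theta>_def field_simps)

lemma DERIV_w: "(X has_real_derivative X') (at t) \<Longrightarrow> ((\<lambda>t. w (X t)) has_real_derivative 2 * X t * X') (at t)"
  unfolding w_def by (auto intro!: derivative_eq_intros)

lemma DERIV_W: "(X has_real_derivative X') (at t) \<Longrightarrow> ((\<lambda>t. W r (X t)) has_real_derivative W1 r (X t) * X') (at t)"
  unfolding W_def by (rule DERIV_cong[OF DERIV_powr_chain[OF DERIV_w]]) (auto simp: W1_def w_pos)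

lemma DERIV_W1: "(X has_real_derivative X') (at t) \<Longrightarrow> ((\<lambda>t. W1 r (X t)) has_real_derivative W2 r (X t) * X') (at t)"
  unfolding W1_def
  by (rule DERIV_cong[OF DERIV_mult[OF DERIV_cmult DERIV_powr_chain[OF DERIV_w]]])
    (auto simp: W2_def w_pos algebra_simps power2_eq_square)

lemma DERIV_S_powr:
  assumes "(X has_real_derivative X') (at t)" "(Y has_real_derivative Y') (at t)"
  shows "((\<lambda>t. S (X t) (Y t) powr r) has_real_derivative
     r * S (X t) (Y t) powr (r - 1) * (W1 p (X t) * X' + W1 q (Y t) * Y')) (at t)"
proof (rule DERIV_powr_chain)
  show "((\<lambda>t. S (X t) (Y t)) has_real_derivative W1 p (X t) * X' + W1 q (Y t) * Y') (at t)"
    unfolding S_def by (intro DERIV_add DERIV_W assms)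
qed (rule S_pos)

lemma DERIV_Q:
  assumes X: "(X has_real_derivative X') (at t)" and Y: "(Y has_real_derivative Y') (at t)"
  shows "((\<lambda>t. Q (X t) (Y t)) has_real_derivative (Qx (X t) (Y t) * X' + Qy (X t) (Y t) * Y')) (at t)"
proof -
  have X2: "((\<lambda>t. (X t)\<^sup>2) has_real_derivative 2 * X t * X') (at t)"
    using X by (auto intro!: derivative_eq_intros)
  show ?thesis unfolding Q_def
    by (rule DERIV_cong[OF DERIV_add[OF DERIV_cmult[OF DERIV_W[OF Y]] DERIV_mult[OF X2 DERIV_S_powr[OF X Y]]]])
      (simp add: Qx_def Qy_def algebra_simps)
qed

lemma DERIV_Qx:
  assumes X: "(X has_real_derivative X') (at t)" and Y: "(Y has_real_derivative Y') (at t)"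
  shows "((\<lambda>t. Qx (X t) (Y t)) has_real_derivative (Qxx (X t) (Y t) * X' + Qxy (X t) (Y t) * Y')) (at t)"
proof -
  have X2: "((\<lambda>t. (X t)\<^sup>2) has_real_derivative 2 * X t * X') (at t)"
    using X by (auto intro!: derivative_eq_intros)
  show ?thesis unfolding Qx_def
    by (rule DERIV_cong[OF DERIV_add[OF DERIV_mult[OF DERIV_cmult[OF X] DERIV_S_powr[OF X Y]]
       DERIV_mult[OF X2 DERIV_mult[OF DERIV_cmult[OF DERIV_S_powr[OF X Y]] DERIV_W1[OF X]]]]])
      (simp add: Qxx_def Qxy_def algebra_simps power2_eq_square)
qed

lemma DERIV_Qy:
  assumes X: "(X has_real_derivative X') (at t)" and Y: "(Y has_real_derivative Y') (at t)"
  shows "((\<lambda>t. Qy (X t) (Y t)) has_real_derivative (Qxy (X t) (Y t) * X' + Qyy (X t) (Y t) * Y')) (at t)"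
proof -
  have X2: "((\<lambda>t. (X t)\<^sup>2) has_real_derivative 2 * X t * X') (at t)"
    using X by (auto intro!: derivative_eq_intros)
  show ?thesis unfolding Qy_def
    by (rule DERIV_cong[OF DERIV_add[OF DERIV_cmult[OF DERIV_W1[OF Y]]
       DERIV_mult[OF X2 DERIV_mult[OF DERIV_cmult[OF DERIV_S_powr[OF X Y]] DERIV_W1[OF Y]]]]])
      (simp add: Qyy_def Qxy_def algebra_simps power2_eq_square)
qed

lemma continuous_w_powr: "continuous_on A f \<Longrightarrow> continuous_on A (\<lambda>z. w (f z) powr r)" for f :: "real \<times> real \<Rightarrow> real"
  unfolding w_def by (intro continuous_intros) (use w_pos in \<open>auto simp: w_def less_imp_neq[symmetric]\<close>)

lemma continuous_W:
  fixes f :: "real \<times> real \<Rightarrow> real"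
  assumes "continuous_on A f"
  shows "continuous_on A (\<lambda>z. W r (f z))" "continuous_on A (\<lambda>z. W1 r (f z))" "continuous_on A (\<lambda>z. W2 r (f z))"
  unfolding W_def W1_def W2_def
  by (intro continuous_on_add continuous_on_mult continuous_on_const continuous_on_power continuous_w_powr assms)+

lemma continuous_S_powr: "continuous_on A (\<lambda>z. S (fst z) (snd z) powr r)"
proof -
  have "continuous_on A (\<lambda>z. S (fst z) (snd z))"
    unfolding S_def W_def by (intro continuous_intros continuous_w_powr)
  then show ?thesis by (intro continuous_on_powr continuous_intros) (use S_pos in \<open>auto simp: less_imp_neq[symmetric]\<close>)
qed

lemma continuous_Q:
  "continuous_on UNIV (\<lambda>z. Q (fst z) (snd z))"
  "continuous_on UNIV (\<lambda>z. Qx (fst z) (snd z))" "continuous_on UNIV (\<lambda>z. Qy (fst z) (snd z))"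
  "continuous_on UNIV (\<lambda>z. Qxx (fst z) (snd z))" "continuous_on UNIV (\<lambda>z. Qxy (fst z) (snd z))"
  "continuous_on UNIV (\<lambda>z. Qyy (fst z) (snd z))"
  unfolding Q_def Qx_def Qy_def Qxx_def Qxy_def Qyy_def
  by (intro continuous_on_add continuous_on_mult continuous_on_const continuous_on_power continuous_W
      continuous_S_powr continuous_on_fst continuous_on_snd continuous_on_id)+

text \<open>\<open>x\<^sup>2 \<le> w x = W p x powr (2 / p)\<close> and
  \<open>2 / p + \<theta> = 1\<close>. Hence \<open>Q\<close> grows no faster than
  \<open>W p x + W q y\<close>.\<close>

lemma x2_le: "x\<^sup>2 * S x y powr \<theta> \<le> S x y"
proof -
  have "x\<^sup>2 \<le> w x" by (simp add: w_def)
  also have "\<dots> = W p x powr (2 / p)" using w_pos[of x] p2 by (simp add: W_def powr_powr)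
  also have "\<dots> \<le> S x y powr (2 / p)"
    using W_pos p2 by (intro powr_mono2) (auto simp: S_def less_imp_le)
  finally have "x\<^sup>2 * S x y powr \<theta> \<le> S x y powr (2 / p) * S x y powr \<theta>" by (intro mult_right_mono) auto
  also have "\<dots> = S x y" using S_pos[of x y] by (simp add: powr_add[symmetric] \<theta>_def)
  finally show ?thesis .
qed

lemma K_pos: "K > 0" using q_bounds by (auto simp: K_def intro!: divide_pos_pos add_nonneg_pos)

lemma Q_le: "Q x y \<le> (K + 1) * (W p x + W q y)"
proof -
  have "Q x y \<le> K * W q y + S x y" unfolding Q_def using x2_le by simp
  also have "\<dots> \<le> (K + 1) * (W p x + W q y)"
    using K_pos W_pos[of p x] by (simp add: S_def algebra_simps)
  finally show ?thesis .
qed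

lemma Q_nonneg: "Q x y \<ge> 0" using K_pos W_pos[of q y] by (simp add: Q_def)

text \<open>Everything is measured against the weights \<sigma> and \<open>b\<close>:
  \<open>Qxx\<close> is at least \<open>2 * \<sigma>\<close>, \<open>Qyy\<close> at least
  \<open>(4 * q\<^sup>2 + 1) * b\<close>, and the square of \<open>Qxy\<close> at most
  \<open>\<sigma> * (4 * q\<^sup>2 * b)\<close>. One \<sigma> and \<open>4 * q\<^sup>2 * b\<close>
  are spent on the mixed term; the rest is the claim.\<close>

lemma hess:
  "Qxx x y * \<alpha>\<^sup>2 + 2 * Qxy x y * \<alpha> * \<beta> + Qyy x y * \<beta>\<^sup>2 \<ge> S x y powr \<theta> * \<alpha>\<^sup>2 + w y powr (q / 2 - 1) * \<beta>\<^sup>2"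
proof -
  define s \<sigma> b A1 B1 A2 B2 where "s = S x y" and "\<sigma> = S x y powr \<theta>" and "b = w y powr (q / 2 - 1)"
    and "A1 = W1 p x" and "B1 = W1 q y" and "A2 = W2 p x" and "B2 = W2 q y"
  have s: "s > 0" using S_pos by (simp add: s_def)
  have \<sigma>: "\<sigma> > 0" using S_pos[of x y] by (simp add: \<sigma>_def)
  have b: "b > 0" using w_pos[of y] by (simp add: b_def)
  have p1: "S x y powr (\<theta> - 1) = \<sigma> / s" and p2': "S x y powr (\<theta> - 2) = \<sigma> / s\<^sup>2"
    using s unfolding s_def \<sigma>_def by (simp_all add: powr_diff)
  have xs: "x\<^sup>2 * \<sigma> \<le> s" using x2_le by (simp add: s_def \<sigma>_def)
  \<comment> \<open>The loss caused by the concavity of \<open>S powr \<theta>\<close>. It is at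
    most \<open>(1 - \<theta>) * p = 2\<close>, so \<open>4 - \<rho>\<close> in \<open>Qxx\<close>
    stays positive and \<open>2 - \<rho>\<close> in \<open>Qxy\<close> lies between 0 and 2.\<close>
  define \<rho> where "\<rho> = (1 - \<theta>) * (x * A1) / s"
  have wx: "w x powr (p / 2 - 1) * w x = W p x" and wy: "b * w y = W q y"
    using w_pos[of x] w_pos[of y] by (simp_all add: W_def b_def powr_diff)
  have "x * A1 = p * (x\<^sup>2 * w x powr (p / 2 - 1))" by (simp add: A1_def W1_def power2_eq_square)
  moreover have "x\<^sup>2 * w x powr (p / 2 - 1) \<le> W p x"
    unfolding wx[symmetric] by (subst mult.commute, intro mult_left_mono) (auto simp: w_def)
  moreover have "W p x \<le> s" using W_pos[of q y] by (simp add: s_def S_def)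
  ultimately have xA: "0 \<le> x * A1" "x * A1 \<le> p * s" using p2 by (auto intro!: mult_left_mono)
  have \<rho>: "0 \<le> \<rho>" "\<rho> \<le> 2"
  proof -
    show "0 \<le> \<rho>" using xA s \<theta>_bounds by (simp add: \<rho>_def)
    have "(1 - \<theta>) * (x * A1) \<le> (1 - \<theta>) * (p * s)" using xA \<theta>_bounds by (intro mult_left_mono) auto
    also have "\<dots> = 2 * s" using \<theta>_p by (metis mult.assoc)
    finally show "\<rho> \<le> 2" using s by (simp add: \<rho>_def divide_le_eq)
  qed
  have A2: "A2 \<ge> 0" using p2 by (simp add: A2_def W2_def)
  have B1: "B1\<^sup>2 \<le> q\<^sup>2 * b * s"
  proof -
    have "B1\<^sup>2 = q\<^sup>2 * b * (b * y\<^sup>2)" by (simp add: B1_def W1_def b_def power2_eq_square)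
    also have "\<dots> \<le> q\<^sup>2 * b * s"
    proof (intro mult_left_mono)
      have "b * y\<^sup>2 \<le> b * w y" using b by (intro mult_left_mono) (auto simp: w_def)
      also have "\<dots> \<le> s" using wy W_pos[of p x] by (simp add: s_def S_def)
      finally show "b * y\<^sup>2 \<le> s" .
    qed (use b in auto)
    finally show ?thesis .
  qed
  have B2: "B2 \<ge> q * (q - 1) * b"
  proof -
    have "w y powr (q / 2 - 2) * w y = b" using w_pos[of y] by (simp add: b_def powr_diff power2_eq_square)
    moreover have "w y powr (q / 2 - 2) * y\<^sup>2 \<le> w y powr (q / 2 - 2) * w y" by (intro mult_left_mono) (auto simp: w_def)
    ultimately have "q * (2 - q) * (y\<^sup>2 * w y powr (q / 2 - 2)) \<le> q * (2 - q) * b"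
      using q_bounds by (intro mult_left_mono) (auto simp: mult.commute)
    then show ?thesis by (simp add: B2_def W2_def b_def algebra_simps)
  qed
  have 1: "Qxx x y \<ge> 2 * \<sigma>"
  proof -
    have "Qxx x y = 2 * \<sigma> + \<theta> * (\<sigma> / s) * (x * A1) * (4 - \<rho>) + x\<^sup>2 * \<theta> * (\<sigma> / s) * A2"
      using s unfolding Qxx_def p1 p2' A1_def[symmetric] A2_def[symmetric] \<sigma>_def[symmetric] \<rho>_def
      by (simp add: field_simps power2_eq_square)
    moreover have "0 \<le> \<theta> * (\<sigma> / s) * (x * A1) * (4 - \<rho>)" "0 \<le> x\<^sup>2 * \<theta> * (\<sigma> / s) * A2"
      using \<theta>_bounds \<sigma> s xA \<rho> A2 by (auto intro!: mult_nonneg_nonneg)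
    ultimately show ?thesis by linarith
  qed
  have t: "x\<^sup>2 * \<sigma> / s \<le> 1" using xs s by simp
  have t0: "0 \<le> x\<^sup>2 * \<sigma> / s" using \<sigma> s by simp
  have 2: "Qyy x y \<ge> (4 * q\<^sup>2 + 1) * b"
  proof -
    have "Qyy x y = K * B2 - \<theta> * (1 - \<theta>) * (x\<^sup>2 * \<sigma> / s) * (B1\<^sup>2 / s) + \<theta> * (x\<^sup>2 * \<sigma> / s) * B2"
      using s unfolding Qyy_def p1 p2' B1_def[symmetric] B2_def[symmetric]
      by (simp add: field_simps power2_eq_square)
    moreover have "\<theta> * (1 - \<theta>) * (x\<^sup>2 * \<sigma> / s) * (B1\<^sup>2 / s) \<le> 1 * 1 * 1 * (q\<^sup>2 * b)"
      using \<theta>_bounds t t0 B1 s by (intro mult_mono) (auto simp: divide_le_eq)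
    moreover have "K * B2 \<ge> (5 * q\<^sup>2 + 1) * b"
    proof -
      have "(5 * q\<^sup>2 + 1) * b = K * (q * (q - 1) * b)" using q_bounds by (simp add: K_def)
      also have "\<dots> \<le> K * B2" using B2 K_pos by (intro mult_left_mono) auto
      finally show ?thesis .
    qed
    moreover have "0 \<le> \<theta> * (x\<^sup>2 * \<sigma> / s) * B2"
    proof -
      have "B2 \<ge> 0" using B2 q_bounds b by (smt (verit) mult_nonneg_nonneg)
      then show ?thesis using \<theta>_bounds t0 by (intro mult_nonneg_nonneg) auto
    qed
    ultimately show ?thesis by (simp add: algebra_simps)
  qed
  have 3: "(Qxy x y)\<^sup>2 \<le> \<sigma> * (4 * q\<^sup>2 * b)"
  proof -
    have e: "Qxy x y = \<theta> * (\<sigma> / s) * B1 * x * (2 - \<rho>)"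
      using s unfolding Qxy_def p1 p2' A1_def[symmetric] B1_def[symmetric] \<rho>_def
      by (simp add: field_simps power2_eq_square)
    have "(Qxy x y)\<^sup>2 = \<theta>\<^sup>2 * (2 - \<rho>)\<^sup>2 * (x\<^sup>2 * \<sigma> / s) * (\<sigma> * (B1\<^sup>2 / s))"
      unfolding e using s by (simp add: power_mult_distrib power2_eq_square field_simps)
    also have "\<dots> \<le> 1 * 2\<^sup>2 * 1 * (\<sigma> * (q\<^sup>2 * b))"
      using \<theta>_bounds \<rho> t t0 B1 s \<sigma> by (intro mult_mono power_mono) (auto simp: divide_le_eq power_le_one)
    finally show ?thesis by (simp add: mult_ac)
  qed
  have "\<sigma> * \<alpha>\<^sup>2 + 2 * Qxy x y * \<alpha> * \<beta> + (4 * q\<^sup>2 * b) * \<beta>\<^sup>2 \<ge> 0"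
    using 3 \<sigma> b by (intro psd_form) auto
  moreover have "Qxx x y * \<alpha>\<^sup>2 \<ge> 2 * \<sigma> * \<alpha>\<^sup>2" using 1 by (intro mult_right_mono) auto
  moreover have "Qyy x y * \<beta>\<^sup>2 \<ge> (4 * q\<^sup>2 + 1) * b * \<beta>\<^sup>2" using 2 by (intro mult_right_mono) auto
  ultimately show ?thesis by (simp add: \<sigma>_def[symmetric] b_def[symmetric] algebra_simps)
qed

text \<open>Here the conjugacy of \<open>p\<close> and \<open>q\<close> enters:
  \<open>q / 2 * \<theta> + (q / 2 - 1) = 0\<close>, so the powers of \<open>w y\<close>
  cancel.\<close>

lemma weights: "S x y powr \<theta> * w y powr (q / 2 - 1) \<ge> 1"
proof -
  have "w y powr (q / 2 * \<theta>) = W q y powr \<theta>" by (simp add: W_def powr_powr)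
  also have "\<dots> \<le> S x y powr \<theta>"
    using W_pos \<theta>_bounds by (intro powr_mono2) (auto simp: S_def less_imp_le)
  finally have "w y powr (q / 2 * \<theta>) * w y powr (q / 2 - 1) \<le> S x y powr \<theta> * w y powr (q / 2 - 1)"
    by (intro mult_right_mono) auto
  moreover have "q / 2 * \<theta> + (q / 2 - 1) = 0" using p2 by (simp add: \<theta>_def q_def field_simps)
  ultimately show ?thesis using w_pos[of y] by (simp add: powr_add[symmetric])
qed

lemma W_le: assumes "r \<ge> 1" "\<kappa> \<le> 1" shows "W r x \<le> 2 powr r * (\<bar>x\<bar> powr r + \<kappa>)"
proof -
  have "w x \<le> (\<bar>x\<bar> + \<kappa>)\<^sup>2" using \<kappa> by (simp add: w_def power2_sum)
  then have "W r x \<le> ((\<bar>x\<bar> + \<kappa>)\<^sup>2) powr (r / 2)"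
    unfolding W_def using assms w_pos[of x] by (intro powr_mono2) auto
  also have "\<dots> = (\<bar>x\<bar> + \<kappa>) powr r"
    using \<kappa> powr_numeral[of "\<bar>x\<bar> + \<kappa>" "num.Bit0 num.One"] powr_powr[of "\<bar>x\<bar> + \<kappa>" 2 "r / 2"] by simp
  also have "\<dots> = \<bar>\<bar>x\<bar> + \<kappa>\<bar> powr r" using \<kappa> by simp
  also have "\<dots> \<le> 2 powr r * (\<bar>\<bar>x\<bar>\<bar> powr r + \<bar>\<kappa>\<bar> powr r)" using assms by (intro abs_add_powr_le) auto
  also have "\<dots> \<le> 2 powr r * (\<bar>x\<bar> powr r + \<kappa>)"
    using \<kappa> assms powr_mono'[of 1 r \<kappa>] by (intro mult_left_mono add_mono) auto
  finally show ?thesis .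
qed

end

section \<open>From the Bellman function to the Calderon--Zygmund inequality\<close>

context lattice2
begin

text \<open>The Bellman function treats its arguments differently and requires
  \<open>2 \<le> p\<close>. The second bound inserts them in exchanged order, so that the function
  whose potential is differentiated may carry the smaller exponent \<open>q\<close>.\<close>

lemma cz_bellman:
  fixes i j :: 2
  assumes bl: "bellman p q \<kappa>" "\<kappa> \<le> 1"
    and A: "finite A" "A \<subseteq> dl" "0 \<notin> A" and B: "finite B" "B \<subseteq> dl"
    and I: "I = (\<integral>x. tp A (dco (axis j 1) (dco (axis i 1) (gco c))) x * tp B d x \<partial>T)"
  shows "\<bar>I\<bar> \<le> (bellman.K q + 1) * (2 powr p + 2 powr q) * (N p (tp A c) + N q (tp B d) + 2 * V * \<kappa>)"
    "\<bar>I\<bar> \<le> (bellman.K q + 1) * (2 powr p + 2 powr q) * (N q (tp A c) + N p (tp B d) + 2 * V * \<kappa>)"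
proof -
  interpret bellman p q \<kappa> by fact
  have bnd: "\<bar>I\<bar> \<le> (K + 1) * (2 powr p + 2 powr q) * (N p f + N q g + 2 * V * \<kappa>)"
    if le: "\<bar>I\<bar> \<le> (\<integral>x. Q (f x) (g x) \<partial>T)" and f: "continuous_on UNIV f" and g: "continuous_on UNIV g" for f g
  proof -
    have c: "continuous_on UNIV (\<lambda>x. Q (f x) (g x))"
      using continuous_on_compose2[OF continuous_Q(1), of UNIV "\<lambda>x. (f x, g x)"] f g by (simp add: continuous_on_Pair)
    have fi: "integrable T (\<lambda>x. \<bar>f x\<bar> powr p)" "integrable T (\<lambda>x. \<bar>g x\<bar> powr q)"
      using mLp_cont[OF f, of p] mLp_cont[OF g, of q] p2 q_bounds by (auto simp: mLp_def)
    have ineq: "Q (f x) (g x) \<le> (K + 1) * (2 powr p + 2 powr q) * (\<bar>f x\<bar> powr p + \<bar>g x\<bar> powr q + 2 * \<kappa>)" for x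
    proof -
      have "W p (f x) + W q (g x) \<le> 2 powr p * (\<bar>f x\<bar> powr p + \<kappa>) + 2 powr q * (\<bar>g x\<bar> powr q + \<kappa>)"
        using p2 q_bounds bl(2) by (intro add_mono W_le) auto
      also have "\<dots> \<le> (2 powr p + 2 powr q) * (\<bar>f x\<bar> powr p + \<kappa>) + (2 powr p + 2 powr q) * (\<bar>g x\<bar> powr q + \<kappa>)"
        using \<kappa> by (intro add_mono mult_right_mono) auto
      also have "\<dots> = (2 powr p + 2 powr q) * (\<bar>f x\<bar> powr p + \<bar>g x\<bar> powr q + 2 * \<kappa>)" by (simp add: algebra_simps)
      finally have "(K + 1) * (W p (f x) + W q (g x)) \<le> (K + 1) * ((2 powr p + 2 powr q) * (\<bar>f x\<bar> powr p + \<bar>g x\<bar> powr q + 2 * \<kappa>))"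
        using K_pos by (intro mult_left_mono) auto
      with Q_le[of "f x" "g x"] show ?thesis by (simp add: mult.assoc)
    qed
    have "(\<integral>x. Q (f x) (g x) \<partial>T) \<le> (\<integral>x. (K + 1) * (2 powr p + 2 powr q) * (\<bar>f x\<bar> powr p + \<bar>g x\<bar> powr q + 2 * \<kappa>) \<partial>T)"
    proof (rule integral_mono)
      show "integrable T (\<lambda>x. Q (f x) (g x))" using c by (rule integrable_cont)
      show "integrable T (\<lambda>x. (K + 1) * (2 powr p + 2 powr q) * (\<bar>f x\<bar> powr p + \<bar>g x\<bar> powr q + 2 * \<kappa>))"
        using fi by (intro integrable_mult_right Bochner_Integration.integrable_add) auto
    qed (rule ineq)
    also have "\<dots> = (K + 1) * (2 powr p + 2 powr q) * (N p f + N q g + 2 * V * \<kappa>)"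
      using fi by (simp add: N_def V_def)
    finally show ?thesis using le by simp
  qed
  have h2: "Qyy y x * \<alpha>\<^sup>2 + 2 * Qxy y x * \<alpha> * \<beta> + Qxx y x * \<beta>\<^sup>2 \<ge> w x powr (q / 2 - 1) * \<alpha>\<^sup>2 + S y x powr \<theta> * \<beta>\<^sup>2" for x y \<alpha> \<beta>
    using hess[of y x \<beta> \<alpha>] by (simp add: algebra_simps)
  have cs: "continuous_on UNIV (\<lambda>z. h (snd z) (fst z))" if "continuous_on UNIV (\<lambda>z. h (fst z) (snd z))" for h :: "real \<Rightarrow> real \<Rightarrow> real"
  proof -
    have "continuous_on UNIV (\<lambda>z::real\<times>real. (snd z, fst z))" by (intro continuous_intros)
    from continuous_on_compose2[OF that this] show ?thesis by simp
  qed
  have "\<bar>I\<bar> \<le> (\<integral>x. Q (tp A c x) (tp B d x) \<partial>T)"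
    unfolding I
    by (rule bellman_bilinear[of Q Qx Qy Qxx Qxy Qyy "\<lambda>x y. S x y powr \<theta>" "\<lambda>x y. w y powr (q / 2 - 1)"])
      (intro DERIV_Q DERIV_Qx DERIV_Qy continuous_Q hess weights Q_nonneg powr_ge_zero A B; assumption)+
  from bnd[OF this] show "\<bar>I\<bar> \<le> (K + 1) * (2 powr p + 2 powr q) * (N p (tp A c) + N q (tp B d) + 2 * V * \<kappa>)"
    by (simp add: continuous_tp)
  have "\<bar>I\<bar> \<le> (\<integral>x. Q (tp B d x) (tp A c x) \<partial>T)"
    unfolding I
  proof (rule bellman_bilinear[of "\<lambda>x y. Q y x" "\<lambda>x y. Qy y x" "\<lambda>x y. Qx y x" "\<lambda>x y. Qyy y x" "\<lambda>x y. Qxy y x" "\<lambda>x y. Qxx y x"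
      "\<lambda>x y. w x powr (q / 2 - 1)" "\<lambda>x y. S y x powr \<theta>"])
    fix X Y :: "real \<Rightarrow> real" and X' Y' t
    assume D: "(X has_real_derivative X') (at t)" "(Y has_real_derivative Y') (at t)"
    show "((\<lambda>t. Q (Y t) (X t)) has_real_derivative Qy (Y t) (X t) * X' + Qx (Y t) (X t) * Y') (at t)"
      using DERIV_Q[OF D(2,1)] by (simp add: add.commute)
    show "((\<lambda>t. Qy (Y t) (X t)) has_real_derivative Qyy (Y t) (X t) * X' + Qxy (Y t) (X t) * Y') (at t)"
      using DERIV_Qy[OF D(2,1)] by (simp add: add.commute)
    show "((\<lambda>t. Qx (Y t) (X t)) has_real_derivative Qxy (Y t) (X t) * X' + Qxx (Y t) (X t) * Y') (at t)"
      using DERIV_Qx[OF D(2,1)] by (simp add: add.commute)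
  next
    show "1 \<le> w x powr (q / 2 - 1) * S y x powr \<theta>" for x y using weights[of y x] by (simp add: mult.commute)
  qed (intro cs[OF continuous_Q(1)] cs[OF continuous_Q(2)] cs[OF continuous_Q(3)] cs[OF continuous_Q(4)]
      cs[OF continuous_Q(5)] cs[OF continuous_Q(6)] h2 powr_ge_zero Q_nonneg A B)+
  from bnd[OF this] show "\<bar>I\<bar> \<le> (K + 1) * (2 powr p + 2 powr q) * (N q (tp A c) + N p (tp B d) + 2 * V * \<kappa>)"
    by (simp add: continuous_tp add.commute)
qed

text \<open>For \<open>p < 2\<close> the conjugate exponent is at least 2 and the exchanged bound
  applies. The constant is the same for all \<kappa>, so the regularisation error vanishes as
  \<kappa> tends to zero.\<close>

lemma cz_bilinear:
  assumes p: "1 < p" and q: "q = p / (p - 1)"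
  obtains C where "C > 0" "\<And>A B c d i j. finite A \<Longrightarrow> A \<subseteq> dl \<Longrightarrow> 0 \<notin> A \<Longrightarrow> finite B \<Longrightarrow> B \<subseteq> dl \<Longrightarrow>
    \<bar>\<integral>x. tp A (dco (axis (j::2) 1) (dco (axis (i::2) 1) (gco c))) x * tp B d x \<partial>T\<bar> \<le> C * (N p (tp A c) + N q (tp B d))"
proof -
  have "\<exists>C>0. \<forall>A B c d i j \<kappa>. finite A \<longrightarrow> A \<subseteq> dl \<longrightarrow> 0 \<notin> A \<longrightarrow> finite B \<longrightarrow> B \<subseteq> dl \<longrightarrow> 0 < \<kappa> \<longrightarrow> \<kappa> \<le> 1 \<longrightarrow>
    \<bar>\<integral>x. tp A (dco (axis (j::2) 1) (dco (axis (i::2) 1) (gco c))) x * tp B d x \<partial>T\<bar> \<le> C * (N p (tp A c) + N q (tp B d) + 2 * V * \<kappa>)"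
  proof (cases "p \<ge> 2")
    case True
    have bl: "bellman p q \<kappa>" if "0 < \<kappa>" for \<kappa> using True q that by unfold_locales
    have "(bellman.K q + 1) * (2 powr p + 2 powr q) > 0"
      using bellman.K_pos[OF bl[of 1]] by (intro mult_pos_pos add_pos_pos) auto
    then show ?thesis using cz_bellman(1)[OF bl] by (intro exI[of _ "(bellman.K q + 1) * (2 powr p + 2 powr q)"]) auto
  next
    case False
    have q1: "q - 1 = 1 / (p - 1)" using p q by (simp add: field_simps)
    have bl: "bellman q p \<kappa>" if "0 < \<kappa>" for \<kappa>
    proof
      show "2 \<le> q" unfolding q using False p by (simp add: le_divide_eq)
      show "p = q / (q - 1)" unfolding q1 using p q by simp
    qed fact
    have "(bellman.K p + 1) * (2 powr q + 2 powr p) > 0"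
      using bellman.K_pos[OF bl[of 1]] by (intro mult_pos_pos add_pos_pos) auto
    then show ?thesis using cz_bellman(2)[OF bl] by (intro exI[of _ "(bellman.K p + 1) * (2 powr q + 2 powr p)"]) auto
  qed
  then obtain C where C: "C > 0" and b: "\<And>A B c d i j \<kappa>. finite A \<Longrightarrow> A \<subseteq> dl \<Longrightarrow> 0 \<notin> A \<Longrightarrow> finite B \<Longrightarrow> B \<subseteq> dl \<Longrightarrow> 0 < \<kappa> \<Longrightarrow> \<kappa> \<le> 1 \<Longrightarrow>
    \<bar>\<integral>x. tp A (dco (axis (j::2) 1) (dco (axis (i::2) 1) (gco c))) x * tp B d x \<partial>T\<bar> \<le> C * (N p (tp A c) + N q (tp B d) + 2 * V * \<kappa>)"
    by blast
  show ?thesis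
  proof (rule that[OF C])
    fix A B c d and i j :: 2 assume A: "finite A" "A \<subseteq> dl" "0 \<notin> A" "finite B" "B \<subseteq> dl"
    show "\<bar>\<integral>x. tp A (dco (axis j 1) (dco (axis i 1) (gco c))) x * tp B d x \<partial>T\<bar> \<le> C * (N p (tp A c) + N q (tp B d))"
    proof (rule field_le_epsilon)
      fix e :: real assume e: "e > 0"
      define \<kappa> where "\<kappa> = min 1 (e / (C * (2 * V)))"
      have k: "0 < \<kappa>" "\<kappa> \<le> 1" using e C V_pos by (auto simp: \<kappa>_def)
      have "C * (2 * V) * \<kappa> \<le> C * (2 * V) * (e / (C * (2 * V)))"
        using C V_pos by (intro mult_left_mono) (auto simp: \<kappa>_def)
      also have "\<dots> = e" using C V_pos by simp
      finally show "\<bar>\<integral>x. tp A (dco (axis j 1) (dco (axis i 1) (gco c))) x * tp B d x \<partial>T\<bar> \<le> C * (N p (tp A c) + N q (tp B d)) + e"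
        using b[OF A k, of j i c d] by (simp add: algebra_simps)
    qed
  qed
qed

text \<open>
  Duality: testing against \<open>\<mu> sgn F \<bar>F\<bar>\<^sup>p\<^sup>-\<^sup>1\<close> with small \<open>\<mu>\<close> absorbs the term \<open>N q g\<close>.
\<close>

lemma calderon_zygmund:
  assumes p: "1 < p"
  obtains C where "C > 0" "\<And>A c i j. finite A \<Longrightarrow> A \<subseteq> dl \<Longrightarrow> 0 \<notin> A \<Longrightarrow>
    N p (tp A (dco (axis (j::2) 1) (dco (axis (i::2) 1) (gco c)))) \<le> C * N p (tp A c)"
proof -
  define q where "q = p / (p - 1)"
  have q: "q > 1" "(p - 1) * q = p" using p by (auto simp: q_def field_simps)
  obtain C where C: "C > 0" and b: "\<And>A B c d i j. finite A \<Longrightarrow> A \<subseteq> dl \<Longrightarrow> 0 \<notin> A \<Longrightarrow> finite B \<Longrightarrow> B \<subseteq> dl \<Longrightarrow>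
    \<bar>\<integral>x. tp A (dco (axis (j::2) 1) (dco (axis (i::2) 1) (gco c))) x * tp B d x \<partial>T\<bar> \<le> C * (N p (tp A c) + N q (tp B d))"
    by (rule cz_bilinear[OF p q_def]) (rule that)
  define E where "E = C * 2 powr q"
  have E: "E > 0" "C \<le> E" using C q ge_one_powr_ge_zero[of 2 q] by (auto simp: E_def)
  \<comment> \<open>The solution of \<open>E * \<mu> powr q = \<mu> / 2\<close>: the term to be
    absorbed is then exactly half of the left-hand side.\<close>
  define \<mu> where "\<mu> = (1 / (2 * E)) powr (1 / (q - 1))"
  have \<mu>: "\<mu> > 0" using E by (simp add: \<mu>_def)
  have "\<mu> powr (q - 1) = 1 / (2 * E)" using E q by (simp add: \<mu>_def powr_powr)
  then have \<mu>q: "E * \<mu> powr q = \<mu> / 2"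
    using \<mu> E powr_add[of \<mu> "q - 1" 1] by (simp add: field_simps)
  show ?thesis
  proof (rule that[of "2 * E / \<mu>"])
    show "0 < 2 * E / \<mu>" using E \<mu> by simp
    fix A c and i j :: 2 assume A: "finite A" "A \<subseteq> dl" "0 \<notin> A"
    define F where "F = tp A (dco (axis j 1) (dco (axis i 1) (gco c)))"
    have Fc: "continuous_on UNIV F" "per F" unfolding F_def using A by (auto intro: continuous_tp per_tp)
    \<comment> \<open>The test function built from \<open>F\<close> below is continuous and periodic
      but in general no trigonometric polynomial. Uniform approximation extends the bilinear bound
      to it, at the price of the factor \<open>2 powr q\<close> contained in
      \<open>E\<close>.\<close>
    have dual: "\<bar>\<integral>x. F x * g x \<partial>T\<bar> \<le> E * (N p (tp A c) + N q g)" if g: "continuous_on UNIV g" "per g" for g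
    proof (rule field_le_epsilon)
      fix e :: real assume e: "e > 0"
      define IF where "IF = (\<integral>x. \<bar>F x\<bar> \<partial>T)"
      have IF: "IF \<ge> 0" unfolding IF_def by (intro integral_nonneg_AE) auto
      define r where "r = min 1 (e / (E * V + IF))"
      have EV: "E * V + IF > 0" using E V_pos IF by (simp add: add_pos_nonneg)
      have r: "0 < r" "r \<le> 1" using e EV by (auto simp: r_def)
      obtain h where h: "h \<in> trig" "\<And>x. \<bar>g x - h x\<bar> < r" using trig_dense[OF g r(1)] by metis
      obtain B d where B: "finite B" "B \<subseteq> dl" "h = tp B d" using h(1) by (rule trigE)
      have hc: "continuous_on UNIV h" using h(1) trig_cont by blast
      have 1: "\<bar>\<integral>x. F x * h x \<partial>T\<bar> \<le> C * (N p (tp A c) + N q h)"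
        unfolding F_def B(3) by (intro b A B)
      have "N q h = N q (\<lambda>x. g x + (h x - g x))" by simp
      also have "\<dots> \<le> 2 powr q * (N q g + N q (\<lambda>x. h x - g x))"
        using q by (intro mLp_add mLp_cont continuous_intros g hc) auto
      also have "N q (\<lambda>x. h x - g x) \<le> N q (\<lambda>x. r)"
        using q h(2) r by (intro N_mono mLp_cont cont_measurable_T continuous_intros hc g AE_I2) (auto simp: abs_minus_commute less_imp_le)
      also have "N q (\<lambda>x. r) = r powr q * V" using r by (simp add: N_def V_def)
      also have "r powr q \<le> r" using r q powr_mono'[of 1 q r] by simp
      finally have "N q h \<le> 2 powr q * (N q g + r * V)" using V_pos by (simp add: mult_right_mono)
      then have "C * (N p (tp A c) + N q h) \<le> C * (N p (tp A c) + 2 powr q * (N q g + r * V))"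
        using C by (intro mult_left_mono add_mono) auto
      also have "\<dots> = C * N p (tp A c) + E * N q g + E * V * r" by (simp add: E_def algebra_simps)
      also have "C * N p (tp A c) \<le> E * N p (tp A c)" using E(2) by (intro mult_right_mono) auto
      finally have 2: "\<bar>\<integral>x. F x * h x \<partial>T\<bar> \<le> E * (N p (tp A c) + N q g) + E * V * r" using 1 by (simp add: algebra_simps)
      have "\<bar>\<integral>x. F x * (g x - h x) \<partial>T\<bar> \<le> (\<integral>x. \<bar>F x * (g x - h x)\<bar> \<partial>T)" by (rule integral_abs_bound)
      also have "\<dots> \<le> (\<integral>x. r * \<bar>F x\<bar> \<partial>T)"
      proof (rule integral_mono)
        show "\<bar>F x * (g x - h x)\<bar> \<le> r * \<bar>F x\<bar>" for x
          using mult_left_mono[OF less_imp_le[OF h(2)[of x]], of "\<bar>F x\<bar>"] by (simp add: abs_mult mult.commute)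
      qed (intro integrable_cont continuous_intros Fc g hc)+
      also have "\<dots> = IF * r" by (simp add: IF_def)
      finally have 3: "\<bar>\<integral>x. F x * (g x - h x) \<partial>T\<bar> \<le> IF * r" .
      have "(\<integral>x. F x * g x \<partial>T) = (\<integral>x. F x * h x + F x * (g x - h x) \<partial>T)" by (simp add: algebra_simps)
      also have "\<dots> = (\<integral>x. F x * h x \<partial>T) + (\<integral>x. F x * (g x - h x) \<partial>T)"
        by (intro Bochner_Integration.integral_add integrable_cont continuous_intros Fc g hc)
      finally have "\<bar>\<integral>x. F x * g x \<partial>T\<bar> \<le> E * (N p (tp A c) + N q g) + (E * V + IF) * r"
        using 2 3 by (simp add: algebra_simps)
      also have "(E * V + IF) * r \<le> (E * V + IF) * (e / (E * V + IF))"
        using EV by (intro mult_left_mono) (auto simp: r_def)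
      also have "\<dots> = e" using EV by simp
      finally show "\<bar>\<integral>x. F x * g x \<partial>T\<bar> \<le> E * (N p (tp A c) + N q g) + e" by simp
    qed
    define g where "g x = \<mu> * (max (F x) 0 powr (p - 1) - max (- F x) 0 powr (p - 1))" for x
    have gc: "continuous_on UNIV g" unfolding g_def
      by (intro continuous_intros continuous_on_powr' Fc) (use p in auto)
    have gp: "per g" using Fc(2) by (simp add: g_def periodic_def)
    have pp: "x * x powr (p - 1) = x powr p" if "x \<ge> 0" for x :: real
      using that powr_add[of x 1 "p - 1"] by (cases "x = 0") auto
    have "F x * g x = \<mu> * \<bar>F x\<bar> powr p" for x
    proof (cases "F x \<ge> 0")
      case True
      then show ?thesis using pp[of "F x"] p by (simp add: g_def max_def)
    next
      case False
      then have "F x * g x = \<mu> * ((- F x) * (- F x) powr (p - 1))" using p by (simp add: g_def max_def)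
      also have "\<dots> = \<mu> * \<bar>F x\<bar> powr p" using False by (subst pp) auto
      finally show ?thesis .
    qed
    then have l: "(\<integral>x. F x * g x \<partial>T) = \<mu> * N p F" by (simp add: N_def)
    have "\<bar>g x\<bar> powr q = \<mu> powr q * \<bar>F x\<bar> powr p" for x
      using \<mu> q p by (auto simp: g_def max_def abs_mult powr_mult powr_powr)
    then have "N q g = \<mu> powr q * N p F" by (simp add: N_def)
    with dual[OF gc gp] l have "\<mu> * N p F \<le> E * N p (tp A c) + (E * \<mu> powr q) * N p F"
      using \<mu> by (simp add: abs_mult algebra_simps)
    then have "\<mu> * N p F \<le> 2 * E * N p (tp A c)" unfolding \<mu>q by simp
    then show "N p (tp A (dco (axis j 1) (dco (axis i 1) (gco c)))) \<le> 2 * E / \<mu> * N p (tp A c)"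
      using \<mu> by (simp add: F_def field_simps)
  qed
qed

end

section \<open>Poincare and Sobolev inequalities\<close>

text \<open>Convexity in tangent form, obtained from Young's inequality. Integrating it at the mean
  value \<open>b\<close> of a function gives Jensen's inequality.\<close>

lemma powr_tangent:
  fixes a b p :: real
  assumes "1 \<le> p" "0 \<le> a" "0 \<le> b"
  shows "b powr p + p * b powr (p - 1) * (a - b) \<le> a powr p"
proof (cases "p = 1 \<or> b = 0")
  case True
  then show ?thesis using assms by (cases "b = 0") auto
next
  case False
  define q where "q = p / (p - 1)"
  have p: "p > 1" "b > 0" using False assms by auto
  have q: "q > 1" "1 / p + 1 / q = 1" "(p - 1) * q = p" using p by (auto simp: q_def field_simps)
  have "a * b powr (p - 1) \<le> a powr p / p + (b powr (p - 1)) powr q / q"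
    using p q assms by (intro Youngs_inequality) auto
  also have "(b powr (p - 1)) powr q / q = b powr p * (1 - 1 / p)"
  proof -
    have "1 / q = 1 - 1 / p" using q(2) by linarith
    then show ?thesis using q(3) by (simp add: powr_powr divide_inverse)
  qed
  finally have "p * (a * b powr (p - 1)) \<le> p * (a powr p / p + b powr p * (1 - 1 / p))"
    using p by (intro mult_left_mono) auto
  also have "\<dots> = a powr p + (p - 1) * b powr p" using p by (simp add: field_simps)
  finally have "p * (a * b powr (p - 1)) \<le> a powr p + (p - 1) * b powr p" .
  moreover have "b powr (p - 1) * b = b powr p" using p powr_add[of b "p - 1" 1] by simp
  ultimately show ?thesis by (simp add: algebra_simps)
qed

lemma integral_powr_le:
  fixes h :: "real \<Rightarrow> real"
  assumes "1 \<le> p" "continuous_on {0..1} h" "\<And>s. s \<in> {0..1} \<Longrightarrow> 0 \<le> h s"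
  shows "(integral {0..1} h) powr p \<le> integral {0..1} (\<lambda>s. h s powr p)"
proof -
  define b where "b = integral {0..1} h"
  have h: "h integrable_on {0..1}" using assms(2) by (rule integrable_continuous_real)
  have b: "b \<ge> 0" unfolding b_def using assms(3) by (intro integral_nonneg h) auto
  have hp: "(\<lambda>s. h s powr p) integrable_on {0..1}"
    using assms by (intro integrable_continuous_real continuous_on_powr') auto
  have l: "(\<lambda>s. b powr p + p * b powr (p - 1) * (h s - b)) integrable_on {0..1}"
    by (intro integrable_continuous_real continuous_intros assms)
  have hb: "(h has_integral b) {0..1}" unfolding b_def using h by (rule integrable_integral)
  have cb: "((\<lambda>s. r) has_integral r) {0..1::real}" for r :: real
    using has_integral_const_real[of r 0 1] by simp
  have "((\<lambda>s. b powr p + p * b powr (p - 1) * (h s - b)) has_integral b powr p + p * b powr (p - 1) * (b - b)) {0..1}"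
    by (intro has_integral_add has_integral_mult_right has_integral_diff hb cb)
  then have "b powr p = integral {0..1} (\<lambda>s. b powr p + p * b powr (p - 1) * (h s - b))"
    by (simp add: integral_unique)
  also have "\<dots> \<le> integral {0..1} (\<lambda>s. h s powr p)"
    using assms b by (intro integral_le l hp powr_tangent) auto
  finally show ?thesis by (simp add: b_def)
qed

lemma tp_dco_linear: "tp A (dco a c) x = a$1 * tp A (dco (axis 1 1) c) x + a$2 * tp A (dco (axis 2 1) c) x"
proof -
  have "dco a c = (\<lambda>k. of_real (a$1) * dco (axis 1 1) c k + of_real (a$2) * dco (axis 2 1) c k)"
    by (simp add: dco_def fun_eq_iff inner_vec_def sum_2 axis_def algebra_simps)
  then show ?thesis by (simp only: tp_add[symmetric] tp_scale[symmetric])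
qed

lemma dco_commute: "dco a (dco b c) = dco b (dco a c)"
  by (simp add: dco_def fun_eq_iff)

section \<open>Averages over a period segment\<close>

definition av :: "real^2 \<Rightarrow> (real^2 \<Rightarrow> real) \<Rightarrow> real^2 \<Rightarrow> real" where
  "av \<zeta> \<Psi> x = integral {0..1} (\<lambda>s. \<Psi> (x + s *\<^sub>R \<zeta>))"

lemma continuous_on_line:
  fixes \<Psi> :: "real^2 \<Rightarrow> real"
  shows "continuous_on UNIV \<Psi> \<Longrightarrow> continuous_on S (\<lambda>s. \<Psi> (x + s *\<^sub>R \<zeta>))"
  by (rule continuous_on_compose2[of UNIV \<Psi>]) (auto intro!: continuous_intros)

lemma line_integrable: "continuous_on UNIV \<Psi> \<Longrightarrow> (\<lambda>s. \<Psi> (x + s *\<^sub>R \<zeta>) :: real) integrable_on {0..1}"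
  for \<Psi> :: "real^2 \<Rightarrow> real"
  by (intro integrable_continuous_real continuous_on_line)

lemma continuous_av:
  assumes "continuous_on UNIV \<Psi>" shows "continuous_on UNIV (av \<zeta> \<Psi>)"
proof -
  have "continuous_on (UNIV \<times> cbox 0 1) (\<lambda>(x, s::real). \<Psi> (x + s *\<^sub>R \<zeta>))"
    unfolding case_prod_beta
    by (rule continuous_on_compose2[OF assms]) (auto intro!: continuous_intros)
  from integral_continuous_on_param[OF this] show ?thesis by (simp add: av_def[abs_def])
qed

lemma av_mono:
  assumes "continuous_on UNIV \<Psi>" "continuous_on UNIV \<Omega>" "\<And>x. \<Psi> x \<le> \<Omega> x"
  shows "av \<zeta> \<Psi> x \<le> av \<zeta> \<Omega> x"
  unfolding av_def by (intro integral_le line_integrable assms)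

lemma av_nonneg: "continuous_on UNIV \<Psi> \<Longrightarrow> (\<And>x. 0 \<le> \<Psi> x) \<Longrightarrow> 0 \<le> av \<zeta> \<Psi> x"
  unfolding av_def by (intro integral_nonneg line_integrable)

lemma av_abs: assumes "continuous_on UNIV \<Psi>" shows "\<bar>av \<zeta> \<Psi> x\<bar> \<le> av \<zeta> (\<lambda>x. \<bar>\<Psi> x\<bar>) x"
proof -
  have "norm (integral {0..1} (\<lambda>s. \<Psi> (x + s *\<^sub>R \<zeta>))) \<le> integral {0..1} (\<lambda>s. \<bar>\<Psi> (x + s *\<^sub>R \<zeta>)\<bar>)"
    by (intro integral_norm_bound_integral line_integrable[of \<Psi>] line_integrable[of "\<lambda>x. \<bar>\<Psi> x\<bar>"] continuous_intros assms) simp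
  then show ?thesis by (simp add: av_def)
qed

lemma av_dist:
  assumes "continuous_on UNIV \<Psi>" "continuous_on UNIV \<Omega>" "\<And>x. \<bar>\<Psi> x - \<Omega> x\<bar> \<le> e"
  shows "\<bar>av \<zeta> \<Psi> x - av \<zeta> \<Omega> x\<bar> \<le> e"
proof -
  have "av \<zeta> \<Psi> x - av \<zeta> \<Omega> x = av \<zeta> (\<lambda>x. \<Psi> x - \<Omega> x) x"
    unfolding av_def by (simp add: integral_diff line_integrable assms)
  also have "\<bar>\<dots>\<bar> \<le> av \<zeta> (\<lambda>x. \<bar>\<Psi> x - \<Omega> x\<bar>) x" by (intro av_abs continuous_intros assms)
  also have "\<dots> \<le> av \<zeta> (\<lambda>x. e) x" by (intro av_mono continuous_intros assms)
  also have "\<dots> = e" by (simp add: av_def)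
  finally show ?thesis .
qed

lemma av_powr_le:
  assumes "1 \<le> p" "continuous_on UNIV \<Psi>"
  shows "(av \<zeta> (\<lambda>x. \<bar>\<Psi> x\<bar>) x) powr p \<le> av \<zeta> (\<lambda>x. \<bar>\<Psi> x\<bar> powr p) x"
  unfolding av_def by (intro integral_powr_le assms(1) continuous_on_line continuous_intros assms(2)) auto

lemma tp_segment_bound:
  assumes s: "s \<in> {0..1}"
  shows "\<bar>tp A c (x + s *\<^sub>R \<zeta>) - tp A c x\<bar> \<le> av \<zeta> (\<lambda>x. \<bar>tp A (dco \<zeta> c) x\<bar>) x"
proof -
  let ?F = "\<lambda>r. tp A (dco \<zeta> c) (x + r *\<^sub>R \<zeta>)"
  have c: "continuous_on S ?F" for S by (intro continuous_on_line continuous_tp)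
  have "(?F has_integral tp A c (x + s *\<^sub>R \<zeta>) - tp A c (x + 0 *\<^sub>R \<zeta>)) {0..s}"
    using s tp_deriv[where A = A and c = c and x = x and a = \<zeta>]
    by (intro fundamental_theorem_of_calculus)
      (auto simp: has_real_derivative_iff_has_vector_derivative[symmetric] intro: has_field_derivative_at_within)
  then have "\<bar>tp A c (x + s *\<^sub>R \<zeta>) - tp A c x\<bar> = \<bar>integral {0..s} ?F\<bar>" by (simp add: integral_unique)
  also have "\<dots> \<le> integral {0..s} (\<lambda>r. \<bar>?F r\<bar>)"
    using integral_norm_bound_integral[of ?F "{0..s}" "\<lambda>r. \<bar>?F r\<bar>"]
    by (simp add: integrable_continuous_real c continuous_intros)
  also have "\<dots> \<le> integral {0..1} (\<lambda>r. \<bar>?F r\<bar>)"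
    using s by (intro integral_subset_le integrable_continuous_real continuous_intros c) auto
  finally show ?thesis by (simp add: av_def)
qed

lemma tp_av_bound: "\<bar>tp A c x - av \<zeta> (tp A c) x\<bar> \<le> av \<zeta> (\<lambda>x. \<bar>tp A (dco \<zeta> c) x\<bar>) x"
proof -
  have "integral {0..1} (\<lambda>s. tp A c x - tp A c (x + s *\<^sub>R \<zeta>))
      = integral {0..1} (\<lambda>s::real. tp A c x) - integral {0..1} (\<lambda>s. tp A c (x + s *\<^sub>R \<zeta>))"
    by (intro integral_diff integrable_const_ivl line_integrable continuous_tp)
  then have "tp A c x - av \<zeta> (tp A c) x = integral {0..1} (\<lambda>s. tp A c x - tp A c (x + s *\<^sub>R \<zeta>))"
    by (simp add: av_def)
  also have "\<bar>\<dots>\<bar> \<le> integral {0..1} (\<lambda>s::real. av \<zeta> (\<lambda>x. \<bar>tp A (dco \<zeta> c) x\<bar>) x)"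
  proof -
    have "(\<lambda>s. tp A c x - tp A c (x + s *\<^sub>R \<zeta>)) integrable_on {0..1}"
      by (intro integrable_diff integrable_const_ivl line_integrable continuous_tp)
    then show ?thesis
      using integral_norm_bound_integral[of "\<lambda>s. tp A c x - tp A c (x + s *\<^sub>R \<zeta>)" "{0..1}" "\<lambda>s. av \<zeta> (\<lambda>x. \<bar>tp A (dco \<zeta> c) x\<bar>) x"]
      using tp_segment_bound[of _ A c x \<zeta>] by (simp add: abs_minus_commute integrable_const_ivl)
  qed
  finally show ?thesis by simp
qed

lemma av_wave:
  assumes "k \<bullet> \<zeta> \<in> \<int>"
  shows "av \<zeta> (wave c k) x = (if k \<bullet> \<zeta> = 0 then wave c k x else 0)"
proof (cases "k \<bullet> \<zeta> = 0")
  case True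
  then show ?thesis by (simp add: av_def wave_shift)
next
  case False
  define m where "m = 2 * pi * (k \<bullet> \<zeta>)"
  have m: "m \<noteq> 0" using False by (simp add: m_def)
  define d where "d = c / (of_real m * \<i>)"
  have d: "of_real (2 * pi * (k \<bullet> \<zeta>)) * \<i> * d = c" using m by (simp add: d_def m_def[symmetric])
  have "((\<lambda>s. wave c k (x + s *\<^sub>R \<zeta>)) has_integral wave d k (x + 1 *\<^sub>R \<zeta>) - wave d k (x + 0 *\<^sub>R \<zeta>)) {0..1}"
    using has_derivative_line[OF wave_has_derivative[of d k], where x = x and a = \<zeta>] unfolding d
    by (intro fundamental_theorem_of_calculus)
      (auto simp: has_real_derivative_iff_has_vector_derivative[symmetric] intro: has_field_derivative_at_within)
  moreover have "wave d k (x + \<zeta>) = wave d k x"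
  proof -
    obtain n where "k \<bullet> \<zeta> = of_int n" by (rule Ints_cases[OF assms])
    then have "cis (2 * pi * (k \<bullet> \<zeta>)) = 1" using cis_multiple_2pi[of "of_int n"] by simp
    then show ?thesis by (simp add: wave_shift)
  qed
  ultimately show ?thesis using False by (simp add: av_def integral_unique)
qed

lemma av_tp:
  assumes "finite A" "\<And>k. k \<in> A \<Longrightarrow> k \<bullet> \<zeta> \<in> \<int>"
  shows "av \<zeta> (tp A c) = tp {k \<in> A. k \<bullet> \<zeta> = 0} c"
proof
  fix x
  have "av \<zeta> (tp A c) x = (\<Sum>k\<in>A. av \<zeta> (wave (c k) k) x)"
    unfolding av_def tp_def using assms(1) by (intro integral_sum line_integrable continuous_wave)
  also have "\<dots> = (\<Sum>k\<in>A. if k \<bullet> \<zeta> = 0 then wave (c k) k x else 0)"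
    using assms(2) by (intro sum.cong refl av_wave)
  also have "\<dots> = tp {k \<in> A. k \<bullet> \<zeta> = 0} c x"
    unfolding tp_def by (rule sum.inter_filter[symmetric]) fact
  finally show "av \<zeta> (tp A c) x = tp {k \<in> A. k \<bullet> \<zeta> = 0} c x" .
qed

context lattice2
begin

lemma dl_int: "A \<subseteq> dl \<Longrightarrow> k \<in> A \<Longrightarrow> k \<bullet> \<xi> \<in> \<int>" "A \<subseteq> dl \<Longrightarrow> k \<in> A \<Longrightarrow> k \<bullet> \<eta> \<in> \<int>"
  by (auto simp: dl_def)

lemma dual_zero: "k \<bullet> \<xi> = 0 \<Longrightarrow> k \<bullet> \<eta> = 0 \<Longrightarrow> k = 0"
  using decompose_dual[of k] by simp

lemma integral_av:
  assumes f: "continuous_on UNIV f" "per f" and z: "\<zeta> = \<xi> \<or> \<zeta> = \<eta>"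
  shows "(\<integral>x. av \<zeta> f x \<partial>T) = (\<integral>x. f x \<partial>T)"
proof (rule eq_by_approx)
  fix e :: real assume e: "e > 0"
  obtain g where g: "g \<in> trig" "\<And>x. \<bar>f x - g x\<bar> < e" using trig_dense[OF f e] by metis
  obtain A c where A: "finite A" "A \<subseteq> dl" "g = tp A c" using g(1) by (rule trigE)
  have gc: "continuous_on UNIV g" using g(1) trig_cont by blast
  have "av \<zeta> g = tp {k \<in> A. k \<bullet> \<zeta> = 0} c"
    unfolding A(3) using A z dl_int by (intro av_tp) auto
  moreover have "{k \<in> A. k \<bullet> \<zeta> = 0} \<subseteq> dl" using A by auto
  ultimately have gs: "(\<integral>x. av \<zeta> g x \<partial>T) = (\<integral>x. g x \<partial>T)"
    using A by (simp add: integral_tp)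
  have "\<bar>\<integral>x. av \<zeta> f x - av \<zeta> g x \<partial>T\<bar> \<le> e * V"
    by (intro abs_integral_le_bound integrable_cont continuous_intros continuous_av f gc av_dist less_imp_le g)
  moreover have "\<bar>\<integral>x. f x - g x \<partial>T\<bar> \<le> e * V"
    by (intro abs_integral_le_bound integrable_cont continuous_intros continuous_av f gc av_dist less_imp_le g)
  moreover have "(\<integral>x. av \<zeta> f x - av \<zeta> g x \<partial>T) = (\<integral>x. av \<zeta> f x \<partial>T) - (\<integral>x. av \<zeta> g x \<partial>T)"
    by (intro Bochner_Integration.integral_diff integrable_cont continuous_av f gc)
  moreover have "(\<integral>x. f x - g x \<partial>T) = (\<integral>x. f x \<partial>T) - (\<integral>x. g x \<partial>T)"
    by (intro Bochner_Integration.integral_diff integrable_cont f gc)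
  ultimately have "\<bar>(\<integral>x. av \<zeta> f x \<partial>T) - (\<integral>x. f x \<partial>T)\<bar> \<le> e * V + e * V" using gs by linarith
  then show "\<bar>(\<integral>x. av \<zeta> f x \<partial>T) - (\<integral>x. f x \<partial>T)\<bar> \<le> (2 * V) * e" by (simp add: algebra_simps)
qed

lemma av_av:
  assumes f: "continuous_on UNIV f" "per f" and z: "(\<zeta> = \<xi> \<and> \<zeta>' = \<eta>) \<or> (\<zeta> = \<eta> \<and> \<zeta>' = \<xi>)"
  shows "av \<zeta> (av \<zeta>' f) y = (\<integral>x. f x \<partial>T) / V"
proof (rule eq_by_approx)
  fix e :: real assume e: "e > 0"
  obtain g where g: "g \<in> trig" "\<And>x. \<bar>f x - g x\<bar> < e" using trig_dense[OF f e] by metis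
  obtain A c where A: "finite A" "A \<subseteq> dl" "g = tp A c" using g(1) by (rule trigE)
  have gc: "continuous_on UNIV g" using g(1) trig_cont by blast
  have e1: "av \<zeta>' g = tp {k \<in> A. k \<bullet> \<zeta>' = 0} c"
    unfolding A(3) using A z dl_int by (intro av_tp) auto
  have e2: "av \<zeta> (tp {k \<in> A. k \<bullet> \<zeta>' = 0} c) = tp {k \<in> {k \<in> A. k \<bullet> \<zeta>' = 0}. k \<bullet> \<zeta> = 0} c"
    using A z dl_int by (intro av_tp) auto
  have e3: "{k \<in> {k \<in> A. k \<bullet> \<zeta>' = 0}. k \<bullet> \<zeta> = 0} = (if 0 \<in> A then {0} else {})"
    using z by (auto dest: dual_zero)
  have "av \<zeta> (av \<zeta>' g) y = tp (if 0 \<in> A then {0} else {}) c y" unfolding e1 e2 e3 ..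
  also have "\<dots> = (\<integral>x. g x \<partial>T) / V"
    unfolding A(3) integral_tp[OF A(1,2)] by (simp add: tp_def wave_zero_freq)
  finally have gs: "av \<zeta> (av \<zeta>' g) y = (\<integral>x. g x \<partial>T) / V" .
  have 1: "\<bar>av \<zeta> (av \<zeta>' f) y - av \<zeta> (av \<zeta>' g) y\<bar> \<le> e"
    by (intro av_dist continuous_av f gc less_imp_le g)
  have "\<bar>\<integral>x. f x - g x \<partial>T\<bar> \<le> e * V"
    by (intro abs_integral_le_bound integrable_cont continuous_intros f gc less_imp_le g)
  moreover have "(\<integral>x. f x - g x \<partial>T) = (\<integral>x. f x \<partial>T) - (\<integral>x. g x \<partial>T)"
    by (intro Bochner_Integration.integral_diff integrable_cont f gc)
  ultimately have "\<bar>(\<integral>x. f x \<partial>T) / V - (\<integral>x. g x \<partial>T) / V\<bar> \<le> e"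
    using V_pos by (simp add: diff_divide_distrib[symmetric] divide_le_eq)
  then show "\<bar>av \<zeta> (av \<zeta>' f) y - (\<integral>x. f x \<partial>T) / V\<bar> \<le> 2 * e" using 1 gs by linarith
qed

text \<open>Jensen's inequality on each segment moves the power inside the average, and averaging
  along a period preserves the integral.\<close>

lemma N_av_le:
  assumes p: "1 \<le> p" and f: "continuous_on UNIV f" "per f" and z: "\<zeta> = \<xi> \<or> \<zeta> = \<eta>"
  shows "N p (av \<zeta> (\<lambda>x. \<bar>f x\<bar>)) \<le> N p f"
proof -
  have c: "continuous_on UNIV (\<lambda>x. \<bar>f x\<bar> powr p)" using p by (intro continuous_on_powr' continuous_intros f) auto
  have "N p (av \<zeta> (\<lambda>x. \<bar>f x\<bar>)) \<le> (\<integral>x. av \<zeta> (\<lambda>x. \<bar>f x\<bar> powr p) x \<partial>T)"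
    unfolding N_def
  proof (rule integral_mono)
    show "\<bar>av \<zeta> (\<lambda>x. \<bar>f x\<bar>) x\<bar> powr p \<le> av \<zeta> (\<lambda>x. \<bar>f x\<bar> powr p) x" for x
      using av_powr_le[OF p f(1)] av_nonneg[of "\<lambda>x. \<bar>f x\<bar>" \<zeta> x] f by (simp add: continuous_intros)
    show "integrable T (\<lambda>x. \<bar>av \<zeta> (\<lambda>x. \<bar>f x\<bar>) x\<bar> powr p)"
      using p by (intro integrable_cont continuous_on_powr' continuous_intros continuous_av f) auto
  qed (intro integrable_cont continuous_av c)
  also have "\<dots> = N p f" unfolding N_def using f z
    by (intro integral_av c) (auto simp: periodic_def)
  finally show ?thesis .
qed

text \<open>The average along \<xi> retains exactly the frequencies orthogonal to \<xi>. The
  remainder is controlled by the \<xi>-derivative. The retained part has zero average along \<eta>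
  and is controlled by its \<eta>-derivative, which is itself an average along \<xi>; averaging is a
  contraction for \<open>N p\<close>.\<close>

lemma poincare:
  assumes p: "1 \<le> p" and A: "finite A" "A \<subseteq> dl" "0 \<notin> A"
  shows "N p (tp A c) \<le> 2 powr p * (N p (tp A (dco \<xi> c)) + N p (tp A (dco \<eta> c)))"
proof -
  have ml: "f \<in> mLp p" if "continuous_on UNIV f" for f using p that by (intro mLp_cont) auto
  let ?A = "{k \<in> A. k \<bullet> \<xi> = 0}"
  have a1: "av \<xi> (tp A d) = tp ?A d" for d using A dl_int by (intro av_tp) auto
  have "av \<eta> (tp ?A c) = tp {k \<in> ?A. k \<bullet> \<eta> = 0} c" using A dl_int by (intro av_tp) auto
  also have "{k \<in> ?A. k \<bullet> \<eta> = 0} = {}"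
    using A(3) by (auto dest: dual_zero)
  finally have a2: "av \<eta> (tp ?A c) = (\<lambda>x. 0)" by (simp add: tp_def[of "{}"] fun_eq_iff)
  have A': "finite ?A" "?A \<subseteq> dl" using A by auto
  have "N p (tp ?A c) \<le> N p (av \<eta> (\<lambda>x. \<bar>tp ?A (dco \<eta> c) x\<bar>))"
    using p tp_av_bound[of ?A c _ \<eta>] unfolding a2
    by (intro N_mono ml cont_measurable_T continuous_av continuous_intros AE_I2) (auto intro: order.trans[OF _ abs_ge_self])
  also have "\<dots> \<le> N p (tp ?A (dco \<eta> c))" using p A' by (intro N_av_le continuous_tp per_tp) auto
  also have "\<dots> = N p (av \<xi> (tp A (dco \<eta> c)))" by (simp add: a1)
  also have "\<dots> \<le> N p (av \<xi> (\<lambda>x. \<bar>tp A (dco \<eta> c) x\<bar>))"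
    using p av_abs[of "tp A (dco \<eta> c)" \<xi>]
    by (intro N_mono ml cont_measurable_T continuous_av continuous_intros AE_I2) (auto simp: continuous_tp intro: order.trans[OF _ abs_ge_self])
  also have "\<dots> \<le> N p (tp A (dco \<eta> c))" using p A by (intro N_av_le continuous_tp per_tp) auto
  finally have 1: "N p (tp ?A c) \<le> N p (tp A (dco \<eta> c))" .
  have "N p (\<lambda>x. tp A c x - tp ?A c x) \<le> N p (av \<xi> (\<lambda>x. \<bar>tp A (dco \<xi> c) x\<bar>))"
    using p tp_av_bound[of A c _ \<xi>] unfolding a1
    by (intro N_mono ml cont_measurable_T continuous_av continuous_intros AE_I2) (auto intro: order.trans[OF _ abs_ge_self])
  also have "\<dots> \<le> N p (tp A (dco \<xi> c))" using p A by (intro N_av_le continuous_tp per_tp) auto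
  finally have 2: "N p (\<lambda>x. tp A c x - tp ?A c x) \<le> N p (tp A (dco \<xi> c))" .
  have "N p (tp A c) = N p (\<lambda>x. (tp A c x - tp ?A c x) + tp ?A c x)" by simp
  also have "\<dots> \<le> 2 powr p * (N p (\<lambda>x. tp A c x - tp ?A c x) + N p (tp ?A c))"
    using p by (intro mLp_add ml continuous_intros) auto
  also have "\<dots> \<le> 2 powr p * (N p (tp A (dco \<xi> c)) + N p (tp A (dco \<eta> c)))"
    using 1 2 by (intro mult_left_mono add_mono) auto
  finally show ?thesis .
qed

text \<open>
  Averaging over the line segment \<open>\<xi>\<close> removes every frequency with \<open>k \<bullet> \<xi> \<noteq> 0\<close> and averaging over \<open>\<eta>\<close>
  the remaining nonzero ones; each average differs from the function by at most the average of a derivative.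
\<close>

lemma sup_bound:
  assumes A: "finite A" "A \<subseteq> dl" "0 \<notin> A"
  shows "\<bar>tp A c x\<bar> \<le> ((\<integral>x. \<bar>tp A (dco \<eta> c) x\<bar> \<partial>T) + (\<integral>x. \<bar>tp A (dco \<xi> c) x\<bar> \<partial>T) + (\<integral>x. \<bar>tp A (dco \<eta> (dco \<xi> c)) x\<bar> \<partial>T)) / V"
proof -
  let ?A = "{k \<in> A. k \<bullet> \<xi> = 0}"
  have a1: "av \<xi> (tp A d) = tp ?A d" for d using A dl_int by (intro av_tp) auto
  have "av \<eta> (tp ?A c) = tp {k \<in> ?A. k \<bullet> \<eta> = 0} c" using A dl_int by (intro av_tp) auto
  also have "{k \<in> ?A. k \<bullet> \<eta> = 0} = {}"
    using A(3) by (auto dest: dual_zero)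
  finally have a2: "av \<eta> (tp ?A c) = (\<lambda>x. 0)" by (simp add: tp_def[of "{}"] fun_eq_iff)
  have pa: "per (\<lambda>x. \<bar>tp A d x\<bar>)" for d using per_tp[OF A(2)] by (simp add: periodic_def)
  have ca: "continuous_on UNIV (\<lambda>x. \<bar>tp B d x\<bar>)" for B d by (intro continuous_intros)
  have "\<bar>tp ?A c x\<bar> \<le> av \<eta> (\<lambda>x. \<bar>tp ?A (dco \<eta> c) x\<bar>) x"
    using tp_av_bound[of ?A c x \<eta>] unfolding a2 by simp
  also have "\<dots> \<le> av \<eta> (av \<xi> (\<lambda>x. \<bar>tp A (dco \<eta> c) x\<bar>)) x"
    unfolding a1[symmetric] by (intro av_mono av_abs continuous_av continuous_intros)
  also have "\<dots> = (\<integral>x. \<bar>tp A (dco \<eta> c) x\<bar> \<partial>T) / V" by (intro av_av ca pa) auto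
  finally have 1: "\<bar>tp ?A c x\<bar> \<le> (\<integral>x. \<bar>tp A (dco \<eta> c) x\<bar> \<partial>T) / V" .
  \<comment> \<open>A bound by an average along \<xi> is not yet a bound by an integral. Comparing
    the derivative with its own average along \<eta> produces double averages, which are integrals,
    and costs the mixed second derivative.\<close>
  have z: "\<bar>tp A d y\<bar> \<le> av \<eta> (\<lambda>x. \<bar>tp A (dco \<eta> d) x\<bar>) y + av \<eta> (\<lambda>x. \<bar>tp A d x\<bar>) y" for y d
    using tp_av_bound[of A d y \<eta>] av_abs[of "tp A d" \<eta> y] by (simp add: continuous_tp)
  have "\<bar>tp A c x - tp ?A c x\<bar> \<le> av \<xi> (\<lambda>x. \<bar>tp A (dco \<xi> c) x\<bar>) x"
    using tp_av_bound[of A c x \<xi>] by (simp add: a1)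
  also have "\<dots> \<le> av \<xi> (\<lambda>y. av \<eta> (\<lambda>x. \<bar>tp A (dco \<eta> (dco \<xi> c)) x\<bar>) y + av \<eta> (\<lambda>x. \<bar>tp A (dco \<xi> c) x\<bar>) y) x"
    by (intro av_mono z continuous_on_add continuous_av ca)
  also have "\<dots> = av \<xi> (av \<eta> (\<lambda>x. \<bar>tp A (dco \<eta> (dco \<xi> c)) x\<bar>)) x + av \<xi> (av \<eta> (\<lambda>x. \<bar>tp A (dco \<xi> c) x\<bar>)) x"
    unfolding av_def[of \<xi>] by (intro integral_add line_integrable continuous_av ca)
  also have "\<dots> = (\<integral>x. \<bar>tp A (dco \<eta> (dco \<xi> c)) x\<bar> \<partial>T) / V + (\<integral>x. \<bar>tp A (dco \<xi> c) x\<bar> \<partial>T) / V"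
    by (subst (1 2) av_av) (auto intro: ca pa)
  finally show ?thesis using 1 by (simp add: add_divide_distrib)
qed

end

section \<open>Mean-zero polynomials, density and completeness\<close>

lemma gco_diff: "gco (\<lambda>k. c k - d k) = (\<lambda>k. gco c k - gco d k)"
  and dco_diff: "dco a (\<lambda>k. c k - d k) = (\<lambda>k. dco a c k - dco a d k)"
  by (simp_all add: gco_def dco_def fun_eq_iff right_diff_distrib diff_divide_distrib)

lemma tp_extend: "finite B \<Longrightarrow> A \<subseteq> B \<Longrightarrow> (\<And>k. k \<notin> A \<Longrightarrow> c k = 0) \<Longrightarrow> tp A c = tp B c"
  by (subst tp_mono[of B A c]) (auto intro!: tp_cong)

context lattice2
begin

text \<open>Coefficients are required to vanish off \<open>A\<close> so that a polynomial can be
  rewritten over any larger finite set of frequencies; differences of two polynomials then live on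
  the union. Excluding frequency zero encodes mean zero.\<close>

definition tp0 :: "(real^2) set \<Rightarrow> (real^2 \<Rightarrow> complex) \<Rightarrow> bool" where
  "tp0 A c \<longleftrightarrow> finite A \<and> A \<subseteq> dl \<and> 0 \<notin> A \<and> (\<forall>k. k \<notin> A \<longrightarrow> c k = 0)"

lemma tp0_diff:
  assumes "tp0 A c" "tp0 B d"
  shows "tp0 (A \<union> B) (\<lambda>k. c k - d k)"
    "tp A c x - tp B d x = tp (A \<union> B) (\<lambda>k. c k - d k) x"
    "tp A (gco c) x - tp B (gco d) x = tp (A \<union> B) (gco (\<lambda>k. c k - d k)) x"
    "tp A (dco a (gco c)) x - tp B (dco a (gco d)) x = tp (A \<union> B) (dco a (gco (\<lambda>k. c k - d k))) x"
    "tp A (dco b (dco a (gco c))) x - tp B (dco b (dco a (gco d))) x = tp (A \<union> B) (dco b (dco a (gco (\<lambda>k. c k - d k)))) x"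
proof -
  have f: "finite (A \<union> B)" using assms by (simp add: tp0_def)
  have z: "\<And>k. k \<notin> A \<Longrightarrow> c k = 0" "\<And>k. k \<notin> B \<Longrightarrow> d k = 0" using assms by (auto simp: tp0_def)
  show "tp0 (A \<union> B) (\<lambda>k. c k - d k)" using assms by (auto simp: tp0_def)
  have eA: "tp A c = tp (A \<union> B) c" "tp A (gco c) = tp (A \<union> B) (gco c)"
    "tp A (dco a (gco c)) = tp (A \<union> B) (dco a (gco c))" "tp A (dco b (dco a (gco c))) = tp (A \<union> B) (dco b (dco a (gco c)))"
    by (rule tp_extend[OF f]; auto simp: z gco_def dco_def)+
  have eB: "tp B d = tp (A \<union> B) d" "tp B (gco d) = tp (A \<union> B) (gco d)"
    "tp B (dco a (gco d)) = tp (A \<union> B) (dco a (gco d))" "tp B (dco b (dco a (gco d))) = tp (A \<union> B) (dco b (dco a (gco d)))"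
    by (rule tp_extend[OF f]; auto simp: z gco_def dco_def)+
  show "tp A c x - tp B d x = tp (A \<union> B) (\<lambda>k. c k - d k) x"
    unfolding eA(1) eB(1) by (rule tp_diff)
  show "tp A (gco c) x - tp B (gco d) x = tp (A \<union> B) (gco (\<lambda>k. c k - d k)) x"
    unfolding eA(2) eB(2) gco_diff by (rule tp_diff)
  show "tp A (dco a (gco c)) x - tp B (dco a (gco d)) x = tp (A \<union> B) (dco a (gco (\<lambda>k. c k - d k))) x"
    unfolding eA(3) eB(3) gco_diff dco_diff by (rule tp_diff)
  show "tp A (dco b (dco a (gco c))) x - tp B (dco b (dco a (gco d))) x = tp (A \<union> B) (dco b (dco a (gco (\<lambda>k. c k - d k)))) x"
    unfolding eA(4) eB(4) gco_diff dco_diff by (rule tp_diff)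
qed

lemma tp0_strip:
  assumes "\<phi> \<in> trig"
  shows "\<exists>A c. tp0 A c \<and> (\<forall>x. \<phi> x = tp A c x + (\<integral>x. \<phi> x \<partial>T) / V)"
proof -
  obtain A c where A: "finite A" "A \<subseteq> dl" "\<phi> = tp A c" using assms by (rule trigE)
  define d where "d k = (if k \<in> A - {0} then c k else 0)" for k
  have "tp0 (A - {0}) d" using A by (auto simp: tp0_def d_def)
  moreover have "\<phi> x = tp (A - {0}) d x + (\<integral>x. \<phi> x \<partial>T) / V" for x
  proof -
    have "tp (A - {0}) d x = tp (A - {0}) c x" by (rule fun_cong[OF tp_cong]) (simp add: d_def)
    moreover have "tp A c x = tp (A - {0}) c x + (if 0 \<in> A then Re (c 0) else 0)"
      using A(1) sum.remove[of A 0 "\<lambda>k. wave (c k) k x"] by (auto simp: tp_def wave_zero_freq)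
    ultimately show ?thesis by (simp add: A(3) integral_tp[OF A(1,2)])
  qed
  ultimately show ?thesis by blast
qed

lemma mean_approx:
  assumes i: "\<And>n. integrable T (\<phi> n)" "integrable T f" and z: "(\<integral>x. f x \<partial>T) = 0"
    and l: "(\<lambda>n. \<integral>x. \<bar>f x - \<phi> n x\<bar> \<partial>T) \<longlonglongrightarrow> 0"
  shows "(\<lambda>n. (\<integral>x. \<phi> n x \<partial>T) / V) \<longlonglongrightarrow> 0"
proof -
  have "(\<lambda>n. \<integral>x. \<phi> n x \<partial>T) \<longlonglongrightarrow> 0"
  proof (rule Lim_null_comparison[OF always_eventually l], rule allI)
    fix n
    have "\<bar>\<integral>x. f x - \<phi> n x \<partial>T\<bar> \<le> (\<integral>x. \<bar>f x - \<phi> n x\<bar> \<partial>T)" by (rule integral_abs_bound)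
    then show "norm (\<integral>x. \<phi> n x \<partial>T) \<le> (\<integral>x. \<bar>f x - \<phi> n x\<bar> \<partial>T)" using i z by simp
  qed
  from tendsto_divide[OF this tendsto_const[of V]] show ?thesis by simp
qed

lemma N_const: "N p (\<lambda>x. r) = \<bar>r\<bar> powr p * V" by (simp add: N_def V_def)

lemma N_triangle_tendsto:
  assumes p: "0 \<le> p" and m: "\<And>n. f n \<in> mLp p" "\<And>n. g n \<in> mLp p"
    and l: "(\<lambda>n. N p (f n)) \<longlonglongrightarrow> 0" "(\<lambda>n. N p (g n)) \<longlonglongrightarrow> 0"
  shows "(\<lambda>n. N p (\<lambda>x. f n x + g n x)) \<longlonglongrightarrow> 0"
proof (rule Lim_null_comparison)
  show "(\<lambda>n. 2 powr p * (N p (f n) + N p (g n))) \<longlonglongrightarrow> 0"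
    by (intro tendsto_mult_right_zero tendsto_add_zero l)
  show "\<forall>\<^sub>F n in sequentially. norm (N p (\<lambda>x. f n x + g n x)) \<le> 2 powr p * (N p (f n) + N p (g n))"
    using mLp_add(2)[OF m p] by simp
qed

lemma tp0_dense_Lp:
  assumes f: "f \<in> mLp p" and p: "1 \<le> p" and z: "(\<integral>x. f x \<partial>T) = 0"
  obtains A c where "\<And>n::nat. tp0 (A n) (c n)" "(\<lambda>n. N p (\<lambda>x. f x - tp (A n) (c n) x)) \<longlonglongrightarrow> 0"
proof -
  obtain \<phi> :: "nat \<Rightarrow> real^2 \<Rightarrow> real" where \<phi>: "\<And>n. \<phi> n \<in> trig" "(\<lambda>n. N p (\<lambda>x. f x - \<phi> n x)) \<longlonglongrightarrow> 0"
    using trig_dense_Lp[OF f p] by blast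
  define r where "r n = (\<integral>x. \<phi> n x \<partial>T) / V" for n
  have "\<forall>n. \<exists>A c. tp0 A c \<and> (\<forall>x. \<phi> n x = tp A c x + r n)"
    unfolding r_def using tp0_strip[OF \<phi>(1)] by blast
  then obtain A c where A: "\<And>n. tp0 (A n) (c n)" "\<And>n x. \<phi> n x = tp (A n) (c n) x + r n" by metis
  have ml: "\<phi> n \<in> mLp p" for n using trig_mLp[OF \<phi>(1)] p by simp
  have d: "(\<lambda>x. f x - \<phi> n x) \<in> mLp p" for n using p by (intro mLp_diff f ml) auto
  have "r \<longlonglongrightarrow> 0" unfolding r_def
    by (rule mean_approx[OF mLp_L1(1)[OF ml p] mLp_L1(1)[OF f p] z N_tendsto_L1[OF d p \<phi>(2)]])
  then have "(\<lambda>n. \<bar>r n\<bar>) \<longlonglongrightarrow> 0" by (rule tendsto_rabs_zero)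
  then have "(\<lambda>n. \<bar>r n\<bar> powr p) \<longlonglongrightarrow> 0" using p by (intro tendsto_zero_powrI[where b = p]) auto
  then have rl: "(\<lambda>n. N p (\<lambda>x. r n)) \<longlonglongrightarrow> 0" unfolding N_const by (rule tendsto_mult_left_zero)
  have "(\<lambda>n. N p (\<lambda>x. (f x - \<phi> n x) + r n)) \<longlonglongrightarrow> 0"
    using p by (intro N_triangle_tendsto d \<phi>(2) rl mLp_cont continuous_on_const) auto
  then have "(\<lambda>n. N p (\<lambda>x. f x - tp (A n) (c n) x)) \<longlonglongrightarrow> 0" by (simp add: A(2))
  then show ?thesis using that A(1) by blast
qed

lemma N_zero_AE:
  assumes "f \<in> mLp p" "N p f = 0" shows "AE x in T. f x = 0"
proof -
  have "AE x in T. \<bar>f x\<bar> powr p = 0"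
    using assms by (subst integral_nonneg_eq_0_iff_AE[symmetric]) (auto simp: mLp_def N_def)
  then show ?thesis by eventually_elim simp
qed

text \<open>The Riesz--Fischer argument: a Cauchy sequence in \<open>N p\<close> is Cauchy in L1, a
  subsequence converges almost everywhere, and Fatou's lemma along it bounds the distance to the
  limit.\<close>

lemma mLp_complete:
  assumes m: "\<And>n. f n \<in> mLp p" and per: "\<And>n. per (f n)" and p: "1 \<le> p"
    and C: "\<And>e. e > 0 \<Longrightarrow> \<exists>M::nat. \<forall>m\<ge>M. \<forall>n\<ge>M. N p (\<lambda>x. f m x - f n x) < e"
  shows "\<exists>F. per F \<and> F \<in> mLp p \<and> (\<lambda>n. N p (\<lambda>x. f n x - F x)) \<longlonglongrightarrow> 0"
proof -
  have fm [measurable]: "f n \<in> borel_measurable T" for n using m by (rule mLp_measurable)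
  have d: "(\<lambda>x. f a x - f b x) \<in> mLp p" for a b using p by (intro mLp_diff m) auto
  have L1: "\<exists>M. \<forall>i\<ge>M. \<forall>j\<ge>M. (LINT x|T. norm (f i x - f j x)) < e" if e: "e > 0" for e :: real
  proof -
    define r where "r = e / (2 * V)"
    have r: "r > 0" using e V_pos by (simp add: r_def)
    obtain M where M: "\<forall>m\<ge>M. \<forall>n\<ge>M. N p (\<lambda>x. f m x - f n x) < e / (2 * r powr (1 - p))"
      using C[of "e / (2 * r powr (1 - p))"] e r by auto
    have "(LINT x|T. norm (f i x - f j x)) < e" if "i \<ge> M" "j \<ge> M" for i j
    proof -
      have "(LINT x|T. \<bar>f i x - f j x\<bar>) \<le> r * V + r powr (1 - p) * N p (\<lambda>x. f i x - f j x)"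
        by (rule mLp_L1(2)[OF d p r])
      also have "r powr (1 - p) * N p (\<lambda>x. f i x - f j x) < e / 2"
        using M that r by (simp add: field_simps)
      finally show ?thesis using V_pos by (simp add: r_def)
    qed
    then show ?thesis by blast
  qed
  obtain r where r: "strict_mono r" "AE x in T. Cauchy (\<lambda>i. f (r i) x)"
    by (rule cauchy_L1_AE_cauchy_subseq[OF mLp_L1(1)[OF m p] L1])
  \<comment> \<open>Where the subsequence diverges, \<open>lim\<close> is some unspecified value,
    but congruent points see the same sequence and hence get the same value. This makes
    \<open>F\<close> periodic everywhere and not merely almost everywhere.\<close>
  define F where "F x = lim (\<lambda>i. f (r i) x)" for x
  have [measurable]: "F \<in> borel_measurable T" unfolding F_def by (rule borel_measurable_lim_metric) measurable
  have conv: "AE x in T. (\<lambda>i. f (r i) x) \<longlonglongrightarrow> F x"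
    using r(2) by eventually_elim (simp add: F_def convergent_LIMSEQ_iff[symmetric] Cauchy_convergent)
  have Fper: "per F" using per by (simp add: periodic_def F_def)
  have key: "(\<lambda>x. f n x - F x) \<in> mLp p \<and> N p (\<lambda>x. f n x - F x) \<le> e"
    if e: "e > 0" and M: "\<forall>m\<ge>M. \<forall>n\<ge>M. N p (\<lambda>x. f m x - f n x) < e" and n: "n \<ge> M" for e M n
  proof -
    have "AE x in T. (\<lambda>i. ennreal (\<bar>f n x - f (r i) x\<bar> powr p)) \<longlonglongrightarrow> ennreal (\<bar>f n x - F x\<bar> powr p)"
      using conv
    proof eventually_elim
      case (elim x)
      have "(\<lambda>i. \<bar>f n x - f (r i) x\<bar>) \<longlonglongrightarrow> \<bar>f n x - F x\<bar>" by (intro tendsto_intros elim)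
      then show ?case using p by (intro tendsto_ennrealI tendsto_powr') auto
    qed
    then have "AE x in T. ennreal (\<bar>f n x - F x\<bar> powr p) = liminf (\<lambda>i. ennreal (\<bar>f n x - f (r i) x\<bar> powr p))"
      by eventually_elim (intro lim_imp_Liminf[symmetric] sequentially_bot)
    then have "(\<integral>\<^sup>+x. ennreal (\<bar>f n x - F x\<bar> powr p) \<partial>T) = (\<integral>\<^sup>+x. liminf (\<lambda>i. ennreal (\<bar>f n x - f (r i) x\<bar> powr p)) \<partial>T)"
      by (rule nn_integral_cong_AE)
    also have "\<dots> \<le> liminf (\<lambda>i. \<integral>\<^sup>+x. ennreal (\<bar>f n x - f (r i) x\<bar> powr p) \<partial>T)"
      by (rule nn_integral_liminf) measurable
    also have "\<dots> \<le> ennreal e"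
    proof (rule Liminf_le)
      show "\<forall>\<^sub>F i in sequentially. (\<integral>\<^sup>+x. ennreal (\<bar>f n x - f (r i) x\<bar> powr p) \<partial>T) \<le> ennreal e"
        using eventually_ge_at_top[of M]
      proof eventually_elim
        case (elim i)
        have "r i \<ge> M" using elim seq_suble[OF r(1), of i] by linarith
        then have "N p (\<lambda>x. f n x - f (r i) x) \<le> e" using M n by (simp add: less_imp_le)
        moreover have "(\<integral>\<^sup>+x. ennreal (\<bar>f n x - f (r i) x\<bar> powr p) \<partial>T) = ennreal (N p (\<lambda>x. f n x - f (r i) x))"
          unfolding N_def using d[of n "r i"] by (intro nn_integral_eq_integral) (auto simp: mLp_def)
        ultimately show ?case by (simp add: ennreal_leI)
      qed
    qed simp
    finally have le: "(\<integral>\<^sup>+x. ennreal (\<bar>f n x - F x\<bar> powr p) \<partial>T) \<le> ennreal e" .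
    have i: "integrable T (\<lambda>x. \<bar>f n x - F x\<bar> powr p)"
    proof (rule integrableI_bounded)
      have "(\<integral>\<^sup>+x. ennreal (norm (\<bar>f n x - F x\<bar> powr p)) \<partial>T) \<le> ennreal e" using le by simp
      also have "\<dots> < \<infinity>" by simp
      finally show "(\<integral>\<^sup>+x. ennreal (norm (\<bar>f n x - F x\<bar> powr p)) \<partial>T) < \<infinity>" .
    qed measurable
    have "ennreal (N p (\<lambda>x. f n x - F x)) \<le> ennreal e"
      unfolding N_def using le nn_integral_eq_integral[OF i] by simp
    then show ?thesis using i e by (auto simp: mLp_def)
  qed
  obtain M where "\<forall>m\<ge>M. \<forall>n\<ge>M. N p (\<lambda>x. f m x - f n x) < 1" using C[of 1] by auto
  then have "(\<lambda>x. f M x - F x) \<in> mLp p" using key[of 1 M M] by simp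
  from mLp_diff(1)[OF m[of M] this] p have FL: "F \<in> mLp p" by simp
  have "(\<lambda>n. N p (\<lambda>x. f n x - F x)) \<longlonglongrightarrow> 0"
  proof (rule LIMSEQ_I)
    fix e :: real assume e: "e > 0"
    then obtain M where M: "\<forall>m\<ge>M. \<forall>n\<ge>M. N p (\<lambda>x. f m x - f n x) < e / 2" using C[of "e / 2"] by auto
    have "norm (N p (\<lambda>x. f n x - F x) - 0) < e" if "n \<ge> M" for n
      using key[of "e / 2" M n] e M that by simp
    then show "\<exists>M. \<forall>n\<ge>M. norm (N p (\<lambda>x. f n x - F x) - 0) < e" by blast
  qed
  then show ?thesis using Fper FL by blast
qed

section \<open>Bounds for second derivatives, gradients and potentials\<close>

lemma N_dco_le:
  assumes p: "1 \<le> p"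
  shows "N p (tp A (dco a c)) \<le> 2 powr p * (\<bar>a$1\<bar> powr p * N p (tp A (dco (axis 1 1) c)) + \<bar>a$2\<bar> powr p * N p (tp A (dco (axis 2 1) c)))"
proof -
  have ml: "tp A d \<in> mLp p" for d using p by (intro mLp_cont continuous_tp) auto
  have "tp A (dco a c) = (\<lambda>x. a$1 * tp A (dco (axis 1 1) c) x + a$2 * tp A (dco (axis 2 1) c) x)"
    by (rule ext) (rule tp_dco_linear)
  then have "N p (tp A (dco a c)) = N p (\<lambda>x. a$1 * tp A (dco (axis 1 1) c) x + a$2 * tp A (dco (axis 2 1) c) x)"
    by (rule arg_cong)
  also have "\<dots> \<le> 2 powr p * (N p (\<lambda>x. a$1 * tp A (dco (axis 1 1) c) x) + N p (\<lambda>x. a$2 * tp A (dco (axis 2 1) c) x))"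
    using p by (intro mLp_add mLp_scale ml) auto
  finally show ?thesis by (simp add: mLp_scale ml)
qed

lemma cz_directions:
  assumes p: "1 < p"
  shows "\<exists>C>0. \<forall>A c. tp0 A c \<longrightarrow> N p (tp A (dco b (dco a (gco c)))) \<le> C * N p (tp A c)"
proof -
  obtain C where C: "C > 0" "\<And>A c i j. finite A \<Longrightarrow> A \<subseteq> dl \<Longrightarrow> 0 \<notin> A \<Longrightarrow>
    N p (tp A (dco (axis (j::2) 1) (dco (axis (i::2) 1) (gco c)))) \<le> C * N p (tp A c)"
    by (rule calderon_zygmund[OF p]) (rule that)
  define s where "s a = 2 powr p * (\<bar>a$1\<bar> powr p + \<bar>a$2\<bar> powr p)" for a :: "real^2"
  have s0: "s a \<ge> 0" for a by (simp add: s_def)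
  have step: "N p (tp A (dco a d)) \<le> s a * K"
    if "\<And>i::2. N p (tp A (dco (axis i 1) d)) \<le> K" for a A d K
  proof -
    have "N p (tp A (dco a d)) \<le> 2 powr p * (\<bar>a$1\<bar> powr p * K + \<bar>a$2\<bar> powr p * K)"
      using p by (intro order.trans[OF N_dco_le] mult_left_mono add_mono that) auto
    then show ?thesis by (simp add: s_def algebra_simps)
  qed
  \<comment> \<open>The added 1 keeps the constant positive when one of the directions is
    zero.\<close>
  have "N p (tp A (dco b (dco a (gco c)))) \<le> (s b * s a * C + 1) * N p (tp A c)" if A: "tp0 A c" for A c
  proof -
    have "N p (tp A (dco b (dco a (gco c)))) \<le> s b * (s a * (C * N p (tp A c)))"
    proof (rule step)
      fix i :: 2
      have "N p (tp A (dco a (dco (axis i 1) (gco c)))) \<le> s a * (C * N p (tp A c))"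
        by (rule step) (rule C(2), use A in \<open>auto simp: tp0_def\<close>)
      then show "N p (tp A (dco (axis i 1) (dco a (gco c)))) \<le> s a * (C * N p (tp A c))"
        by (simp only: dco_commute)
    qed
    also have "\<dots> \<le> (s b * s a * C + 1) * N p (tp A c)" by (simp add: algebra_simps)
    finally show ?thesis .
  qed
  moreover have "s b * s a * C + 1 > 0" using s0 C(1) by (simp add: add_nonneg_pos)
  ultimately show ?thesis by blast
qed

text \<open>The Poincare inequality applied to a first derivative of the potential, whose own
  derivatives are covered by \<open>cz_directions\<close>.\<close>

lemma gradient_bound:
  assumes p: "1 < p"
  shows "\<exists>C>0. \<forall>A c. tp0 A c \<longrightarrow> N p (tp A (dco a (gco c))) \<le> C * N p (tp A c)"
proof -
  obtain C1 where C1: "C1 > 0" "\<And>A c. tp0 A c \<Longrightarrow> N p (tp A (dco \<xi> (dco a (gco c)))) \<le> C1 * N p (tp A c)"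
    using cz_directions[OF p, of \<xi> a] by blast
  obtain C2 where C2: "C2 > 0" "\<And>A c. tp0 A c \<Longrightarrow> N p (tp A (dco \<eta> (dco a (gco c)))) \<le> C2 * N p (tp A c)"
    using cz_directions[OF p, of \<eta> a] by blast
  have "N p (tp A (dco a (gco c))) \<le> (2 powr p * (C1 + C2)) * N p (tp A c)" if A: "tp0 A c" for A c
  proof -
    have "N p (tp A (dco a (gco c))) \<le> 2 powr p * (N p (tp A (dco \<xi> (dco a (gco c)))) + N p (tp A (dco \<eta> (dco a (gco c)))))"
      using A p by (intro poincare) (auto simp: tp0_def)
    also have "\<dots> \<le> 2 powr p * (C1 * N p (tp A c) + C2 * N p (tp A c))"
      by (intro mult_left_mono add_mono C1(2) C2(2) A) auto
    finally show ?thesis by (simp add: algebra_simps)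
  qed
  moreover have "2 powr p * (C1 + C2) > 0" using C1 C2 by simp
  ultimately show ?thesis by blast
qed

text \<open>In two dimensions L1 bounds on first and mixed second derivatives control the supremum,
  and \<open>mLp_L1\<close> trades L1 for \<open>N p\<close>. The parameter \<open>e\<close> stays
  free: choosing it first makes potentials uniformly Cauchy as soon as the data are Cauchy in
  \<open>N p\<close>.\<close>

lemma potential_sup_bound:
  assumes p: "1 < p"
  shows "\<exists>C>0. \<forall>A c e x. tp0 A c \<longrightarrow> 0 < e \<longrightarrow> \<bar>tp A (gco c) x\<bar> \<le> 3 * e + C * e powr (1 - p) * N p (tp A c)"
proof -
  obtain C1 where C1: "C1 > 0" "\<And>A c. tp0 A c \<Longrightarrow> N p (tp A (dco \<eta> (gco c))) \<le> C1 * N p (tp A c)"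
    using gradient_bound[OF p, of \<eta>] by blast
  obtain C2 where C2: "C2 > 0" "\<And>A c. tp0 A c \<Longrightarrow> N p (tp A (dco \<xi> (gco c))) \<le> C2 * N p (tp A c)"
    using gradient_bound[OF p, of \<xi>] by blast
  obtain C3 where C3: "C3 > 0" "\<And>A c. tp0 A c \<Longrightarrow> N p (tp A (dco \<eta> (dco \<xi> (gco c)))) \<le> C3 * N p (tp A c)"
    using cz_directions[OF p, of \<eta> \<xi>] by blast
  have "\<bar>tp A (gco c) x\<bar> \<le> 3 * e + ((C1 + C2 + C3) / V) * e powr (1 - p) * N p (tp A c)"
    if A: "tp0 A c" and e: "0 < e" for A c e x
  proof -
    have l: "(\<integral>x. \<bar>tp A d x\<bar> \<partial>T) \<le> e * V + e powr (1 - p) * (K * N p (tp A c))" if "N p (tp A d) \<le> K * N p (tp A c)" for d K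
    proof -
      have "(\<integral>x. \<bar>tp A d x\<bar> \<partial>T) \<le> e * V + e powr (1 - p) * N p (tp A d)"
        using p by (intro mLp_L1 mLp_cont continuous_tp e) auto
      also have "\<dots> \<le> e * V + e powr (1 - p) * (K * N p (tp A c))" by (intro add_left_mono mult_left_mono that) auto
      finally show ?thesis .
    qed
    have "\<bar>tp A (gco c) x\<bar> \<le> ((\<integral>x. \<bar>tp A (dco \<eta> (gco c)) x\<bar> \<partial>T) + (\<integral>x. \<bar>tp A (dco \<xi> (gco c)) x\<bar> \<partial>T) + (\<integral>x. \<bar>tp A (dco \<eta> (dco \<xi> (gco c))) x\<bar> \<partial>T)) / V"
      using A by (intro sup_bound) (auto simp: tp0_def)
    also have "\<dots> \<le> ((e * V + e powr (1 - p) * (C1 * N p (tp A c))) + (e * V + e powr (1 - p) * (C2 * N p (tp A c))) + (e * V + e powr (1 - p) * (C3 * N p (tp A c)))) / V"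
      using V_pos by (intro divide_right_mono add_mono l C1(2) C2(2) C3(2) A) auto
    also have "\<dots> = 3 * e + ((C1 + C2 + C3) / V) * e powr (1 - p) * N p (tp A c)"
      using V_pos by (simp add: field_simps)
    finally show ?thesis .
  qed
  moreover have "(C1 + C2 + C3) / V > 0" using C1 C2 C3 V_pos by simp
  ultimately show ?thesis by blast
qed

section \<open>The Poisson equation and the energy\<close>

lemma integrable_mult_bounded:
  fixes g h :: "real^2 \<Rightarrow> real"
  assumes g: "integrable T g" and h: "h \<in> borel_measurable T" "\<And>x. x \<in> cell \<Longrightarrow> \<bar>h x\<bar> \<le> B"
  shows "integrable T (\<lambda>x. g x * h x)" "\<bar>\<integral>x. g x * h x \<partial>T\<bar> \<le> B * (\<integral>x. \<bar>g x\<bar> \<partial>T)"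
proof -
  have [measurable]: "g \<in> borel_measurable T" using g by auto
  note [measurable] = h(1)
  have le: "\<bar>g x * h x\<bar> \<le> B * \<bar>g x\<bar>" if "x \<in> cell" for x
    using mult_left_mono[OF h(2)[OF that], of "\<bar>g x\<bar>"] by (simp add: abs_mult mult.commute)
  have i: "integrable T (\<lambda>x. B * \<bar>g x\<bar>)" using g by auto
  show gh: "integrable T (\<lambda>x. g x * h x)"
    by (rule Bochner_Integration.integrable_bound[OF i]) (auto intro!: AE_I2 order.trans[OF le abs_ge_self])
  have "\<bar>\<integral>x. g x * h x \<partial>T\<bar> \<le> (\<integral>x. \<bar>g x * h x\<bar> \<partial>T)" by (rule integral_abs_bound)
  also have "\<dots> \<le> (\<integral>x. B * \<bar>g x\<bar> \<partial>T)" using gh le by (intro integral_mono i) auto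
  finally show "\<bar>\<integral>x. g x * h x \<partial>T\<bar> \<le> B * (\<integral>x. \<bar>g x\<bar> \<partial>T)" by simp
qed

lemma integrable_mult_cont:
  fixes g h :: "real^2 \<Rightarrow> real"
  assumes "integrable T g" "continuous_on UNIV h" shows "integrable T (\<lambda>x. g x * h x)"
proof -
  obtain B where B: "\<And>x. x \<in> cell \<Longrightarrow> \<bar>h x\<bar> \<le> B" using cont_bounded_cell[OF assms(2)] by metis
  show ?thesis by (rule integrable_mult_bounded(1)[OF assms(1) cont_measurable_T[OF assms(2)] B])
qed

lemma L1_tendsto_integral:
  fixes f :: "'i \<Rightarrow> real^2 \<Rightarrow> real" and F h :: "real^2 \<Rightarrow> real"
  assumes f: "\<And>n. integrable T (f n)" "integrable T F" "((\<lambda>n. \<integral>x. \<bar>f n x - F x\<bar> \<partial>T) \<longlongrightarrow> 0) K"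
    and h: "h \<in> borel_measurable T" "\<And>x. x \<in> cell \<Longrightarrow> \<bar>h x\<bar> \<le> B"
  shows "((\<lambda>n. \<integral>x. f n x * h x \<partial>T) \<longlongrightarrow> (\<integral>x. F x * h x \<partial>T)) K"
proof -
  have "((\<lambda>n. (\<integral>x. f n x * h x \<partial>T) - (\<integral>x. F x * h x \<partial>T)) \<longlongrightarrow> 0) K"
  proof (rule Lim_null_comparison[OF always_eventually])
    show "((\<lambda>n. B * (\<integral>x. \<bar>f n x - F x\<bar> \<partial>T)) \<longlongrightarrow> 0) K" by (rule tendsto_mult_right_zero[OF f(3)])
    show "\<forall>n. norm ((\<integral>x. f n x * h x \<partial>T) - (\<integral>x. F x * h x \<partial>T)) \<le> B * (\<integral>x. \<bar>f n x - F x\<bar> \<partial>T)"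
    proof
      fix n
      have "(\<integral>x. f n x * h x \<partial>T) - (\<integral>x. F x * h x \<partial>T) = (\<integral>x. f n x * h x - F x * h x \<partial>T)"
        by (intro Bochner_Integration.integral_diff[symmetric] integrable_mult_bounded(1)[OF _ h] f)
      also have "\<dots> = (\<integral>x. (f n x - F x) * h x \<partial>T)" by (simp add: algebra_simps)
      finally show "norm ((\<integral>x. f n x * h x \<partial>T) - (\<integral>x. F x * h x \<partial>T)) \<le> B * (\<integral>x. \<bar>f n x - F x\<bar> \<partial>T)"
        using integrable_mult_bounded(2)[OF Bochner_Integration.integrable_diff[OF f(1)[of n] f(2)] h] by simp
    qed
  qed
  then show ?thesis by (simp add: LIM_zero_iff)
qed

text \<open>L1 convergence of one factor against uniform convergence of the other: the pairing of
  data with potentials passes to the limit for every exponent, with no duality of Lebesgue spaces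
  involved.\<close>

lemma pair_tendsto_integral:
  fixes f v :: "nat \<Rightarrow> real^2 \<Rightarrow> real"
  assumes f: "\<And>n. integrable T (f n)" "integrable T F" "(\<lambda>n. \<integral>x. \<bar>f n x - F x\<bar> \<partial>T) \<longlonglongrightarrow> 0"
    and v: "\<And>n. continuous_on UNIV (v n)" "continuous_on UNIV W" "uniform_limit UNIV v W sequentially"
  shows "(\<lambda>n. \<integral>x. f n x * v n x \<partial>T) \<longlonglongrightarrow> (\<integral>x. F x * W x \<partial>T)"
proof -
  obtain B where B: "\<And>x. x \<in> cell \<Longrightarrow> \<bar>W x\<bar> \<le> B" using cont_bounded_cell[OF v(2)] by metis
  have 1: "(\<lambda>n. \<integral>x. f n x * W x \<partial>T) \<longlonglongrightarrow> (\<integral>x. F x * W x \<partial>T)"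
    by (rule L1_tendsto_integral[OF f cont_measurable_T[OF v(2)] B])
  define I where "I = (\<integral>x. \<bar>F x\<bar> \<partial>T)"
  have I0: "I \<ge> 0" unfolding I_def by (intro integral_nonneg_AE) auto
  have fI: "(\<integral>x. \<bar>f n x\<bar> \<partial>T) \<le> (\<integral>x. \<bar>f n x - F x\<bar> \<partial>T) + I" for n
  proof -
    have "(\<integral>x. \<bar>f n x\<bar> \<partial>T) \<le> (\<integral>x. \<bar>f n x - F x\<bar> + \<bar>F x\<bar> \<partial>T)" using f(1)[of n] f(2) by (intro integral_mono) auto
    also have "\<dots> = (\<integral>x. \<bar>f n x - F x\<bar> \<partial>T) + I" unfolding I_def using f(1)[of n] f(2) by (intro Bochner_Integration.integral_add) auto
    finally show ?thesis .
  qed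
  have ev: "eventually (\<lambda>n. (\<integral>x. \<bar>f n x\<bar> \<partial>T) \<le> 1 + I) sequentially"
    using order_tendstoD(2)[OF f(3), of 1] by (auto elim!: eventually_mono intro: order.trans[OF fI])
  have "(\<lambda>n. \<integral>x. f n x * (v n x - W x) \<partial>T) \<longlonglongrightarrow> 0"
  proof (rule tendstoI)
    fix e :: real assume e: "e > 0"
    define J where "J = 1 + I"
    have J: "J > 0" using I0 by (simp add: J_def)
    define d where "d = e / (2 * J)"
    have d: "d > 0" using e J by (simp add: d_def)
    have "eventually (\<lambda>n. \<forall>x. dist (v n x) (W x) < d) sequentially"
      using v(3) d unfolding uniform_limit_iff by simp
    with ev show "eventually (\<lambda>n. dist (\<integral>x. f n x * (v n x - W x) \<partial>T) 0 < e) sequentially"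
    proof eventually_elim
      case (elim n)
      have "\<bar>\<integral>x. f n x * (v n x - W x) \<partial>T\<bar> \<le> d * (\<integral>x. \<bar>f n x\<bar> \<partial>T)"
        using elim(2) by (intro integrable_mult_bounded f cont_measurable_T continuous_intros v) (auto simp: dist_real_def less_imp_le)
      also have "\<dots> \<le> d * J" using elim(1) d by (intro mult_left_mono) (auto simp: J_def)
      also have "\<dots> = e / 2" using J by (simp add: d_def)
      finally show ?case using e by simp
    qed
  qed
  from tendsto_add[OF this 1] have "(\<lambda>n. (\<integral>x. f n x * (v n x - W x) \<partial>T) + (\<integral>x. f n x * W x \<partial>T)) \<longlonglongrightarrow> (\<integral>x. F x * W x \<partial>T)" by simp
  moreover have "(\<integral>x. f n x * (v n x - W x) \<partial>T) + (\<integral>x. f n x * W x \<partial>T) = (\<integral>x. f n x * v n x \<partial>T)" for n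
    by (subst Bochner_Integration.integral_add[symmetric])
      (intro integrable_mult_cont f continuous_intros v, intro integrable_mult_cont f v, simp add: algebra_simps)
  ultimately show ?thesis by simp
qed

text \<open>
  The potential as a uniform limit of explicit potentials of trigonometric polynomials; up to
  almost-everywhere equality it is the solution chosen by \<open>G\<close>.
\<close>

definition gsol :: "real \<Rightarrow> (real^2 \<Rightarrow> real) \<Rightarrow> (real^2 \<Rightarrow> real) \<Rightarrow> bool" where
  "gsol p f u \<longleftrightarrow> continuous_on UNIV u \<and> per u \<and> (\<exists>A c. (\<forall>n::nat. tp0 (A n) (c n)) \<and>
     (\<lambda>n. N p (\<lambda>x. f x - tp (A n) (c n) x)) \<longlonglongrightarrow> 0 \<and> uniform_limit UNIV (\<lambda>n. tp (A n) (gco (c n))) u sequentially)"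

lemma tp_mLp: "0 \<le> p \<Longrightarrow> tp A c \<in> mLp p" by (intro mLp_cont continuous_tp)

lemma N_cauchy:
  assumes p: "1 \<le> p" and f: "f \<in> mLp p" "\<And>n. \<phi> n \<in> mLp p" and l: "(\<lambda>n. N p (\<lambda>x. f x - \<phi> n x)) \<longlonglongrightarrow> 0" and e: "e > 0"
  shows "\<exists>M::nat. \<forall>m\<ge>M. \<forall>n\<ge>M. N p (\<lambda>x. \<phi> m x - \<phi> n x) < e"
proof -
  have "e / (2 powr p * 2) > 0" using e by simp
  from order_tendstoD(2)[OF l this] obtain M where M: "\<And>n. n \<ge> M \<Longrightarrow> N p (\<lambda>x. f x - \<phi> n x) < e / (2 powr p * 2)"
    by (auto simp: eventually_sequentially)
  have "N p (\<lambda>x. \<phi> m x - \<phi> n x) < e" if "m \<ge> M" "n \<ge> M" for m n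
  proof -
    have "N p (\<lambda>x. \<phi> m x - \<phi> n x) = N p (\<lambda>x. (f x - \<phi> n x) - (f x - \<phi> m x))" by simp
    also have "\<dots> \<le> 2 powr p * (N p (\<lambda>x. f x - \<phi> n x) + N p (\<lambda>x. f x - \<phi> m x))"
      using p by (intro mLp_diff f) auto
    also have "\<dots> < 2 powr p * (e / (2 powr p * 2) + e / (2 powr p * 2))"
      using M that by (intro mult_strict_left_mono add_strict_mono) auto
    also have "\<dots> = e" by simp
    finally show ?thesis .
  qed
  then show ?thesis by blast
qed

lemma gsol_exists:
  assumes p: "1 < p" and f: "f \<in> mLp p" and z: "(\<integral>x. f x \<partial>T) = 0"
  shows "\<exists>u. gsol p f u"
proof -
  have p1: "1 \<le> p" using p by simp
  obtain A c where A: "\<And>n::nat. tp0 (A n) (c n)" "(\<lambda>n. N p (\<lambda>x. f x - tp (A n) (c n) x)) \<longlonglongrightarrow> 0"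
    by (rule tp0_dense_Lp[OF f p1 z]) (rule that)
  obtain C where C: "C > 0" "\<And>A c e x. tp0 A c \<Longrightarrow> 0 < e \<Longrightarrow> \<bar>tp A (gco c) x\<bar> \<le> 3 * e + C * e powr (1 - p) * N p (tp A c)"
    using potential_sup_bound[OF p] by blast
  let ?u = "\<lambda>n. tp (A n) (gco (c n))"
  have "uniformly_Cauchy_on UNIV ?u"
    unfolding uniformly_Cauchy_on_def
  proof (intro allI impI)
    fix d :: real assume d: "d > 0"
    define e where "e = d / 6"
    have e: "e > 0" using d by (simp add: e_def)
    have "d / (2 * (C * e powr (1 - p))) > 0" using d e C by simp
    from N_cauchy[OF p1 f tp_mLp A(2) this] p1 obtain M where
      M: "\<forall>m\<ge>M. \<forall>n\<ge>M. N p (\<lambda>x. tp (A m) (c m) x - tp (A n) (c n) x) < d / (2 * (C * e powr (1 - p)))" by auto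
    have "dist (?u m x) (?u n x) < d" if "m \<ge> M" "n \<ge> M" for m n x
    proof -
      let ?B = "A m \<union> A n" and ?d = "\<lambda>k. c m k - c n k"
      have "\<bar>tp ?B (gco ?d) x\<bar> \<le> 3 * e + C * e powr (1 - p) * N p (tp ?B ?d)"
        by (rule C(2)[OF tp0_diff(1)[OF A(1) A(1)] e])
      also have "tp ?B ?d = (\<lambda>x. tp (A m) (c m) x - tp (A n) (c n) x)"
        by (rule ext) (rule tp0_diff(2)[OF A(1) A(1), symmetric])
      also have "C * e powr (1 - p) * N p (\<lambda>x. tp (A m) (c m) x - tp (A n) (c n) x) < d / 2"
        using M that C e by (simp add: field_simps)
      also have "3 * e = d / 2" by (simp add: e_def)
      finally show ?thesis unfolding dist_real_def tp0_diff(3)[OF A(1) A(1)] by simp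
    qed
    then show "\<exists>M. \<forall>x\<in>UNIV. \<forall>m\<ge>M. \<forall>n\<ge>M. dist (?u m x) (?u n x) < d" by blast
  qed
  then have "uniformly_convergent_on UNIV ?u" by (rule Cauchy_uniformly_convergent)
  then obtain u where u: "uniform_limit UNIV ?u u sequentially" by (auto simp: uniformly_convergent_on_def)
  have uc: "continuous_on UNIV u"
    by (rule uniform_limit_theorem[OF always_eventually u]) (auto intro: continuous_tp)
  have ul: "(\<lambda>n. ?u n x) \<longlonglongrightarrow> u x" for x using u by (rule tendsto_uniform_limitI) simp
  have "per u"
    unfolding periodic_def
  proof (intro ballI allI)
    fix v x assume v: "v \<in> period_lattice \<xi> \<eta>"
    have "?u n (x + v) = ?u n x" for n
      using per_tp[of "A n" "gco (c n)"] A(1)[of n] v by (simp add: tp0_def periodic_def)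
    then have "(\<lambda>n. ?u n x) \<longlonglongrightarrow> u (x + v)" using ul[of "x + v"] by simp
    then show "u (x + v) = u x" using ul[of x] by (rule LIMSEQ_unique)
  qed
  then show ?thesis unfolding gsol_def using uc u A by blast
qed

text \<open>The weak identities and the equation hold for the approximating polynomials. Their first
  and second derivatives converge in \<open>N p\<close> by the a priori bounds, and integrals
  against a fixed smooth test function pass to the limit.\<close>

lemma gsol_poisson:
  assumes p: "1 < p" and f: "f \<in> mLp p" and g: "gsol p f u"
  shows "poisson_solution \<xi> \<eta> p f u"
proof -
  have p1: "1 \<le> p" and p0: "0 \<le> p" using p by auto
  obtain A c where A: "\<And>n::nat. tp0 (A n) (c n)" and Al: "(\<lambda>n. N p (\<lambda>x. f x - tp (A n) (c n) x)) \<longlonglongrightarrow> 0"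
    and u: "uniform_limit UNIV (\<lambda>n. tp (A n) (gco (c n))) u sequentially" and uc: "continuous_on UNIV u" and up: "per u"
    using g unfolding gsol_def by blast
  have Ad: "A n \<subseteq> dl" "finite (A n)" "0 \<notin> A n" for n using A[of n] by (auto simp: tp0_def)
  let ?e = "\<lambda>i::2. axis i (1::real)"
  \<comment> \<open>A derived sequence converges once its differences are dominated by those of the
    data, which are Cauchy. It is used for the first and for the second derivatives.\<close>
  have cl: "\<exists>F. per F \<and> F \<in> mLp p \<and> (\<lambda>n. N p (\<lambda>x. tp (A n) (m n) x - F x)) \<longlonglongrightarrow> 0"
    if C: "C > 0" and b: "\<And>i j. N p (\<lambda>x. tp (A i) (m i) x - tp (A j) (m j) x) \<le> C * N p (\<lambda>x. tp (A i) (c i) x - tp (A j) (c j) x)" for m C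
  proof (rule mLp_complete[OF tp_mLp[OF p0] per_tp[OF Ad(1)] p1])
    fix e :: real assume "e > 0"
    then have "e / C > 0" using C by simp
    from N_cauchy[OF p1 f tp_mLp[OF p0] Al this] obtain M where
      M: "\<forall>i\<ge>M. \<forall>j\<ge>M. N p (\<lambda>x. tp (A i) (c i) x - tp (A j) (c j) x) < e / C" by blast
    have "N p (\<lambda>x. tp (A i) (m i) x - tp (A j) (m j) x) < e" if "i \<ge> M" "j \<ge> M" for i j
    proof -
      have "C * N p (\<lambda>x. tp (A i) (c i) x - tp (A j) (c j) x) < C * (e / C)"
        using M that C by (intro mult_strict_left_mono) auto
      then show ?thesis using b[of i j] C by simp
    qed
    then show "\<exists>M. \<forall>i\<ge>M. \<forall>j\<ge>M. N p (\<lambda>x. tp (A i) (m i) x - tp (A j) (m j) x) < e" by blast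
  qed
  have dif: "tp (A i \<union> A j) (\<lambda>k. c i k - c j k) = (\<lambda>x. tp (A i) (c i) x - tp (A j) (c j) x)" for i j
    by (rule ext) (rule tp0_diff(2)[OF A A, symmetric])
  have "\<exists>F. per F \<and> F \<in> mLp p \<and> (\<lambda>n. N p (\<lambda>x. tp (A n) (dco (?e i) (gco (c n))) x - F x)) \<longlonglongrightarrow> 0" for i
  proof -
    obtain C where "C > 0" "\<And>A c. tp0 A c \<Longrightarrow> N p (tp A (dco (?e i) (gco c))) \<le> C * N p (tp A c)"
      using gradient_bound[OF p, of "?e i"] by blast
    note C = this
    show ?thesis
      by (rule cl[OF C(1)], unfold tp0_diff(4)[OF A A], rule C(2)[OF tp0_diff(1)[OF A A], unfolded dif])
  qed
  then have "\<forall>i. \<exists>F. per F \<and> F \<in> mLp p \<and> (\<lambda>n. N p (\<lambda>x. tp (A n) (dco (?e i) (gco (c n))) x - F x)) \<longlonglongrightarrow> 0" ..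
  from choice[OF this] obtain D where D: "\<And>i. per (D i)" "\<And>i. D i \<in> mLp p" "\<And>i. (\<lambda>n. N p (\<lambda>x. tp (A n) (dco (?e i) (gco (c n))) x - D i x)) \<longlonglongrightarrow> 0"
    by blast
  have "\<exists>F. per F \<and> F \<in> mLp p \<and> (\<lambda>n. N p (\<lambda>x. tp (A n) (dco (?e j) (dco (?e i) (gco (c n)))) x - F x)) \<longlonglongrightarrow> 0" for i j
  proof -
    obtain C where "C > 0" "\<And>A c. tp0 A c \<Longrightarrow> N p (tp A (dco (?e j) (dco (?e i) (gco c)))) \<le> C * N p (tp A c)"
      using cz_directions[OF p, of "?e j" "?e i"] by blast
    note C = this
    show ?thesis
      by (rule cl[OF C(1)], unfold tp0_diff(5)[OF A A], rule C(2)[OF tp0_diff(1)[OF A A], unfolded dif])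
  qed
  then have "\<forall>ij. \<exists>F. per F \<and> F \<in> mLp p \<and> (\<lambda>n. N p (\<lambda>x. tp (A n) (dco (?e (snd ij)) (dco (?e (fst ij)) (gco (c n)))) x - F x)) \<longlonglongrightarrow> 0" by blast
  from choice[OF this] obtain H' where H': "\<And>ij. per (H' ij)" "\<And>ij. H' ij \<in> mLp p"
    "\<And>ij. (\<lambda>n. N p (\<lambda>x. tp (A n) (dco (?e (snd ij)) (dco (?e (fst ij)) (gco (c n)))) x - H' ij x)) \<longlonglongrightarrow> 0"
    by blast
  define H where "H i j = H' (i, j)" for i j
  have H: "\<And>i j. per (H i j)" "\<And>i j. H i j \<in> mLp p"
    "\<And>i j. (\<lambda>n. N p (\<lambda>x. tp (A n) (dco (?e j) (dco (?e i) (gco (c n)))) x - H i j x)) \<longlonglongrightarrow> 0"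
    unfolding H_def using H'(1,2) H'(3)[of "(_, _)"] by simp_all
  have lim: "(\<lambda>n. \<integral>x. tp (A n) (m n) x * h x \<partial>T) \<longlonglongrightarrow> (\<integral>x. F x * h x \<partial>T)"
    if F: "F \<in> mLp p" and l: "(\<lambda>n. N p (\<lambda>x. tp (A n) (m n) x - F x)) \<longlonglongrightarrow> 0" and h: "continuous_on UNIV h" for F m h
  proof -
    obtain B where B: "\<And>x. x \<in> cell \<Longrightarrow> \<bar>h x\<bar> \<le> B" using cont_bounded_cell[OF h] by metis
    show ?thesis
      by (rule L1_tendsto_integral[OF mLp_L1(1)[OF tp_mLp[OF p0] p1] mLp_L1(1)[OF F p1]
            N_tendsto_L1[OF mLp_diff(1)[OF tp_mLp[OF p0] F p0] p1 l] cont_measurable_T[OF h] B])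
  qed
  have limu: "(\<lambda>n. \<integral>x. h x * tp (A n) (gco (c n)) x \<partial>T) \<longlonglongrightarrow> (\<integral>x. h x * u x \<partial>T)" if h: "continuous_on UNIV h" for h
    by (rule pair_tendsto_integral[of "\<lambda>_. h"]) (use h uc u in \<open>auto intro: continuous_tp\<close>)
  have w1: "weak_partial_deriv \<xi> \<eta> i u (D i)" for i
    unfolding weak_partial_deriv_def
  proof (intro allI impI)
    fix \<phi> assume \<phi>: "smooth \<phi> \<and> per \<phi>"
    have eq: "(\<integral>x. partial_deriv i \<phi> x * tp (A n) (gco (c n)) x \<partial>T) = - (\<integral>x. tp (A n) (dco (?e i) (gco (c n))) x * \<phi> x \<partial>T)" for n
      using weak_partial_tp[OF Ad(1)[of n], where i = i] \<phi> unfolding weak_partial_deriv_def by (simp add: mult.commute)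
    have "(\<lambda>n. - (\<integral>x. tp (A n) (dco (?e i) (gco (c n))) x * \<phi> x \<partial>T)) \<longlonglongrightarrow> (\<integral>x. partial_deriv i \<phi> x * u x \<partial>T)"
      unfolding eq[symmetric] using \<phi> smooth_cont by (intro limu) auto
    moreover have "(\<lambda>n. - (\<integral>x. tp (A n) (dco (?e i) (gco (c n))) x * \<phi> x \<partial>T)) \<longlonglongrightarrow> - (\<integral>x. D i x * \<phi> x \<partial>T)"
      using \<phi> smooth_cont by (intro tendsto_minus lim D) auto
    ultimately show "(\<integral>x. u x * partial_deriv i \<phi> x \<partial>T) = - (\<integral>x. D i x * \<phi> x \<partial>T)"
      using LIMSEQ_unique by (auto simp: mult.commute)
  qed
  have w2: "weak_partial_deriv \<xi> \<eta> j (D i) (H i j)" for i j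
    unfolding weak_partial_deriv_def
  proof (intro allI impI)
    fix \<phi> assume \<phi>: "smooth \<phi> \<and> per \<phi>"
    have eq: "(\<integral>x. tp (A n) (dco (?e i) (gco (c n))) x * partial_deriv j \<phi> x \<partial>T) = - (\<integral>x. tp (A n) (dco (?e j) (dco (?e i) (gco (c n)))) x * \<phi> x \<partial>T)" for n
      using weak_partial_tp[OF Ad(1)[of n], where i = j] \<phi> unfolding weak_partial_deriv_def by simp
    have "(\<lambda>n. - (\<integral>x. tp (A n) (dco (?e j) (dco (?e i) (gco (c n)))) x * \<phi> x \<partial>T)) \<longlonglongrightarrow> (\<integral>x. D i x * partial_deriv j \<phi> x \<partial>T)"
      unfolding eq[symmetric] using \<phi> smooth_cont by (intro lim D) auto
    moreover have "(\<lambda>n. - (\<integral>x. tp (A n) (dco (?e j) (dco (?e i) (gco (c n)))) x * \<phi> x \<partial>T)) \<longlonglongrightarrow> - (\<integral>x. H i j x * \<phi> x \<partial>T)"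
      using \<phi> smooth_cont by (intro tendsto_minus lim H) auto
    ultimately show "(\<integral>x. D i x * partial_deriv j \<phi> x \<partial>T) = - (\<integral>x. H i j x * \<phi> x \<partial>T)"
      using LIMSEQ_unique by blast
  qed
  have w: "weak_derivs_Lp \<xi> \<eta> p u D H"
    unfolding weak_derivs_Lp_def Lp_iff using D H w1 w2 by blast
  have sumH: "(\<Sum>i\<in>UNIV. H i i x) = H 1 1 x + H 2 2 x" for x by (simp add: UNIV_2)
  have "AE x in T. f x + (H 1 1 x + H 2 2 x) = 0"
  proof (rule N_zero_AE)
    show m: "(\<lambda>x. f x + (H 1 1 x + H 2 2 x)) \<in> mLp p" using p0 by (intro mLp_add f H)
    let ?h = "\<lambda>n i. tp (A n) (dco (?e i) (dco (?e i) (gco (c n))))"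
    have s: "tp (A n) (c n) x = - (?h n 1 x + ?h n 2 x)" for n x
    proof -
      have "tp (A n) (\<lambda>k. of_real (lam k) * gco (c n) k) = tp (A n) (c n)"
      proof (rule tp_cong)
        fix k assume "k \<in> A n"
        then have "lam k > 0" using Ad(3) lam_pos by metis
        then show "of_real (lam k) * gco (c n) k = c n k" by (simp add: gco_def)
      qed
      then show ?thesis using tp_laplacian[of "A n" "gco (c n)" x] by (simp add: UNIV_2)
    qed
    have H': "(\<lambda>n. N p (\<lambda>x. - (?h n i x - H i i x))) \<longlonglongrightarrow> 0" for i
      using H(3)[of i i] by (simp only: mLp_minus(2))
    have "(\<lambda>n. N p (\<lambda>x. (f x - tp (A n) (c n) x) + (- (?h n 1 x - H 1 1 x) + - (?h n 2 x - H 2 2 x)))) \<longlonglongrightarrow> 0"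
      by (intro N_triangle_tendsto p0 mLp_diff mLp_add mLp_minus f H H' Al tp_mLp)
    then have "(\<lambda>n. N p (\<lambda>x. f x + (H 1 1 x + H 2 2 x))) \<longlonglongrightarrow> 0" by (simp add: s algebra_simps)
    then show "N p (\<lambda>x. f x + (H 1 1 x + H 2 2 x)) = 0" by (simp add: LIMSEQ_const_iff)
  qed
  then have ae: "AE x in T. - (\<Sum>i\<in>UNIV. H i i x) = f x"
    by eventually_elim (simp add: sumH)
  have "(\<lambda>n. \<integral>x. 1 * tp (A n) (gco (c n)) x \<partial>T) \<longlonglongrightarrow> (\<integral>x. 1 * u x \<partial>T)" by (intro limu continuous_on_const)
  then have "(\<integral>x. u x \<partial>T) = 0" using Ad by (simp add: integral_tp LIMSEQ_const_iff)
  moreover have "u \<in> Lp \<xi> \<eta> p" unfolding Lp_iff using up uc p0 by (intro conjI mLp_cont)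
  ultimately have "u \<in> W2p0 \<xi> \<eta> p" unfolding W2p0_def W2p_def mean_zero_def using w by blast
  then show ?thesis unfolding poisson_solution_def using w ae by blast
qed

text \<open>Waves are admissible test functions, so both derivatives can be moved onto the wave,
  where the Laplacian acts as multiplication by \<open>- lam k\<close>. Uniqueness of solutions and
  the spectrum are both read off from this relation.\<close>

lemma poisson_fourier:
  assumes p: "1 \<le> p" and f: "f \<in> borel_measurable T" and s: "poisson_solution \<xi> \<eta> p f u" and k: "k \<in> dl"
  shows "lam k * (\<integral>x. u x * wave c k x \<partial>T) = (\<integral>x. f x * wave c k x \<partial>T)"
proof -
  obtain D H where w: "weak_derivs_Lp \<xi> \<eta> p u D H" and ae: "AE x in T. - (\<Sum>i\<in>UNIV. H i i x) = f x" and uW: "u \<in> W2p0 \<xi> \<eta> p"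
    using s unfolding poisson_solution_def by blast
  have u: "u \<in> mLp p" using uW by (simp add: W2p0_def W2p_def Lp_iff)
  have ui: "integrable T u" using mLp_L1(1)[OF u p] .
  have H: "H i j \<in> mLp p" for i j using w by (simp add: weak_derivs_Lp_def Lp_iff)
  have Hi: "integrable T (H i j)" for i j using mLp_L1(1)[OF H p] .
  let ?A = "{k}" and ?c = "\<lambda>_. c"
  let ?e = "\<lambda>i::2. axis i (1::real)"
  have tw: "tp ?A ?c = wave c k" by (simp add: tp_def fun_eq_iff)
  have pt: "per (tp ?A d)" for d using k by (intro per_tp) auto
  have ibp: "(\<integral>x. a x * tp ?A (dco (?e i) d) x \<partial>T) = - (\<integral>x. b x * tp ?A d x \<partial>T)"
    if "weak_partial_deriv \<xi> \<eta> i a b" for i a b d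
    using that[unfolded weak_partial_deriv_def, rule_format, of "tp ?A d"] smooth_tp pt by (simp add: partial_deriv_tp)
  have 1: "(\<integral>x. u x * tp ?A (dco (?e i) (dco (?e i) ?c)) x \<partial>T) = (\<integral>x. H i i x * wave c k x \<partial>T)" for i
  proof -
    have "(\<integral>x. u x * tp ?A (dco (?e i) (dco (?e i) ?c)) x \<partial>T) = - (\<integral>x. D i x * tp ?A (dco (?e i) ?c) x \<partial>T)"
      using w by (intro ibp) (simp add: weak_derivs_Lp_def)
    also have "(\<integral>x. D i x * tp ?A (dco (?e i) ?c) x \<partial>T) = - (\<integral>x. H i i x * tp ?A ?c x \<partial>T)"
      using w by (intro ibp) (simp add: weak_derivs_Lp_def)
    finally show ?thesis by (simp add: tw)
  qed
  have lap: "(\<Sum>i\<in>UNIV. tp ?A (dco (?e i) (dco (?e i) ?c)) x) = - (lam k * wave c k x)" for x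
    unfolding tp_laplacian by (simp add: tp_def wave_scale)
  have "(\<integral>x. u x * (\<Sum>i\<in>UNIV. tp ?A (dco (?e i) (dco (?e i) ?c)) x) \<partial>T) = (\<Sum>i\<in>UNIV. \<integral>x. u x * tp ?A (dco (?e i) (dco (?e i) ?c)) x \<partial>T)"
    unfolding sum_distrib_left by (intro Bochner_Integration.integral_sum integrable_mult_cont ui continuous_tp)
  also have "\<dots> = (\<Sum>i\<in>UNIV. \<integral>x. H i i x * wave c k x \<partial>T)" by (simp add: 1)
  also have "\<dots> = (\<integral>x. (\<Sum>i\<in>UNIV. H i i x) * wave c k x \<partial>T)"
    unfolding sum_distrib_right by (intro Bochner_Integration.integral_sum[symmetric] integrable_mult_cont Hi continuous_wave)
  also have "\<dots> = (\<integral>x. - (f x * wave c k x) \<partial>T)"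
  proof (rule integral_cong_AE)
    note [measurable] = f mLp_measurable[OF H] cont_measurable_T[OF continuous_wave]
    show "(\<lambda>x. (\<Sum>i\<in>UNIV. H i i x) * wave c k x) \<in> borel_measurable T" by measurable
    show "(\<lambda>x. - (f x * wave c k x)) \<in> borel_measurable T" by measurable
    show "AE x in T. (\<Sum>i\<in>UNIV. H i i x) * wave c k x = - (f x * wave c k x)"
      using ae by eventually_elim (metis minus_mult_left minus_minus)
  qed
  finally show ?thesis unfolding lap by (simp add: mult.left_commute)
qed

lemma poisson_unique:
  assumes p: "1 \<le> p" and f: "f \<in> borel_measurable T" and s: "poisson_solution \<xi> \<eta> p f u" "poisson_solution \<xi> \<eta> p f v"
  shows "AE x in T. u x = v x"
proof -
  have i: "integrable T u" "integrable T v" and z: "(\<integral>x. u x \<partial>T) = 0" "(\<integral>x. v x \<partial>T) = 0"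
    using s by (auto simp: poisson_solution_def W2p0_def W2p_def Lp_iff mean_zero_def intro: mLp_L1(1)[OF _ p])
  have "AE x in T. u x - v x = 0"
  proof (rule fourier_unique)
    show "integrable T (\<lambda>x. u x - v x)" using i by auto
    fix g assume "g \<in> trig"
    then obtain A c where A: "finite A" "A \<subseteq> dl" "g = tp A c" by (rule trigE)
    have "(\<integral>x. u x * wave (c k) k x \<partial>T) = (\<integral>x. v x * wave (c k) k x \<partial>T)" if "k \<in> A" for k
    proof (cases "k = 0")
      case True
      then show ?thesis using z by (simp add: wave_zero_freq)
    next
      case False
      then have "lam k \<noteq> 0" using lam_pos[of k] by simp
      moreover have "lam k * (\<integral>x. u x * wave (c k) k x \<partial>T) = lam k * (\<integral>x. v x * wave (c k) k x \<partial>T)"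
      proof -
        have "k \<in> dl" using that A by blast
        then show ?thesis using poisson_fourier[OF p f s(1), of k "c k"] poisson_fourier[OF p f s(2), of k "c k"] by simp
      qed
      ultimately show ?thesis by simp
    qed
    then have "(\<Sum>k\<in>A. \<integral>x. u x * wave (c k) k x \<partial>T) = (\<Sum>k\<in>A. \<integral>x. v x * wave (c k) k x \<partial>T)" by simp
    moreover have "(\<integral>x. h x * g x \<partial>T) = (\<Sum>k\<in>A. \<integral>x. h x * wave (c k) k x \<partial>T)" if "integrable T h" for h
      unfolding A(3) tp_def sum_distrib_left
      by (intro Bochner_Integration.integral_sum integrable_mult_cont that continuous_wave)
    moreover have "(\<integral>x. (u x - v x) * g x \<partial>T) = (\<integral>x. u x * g x \<partial>T) - (\<integral>x. v x * g x \<partial>T)"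
      unfolding left_diff_distrib
      by (intro Bochner_Integration.integral_diff integrable_mult_cont i) (auto simp: A(3) intro: continuous_tp)
    ultimately show "(\<integral>x. (u x - v x) * g x \<partial>T) = 0" using i by simp
  qed
  then show ?thesis by eventually_elim simp
qed

text \<open>Since a solution exists, the choice in \<open>G\<close> is a solution, and by uniqueness
  it agrees almost everywhere with the continuous potential \<open>u\<close>. From here on the
  energy is computed with \<open>u\<close>.\<close>

lemma energy_gsol:
  assumes p: "1 < p" and f: "f \<in> mLp p" and g: "gsol p f u"
  shows "energy \<xi> \<eta> p f = 1 / 2 * (\<integral>x. f x * u x \<partial>T)"
proof -
  have p1: "1 \<le> p" using p by simp
  note fm = mLp_measurable[OF f]
  have s: "poisson_solution \<xi> \<eta> p f u" using gsol_poisson[OF p f g] .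
  then have s': "poisson_solution \<xi> \<eta> p f (G \<xi> \<eta> p f)" unfolding G_def by (rule someI[where P = "poisson_solution \<xi> \<eta> p f"])
  have [measurable]: "G \<xi> \<eta> p f \<in> borel_measurable T" "u \<in> borel_measurable T" "f \<in> borel_measurable T"
    using s s' fm by (auto simp: poisson_solution_def W2p0_def W2p_def Lp_iff mLp_def)
  have "(\<integral>x. f x * G \<xi> \<eta> p f x \<partial>T) = (\<integral>x. f x * u x \<partial>T)"
  proof (rule integral_cong_AE)
    show "AE x in T. f x * G \<xi> \<eta> p f x = f x * u x"
      using poisson_unique[OF p1 fm s' s] by eventually_elim simp
  qed measurable
  then show ?thesis by (simp add: energy_def)
qed

lemma gsol_tp:
  assumes "tp0 A c" shows "gsol p (tp A c) (tp A (gco c))"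
  unfolding gsol_def
proof (intro conjI exI)
  show "\<forall>n::nat. tp0 A c" using assms by blast
  show "(\<lambda>n. N p (\<lambda>x. tp A c x - tp A c x)) \<longlonglongrightarrow> 0" by (simp add: N_const)
  show "uniform_limit UNIV (\<lambda>n. tp A (gco c)) (tp A (gco c)) sequentially" by (rule uniform_limit_const)
qed (use assms in \<open>auto simp: tp0_def intro: continuous_tp per_tp\<close>)

lemma energy_tp:
  assumes "1 < p" "tp0 A c" shows "energy \<xi> \<eta> p (tp A c) = 1 / 2 * (\<integral>x. tp A c x * tp A (gco c) x \<partial>T)"
  using assms by (intro energy_gsol tp_mLp gsol_tp) auto

lemma gsol_sym:
  assumes p: "1 < p" and f: "f \<in> mLp p" "gsol p f u" and g: "g \<in> mLp p" "gsol p g v"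
  shows "(\<integral>x. f x * v x \<partial>T) = (\<integral>x. g x * u x \<partial>T)"
proof -
  have p1: "1 \<le> p" and p0: "0 \<le> p" using p by auto
  obtain A c where A: "\<And>n::nat. tp0 (A n) (c n)" and Al: "(\<lambda>n. N p (\<lambda>x. f x - tp (A n) (c n) x)) \<longlonglongrightarrow> 0"
    and u: "uniform_limit UNIV (\<lambda>n. tp (A n) (gco (c n))) u sequentially" and uc: "continuous_on UNIV u"
    using f(2) unfolding gsol_def by blast
  obtain B d where B: "\<And>n::nat. tp0 (B n) (d n)" and Bl: "(\<lambda>n. N p (\<lambda>x. g x - tp (B n) (d n) x)) \<longlonglongrightarrow> 0"
    and v: "uniform_limit UNIV (\<lambda>n. tp (B n) (gco (d n))) v sequentially" and vc: "continuous_on UNIV v"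
    using g(2) unfolding gsol_def by blast
  have L: "(\<lambda>n. \<integral>x. \<bar>tp (A n) (c n) x - f x\<bar> \<partial>T) \<longlonglongrightarrow> 0"
    if "f \<in> mLp p" "(\<lambda>n. N p (\<lambda>x. f x - tp (A n) (c n) x)) \<longlonglongrightarrow> 0" for f A c
    using N_tendsto_L1[OF mLp_diff(1)[OF that(1) tp_mLp[OF p0] p0] p1 that(2)] by (simp add: abs_minus_commute)
  have i: "integrable T (tp A c)" for A c by (intro integrable_cont continuous_tp)
  have l1: "(\<lambda>n. \<integral>x. tp (A n) (c n) x * tp (B n) (gco (d n)) x \<partial>T) \<longlonglongrightarrow> (\<integral>x. f x * v x \<partial>T)"
    by (rule pair_tendsto_integral[OF i mLp_L1(1)[OF f(1) p1] L[OF f(1) Al] continuous_tp vc v])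
  have l2: "(\<lambda>n. \<integral>x. tp (B n) (d n) x * tp (A n) (gco (c n)) x \<partial>T) \<longlonglongrightarrow> (\<integral>x. g x * u x \<partial>T)"
    by (rule pair_tendsto_integral[OF i mLp_L1(1)[OF g(1) p1] L[OF g(1) Bl] continuous_tp uc u])
  have "(\<integral>x. tp (B n) (d n) x * tp (A n) (gco (c n)) x \<partial>T) = (\<integral>x. tp (A n) (c n) x * tp (B n) (gco (d n)) x \<partial>T)" for n
  proof -
    have "(\<integral>x. tp (A n) (gco (c n)) x * tp (B n) (d n) x \<partial>T) = (\<integral>x. tp (A n) (c n) x * tp (B n) (gco (d n)) x \<partial>T)"
      using A[of n] B[of n] unfolding gco_def[abs_def]
      by (intro multiplier_symmetric) (auto simp: tp0_def lam_def)
    then show ?thesis by (simp add: mult.commute)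
  qed
  then show ?thesis using LIMSEQ_unique[OF l1] l2 by simp
qed

lemma gsol_bound:
  assumes p: "1 < p"
  shows "\<exists>C>0. \<forall>f u x. f \<in> mLp p \<longrightarrow> gsol p f u \<longrightarrow> \<bar>u x\<bar> \<le> C * (1 + N p f)"
proof -
  have p0: "0 \<le> p" using p by auto
  obtain C where C: "C > 0" "\<And>A c e x. tp0 A c \<Longrightarrow> 0 < e \<Longrightarrow> \<bar>tp A (gco c) x\<bar> \<le> 3 * e + C * e powr (1 - p) * N p (tp A c)"
    using potential_sup_bound[OF p] by blast
  define K where "K = 3 + C * 2 powr p"
  have "\<bar>u x\<bar> \<le> K * (1 + N p f)" if f: "f \<in> mLp p" and g: "gsol p f u" for f u x
  proof -
    obtain A c where A: "\<And>n::nat. tp0 (A n) (c n)" and Al: "(\<lambda>n. N p (\<lambda>x. f x - tp (A n) (c n) x)) \<longlonglongrightarrow> 0"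
      and u: "uniform_limit UNIV (\<lambda>n. tp (A n) (gco (c n))) u sequentially"
      using g unfolding gsol_def by blast
    have "(\<lambda>n. tp (A n) (gco (c n)) x) \<longlonglongrightarrow> u x" using u by (rule tendsto_uniform_limitI) simp
    then have 1: "(\<lambda>n. \<bar>tp (A n) (gco (c n)) x\<bar>) \<longlonglongrightarrow> \<bar>u x\<bar>" by (rule tendsto_rabs)
    have 2: "(\<lambda>n. 3 + C * (2 powr p * (N p f + N p (\<lambda>x. f x - tp (A n) (c n) x)))) \<longlonglongrightarrow> 3 + C * (2 powr p * (N p f + 0))"
      by (intro tendsto_intros Al)
    have "\<bar>tp (A n) (gco (c n)) x\<bar> \<le> 3 + C * (2 powr p * (N p f + N p (\<lambda>x. f x - tp (A n) (c n) x)))" for n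
    proof -
      have "N p (tp (A n) (c n)) = N p (\<lambda>x. f x - (f x - tp (A n) (c n) x))" by simp
      also have "\<dots> \<le> 2 powr p * (N p f + N p (\<lambda>x. f x - tp (A n) (c n) x))"
        by (intro mLp_diff f tp_mLp p0)
      finally have "C * N p (tp (A n) (c n)) \<le> C * (2 powr p * (N p f + N p (\<lambda>x. f x - tp (A n) (c n) x)))"
        using C(1) by (intro mult_left_mono) auto
      then show ?thesis using C(2)[OF A, of 1 n x] by simp
    qed
    then have "\<bar>u x\<bar> \<le> 3 + C * (2 powr p * (N p f + 0))" by (intro LIMSEQ_le[OF 1 2]) auto
    also have "\<dots> \<le> K * (1 + N p f)" using C(1) by (simp add: K_def algebra_simps)
    finally show ?thesis .
  qed
  moreover have "K > 0" using C by (simp add: K_def add_pos_pos)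
  ultimately show ?thesis by blast
qed

text \<open>By symmetry of the potential operator the difference of energies is half the integral of
  \<open>(f - g) * (u + v)\<close>, where \<open>u\<close> and \<open>v\<close> are the potentials.
  These are bounded in terms of \<open>N p f\<close> and \<open>N p g\<close>, so the L1 distance is
  enough.\<close>

proposition energy_lipschitz:
  assumes p: "1 < p"
  shows "\<exists>C>0. \<forall>f g. f \<in> mLp p \<longrightarrow> (\<integral>x. f x \<partial>T) = 0 \<longrightarrow> g \<in> mLp p \<longrightarrow> (\<integral>x. g x \<partial>T) = 0 \<longrightarrow>
    \<bar>energy \<xi> \<eta> p f - energy \<xi> \<eta> p g\<bar> \<le> C * (2 + N p f + N p g) * (\<integral>x. \<bar>f x - g x\<bar> \<partial>T)"
proof -
  have p1: "1 \<le> p" using p by auto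
  obtain C where C: "C > 0" "\<And>f u x. f \<in> mLp p \<Longrightarrow> gsol p f u \<Longrightarrow> \<bar>u x\<bar> \<le> C * (1 + N p f)"
    using gsol_bound[OF p] by blast
  have "\<bar>energy \<xi> \<eta> p f - energy \<xi> \<eta> p g\<bar> \<le> C * (2 + N p f + N p g) * (\<integral>x. \<bar>f x - g x\<bar> \<partial>T)"
    if f: "f \<in> mLp p" "(\<integral>x. f x \<partial>T) = 0" and g: "g \<in> mLp p" "(\<integral>x. g x \<partial>T) = 0" for f g
  proof -
    obtain u v where u: "gsol p f u" and v: "gsol p g v" using gsol_exists[OF p] f g by blast
    have c: "continuous_on UNIV u" "continuous_on UNIV v" using u v by (auto simp: gsol_def)
    have i: "integrable T f" "integrable T g" using mLp_L1(1)[OF _ p1] f g by auto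
    have b: "\<bar>u x + v x\<bar> \<le> C * (2 + N p f + N p g)" for x
      using C(2)[OF f(1) u, of x] C(2)[OF g(1) v, of x] by (simp add: algebra_simps)
    have "(\<integral>x. (f x - g x) * (u x + v x) \<partial>T) = (\<integral>x. (f x * u x + f x * v x) - (g x * u x + g x * v x) \<partial>T)"
      by (simp add: algebra_simps)
    also have "\<dots> = ((\<integral>x. f x * u x \<partial>T) + (\<integral>x. f x * v x \<partial>T)) - ((\<integral>x. g x * u x \<partial>T) + (\<integral>x. g x * v x \<partial>T))"
      using i c by (simp add: integrable_mult_cont)
    also have "\<dots> = (\<integral>x. f x * u x \<partial>T) - (\<integral>x. g x * v x \<partial>T)"
      using gsol_sym[OF p f(1) u g(1) v] by simp
    finally have "energy \<xi> \<eta> p f - energy \<xi> \<eta> p g = 1 / 2 * (\<integral>x. (f x - g x) * (u x + v x) \<partial>T)"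
      using energy_gsol[OF p f(1) u] energy_gsol[OF p g(1) v] by (simp add: algebra_simps)
    also have "\<bar>\<dots>\<bar> \<le> \<bar>\<integral>x. (f x - g x) * (u x + v x) \<partial>T\<bar>" by simp
    also have "\<dots> \<le> C * (2 + N p f + N p g) * (\<integral>x. \<bar>f x - g x\<bar> \<partial>T)"
      using i c b by (intro integrable_mult_bounded cont_measurable_T continuous_on_add) auto
    finally show ?thesis .
  qed
  then show ?thesis using C(1) by blast
qed

end

section \<open>The first eigenspace\<close>

definition cross :: "real^2 \<Rightarrow> real^2 \<Rightarrow> real" where "cross a b = a$1 * b$2 - a$2 * b$1"

lemma inner2: "(a::real^2) \<bullet> b = a$1 * b$1 + a$2 * b$2"
  by (simp add: inner_vec_def sum_2)

lemma cross_lagrange: "(cross a b)\<^sup>2 = (a \<bullet> a) * (b \<bullet> b) - (a \<bullet> b)\<^sup>2"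
  by (simp add: cross_def inner2 power2_eq_square algebra_simps)

text \<open>The Gram determinant of three vectors in the plane is zero.\<close>

lemma gram3:
  fixes u v w :: "real^2"
  shows "(u \<bullet> u) * (v \<bullet> v) * (w \<bullet> w) + 2 * (u \<bullet> v) * (u \<bullet> w) * (v \<bullet> w)
    = (u \<bullet> u) * (v \<bullet> w)\<^sup>2 + (v \<bullet> v) * (u \<bullet> w)\<^sup>2 + (w \<bullet> w) * (u \<bullet> v)\<^sup>2"
  by (simp add: inner2 power2_eq_square algebra_simps)

text \<open>Each summand on the right of \<open>g\<close> is at most a quarter of
  \<open>r * r * r\<close>, and \<open>2 * a * b * c\<close> is at least minus a quarter of it. The
  identity therefore forces equality in every one of these bounds.\<close>

lemma hexagon_scalars:
  fixes a b c r :: real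
  assumes r: "r > 0" and bd: "\<bar>a\<bar> \<le> r / 2" "\<bar>b\<bar> \<le> r / 2" "\<bar>c\<bar> \<le> r / 2" and a: "a \<le> 0"
    and g: "r * r * r + 2 * a * b * c = r * c\<^sup>2 + r * b\<^sup>2 + r * a\<^sup>2"
  shows "a = - r / 2" "b = c" "\<bar>b\<bar> = r / 2"
proof -
  have sq: "x\<^sup>2 \<le> (r / 2)\<^sup>2" if "\<bar>x\<bar> \<le> r / 2" for x using power_mono[OF that, of 2] by simp
  have s: "r * a\<^sup>2 \<le> r * (r / 2)\<^sup>2" "r * b\<^sup>2 \<le> r * (r / 2)\<^sup>2" "r * c\<^sup>2 \<le> r * (r / 2)\<^sup>2"
    using sq bd r by (auto intro!: mult_left_mono)
  have "\<bar>a\<bar> * \<bar>b\<bar> * \<bar>c\<bar> \<le> (r / 2) * (r / 2) * (r / 2)" using bd r by (intro mult_mono) auto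
  then have t: "2 * a * b * c \<ge> - 2 * ((r / 2) * (r / 2) * (r / 2))"
    using abs_ge_minus_self[of "a * b * c"] by (simp add: abs_mult)
  have e: "r * (r / 2)\<^sup>2 = r * r * r / 4" "2 * ((r / 2) * (r / 2) * (r / 2)) = r * r * r / 4" by (simp_all add: power2_eq_square)
  have "r * a\<^sup>2 = r * (r / 2)\<^sup>2" "r * b\<^sup>2 = r * (r / 2)\<^sup>2" "2 * a * b * c = - (r * r * r / 4)"
    using s t g unfolding e by linarith+
  then have a2: "a\<^sup>2 = (r / 2)\<^sup>2" and b2: "b\<^sup>2 = (r / 2)\<^sup>2" and abc: "2 * a * b * c = - (r * r * r / 4)" using r by auto
  have "\<bar>a\<bar> = r / 2" using a2 r by (metis abs_of_nonneg power2_eq_iff_nonneg abs_ge_zero power2_abs less_imp_le half_gt_zero)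
  then show av: "a = - r / 2" using a by simp
  show "\<bar>b\<bar> = r / 2" using b2 r by (metis abs_of_nonneg power2_eq_iff_nonneg abs_ge_zero power2_abs less_imp_le half_gt_zero)
  have "r * (b * c) = r * (r / 2)\<^sup>2" using abc unfolding av by (simp add: power2_eq_square)
  then have "b * c = (r / 2)\<^sup>2" using r by simp
  then have "b * c = b * b" unfolding b2[symmetric] by (simp add: power2_eq_square)
  moreover have "b \<noteq> 0" using b2 r by auto
  ultimately show "b = c" by simp
qed

context lattice2
begin

lemma dl_finite: "finite {k \<in> dl. k \<bullet> k \<le> R}"
proof -
  define B where "B = \<lceil>sqrt R * (norm \<xi> + norm \<eta>)\<rceil>"
  have "{k \<in> dl. k \<bullet> k \<le> R} \<subseteq> (\<lambda>(m, n). of_int m *\<^sub>R xs + of_int n *\<^sub>R ys) ` ({- B..B} \<times> {- B..B})"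
  proof
    fix k assume k: "k \<in> {k \<in> dl. k \<bullet> k \<le> R}"
    then obtain m n where m: "k \<bullet> \<xi> = of_int m" and n: "k \<bullet> \<eta> = of_int n" by (auto simp: dl_def elim!: Ints_cases)
    have nk: "norm k \<le> sqrt R" using k by (simp add: norm_eq_sqrt_inner)
    have b: "\<bar>of_int i :: real\<bar> \<le> sqrt R * (norm \<xi> + norm \<eta>) \<Longrightarrow> i \<in> {- B..B}" for i
      unfolding B_def by simp linarith
    have "\<bar>k \<bullet> \<xi>\<bar> \<le> sqrt R * (norm \<xi> + norm \<eta>)" "\<bar>k \<bullet> \<eta>\<bar> \<le> sqrt R * (norm \<xi> + norm \<eta>)"
      using order.trans[OF norm_ge_zero nk]
      by (auto intro!: order.trans[OF Cauchy_Schwarz_ineq2] mult_mono nk)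
    then have "m \<in> {- B..B}" "n \<in> {- B..B}" using b m n by auto
    moreover have "k = of_int m *\<^sub>R xs + of_int n *\<^sub>R ys" using decompose_dual[of k] m n by simp
    ultimately show "k \<in> (\<lambda>(m, n). of_int m *\<^sub>R xs + of_int n *\<^sub>R ys) ` ({- B..B} \<times> {- B..B})" by auto
  qed
  then show ?thesis by (rule finite_subset) simp
qed

lemma dl_minimum:
  assumes "A \<subseteq> dl" "A \<noteq> {}" shows "\<exists>k\<in>A. \<forall>l\<in>A. k \<bullet> k \<le> l \<bullet> l"
proof -
  obtain a where a: "a \<in> A" using assms by auto
  let ?F = "{k \<in> A. k \<bullet> k \<le> a \<bullet> a}"
  have "finite ?F" by (rule finite_subset[OF _ dl_finite[of "a \<bullet> a"]]) (use assms in auto)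
  moreover have "?F \<noteq> {}" using a by auto
  ultimately obtain k where k: "k \<in> ?F" "\<forall>l\<in>?F. k \<bullet> k \<le> l \<bullet> l"
    using ex_min_if_finite[of "(\<lambda>k. k \<bullet> k) ` ?F"] by (auto simp: not_less)
  have "k \<bullet> k \<le> l \<bullet> l" if "l \<in> A" for l
    using k that by (cases "l \<bullet> l \<le> a \<bullet> a") auto
  then show ?thesis using k by auto
qed

definition shell :: "(real^2) set" where
  "shell = {k \<in> dl - {0}. \<forall>l \<in> dl - {0}. k \<bullet> k \<le> l \<bullet> l}"

lemma xs_nonzero: "xs \<noteq> 0" using dual_basis(1) by force

lemma shell_nonempty: "shell \<noteq> {}"
  using dl_minimum[of "dl - {0}"] dl_xs xs_nonzero by (auto simp: shell_def)

lemma shell_dl: "k \<in> shell \<Longrightarrow> k \<in> dl" "k \<in> shell \<Longrightarrow> k \<noteq> 0" and shell_minus: "k \<in> shell \<Longrightarrow> - k \<in> shell"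
  by (auto simp: shell_def dl_minus)

lemma shell_eq: "k \<in> shell \<Longrightarrow> l \<in> shell \<Longrightarrow> k \<bullet> k = l \<bullet> l"
  by (auto simp: shell_def intro: order.antisym)

lemma shell_less: "k \<in> shell \<Longrightarrow> l \<in> dl \<Longrightarrow> l \<noteq> 0 \<Longrightarrow> l \<notin> shell \<Longrightarrow> k \<bullet> k < l \<bullet> l"
  unfolding shell_def by (force simp: not_le)

text \<open>\<open>u - v\<close> and \<open>u + v\<close> are nonzero dual vectors and so no shorter
  than \<open>u\<close>; expanding their squared lengths bounds the inner product from both
  sides.\<close>

lemma shell_inner_le:
  assumes "u \<in> shell" "v \<in> shell" "u \<noteq> v" "u \<noteq> - v" shows "\<bar>u \<bullet> v\<bar> \<le> (u \<bullet> u) / 2"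
proof -
  have "u - v \<in> dl - {0}" "u + v \<in> dl - {0}"
    using assms shell_dl dl_add dl_diff by (auto simp: add_eq_0_iff2)
  then have "u \<bullet> u \<le> (u - v) \<bullet> (u - v)" "u \<bullet> u \<le> (u + v) \<bullet> (u + v)"
    using assms(1) by (auto simp: shell_def)
  then show ?thesis using shell_eq[OF assms(1,2)] by (simp add: inner_add inner_diff inner_commute abs_le_iff)
qed

text \<open>
  Two shortest dual vectors enclose an angle of at least 60 degrees, so the shell has at most six elements,
  and a third pair forces a hexagon. When the shell is smaller, some of the listed frequencies lie outside it.
\<close>

lemma shell_frame:
  obtains k1 k2 where "k1 \<in> dl" "k2 \<in> dl" "cross k1 k2 \<noteq> 0"
    "shell \<subseteq> {k1, k2, - (k1 + k2), - k1, - k2, k1 + k2}"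
proof -
  obtain k1 where k1: "k1 \<in> shell" using shell_nonempty by auto
  have r: "k1 \<bullet> k1 > 0" using shell_dl(2)[OF k1] by simp
  show ?thesis
  proof (cases "shell \<subseteq> {k1, - k1}")
    case True
    \<comment> \<open>A single pair \<open>k1\<close>, \<open>- k1\<close> determines no frame. Any
      dual vector not parallel to \<open>k1\<close> may complete it, and one of the basis vectors is
      such.\<close>
    have "cross k1 xs \<noteq> 0 \<or> cross k1 ys \<noteq> 0"
    proof (rule ccontr)
      assume "\<not> ?thesis"
      then have z: "cross k1 xs = 0" "cross k1 ys = 0" by auto
      define m n where "m = k1 \<bullet> \<xi>" and "n = k1 \<bullet> \<eta>"
      have k: "k1 = m *\<^sub>R xs + n *\<^sub>R ys" unfolding m_def n_def by (rule decompose_dual)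
      have c: "cross xs ys * dt = 1" using dt_nonzero
        by (simp add: cross_def xs_def ys_def field_simps) (simp add: dt_def algebra_simps)
      have "cross k1 xs = - n * cross xs ys" "cross k1 ys = m * cross xs ys"
        unfolding k cross_def by (simp_all add: algebra_simps)
      then have "m = 0" "n = 0" using z c by auto
      then show False using k shell_dl(2)[OF k1] by simp
    qed
    then obtain k2 where "k2 \<in> dl" "cross k1 k2 \<noteq> 0" using dl_xs dl_ys by blast
    then show ?thesis using that[of k1 k2] k1 shell_dl True by auto
  next
    case False
    then obtain k where k: "k \<in> shell" "k \<noteq> k1" "k \<noteq> - k1" by auto
    \<comment> \<open>The sign is chosen to make the angle with \<open>k1\<close> obtuse or right,
      so that \<open>k1 + k2\<close> is the only candidate, up to sign, for a further shortest
      vector.\<close>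
    define k2 where "k2 = (if k1 \<bullet> k \<le> 0 then k else - k)"
    have k2: "k2 \<in> shell" "k1 \<noteq> k2" "k1 \<noteq> - k2" "k1 \<bullet> k2 \<le> 0"
      using k shell_minus by (auto simp: k2_def)
    have k12: "\<bar>k1 \<bullet> k2\<bar> \<le> (k1 \<bullet> k1) / 2" by (rule shell_inner_le) (use k1 k2 in auto)
    have cr: "(cross k1 k2)\<^sup>2 > 0"
    proof -
      have "(k1 \<bullet> k2)\<^sup>2 \<le> ((k1 \<bullet> k1) / 2)\<^sup>2" using power_mono[OF k12, of 2] by simp
      also have "\<dots> < (k1 \<bullet> k1)\<^sup>2" using r by (simp add: power2_eq_square)
      finally show ?thesis unfolding cross_lagrange shell_eq[OF k2(1) k1] by (simp add: power2_eq_square)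
    qed
    have sub: "v \<in> {k1, k2, - (k1 + k2), - k1, - k2, k1 + k2}" if v: "v \<in> shell" for v
    proof (rule ccontr)
      assume nv: "v \<notin> {k1, k2, - (k1 + k2), - k1, - k2, k1 + k2}"
      define r where "r = k1 \<bullet> k1"
      have e: "k2 \<bullet> k2 = r" "v \<bullet> v = r" using shell_eq[OF k1 k2(1)] shell_eq[OF k1 v] by (simp_all add: r_def)
      have b1: "\<bar>k1 \<bullet> v\<bar> \<le> r / 2" unfolding r_def by (rule shell_inner_le[OF k1 v]) (use nv in auto)
      have b2: "\<bar>k2 \<bullet> v\<bar> \<le> r / 2" unfolding e(1)[symmetric] by (rule shell_inner_le[OF k2(1) v]) (use nv in auto)
      have g: "r * r * r + 2 * (k1 \<bullet> k2) * (k1 \<bullet> v) * (k2 \<bullet> v) = r * (k2 \<bullet> v)\<^sup>2 + r * (k1 \<bullet> v)\<^sup>2 + r * (k1 \<bullet> k2)\<^sup>2"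
        using gram3[of k1 k2 v] by (simp add: e r_def[symmetric])
      have rp: "r > 0" using \<open>k1 \<bullet> k1 > 0\<close> by (simp add: r_def)
      note h = hexagon_scalars[OF rp k12[folded r_def] b1 b2 k2(4) g]
      have n: "(k1 + k2) \<bullet> (k1 + k2) = r" using h(1) e by (simp add: inner_add r_def[symmetric] inner_commute)
      have p: "(k1 + k2) \<bullet> v = 2 * (k1 \<bullet> v)" using h(2) by (simp add: inner_add)
      define w where "w = k1 + k2"
      have sq: "(v - w) \<bullet> (v - w) = v \<bullet> v - 2 * (w \<bullet> v) + w \<bullet> w" "(v + w) \<bullet> (v + w) = v \<bullet> v + 2 * (w \<bullet> v) + w \<bullet> w"
        by (simp_all add: inner_diff_left inner_diff_right inner_add_left inner_add_right inner_commute[of v w])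
      \<comment> \<open>Both vectors have squared length \<open>r\<close>, and their inner product
        is \<open>r\<close> or \<open>- r\<close>: the case of equality in the Cauchy--Schwarz
        inequality.\<close>
      have "v = w \<or> v = - w"
      proof (cases "k1 \<bullet> v \<ge> 0")
        case True
        then have "k1 \<bullet> v = r / 2" using h(3) by simp
        then have "(v - w) \<bullet> (v - w) = 0" unfolding sq using n p e(2) by (simp add: w_def)
        then show ?thesis by simp
      next
        case False
        then have "k1 \<bullet> v = - r / 2" using h(3) by simp
        then have "(v + w) \<bullet> (v + w) = 0" unfolding sq using n p e(2) by (simp add: w_def)
        then show ?thesis by (simp only: inner_eq_zero_iff eq_neg_iff_add_eq_0) simp
      qed
      then have "v = k1 + k2 \<or> v = - (k1 + k2)" unfolding w_def .
      then show False using nv by auto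
    qed
    show ?thesis
    proof (rule that)
      show "k1 \<in> dl" "k2 \<in> dl" using shell_dl(1)[OF k1] shell_dl(1)[OF k2(1)] .
      show "cross k1 k2 \<noteq> 0" using cr by auto
      show "shell \<subseteq> {k1, k2, - (k1 + k2), - k1, - k2, k1 + k2}" using sub by (rule subsetI)
    qed
  qed
qed

text \<open>An eigenfunction for \<open>c\<close> satisfies \<open>lam k = c\<close> at every
  nonzero frequency where it has a nonzero coefficient, and it must have one since its mean
  vanishes. This ties the \<open>LEAST\<close> in \<open>first_eigenvalue\<close> to the shortest
  nonzero dual vectors.\<close>

lemma laplace_eigenvalue_iff: "laplace_eigenvalue \<xi> \<eta> c \<longleftrightarrow> (\<exists>k\<in>dl - {0}. c = lam k)"
proof
  assume "laplace_eigenvalue \<xi> \<eta> c"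
  then obtain u where s: "poisson_solution \<xi> \<eta> 2 (\<lambda>x. c * u x) u" and nz: "\<not> (AE x in T. u x = 0)"
    by (auto simp: laplace_eigenvalue_def)
  have u: "u \<in> mLp 2" and z: "(\<integral>x. u x \<partial>T) = 0"
    using s by (auto simp: poisson_solution_def W2p0_def W2p_def Lp_iff mean_zero_def)
  have ui: "integrable T u" using u by (rule mLp_L1) simp
  have cm: "(\<lambda>x. c * u x) \<in> borel_measurable T" using mLp_measurable[OF u] by measurable
  show "\<exists>k\<in>dl - {0}. c = lam k"
  proof (rule ccontr)
    assume n: "\<not> ?thesis"
    have "AE x in T. u x = 0"
    proof (rule fourier_unique[OF ui])
      fix g assume "g \<in> trig"
      then obtain A d where A: "finite A" "A \<subseteq> dl" "g = tp A d" by (rule trigE)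
      have "(\<integral>x. u x * wave (d k) k x \<partial>T) = 0" if "k \<in> A" for k
      proof (cases "k = 0")
        case True
        then show ?thesis using z by (simp add: wave_zero_freq)
      next
        case False
        have k: "k \<in> dl" using that A by blast
        have "lam k * (\<integral>x. u x * wave (d k) k x \<partial>T) = c * (\<integral>x. u x * wave (d k) k x \<partial>T)"
          using poisson_fourier[OF _ cm s k, of "d k"] by (simp add: mult.assoc)
        moreover have "lam k \<noteq> c" using n k False by auto
        ultimately show ?thesis by simp
      qed
      moreover have "(\<integral>x. u x * g x \<partial>T) = (\<Sum>k\<in>A. \<integral>x. u x * wave (d k) k x \<partial>T)"
        unfolding A(3) tp_def sum_distrib_left
        by (intro Bochner_Integration.integral_sum integrable_mult_cont ui continuous_wave)
      ultimately show "(\<integral>x. u x * g x \<partial>T) = 0" by simp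
    qed
    then show False using nz by simp
  qed
next
  assume "\<exists>k\<in>dl - {0}. c = lam k"
  then obtain k where k: "k \<in> dl" "k \<noteq> 0" "c = lam k" by auto
  have "poisson_solution \<xi> \<eta> 2 (tp {k} (\<lambda>_. of_real (lam k))) (tp {k} (gco (\<lambda>_. of_real (lam k))))"
    using k by (intro tp_poisson) auto
  moreover have "tp {k} (\<lambda>_. of_real (lam k)) = (\<lambda>x. c * wave 1 k x)"
    using wave_scale[of "lam k" 1 k] by (simp add: tp_def fun_eq_iff k)
  moreover have "tp {k} (gco (\<lambda>_. of_real (lam k))) = wave 1 k"
    using lam_pos[OF k(2)] by (simp add: tp_def gco_def fun_eq_iff)
  ultimately have s: "poisson_solution \<xi> \<eta> 2 (\<lambda>x. c * wave 1 k x) (wave 1 k)" by simp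
  have "\<not> (AE x in T. wave 1 k x = 0)"
  proof
    assume ae: "AE x in T. wave 1 k x = 0"
    have "(\<integral>x. wave 1 k x * wave 1 k x \<partial>T) = (\<integral>x. 0 \<partial>T)"
    proof (rule integral_cong_AE)
      show "AE x in T. wave 1 k x * wave 1 k x = 0" using ae by eventually_elim simp
    qed (intro cont_measurable_T continuous_intros)+
    moreover have "k + k \<noteq> 0" using k(2) by (metis scaleR_2 scaleR_eq_0_iff zero_neq_numeral)
    ultimately show False using integral_wave_mult[OF k(1) k(1), of 1 1] by simp
  qed
  then show "laplace_eigenvalue \<xi> \<eta> c" unfolding laplace_eigenvalue_def using s by blast
qed

lemma first_eigenvalue_eq: assumes "k \<in> shell" shows "first_eigenvalue \<xi> \<eta> = lam k"
  unfolding first_eigenvalue_def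
proof (rule Least_equality)
  show "laplace_eigenvalue \<xi> \<eta> (lam k)" unfolding laplace_eigenvalue_iff using shell_dl[OF assms] by auto
  fix c assume "laplace_eigenvalue \<xi> \<eta> c"
  then show "lam k \<le> c" using assms by (auto simp: laplace_eigenvalue_iff shell_def lam_def)
qed

end

lemma wave_minus_freq: "wave c (- k) x = wave (cnj c) k x"
  by (simp add: wave_def)

section \<open>Eigenfunctions as sums of three waves\<close>

locale lattice_frame = lattice2 +
  fixes k1 k2 :: "real^2"
  assumes k1_dl: "k1 \<in> dl" and k2_dl: "k2 \<in> dl" and cross_nz: "cross k1 k2 \<noteq> 0"
    and shell_sub: "shell \<subseteq> {k1, k2, - (k1 + k2), - k1, - k2, k1 + k2}"
begin

definition k3 :: "real^2" where "k3 = - (k1 + k2)"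

lemma k3_dl: "k3 \<in> dl" unfolding k3_def by (intro dl_minus dl_add k1_dl k2_dl)

lemma frame_inj: "a *\<^sub>R k1 + b *\<^sub>R k2 = c *\<^sub>R k1 + d *\<^sub>R k2 \<longleftrightarrow> a = c \<and> b = d"
proof
  assume e: "a *\<^sub>R k1 + b *\<^sub>R k2 = c *\<^sub>R k1 + d *\<^sub>R k2"
  then have c1: "(a - c) * k1$1 + (b - d) * k2$1 = 0" and c2: "(a - c) * k1$2 + (b - d) * k2$2 = 0"
    by (auto simp: vec_eq_iff forall_2 algebra_simps)
  have "(a - c) * cross k1 k2 = ((a - c) * k1$1 + (b - d) * k2$1) * k2$2 - ((a - c) * k1$2 + (b - d) * k2$2) * k2$1"
    "(b - d) * cross k1 k2 = ((a - c) * k1$2 + (b - d) * k2$2) * k1$1 - ((a - c) * k1$1 + (b - d) * k2$1) * k1$2"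
    by (simp_all add: cross_def algebra_simps)
  then show "a = c \<and> b = d" using cross_nz unfolding c1 c2 by simp
qed simp

lemma frame_distinct:
  "k1 \<noteq> 0" "k2 \<noteq> 0" "k3 \<noteq> 0" "k1 \<noteq> k2" "k1 \<noteq> k3" "k2 \<noteq> k3" "k2 \<noteq> k1" "k3 \<noteq> k1" "k3 \<noteq> k2"
  "k1 + k1 \<noteq> 0" "k2 + k2 \<noteq> 0" "k3 + k3 \<noteq> 0" "k1 + k2 \<noteq> 0" "k1 + k3 \<noteq> 0" "k2 + k3 \<noteq> 0" "k2 + k1 \<noteq> 0" "k3 + k1 \<noteq> 0" "k3 + k2 \<noteq> 0"
  using frame_inj[of 1 0 0 0] frame_inj[of 0 1 0 0] frame_inj[of "-1" "-1" 0 0]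
    frame_inj[of 1 0 0 1] frame_inj[of 1 0 "-1" "-1"] frame_inj[of 0 1 "-1" "-1"]
    frame_inj[of 2 0 0 0] frame_inj[of 0 2 0 0] frame_inj[of "-2" "-2" 0 0]
    frame_inj[of 1 1 0 0] frame_inj[of 0 "-1" 0 0] frame_inj[of "-1" 0 0 0]
  by (auto simp: k3_def scaleR_2 algebra_simps)

text \<open>A real wave divides its amplitude between \<open>k\<close> and \<open>- k\<close>; the
  factor 2 compensates for this, so that the components of \<open>v\<close> are the Fourier
  coefficients of \<open>tri v\<close>, as \<open>coef_tri\<close> confirms.\<close>

definition vc :: "complex \<times> complex \<times> complex \<Rightarrow> real^2 \<Rightarrow> complex" where
  "vc v k = 2 * (if k = k1 then fst v else if k = k2 then fst (snd v) else if k = k3 then snd (snd v) else 0)"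

text \<open>
  All shell types are treated at once by \<open>tri (v\<^sub>1, v\<^sub>2, v\<^sub>3) = 2 Re (\<Sum>j. v\<^sub>j exp (2 \<pi> i k\<^sub>j \<bullet> x))\<close> with
  \<open>k\<^sub>1 + k\<^sub>2 + k\<^sub>3 = 0\<close>; the predicate \<open>supp\<close> below says that frequencies outside the shell do not occur.
\<close>

definition tri :: "complex \<times> complex \<times> complex \<Rightarrow> real^2 \<Rightarrow> real" where "tri v = tp {k1, k2, k3} (vc v)"

lemma tri_tp0: "tp0 {k1, k2, k3} (vc v)"
  using k1_dl k2_dl k3_dl frame_distinct by (auto simp: tp0_def vc_def)

lemma tri_eq: "tri v x = 2 * (wave (fst v) k1 x + wave (fst (snd v)) k2 x + wave (snd (snd v)) k3 x)"
proof -
  have w: "wave (2 * c) k x = 2 * wave c k x" for c k using wave_scale[of 2 c k x] by simp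
  show ?thesis using frame_distinct by (simp add: tri_def tp_def vc_def w)
qed

lemma continuous_tri [continuous_intros]: "continuous_on S (tri v)" unfolding tri_def by (rule continuous_tp)
lemma per_tri: "per (tri v)" using tri_tp0 unfolding tri_def tp0_def by (intro per_tp) auto

text \<open>\<open>cf k h\<close> is the Fourier coefficient, as \<open>wave 1 k\<close> and \<open>wave (- \<i>) k\<close> are cosine and sine.\<close>

definition cf :: "real^2 \<Rightarrow> (real^2 \<Rightarrow> real) \<Rightarrow> complex" where
  "cf k h = Complex ((\<integral>x. h x * wave 1 k x \<partial>T) / V) (- (\<integral>x. h x * wave (- \<i>) k x \<partial>T) / V)"

lemma cf_wave: assumes "integrable T h" shows "(\<integral>x. h x * wave c k x \<partial>T) = V * Re (c * cnj (cf k h))"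
proof -
  have "(\<integral>x. h x * wave c k x \<partial>T) = (\<integral>x. Re c * (h x * wave 1 k x) - Im c * (h x * wave (- \<i>) k x) \<partial>T)"
    by (intro Bochner_Integration.integral_cong) (simp_all add: wave_def algebra_simps)
  also have "\<dots> = Re c * (\<integral>x. h x * wave 1 k x \<partial>T) - Im c * (\<integral>x. h x * wave (- \<i>) k x \<partial>T)"
    by (simp add: integrable_mult_cont assms continuous_wave)
  finally have e: "(\<integral>x. h x * wave c k x \<partial>T) = Re c * (\<integral>x. h x * wave 1 k x \<partial>T) - Im c * (\<integral>x. h x * wave (- \<i>) k x \<partial>T)" .
  show ?thesis unfolding e by (simp add: cf_def field_simps)
qed

lemma cf_norm_le: assumes "integrable T h" shows "cmod (cf k h) \<le> 2 / V * (\<integral>x. \<bar>h x\<bar> \<partial>T)"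
proof -
  have "\<bar>\<integral>x. h x * wave c k x \<partial>T\<bar> \<le> 1 * (\<integral>x. \<bar>h x\<bar> \<partial>T)" if "cmod c = 1" for c
    by (intro integrable_mult_bounded(2)[OF assms] cont_measurable_T continuous_wave) (use abs_wave_le[of c k] that in auto)
  from this[of 1] this[of "- \<i>"]
  have "\<bar>Re (cf k h)\<bar> \<le> (\<integral>x. \<bar>h x\<bar> \<partial>T) / V" "\<bar>Im (cf k h)\<bar> \<le> (\<integral>x. \<bar>h x\<bar> \<partial>T) / V"
    using V_pos by (simp_all add: cf_def divide_right_mono)
  then show ?thesis using cmod_le[of "cf k h"] by (simp add: field_simps)
qed

lemma cf_diff: assumes "integrable T g" "integrable T h" shows "cf k (\<lambda>x. g x - h x) = cf k g - cf k h"
proof -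
  have "(\<integral>x. (g x - h x) * wave c k x \<partial>T) = (\<integral>x. g x * wave c k x \<partial>T) - (\<integral>x. h x * wave c k x \<partial>T)" for c
    unfolding left_diff_distrib by (intro Bochner_Integration.integral_diff integrable_mult_cont assms continuous_wave)
  then show ?thesis by (simp add: cf_def complex_eq_iff diff_divide_distrib)
qed

definition coef :: "(real^2 \<Rightarrow> real) \<Rightarrow> complex \<times> complex \<times> complex" where
  "coef h = (cf k1 h, cf k2 h, cf k3 h)"

lemma integral_tri_wave:
  assumes "k \<in> dl"
  shows "(\<integral>x. tri v x * wave c k x \<partial>T) = 2 * ((\<integral>x. wave (fst v) k1 x * wave c k x \<partial>T)
    + (\<integral>x. wave (fst (snd v)) k2 x * wave c k x \<partial>T) + (\<integral>x. wave (snd (snd v)) k3 x * wave c k x \<partial>T))"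
proof -
  have i: "integrable T (\<lambda>x. wave a l x * wave c k x)" for a l by (intro integrable_cont continuous_intros)
  have "(\<integral>x. tri v x * wave c k x \<partial>T) = (\<integral>x. 2 * (wave (fst v) k1 x * wave c k x + wave (fst (snd v)) k2 x * wave c k x + wave (snd (snd v)) k3 x * wave c k x) \<partial>T)"
    by (simp add: tri_eq algebra_simps)
  then show ?thesis by (simp add: i)
qed

lemma tri_wave_frame:
  "(\<integral>x. tri v x * wave c k1 x \<partial>T) = V * Re (c * cnj (fst v))"
  "(\<integral>x. tri v x * wave c k2 x \<partial>T) = V * Re (c * cnj (fst (snd v)))"
  "(\<integral>x. tri v x * wave c k3 x \<partial>T) = V * Re (c * cnj (snd (snd v)))"
  by (simp_all only: integral_tri_wave integral_wave_mult k1_dl k2_dl k3_dl frame_distinct if_False if_True simp_thms)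
    (simp_all add: algebra_simps)

lemma tri_wave_other:
  assumes "k \<in> dl" "k \<notin> {k1, k2, k3, - k1, - k2, - k3}"
  shows "(\<integral>x. tri v x * wave c k x \<partial>T) = 0"
proof -
  have "k1 + k \<noteq> 0" "k2 + k \<noteq> 0" "k3 + k \<noteq> 0" using assms(2) by (auto simp: add_eq_0_iff)
  then show ?thesis using assms k1_dl k2_dl k3_dl by (simp add: integral_tri_wave integral_wave_mult) auto
qed

lemma coef_tri: "coef (tri v) = v"
proof -
  have "cf k1 (tri v) = fst v" "cf k2 (tri v) = fst (snd v)" "cf k3 (tri v) = snd (snd v)"
    by (simp_all add: cf_def tri_wave_frame complex_eq_iff)
  then show ?thesis by (simp add: coef_def)
qed

definition supp :: "complex \<times> complex \<times> complex \<Rightarrow> bool" where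
  "supp v \<longleftrightarrow> (k1 \<notin> shell \<longrightarrow> fst v = 0) \<and> (k2 \<notin> shell \<longrightarrow> fst (snd v) = 0) \<and> (k3 \<notin> shell \<longrightarrow> snd (snd v) = 0)"

lemma shell_cases: "k \<in> shell \<Longrightarrow> k \<in> {k1, k2, k3, - k1, - k2, - k3}"
  using shell_sub by (auto simp: k3_def)

definition lam1 :: real where "lam1 = first_eigenvalue \<xi> \<eta>"

lemma lam1_eq: "k \<in> shell \<Longrightarrow> lam1 = lam k" by (simp add: lam1_def first_eigenvalue_eq)

lemma lam1_pos: "lam1 > 0"
  using shell_nonempty lam1_eq lam_pos shell_dl(2) by (metis ex_in_conv)

lemma lam1_less: "k \<in> dl \<Longrightarrow> k \<noteq> 0 \<Longrightarrow> k \<notin> shell \<Longrightarrow> lam1 < lam k"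
  using shell_nonempty shell_less[of _ k] lam1_eq by (auto simp: lam_def)

text \<open>Off the shell \<open>lam k\<close> differs from \<open>lam1\<close>, so the coefficients
  vanish there; on the shell those at \<open>- k\<close> are conjugate to those at \<open>k\<close>,
  since the function is real. Three coefficients thus carry everything, and Fourier uniqueness gives
  equality almost everywhere.\<close>

lemma first_eigenspace_tri:
  assumes "\<omega> \<in> first_eigenspace \<xi> \<eta>"
  shows "per \<omega>" "\<omega> \<in> borel_measurable T" "\<exists>v. supp v \<and> (AE x in T. \<omega> x = tri v x)"
proof -
  have s: "poisson_solution \<xi> \<eta> 2 (\<lambda>x. lam1 * \<omega> x) \<omega>" using assms by (simp add: first_eigenspace_def lam1_def)
  have L: "\<omega> \<in> mLp 2" and per: "per \<omega>" and z: "(\<integral>x. \<omega> x \<partial>T) = 0"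
    using s by (auto simp: poisson_solution_def W2p0_def W2p_def Lp_iff mean_zero_def)
  show "per \<omega>" by fact
  show m: "\<omega> \<in> borel_measurable T" by (rule mLp_measurable[OF L])
  have i: "integrable T \<omega>" using L by (rule mLp_L1) simp
  have cm: "(\<lambda>x. lam1 * \<omega> x) \<in> borel_measurable T" using m by measurable
  have wz: "(\<integral>x. \<omega> x * wave c k x \<partial>T) = 0" if "k \<in> dl" "k \<notin> shell" for c k
  proof (cases "k = 0")
    case True
    then show ?thesis using z by (simp add: wave_zero_freq)
  next
    case False
    have "lam k * (\<integral>x. \<omega> x * wave c k x \<partial>T) = lam1 * (\<integral>x. \<omega> x * wave c k x \<partial>T)"
      using poisson_fourier[OF _ cm s that(1), of c] by (simp add: mult.assoc)
    then show ?thesis using lam1_less[OF that(1) False that(2)] by simp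
  qed
  define f where "f k = (if k \<in> shell then cf k \<omega> else 0)" for k
  define v where "v = (f k1, f k2, f k3)"
  have fr: "(\<integral>x. \<omega> x * wave c k x \<partial>T) = V * Re (c * cnj (f k))" if "k \<in> dl" for c k
    using cf_wave[OF i] wz[OF that] by (simp add: f_def)
  have eq: "(\<integral>x. \<omega> x * wave c k x \<partial>T) = (\<integral>x. tri v x * wave c k x \<partial>T)" if k: "k \<in> dl" for c k
  proof -
    have 1: "(\<integral>x. \<omega> x * wave c l x \<partial>T) = (\<integral>x. tri v x * wave c l x \<partial>T)" if "l \<in> {k1, k2, k3}" for c l
      using that fr k1_dl k2_dl k3_dl tri_wave_frame[of v c] by (auto simp: v_def)
    consider "k \<in> {k1, k2, k3}" | "- k \<in> {k1, k2, k3}" | "k \<notin> {k1, k2, k3, - k1, - k2, - k3}" by force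
    then show ?thesis
    proof cases
      case 2
      from 1[OF this, of "cnj c"] show ?thesis by (simp add: wave_minus_freq)
    next
      case 3
      then show ?thesis using wz[OF k] tri_wave_other[OF k 3] shell_cases by metis
    qed (use 1 in auto)
  qed
  have "AE x in T. \<omega> x - tri v x = 0"
  proof (rule fourier_unique)
    show "integrable T (\<lambda>x. \<omega> x - tri v x)" by (rule Bochner_Integration.integrable_diff[OF i integrable_cont[OF continuous_tri]])
    fix g assume "g \<in> trig"
    then obtain A c where A: "finite A" "A \<subseteq> dl" "g = tp A c" by (rule trigE)
    have s: "(\<integral>x. h x * g x \<partial>T) = (\<Sum>k\<in>A. \<integral>x. h x * wave (c k) k x \<partial>T)" if "integrable T h" for h
      unfolding A(3) tp_def sum_distrib_left
      by (intro Bochner_Integration.integral_sum integrable_mult_cont that continuous_wave)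
    have it: "integrable T (tri v)" by (intro integrable_cont continuous_tri)
    have "(\<integral>x. (\<omega> x - tri v x) * g x \<partial>T) = (\<integral>x. \<omega> x * g x \<partial>T) - (\<integral>x. tri v x * g x \<partial>T)"
      unfolding left_diff_distrib
      by (intro Bochner_Integration.integral_diff integrable_mult_cont i it) (auto simp: A(3) intro: continuous_tp)
    also have "\<dots> = 0" unfolding s[OF i] s[OF it] using A(2) by (auto intro!: sum.cong eq)
    finally show "(\<integral>x. (\<omega> x - tri v x) * g x \<partial>T) = 0" .
  qed
  then have "AE x in T. \<omega> x = tri v x" by eventually_elim simp
  moreover have "supp v" by (simp add: supp_def v_def f_def)
  ultimately show "\<exists>v. supp v \<and> (AE x in T. \<omega> x = tri v x)" by blast
qed

lemma energy_tri:
  assumes "1 < p" "supp v"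
  shows "energy \<xi> \<eta> p (tri v) = (\<integral>x. (tri v x)\<^sup>2 \<partial>T) / (2 * lam1)"
proof -
  have "tp {k1, k2, k3} (gco (vc v)) = tp {k1, k2, k3} (\<lambda>k. of_real (1 / lam1) * vc v k)"
  proof (rule tp_cong)
    fix k assume k: "k \<in> {k1, k2, k3}"
    show "gco (vc v) k = of_real (1 / lam1) * vc v k"
    proof (cases "k \<in> shell")
      case True
      then show ?thesis by (simp add: gco_def lam1_eq)
    next
      case False
      then have "vc v k = 0" using k assms(2) frame_distinct by (auto simp: vc_def supp_def)
      then show ?thesis by (simp add: gco_def)
    qed
  qed
  also have "\<dots> = (\<lambda>x. 1 / lam1 * tri v x)" by (rule ext) (simp only: tp_scale tri_def)
  finally have "energy \<xi> \<eta> p (tri v) = 1 / 2 * (\<integral>x. tri v x * (1 / lam1 * tri v x) \<partial>T)"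
    using energy_tp[OF assms(1) tri_tp0] by (simp only: tri_def)
  also have "(\<integral>x. tri v x * (1 / lam1 * tri v x) \<partial>T) = (\<integral>x. 1 / lam1 * (tri v x)\<^sup>2 \<partial>T)"
    by (simp add: power2_eq_square)
  finally show ?thesis by simp
qed

text \<open>\<open>A\<close> may contain both \<open>k\<close> and \<open>- k\<close>. As only real
  parts are taken, the wave at \<open>- k\<close> is one at \<open>k\<close> with conjugate
  amplitude, and the two merge.\<close>

lemma shell_part_tri:
  assumes "finite A"
  shows "\<exists>v. tp (A \<inter> shell) c = tri v"
proof -
  define d where "d k = (if k \<in> A \<inter> shell then c k else 0)" for k
  let ?K = "{k1, k2, k3, - k1, - k2, - k3}"
  have sub: "A \<inter> shell \<subseteq> ?K" using shell_cases by blast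
  have "tp (A \<inter> shell) c = tp ?K d" unfolding d_def by (rule tp_mono[OF _ sub]) simp
  moreover have "tp ?K d x = tri ((d k1 + cnj (d (- k1))) / 2, (d k2 + cnj (d (- k2))) / 2, (d k3 + cnj (d (- k3))) / 2) x" for x
  proof -
    have n: "k1 \<noteq> - k1" "k1 \<noteq> - k2" "k1 \<noteq> - k3" "k2 \<noteq> - k1" "k2 \<noteq> - k2" "k2 \<noteq> - k3" "k3 \<noteq> - k1" "k3 \<noteq> - k2" "k3 \<noteq> - k3"
      using frame_distinct by (metis add.right_inverse add.commute)+
    have w: "2 * wave (a / 2) k x = wave a k x" for a k using wave_scale[of 2 "a / 2" k x] by simp
    have "tp ?K d x = (wave (d k1) k1 x + wave (d k2) k2 x + wave (d k3) k3 x) + (wave (d (- k1)) (- k1) x + wave (d (- k2)) (- k2) x + wave (d (- k3)) (- k3) x)"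
      using n frame_distinct unfolding tp_def by simp
    also have "\<dots> = wave (d k1 + cnj (d (- k1))) k1 x + wave (d k2 + cnj (d (- k2))) k2 x + wave (d k3 + cnj (d (- k3))) k3 x"
      by (simp add: wave_minus_freq wave_add)
    finally show ?thesis by (simp add: tri_eq distrib_left w)
  qed
  ultimately have "tp (A \<inter> shell) c = tri ((d k1 + cnj (d (- k1))) / 2, (d k2 + cnj (d (- k2))) / 2, (d k3 + cnj (d (- k3))) / 2)"
    by (simp add: fun_eq_iff)
  then show ?thesis by blast
qed

section \<open>The spectral gap as an energy inequality\<close>

lemma gap_exists: "\<exists>\<kappa>>0. \<forall>k\<in>dl - {0}. k \<notin> shell \<longrightarrow> \<kappa> \<le> 1 / lam1 - 1 / lam k"
proof -
  obtain k0 where k0: "k0 \<in> shell" using shell_nonempty by auto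
  let ?R = "dl - {0} - shell"
  \<comment> \<open>The double of a shortest vector shows that there are nonzero frequencies off the
    shell, so that a shortest one among them exists and determines the gap.\<close>
  have "k0 + k0 \<noteq> 0" using shell_dl(2)[OF k0] by (metis scaleR_2 scaleR_eq_0_iff zero_neq_numeral)
  then have "k0 + k0 \<in> dl - {0}" using dl_add[OF shell_dl(1)[OF k0] shell_dl(1)[OF k0]] by blast
  moreover have "k0 + k0 \<notin> shell"
  proof
    assume "k0 + k0 \<in> shell"
    from shell_eq[OF k0 this] have "k0 \<bullet> k0 = 4 * (k0 \<bullet> k0)" by (simp only: inner_add_left inner_add_right)
    then show False using shell_dl(2)[OF k0] by simp
  qed
  ultimately have "?R \<noteq> {}" by blast
  then obtain l where l: "l \<in> ?R" "\<And>k. k \<in> ?R \<Longrightarrow> l \<bullet> l \<le> k \<bullet> k" using dl_minimum[of ?R] by auto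
  have ll: "lam1 < lam l" using l(1) lam1_less by auto
  have le: "1 / lam1 - 1 / lam l \<le> 1 / lam1 - 1 / lam k" if "k \<in> ?R" for k
  proof -
    have "lam l \<le> lam k" using l(2)[OF that] by (simp add: lam_def)
    then have "1 / lam k \<le> 1 / lam l" using ll lam1_pos by (intro frac_le) auto
    then show ?thesis by simp
  qed
  show ?thesis
  proof (intro exI conjI ballI impI)
    show "1 / lam1 - 1 / lam l > 0" using ll lam1_pos by (simp add: field_simps)
    show "1 / lam1 - 1 / lam l \<le> 1 / lam1 - 1 / lam k" if "k \<in> dl - {0}" "k \<notin> shell" for k
      by (rule le) (use that in blast)
  qed
qed

text \<open>The multiplier \<open>1 / lam1 - 1 / lam k\<close>, reduced by \<kappa> off the shell,
  is still nonnegative on \<open>A\<close> and depends on the length of \<open>k\<close> alone. The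
  claim is the positivity of the associated quadratic form.\<close>

lemma gap_tp0:
  assumes p: "1 < p" and \<kappa>: "\<And>k. k \<in> dl - {0} \<Longrightarrow> k \<notin> shell \<Longrightarrow> \<kappa> \<le> 1 / lam1 - 1 / lam k"
    and A: "tp0 A c"
  shows "\<kappa> * (\<integral>x. (tp A c x - tp (A \<inter> shell) c x)\<^sup>2 \<partial>T) \<le> (\<integral>x. (tp A c x)\<^sup>2 \<partial>T) / lam1 - 2 * energy \<xi> \<eta> p (tp A c)"
proof -
  have A': "finite A" "A \<subseteq> dl" "0 \<notin> A" using A by (auto simp: tp0_def)
  define i where "i k = (if k \<in> shell then 0 else 1 :: real)" for k
  define m where "m k = 1 / lam1 - 1 / lam k - \<kappa> * i k" for k
  have ish: "i k = i l" if "k \<in> A" "l \<in> A" "k \<bullet> k = l \<bullet> l" for k l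
  proof -
    have "k \<in> dl - {0}" "l \<in> dl - {0}" using that A' by auto
    then show ?thesis using that(3) by (auto simp: i_def shell_def)
  qed
  let ?g = "\<lambda>m x. tp A (\<lambda>k. of_real (m k) * c k) x"
  have c: "continuous_on UNIV (tp A d)" for d by (rule continuous_tp)
  have m0: "0 \<le> (\<integral>x. tp A c x * ?g m x \<partial>T)"
  proof (rule multiplier_nonneg[OF A'(1,2)])
    show "m k \<ge> 0" if "k \<in> A" for k
      using \<kappa>[of k] that A' lam1_eq[of k] by (auto simp: m_def i_def)
    show "m k = m l" if "k \<in> A" "l \<in> A" "k \<bullet> k = l \<bullet> l" for k l
      using ish[OF that] that(3) by (simp add: m_def lam_def)
  qed
  have gm: "?g m x = (1 / lam1) * tp A c x - tp A (gco c) x - \<kappa> * ?g i x" for x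
    unfolding tp_scale tp_diff by (intro fun_cong[OF tp_cong]) (simp add: m_def gco_def algebra_simps)
  have "(\<integral>x. tp A c x * ?g m x \<partial>T) = (\<integral>x. (1 / lam1) * (tp A c x)\<^sup>2 - tp A c x * tp A (gco c) x - \<kappa> * (tp A c x * ?g i x) \<partial>T)"
    unfolding gm by (simp add: algebra_simps power2_eq_square)
  also have "\<dots> = (1 / lam1) * (\<integral>x. (tp A c x)\<^sup>2 \<partial>T) - (\<integral>x. tp A c x * tp A (gco c) x \<partial>T) - \<kappa> * (\<integral>x. tp A c x * ?g i x \<partial>T)"
  proof -
    have "integrable T (\<lambda>x. (tp A c x)\<^sup>2)" "integrable T (\<lambda>x. tp A c x * tp A (gco c) x)" "integrable T (\<lambda>x. tp A c x * ?g i x)"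
      by (intro integrable_cont continuous_intros)+
    then show ?thesis by simp
  qed
  also have "(\<integral>x. tp A c x * tp A (gco c) x \<partial>T) = 2 * energy \<xi> \<eta> p (tp A c)" by (simp add: energy_tp[OF p A])
  \<comment> \<open>\<open>i\<close> takes the values 0 and 1 and depends on the length only, so it
    acts as an orthogonal projection.\<close>
  also have "(\<integral>x. tp A c x * ?g i x \<partial>T) = (\<integral>x. (?g i x)\<^sup>2 \<partial>T)"
  proof -
    have "(\<integral>x. ?g i x * ?g i x \<partial>T) = (\<integral>x. tp A c x * tp A (\<lambda>k. of_real (i k) * (of_real (i k) * c k)) x \<partial>T)"
      by (rule multiplier_symmetric[OF A'(1,2) A'(1,2)]) (rule ish)
    moreover have "tp A (\<lambda>k. of_real (i k) * (of_real (i k) * c k)) = ?g i" by (intro tp_cong) (simp add: i_def)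
    ultimately show ?thesis by (simp add: power2_eq_square)
  qed
  finally have le: "0 \<le> (1 / lam1) * (\<integral>x. (tp A c x)\<^sup>2 \<partial>T) - 2 * energy \<xi> \<eta> p (tp A c) - \<kappa> * (\<integral>x. (?g i x)\<^sup>2 \<partial>T)"
    using m0 by simp
  have gi: "?g i x = tp A c x - tp (A \<inter> shell) c x" for x
  proof -
    have "tp (A \<inter> shell) c = tp A (\<lambda>k. if k \<in> A \<inter> shell then c k else 0)" using A'(1) by (intro tp_mono) auto
    then have "tp A c x - tp (A \<inter> shell) c x = tp A (\<lambda>k. c k - (if k \<in> A \<inter> shell then c k else 0)) x" by (simp add: tp_diff)
    also have "\<dots> = ?g i x" by (intro fun_cong[OF tp_cong]) (simp add: i_def)
    finally show ?thesis ..
  qed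
  show ?thesis using le unfolding gi by simp
qed

end

section \<open>Moments of eigenfunctions\<close>

text \<open>
  Weighted walks on the triangular lattice whose six steps carry the weights \<open>a, a', b, b', c, c'\<close>.
  The tables contain only the points from which the origin can be reached in the steps that remain.
\<close>

lemma walk_count:
  fixes J0 J1 J2 J3 J4 J5 J6 :: "int \<Rightarrow> int \<Rightarrow> complex" and a a' b b' c c' :: complex
  assumes J0: "\<And>m n. J0 m n = (if m = 0 \<and> n = 0 then 1 else 0)"
    and J1: "\<And>m n. J1 m n = a * J0 (m + 1) n + a' * J0 (m - 1) n + b * J0 m (n + 1) + b' * J0 m (n - 1) + c * J0 (m - 1) (n - 1) + c' * J0 (m + 1) (n + 1)"
    and J2: "\<And>m n. J2 m n = a * J1 (m + 1) n + a' * J1 (m - 1) n + b * J1 m (n + 1) + b' * J1 m (n - 1) + c * J1 (m - 1) (n - 1) + c' * J1 (m + 1) (n + 1)"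
    and J3: "\<And>m n. J3 m n = a * J2 (m + 1) n + a' * J2 (m - 1) n + b * J2 m (n + 1) + b' * J2 m (n - 1) + c * J2 (m - 1) (n - 1) + c' * J2 (m + 1) (n + 1)"
    and J4: "\<And>m n. J4 m n = a * J3 (m + 1) n + a' * J3 (m - 1) n + b * J3 m (n + 1) + b' * J3 m (n - 1) + c * J3 (m - 1) (n - 1) + c' * J3 (m + 1) (n + 1)"
    and J5: "\<And>m n. J5 m n = a * J4 (m + 1) n + a' * J4 (m - 1) n + b * J4 m (n + 1) + b' * J4 m (n - 1) + c * J4 (m - 1) (n - 1) + c' * J4 (m + 1) (n + 1)"
    and J6: "\<And>m n. J6 m n = a * J5 (m + 1) n + a' * J5 (m - 1) n + b * J5 m (n + 1) + b' * J5 m (n - 1) + c * J5 (m - 1) (n - 1) + c' * J5 (m + 1) (n + 1)"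
  shows "J2 0 0 = 2 * (a * a' + b * b' + c * c')"
    "J3 0 0 = 6 * (a * b * c + a' * b' * c')"
    "J4 0 0 = 6 * (a * a' + b * b' + c * c')^2 + 12 * (a * a' * (b * b') + a * a' * (c * c') + b * b' * (c * c'))"
    "J6 0 0 = 20 * ((a * a')^3 + (b * b')^3 + (c * c')^3)
       + 180 * ((a * a')^2 * (b * b') + (a * a')^2 * (c * c') + (b * b')^2 * (a * a') + (b * b')^2 * (c * c') + (c * c')^2 * (a * a') + (c * c')^2 * (b * b'))
       + 720 * (a * a' * (b * b') * (c * c')) + 90 * ((a * b * c)^2 + (a' * b' * c')^2)"
proof -
  show "J2 0 0 = 2 * (a * a' + b * b' + c * c')" by (simp add: J2 J1 J0)
  have t3:
    "J3 (-3) (-3) = c'^3"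
    "J3 (-3) (-2) = 3 * a * c'^2"
    "J3 (-3) (-1) = 3 * a^2 * c'"
    "J3 (-3) 0 = a^3"
    "J3 (-2) (-3) = 3 * b * c'^2"
    "J3 (-2) (-2) = 6 * a * b * c'"
    "J3 (-2) (-1) = 3 * a^2 * b + 3 * b' * c'^2"
    "J3 (-2) 0 = 6 * a * b' * c'"
    "J3 (-2) 1 = 3 * a^2 * b'"
    "J3 (-1) (-3) = 3 * b^2 * c'"
    "J3 (-1) (-2) = 3 * a * b^2 + 3 * a' * c'^2"
    "J3 (-1) (-1) = 6 * a * a' * c' + 6 * b * b' * c' + 3 * c * c'^2"
    "J3 (-1) 0 = 3 * a^2 * a' + 6 * a * b * b' + 6 * a * c * c'"
    "J3 (-1) 1 = 3 * a^2 * c + 3 * b'^2 * c'"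
    "J3 (-1) 2 = 3 * a * b'^2"
    "J3 0 (-3) = b^3"
    "J3 0 (-2) = 6 * a' * b * c'"
    "J3 0 (-1) = 6 * a * a' * b + 3 * b^2 * b' + 6 * b * c * c'"
    "J3 0 0 = 6 * a * b * c + 6 * a' * b' * c'"
    "J3 0 1 = 6 * a * a' * b' + 3 * b * b'^2 + 6 * b' * c * c'"
    "J3 0 2 = 6 * a * b' * c"
    "J3 0 3 = b'^3"
    "J3 1 (-2) = 3 * a' * b^2"
    "J3 1 (-1) = 3 * a'^2 * c' + 3 * b^2 * c"
    "J3 1 0 = 3 * a * a'^2 + 6 * a' * b * b' + 6 * a' * c * c'"
    "J3 1 1 = 6 * a * a' * c + 6 * b * b' * c + 3 * c^2 * c'"
    "J3 1 2 = 3 * a * c^2 + 3 * a' * b'^2"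
    "J3 1 3 = 3 * b'^2 * c"
    "J3 2 (-1) = 3 * a'^2 * b"
    "J3 2 0 = 6 * a' * b * c"
    "J3 2 1 = 3 * a'^2 * b' + 3 * b * c^2"
    "J3 2 2 = 6 * a' * b' * c"
    "J3 2 3 = 3 * b' * c^2"
    "J3 3 0 = a'^3"
    "J3 3 1 = 3 * a'^2 * c"
    "J3 3 2 = 3 * a' * c^2"
    "J3 3 3 = c^3"
    by (simp_all add: J3 J2 J1 J0 power2_eq_square power3_eq_cube algebra_simps)
  show "J3 0 0 = 6 * (a * b * c + a' * b' * c')" by (simp add: t3)
  have t4:
    "J4 (-2) (-2) = 6 * a^2 * b^2 + 12 * a * a' * c'^2 + 12 * b * b' * c'^2 + 4 * c * c'^3"
    "J4 (-2) (-1) = 12 * a^2 * a' * c' + 24 * a * b * b' * c' + 12 * a * c * c'^2"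
    "J4 (-2) 0 = 4 * a^3 * a' + 12 * a^2 * b * b' + 12 * a^2 * c * c' + 6 * b'^2 * c'^2"
    "J4 (-1) (-2) = 24 * a * a' * b * c' + 12 * b^2 * b' * c' + 12 * b * c * c'^2"
    "J4 (-1) (-1) = 12 * a^2 * a' * b + 12 * a * b^2 * b' + 24 * a * b * c * c' + 12 * a' * b' * c'^2"
    "J4 (-1) 0 = 12 * a^2 * b * c + 24 * a * a' * b' * c' + 12 * b * b'^2 * c' + 12 * b' * c * c'^2"
    "J4 (-1) 1 = 12 * a^2 * a' * b' + 12 * a * b * b'^2 + 24 * a * b' * c * c'"
    "J4 0 (-2) = 12 * a * a' * b^2 + 6 * a'^2 * c'^2 + 4 * b^3 * b' + 12 * b^2 * c * c'"
    "J4 0 (-1) = 12 * a * a'^2 * c' + 12 * a * b^2 * c + 24 * a' * b * b' * c' + 12 * a' * c * c'^2"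
    "J4 0 0 = 6 * a^2 * a'^2 + 24 * a * a' * b * b' + 24 * a * a' * c * c' + 6 * b^2 * b'^2 + 24 * b * b' * c * c' + 6 * c^2 * c'^2"
    "J4 0 1 = 12 * a^2 * a' * c + 24 * a * b * b' * c + 12 * a * c^2 * c' + 12 * a' * b'^2 * c'"
    "J4 0 2 = 6 * a^2 * c^2 + 12 * a * a' * b'^2 + 4 * b * b'^3 + 12 * b'^2 * c * c'"
    "J4 1 (-1) = 12 * a * a'^2 * b + 12 * a' * b^2 * b' + 24 * a' * b * c * c'"
    "J4 1 0 = 24 * a * a' * b * c + 12 * a'^2 * b' * c' + 12 * b^2 * b' * c + 12 * b * c^2 * c'"
    "J4 1 1 = 12 * a * a'^2 * b' + 12 * a * b * c^2 + 12 * a' * b * b'^2 + 24 * a' * b' * c * c'"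
    "J4 1 2 = 24 * a * a' * b' * c + 12 * b * b'^2 * c + 12 * b' * c^2 * c'"
    "J4 2 0 = 4 * a * a'^3 + 12 * a'^2 * b * b' + 12 * a'^2 * c * c' + 6 * b^2 * c^2"
    "J4 2 1 = 12 * a * a'^2 * c + 24 * a' * b * b' * c + 12 * a' * c^2 * c'"
    "J4 2 2 = 12 * a * a' * c^2 + 6 * a'^2 * b'^2 + 12 * b * b' * c^2 + 4 * c^3 * c'"
    by (simp_all add: J4 t3 power2_eq_square power3_eq_cube power4_eq_xxxx algebra_simps)
  show "J4 0 0 = 6 * (a * a' + b * b' + c * c')^2 + 12 * (a * a' * (b * b') + a * a' * (c * c') + b * b' * (c * c'))"
    by (simp add: t4 power2_eq_square algebra_simps)
  have t5:
    "J5 (-1) (-1) = 30 * a^2 * a'^2 * c' + 30 * a^2 * b^2 * c + 120 * a * a' * b * b' * c' + 60 * a * a' * c * c'^2 + 30 * b^2 * b'^2 * c' + 60 * b * b' * c * c'^2 + 10 * c^2 * c'^3"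
    "J5 (-1) 0 = 10 * a^3 * a'^2 + 60 * a^2 * a' * b * b' + 60 * a^2 * a' * c * c' + 30 * a * b^2 * b'^2 + 120 * a * b * b' * c * c' + 30 * a * c^2 * c'^2 + 30 * a' * b'^2 * c'^2"
    "J5 0 (-1) = 30 * a^2 * a'^2 * b + 60 * a * a' * b^2 * b' + 120 * a * a' * b * c * c' + 30 * a'^2 * b' * c'^2 + 10 * b^3 * b'^2 + 60 * b^2 * b' * c * c' + 30 * b * c^2 * c'^2"
    "J5 0 1 = 30 * a^2 * a'^2 * b' + 30 * a^2 * b * c^2 + 60 * a * a' * b * b'^2 + 120 * a * a' * b' * c * c' + 10 * b^2 * b'^3 + 60 * b * b'^2 * c * c' + 30 * b' * c^2 * c'^2"
    "J5 1 0 = 10 * a^2 * a'^3 + 60 * a * a'^2 * b * b' + 60 * a * a'^2 * c * c' + 30 * a * b^2 * c^2 + 30 * a' * b^2 * b'^2 + 120 * a' * b * b' * c * c' + 30 * a' * c^2 * c'^2"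
    "J5 1 1 = 30 * a^2 * a'^2 * c + 120 * a * a' * b * b' * c + 60 * a * a' * c^2 * c' + 30 * a'^2 * b'^2 * c' + 30 * b^2 * b'^2 * c + 60 * b * b' * c^2 * c' + 10 * c^3 * c'^2"
    by (simp_all add: J5 t4 power2_eq_square power3_eq_cube power4_eq_xxxx algebra_simps)
  show "J6 0 0 = 20 * ((a * a')^3 + (b * b')^3 + (c * c')^3)
       + 180 * ((a * a')^2 * (b * b') + (a * a')^2 * (c * c') + (b * b')^2 * (a * a') + (b * b')^2 * (c * c') + (c * c')^2 * (a * a') + (c * c')^2 * (b * b'))
       + 720 * (a * a' * (b * b') * (c * c')) + 90 * ((a * b * c)^2 + (a' * b' * c')^2)"
    by (simp add: J6 t5 power2_eq_square power3_eq_cube algebra_simps)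
qed

text \<open>
  Each factor \<open>tri v\<close> shifts the frequency by some \<open>\<plusminus>k\<^sub>j\<close>, so the Fourier coefficient of \<open>(tri v)\<^sup>l\<close> at
  \<open>m k\<^sub>1 + n k\<^sub>2\<close> counts weighted walks of \<open>l\<close> steps.
\<close>

primrec walk :: "complex \<times> complex \<times> complex \<Rightarrow> nat \<Rightarrow> int \<Rightarrow> int \<Rightarrow> complex" where
  "walk v 0 m n = (if m = 0 \<and> n = 0 then 1 else 0)"
| "walk v (Suc l) m n = fst v * walk v l (m + 1) n + cnj (fst v) * walk v l (m - 1) n
    + fst (snd v) * walk v l m (n + 1) + cnj (fst (snd v)) * walk v l m (n - 1)
    + snd (snd v) * walk v l (m - 1) (n - 1) + cnj (snd (snd v)) * walk v l (m + 1) (n + 1)"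

definition amp :: "complex \<times> complex \<times> complex \<Rightarrow> real \<times> real \<times> real" where
  "amp v = ((cmod (fst v))\<^sup>2, (cmod (fst (snd v)))\<^sup>2, (cmod (snd (snd v)))\<^sup>2)"

definition phase :: "complex \<times> complex \<times> complex \<Rightarrow> complex" where
  "phase v = fst v * fst (snd v) * snd (snd v)"

text \<open>
  The amplitudes together with the phase are complete invariants of the translation orbit of \<open>tri v\<close>.
\<close>

definition inv_dist :: "complex \<times> complex \<times> complex \<Rightarrow> complex \<times> complex \<times> complex \<Rightarrow> real" where
  "inv_dist v w = dist (amp v) (amp w) + dist (phase v) (phase w)"

lemma cis_phase:
  assumes "cmod a = cmod b" shows "\<exists>s. a = b * cis s"
proof (cases "b = 0")
  case False
  have "a / b \<noteq> 0" using False assms by auto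
  then have "cis (Arg (a / b)) = sgn (a / b)" by (rule cis_Arg)
  also have "\<dots> = a / b" using assms False by (simp add: sgn_div_norm norm_divide)
  finally have "a = b * cis (Arg (a / b))" using False by simp
  then show ?thesis ..
qed (use assms in auto)

lemma cubic_root_cases:
  fixes x y z s1 s2 s3 :: real
  assumes "x + y + z = s1 + s2 + s3" "x * y + x * z + y * z = s1 * s2 + s1 * s3 + s2 * s3" "x * y * z = s1 * s2 * s3"
  shows "x \<in> {s1, s2, s3}" "y \<in> {s1, s2, s3}" "z \<in> {s1, s2, s3}"
proof -
  have "(t - s1) * (t - s2) * (t - s3) = (t - x) * (t - y) * (t - z)" for t
  proof -
    have "(t - s1) * (t - s2) * (t - s3) = t^3 - (s1 + s2 + s3) * t^2 + (s1 * s2 + s1 * s3 + s2 * s3) * t - s1 * s2 * s3"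
      by (simp add: power2_eq_square power3_eq_cube algebra_simps)
    also have "\<dots> = (t - x) * (t - y) * (t - z)"
      unfolding assms[symmetric] by (simp add: power2_eq_square power3_eq_cube algebra_simps)
    finally show ?thesis .
  qed
  from this[of x] this[of y] this[of z]
  show "x \<in> {s1, s2, s3}" "y \<in> {s1, s2, s3}" "z \<in> {s1, s2, s3}" by auto
qed

context lattice_frame
begin

definition freq :: "int \<Rightarrow> int \<Rightarrow> real^2" where
  "freq m n = of_int m *\<^sub>R k1 + of_int n *\<^sub>R k2"

lemma dl_scale_int: "k \<in> dl \<Longrightarrow> of_int m *\<^sub>R k \<in> dl" by (auto simp: dl_def)

lemma freq_dl: "freq m n \<in> dl" unfolding freq_def by (intro dl_add dl_scale_int k1_dl k2_dl)

lemma freq_zero: "freq m n = 0 \<longleftrightarrow> m = 0 \<and> n = 0"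
  using frame_inj[of "of_int m" "of_int n" 0 0] by (simp add: freq_def)

lemma tri_power_wave: "(\<integral>x. (tri v x)^l * wave C (freq m n) x \<partial>T) = V * Re (C * walk v l m n)"
proof (induction l arbitrary: C m n)
  case 0
  show ?case using integral_wave[OF freq_dl, of C m n] by (simp add: freq_zero)
next
  case (Suc l)
  \<comment> \<open>The third frequency is \<open>- (k1 + k2)\<close>, so in the coordinates of
    \<open>freq\<close> it is the diagonal step \<open>(-1, -1)\<close>.\<close>
  have f: "freq m n + k1 = freq (m + 1) n" "freq m n - k1 = freq (m - 1) n" "freq m n + k2 = freq m (n + 1)"
    "freq m n - k2 = freq m (n - 1)" "freq m n + k3 = freq (m - 1) (n - 1)" "freq m n - k3 = freq (m + 1) (n + 1)"
    by (simp_all add: freq_def k3_def algebra_simps)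
  have w: "2 * (wave C \<kappa> x * wave a k x) = wave (C * a) (\<kappa> + k) x + wave (C * cnj a) (\<kappa> - k) x" for \<kappa> k a x
    unfolding wave_mult using wave_scale[of 2 "C * a / 2" "\<kappa> + k" x] wave_scale[of 2 "C * cnj a / 2" "\<kappa> - k" x] by simp
  let ?a = "fst v" and ?b = "fst (snd v)" and ?c = "snd (snd v)"
  have "tri v x * wave C (freq m n) x = 2 * (wave C (freq m n) x * wave ?a k1 x) + 2 * (wave C (freq m n) x * wave ?b k2 x) + 2 * (wave C (freq m n) x * wave ?c k3 x)" for x
    by (simp add: tri_eq algebra_simps)
  then have p: "tri v x * wave C (freq m n) x = wave (C * ?a) (freq (m + 1) n) x + wave (C * cnj ?a) (freq (m - 1) n) x
      + wave (C * ?b) (freq m (n + 1)) x + wave (C * cnj ?b) (freq m (n - 1)) x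
      + wave (C * ?c) (freq (m - 1) (n - 1)) x + wave (C * cnj ?c) (freq (m + 1) (n + 1)) x" for x
    by (simp only: w f)
  have i: "integrable T (\<lambda>x. (tri v x)^l * wave a k x)" for a k by (intro integrable_cont continuous_intros)
  have "(\<integral>x. (tri v x)^Suc l * wave C (freq m n) x \<partial>T) = (\<integral>x. (tri v x)^l * (tri v x * wave C (freq m n) x) \<partial>T)"
    by (simp add: mult_ac)
  also have "\<dots> = (\<integral>x. (tri v x)^l * wave (C * ?a) (freq (m + 1) n) x + (tri v x)^l * wave (C * cnj ?a) (freq (m - 1) n) x
      + (tri v x)^l * wave (C * ?b) (freq m (n + 1)) x + (tri v x)^l * wave (C * cnj ?b) (freq m (n - 1)) x
      + (tri v x)^l * wave (C * ?c) (freq (m - 1) (n - 1)) x + (tri v x)^l * wave (C * cnj ?c) (freq (m + 1) (n + 1)) x \<partial>T)"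
    unfolding p by (simp only: distrib_left)
  also have "\<dots> = V * Re (C * ?a * walk v l (m + 1) n) + V * Re (C * cnj ?a * walk v l (m - 1) n)
      + V * Re (C * ?b * walk v l m (n + 1)) + V * Re (C * cnj ?b * walk v l m (n - 1))
      + V * Re (C * ?c * walk v l (m - 1) (n - 1)) + V * Re (C * cnj ?c * walk v l (m + 1) (n + 1))"
    by (simp only: i Bochner_Integration.integral_add Bochner_Integration.integrable_add Suc.IH)
  also have "\<dots> = V * Re (C * walk v (Suc l) m n)"
    unfolding walk.simps distrib_left[of C] plus_complex.sel distrib_left[of V] by (simp only: mult.assoc)
  finally show ?case .
qed

definition mom :: "nat \<Rightarrow> complex \<times> complex \<times> complex \<Rightarrow> real" where
  "mom l v = (\<integral>x. (tri v x)^l \<partial>T)"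

lemma mom_walk: "mom l v = V * Re (walk v l 0 0)"
  using tri_power_wave[of v l 1 0 0] by (simp add: mom_def freq_def wave_zero_freq)

lemma moments:
  fixes v defines "r1 \<equiv> (cmod (fst v))\<^sup>2" and "r2 \<equiv> (cmod (fst (snd v)))\<^sup>2" and "r3 \<equiv> (cmod (snd (snd v)))\<^sup>2"
  shows "mom 2 v = V * (2 * (r1 + r2 + r3))"
    "mom 3 v = V * (12 * Re (phase v))"
    "mom 4 v = V * (6 * (r1 + r2 + r3)^2 + 12 * (r1 * r2 + r1 * r3 + r2 * r3))"
    "mom 6 v = V * (20 * (r1^3 + r2^3 + r3^3) + 180 * (r1^2 * r2 + r1^2 * r3 + r2^2 * r1 + r2^2 * r3 + r3^2 * r1 + r3^2 * r2)
       + 720 * (r1 * r2 * r3) + 180 * (2 * (Re (phase v))\<^sup>2 - r1 * r2 * r3))"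
proof -
  obtain a b c where v: "v = (a, b, c)" by (metis prod.exhaust)
  have r: "a * cnj a = of_real r1" "b * cnj b = of_real r2" "c * cnj c = of_real r3"
    by (simp_all only: r1_def r2_def r3_def v fst_conv snd_conv complex_norm_square)
  have P: "a * b * c = phase v" "cnj a * cnj b * cnj c = cnj (phase v)" by (simp_all add: phase_def v)
  have "(cmod (phase v))\<^sup>2 = r1 * r2 * r3"
    by (simp add: phase_def norm_mult power_mult_distrib r1_def r2_def r3_def)
  \<comment> \<open>With \<open>\<bar>P\<bar>\<^sup>2 = r1 * r2 * r3\<close> the real part of
    \<open>P\<^sup>2\<close> becomes a function of \<open>Re P\<close> and the amplitudes; the
    imaginary part of the phase leaves no other trace in the moments used.\<close>
  then have P2: "Re ((phase v)\<^sup>2 + (cnj (phase v))\<^sup>2) = 2 * (2 * (Re (phase v))\<^sup>2 - r1 * r2 * r3)"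
    unfolding cmod_power2 by (simp add: power2_eq_square)
  have n: "Suc 0 = 1" "Suc 1 = 2" "Suc 2 = 3" "Suc 3 = 4" "Suc 4 = 5" "Suc 5 = 6" by simp_all
  have st: "walk v (Suc l) m n = a * walk v l (m + 1) n + cnj a * walk v l (m - 1) n + b * walk v l m (n + 1)
     + cnj b * walk v l m (n - 1) + c * walk v l (m - 1) (n - 1) + cnj c * walk v l (m + 1) (n + 1)" for l m n
    by (simp add: v)
  note W = walk_count[of "walk v 0" "walk v 1" a "cnj a" b "cnj b" c "cnj c" "walk v 2" "walk v 3" "walk v 4" "walk v 5" "walk v 6",
    OF walk.simps(1) st[of 0, unfolded n] st[of 1, unfolded n] st[of 2, unfolded n] st[of 3, unfolded n] st[of 4, unfolded n] st[of 5, unfolded n],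
    unfolded r P]
  show "mom 2 v = V * (2 * (r1 + r2 + r3))" unfolding mom_walk W by simp
  show "mom 3 v = V * (12 * Re (phase v))" unfolding mom_walk W by simp
  show "mom 4 v = V * (6 * (r1 + r2 + r3)^2 + 12 * (r1 * r2 + r1 * r3 + r2 * r3))"
  proof -
    have "walk v 4 0 0 = of_real (6 * (r1 + r2 + r3)^2 + 12 * (r1 * r2 + r1 * r3 + r2 * r3))" unfolding W by simp
    then show ?thesis unfolding mom_walk by (simp only: Re_complex_of_real)
  qed
  show "mom 6 v = V * (20 * (r1^3 + r2^3 + r3^3) + 180 * (r1^2 * r2 + r1^2 * r3 + r2^2 * r1 + r2^2 * r3 + r3^2 * r1 + r3^2 * r2)
       + 720 * (r1 * r2 * r3) + 180 * (2 * (Re (phase v))\<^sup>2 - r1 * r2 * r3))"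
  proof -
    have "walk v 6 0 0 = of_real (20 * (r1^3 + r2^3 + r3^3) + 180 * (r1^2 * r2 + r1^2 * r3 + r2^2 * r1 + r2^2 * r3 + r3^2 * r1 + r3^2 * r2)
       + 720 * (r1 * r2 * r3)) + 90 * ((phase v)\<^sup>2 + (cnj (phase v))\<^sup>2)" unfolding W by simp
    then have "Re (walk v 6 0 0) = (20 * (r1^3 + r2^3 + r3^3) + 180 * (r1^2 * r2 + r1^2 * r3 + r2^2 * r1 + r2^2 * r3 + r3^2 * r1 + r3^2 * r2)
       + 720 * (r1 * r2 * r3)) + 90 * Re ((phase v)\<^sup>2 + (cnj (phase v))\<^sup>2)" by (simp only: plus_complex.sel Re_complex_of_real) simp
    then show ?thesis unfolding mom_walk P2 by simp
  qed
qed

definition same_moments where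
  "same_moments v w \<longleftrightarrow> mom 2 v = mom 2 w \<and> mom 3 v = mom 3 w \<and> mom 4 v = mom 4 w \<and> mom 6 v = mom 6 w"

text \<open>
  With \<open>r\<^sub>j = \<bar>v\<^sub>j\<bar>\<^sup>2\<close>, the second and fourth moments give the first two elementary symmetric functions of the
  \<open>r\<^sub>j\<close>, the third one gives \<open>Re (v\<^sub>1 v\<^sub>2 v\<^sub>3)\<close>, and then the sixth one gives \<open>r\<^sub>1 r\<^sub>2 r\<^sub>3 = \<bar>v\<^sub>1 v\<^sub>2 v\<^sub>3\<bar>\<^sup>2\<close>.
\<close>

lemma same_moments_invariants:
  assumes "same_moments v w"
  defines "S \<equiv> {(cmod (fst w))\<^sup>2, (cmod (fst (snd w)))\<^sup>2, (cmod (snd (snd w)))\<^sup>2}"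
  shows "amp v \<in> S \<times> S \<times> S" "phase v \<in> {phase w, cnj (phase w)}"
proof -
  define r1 r2 r3 where "r1 = (cmod (fst v))\<^sup>2" and "r2 = (cmod (fst (snd v)))\<^sup>2" and "r3 = (cmod (snd (snd v)))\<^sup>2"
  define s1 s2 s3 where "s1 = (cmod (fst w))\<^sup>2" and "s2 = (cmod (fst (snd w)))\<^sup>2" and "s3 = (cmod (snd (snd w)))\<^sup>2"
  note mv = moments[of v, folded r1_def r2_def r3_def] and mw = moments[of w, folded s1_def s2_def s3_def]
  have m2: "2 * (r1 + r2 + r3) = 2 * (s1 + s2 + s3)" and m3: "12 * Re (phase v) = 12 * Re (phase w)"
    and m4: "6 * (r1 + r2 + r3)^2 + 12 * (r1 * r2 + r1 * r3 + r2 * r3) = 6 * (s1 + s2 + s3)^2 + 12 * (s1 * s2 + s1 * s3 + s2 * s3)"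
    and m6: "20 * (r1^3 + r2^3 + r3^3) + 180 * (r1^2 * r2 + r1^2 * r3 + r2^2 * r1 + r2^2 * r3 + r3^2 * r1 + r3^2 * r2)
       + 720 * (r1 * r2 * r3) + 180 * (2 * (Re (phase v))\<^sup>2 - r1 * r2 * r3) = 20 * (s1^3 + s2^3 + s3^3) + 180 * (s1^2 * s2 + s1^2 * s3 + s2^2 * s1 + s2^2 * s3 + s3^2 * s1 + s3^2 * s2)
       + 720 * (s1 * s2 * s3) + 180 * (2 * (Re (phase w))\<^sup>2 - s1 * s2 * s3)"
    using assms(1) V_nz unfolding same_moments_def mv mw mult_cancel_left by blast+
  have e1: "r1 + r2 + r3 = s1 + s2 + s3" and c: "Re (phase v) = Re (phase w)" using m2 m3 by simp_all
  have e2: "r1 * r2 + r1 * r3 + r2 * r3 = s1 * s2 + s1 * s3 + s2 * s3" using m4 unfolding e1 by simp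
  \<comment> \<open>The sixth moment in terms of elementary symmetric functions. The coefficient 60
    of \<open>x * y * z\<close> does not vanish, so this moment determines the product once the
    other quantities are known.\<close>
  have newton: "20 * (x^3 + y^3 + z^3) + 180 * (x^2 * y + x^2 * z + y^2 * x + y^2 * z + z^2 * x + z^2 * y) + 720 * (x * y * z) + 180 * (2 * t\<^sup>2 - x * y * z)
     = 20 * (x + y + z)^3 + 120 * (x + y + z) * (x * y + x * z + y * z) + 60 * (x * y * z) + 360 * t\<^sup>2" for x y z t :: real
    by (simp add: power2_eq_square power3_eq_cube algebra_simps)
  have e3: "r1 * r2 * r3 = s1 * s2 * s3" using m6 unfolding newton e1 e2 c by simp
  have "r1 \<in> S" "r2 \<in> S" "r3 \<in> S"
    using cubic_root_cases[OF e1 e2 e3] unfolding S_def s1_def s2_def s3_def by auto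
  then show "amp v \<in> S \<times> S \<times> S" by (simp add: amp_def r1_def r2_def r3_def)
  have "(cmod (phase v))\<^sup>2 = r1 * r2 * r3" "(cmod (phase w))\<^sup>2 = s1 * s2 * s3"
    by (simp_all add: phase_def norm_mult power_mult_distrib r1_def r2_def r3_def s1_def s2_def s3_def)
  then have "(Im (phase v))\<^sup>2 = (Im (phase w))\<^sup>2" using e3 c unfolding cmod_power2 by simp
  then show "phase v \<in> {phase w, cnj (phase w)}" using c by (auto simp: complex_eq_iff power2_eq_iff)
qed

text \<open>Among the triples with the moments of \<open>w\<close> the invariants take finitely many
  values, hence so does their distance to those of \<open>w\<close>; its least positive value
  isolates the orbit.\<close>

lemma inv_dist_isolated:
  "\<exists>\<sigma>>0. \<forall>v. same_moments v w \<longrightarrow> inv_dist v w = 0 \<or> \<sigma> \<le> inv_dist v w"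
proof -
  let ?S = "{(cmod (fst w))\<^sup>2, (cmod (fst (snd w)))\<^sup>2, (cmod (snd (snd w)))\<^sup>2}"
  define D where "D = (\<lambda>(a, c). dist a (amp w) + dist c (phase w)) ` ((?S \<times> ?S \<times> ?S) \<times> {phase w, cnj (phase w)})"
  have fin: "finite D" unfolding D_def by (intro finite_imageI finite_cartesian_product) auto
  have mem: "inv_dist v w \<in> D" if "same_moments v w" for v
  proof -
    have "(amp v, phase v) \<in> (?S \<times> ?S \<times> ?S) \<times> {phase w, cnj (phase w)}"
      by (rule SigmaI[OF same_moments_invariants[OF that]])
    moreover have "inv_dist v w = (\<lambda>(a, c). dist a (amp w) + dist c (phase w)) (amp v, phase v)"
      by (simp add: inv_dist_def)
    ultimately show ?thesis unfolding D_def by (rule image_eqI[rotated])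
  qed
  \<comment> \<open>The 1 keeps the set nonempty in case no positive value occurs.\<close>
  define \<sigma> where "\<sigma> = Min (insert 1 {d \<in> D. d > 0})"
  have "\<sigma> > 0" using fin by (simp add: \<sigma>_def)
  moreover have "inv_dist v w = 0 \<or> \<sigma> \<le> inv_dist v w" if "same_moments v w" for v
  proof (cases "inv_dist v w > 0")
    case True
    then have "\<sigma> \<le> inv_dist v w" unfolding \<sigma>_def using fin mem[OF that] by (intro Min_le) auto
    then show ?thesis ..
  next
    case False
    then show ?thesis by (simp add: inv_dist_def add_nonneg_eq_0_iff not_less order.antisym)
  qed
  ultimately show ?thesis by blast
qed

definition rot :: "real^2 \<Rightarrow> complex \<times> complex \<times> complex \<Rightarrow> complex \<times> complex \<times> complex" where
  "rot q v = (fst v * cis (- (2 * pi * (k1 \<bullet> q))), fst (snd v) * cis (- (2 * pi * (k2 \<bullet> q))), snd (snd v) * cis (- (2 * pi * (k3 \<bullet> q))))"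

lemma tri_rot: "tri (rot q v) x = tri v (x - q)"
proof -
  have "wave c k (x - q) = wave (c * cis (- (2 * pi * (k \<bullet> q)))) k x" for c k
    using wave_shift[of c k x "- q"] by simp
  then show ?thesis by (simp add: tri_eq rot_def)
qed

lemma frame_solve: "\<exists>q. k1 \<bullet> q = \<alpha> \<and> k2 \<bullet> q = \<beta>"
proof -
  define q :: "real^2" where "q = vector [(\<alpha> * k2$2 - \<beta> * k1$2) / cross k1 k2, (\<beta> * k1$1 - \<alpha> * k2$1) / cross k1 k2]"
  have "cross k1 k2 * (k1 \<bullet> q) = cross k1 k2 * \<alpha>" "cross k1 k2 * (k2 \<bullet> q) = cross k1 k2 * \<beta>"
    using cross_nz by (simp_all add: q_def inner2 distrib_left) (simp_all add: cross_def algebra_simps)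
  then show ?thesis using cross_nz by auto
qed

text \<open>Equal amplitudes leave three phase shifts, and a translation realises exactly those with
  sum zero, because the three frequencies sum to zero. If no coefficient vanishes, equality of the
  products makes the sum a multiple of a full turn; the shift of a vanishing coefficient can be
  chosen at will.\<close>

lemma inv_dist_zero_orbit:
  assumes "inv_dist v w = 0" shows "\<exists>q. v = rot q w"
proof -
  have a: "amp v = amp w" and p: "phase v = phase w"
    using assms by (auto simp: inv_dist_def add_nonneg_eq_0_iff)
  have c: "cmod (fst v) = cmod (fst w)" "cmod (fst (snd v)) = cmod (fst (snd w))" "cmod (snd (snd v)) = cmod (snd (snd w))"
    using a by (auto simp: amp_def power2_eq_iff_nonneg)
  obtain \<alpha> \<beta> \<gamma> where s: "fst v = fst w * cis \<alpha>" "fst (snd v) = fst (snd w) * cis \<beta>" "snd (snd v) = snd (snd w) * cis \<gamma>"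
    using cis_phase[OF c(1)] cis_phase[OF c(2)] cis_phase[OF c(3)] by blast
  have "\<exists>\<alpha> \<beta>. fst v = fst w * cis \<alpha> \<and> fst (snd v) = fst (snd w) * cis \<beta> \<and> snd (snd v) = snd (snd w) * cis (- \<alpha> - \<beta>)"
  proof -
    consider "fst w = 0" | "fst (snd w) = 0" | "fst w \<noteq> 0" "fst (snd w) \<noteq> 0" by blast
    then show ?thesis
    proof cases
      case 1
      then show ?thesis using s by - (rule exI[of _ "- \<beta> - \<gamma>"], rule exI[of _ \<beta>], simp)
    next
      case 2
      then show ?thesis using s by - (rule exI[of _ \<alpha>], rule exI[of _ "- \<alpha> - \<gamma>"], simp)
    next
      case 3
      have "fst w * fst (snd w) * (cis (\<alpha> + \<beta>) * snd (snd v)) = fst w * fst (snd w) * snd (snd w)"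
        using p s by (simp add: phase_def cis_mult[symmetric] mult_ac)
      then have "cis (\<alpha> + \<beta>) * snd (snd v) = snd (snd w)" using 3 by simp
      then have "snd (snd w) * cis (- \<alpha> - \<beta>) = (cis (\<alpha> + \<beta>) * cis (- \<alpha> - \<beta>)) * snd (snd v)" by (simp add: mult_ac)
      also have "cis (\<alpha> + \<beta>) * cis (- \<alpha> - \<beta>) = 1" by (simp add: cis_mult)
      finally have "snd (snd w) * cis (- \<alpha> - \<beta>) = snd (snd v)" by simp
      then show ?thesis using s(1,2) by - (rule exI[of _ \<alpha>], rule exI[of _ \<beta>], simp)
    qed
  qed
  then obtain \<alpha> \<beta> where ab: "fst v = fst w * cis \<alpha>" "fst (snd v) = fst (snd w) * cis \<beta>" "snd (snd v) = snd (snd w) * cis (- \<alpha> - \<beta>)"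
    by blast
  obtain q where q: "k1 \<bullet> q = - \<alpha> / (2 * pi)" "k2 \<bullet> q = - \<beta> / (2 * pi)" using frame_solve by blast
  have "k3 \<bullet> q = - (k1 \<bullet> q + k2 \<bullet> q)" unfolding k3_def by (simp only: inner_minus_left inner_add_left)
  then have q3: "2 * pi * (k3 \<bullet> q) = \<alpha> + \<beta>" unfolding q by (simp add: field_simps)
  have q12: "2 * pi * (k1 \<bullet> q) = - \<alpha>" "2 * pi * (k2 \<bullet> q) = - \<beta>" using q by simp_all
  have "- (\<alpha> + \<beta>) = - \<alpha> - \<beta>" by simp
  then have "v = rot q w" unfolding rot_def q12 q3 using ab by (simp add: prod_eq_iff)
  then show ?thesis ..
qed

lemma continuous_inv_dist: "continuous_on UNIV (\<lambda>v. inv_dist v w)"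
  unfolding inv_dist_def amp_def phase_def by (intro continuous_intros)

end

section \<open>Rearrangements and the spectral gap\<close>

lemma abs_power_diff_le:
  fixes a b B :: real
  assumes "\<bar>a\<bar> \<le> B" "\<bar>b\<bar> \<le> B"
  shows "\<bar>a ^ m - b ^ m\<bar> \<le> real m * B ^ (m - 1) * \<bar>a - b\<bar>"
proof (induction m)
  case (Suc m)
  have B: "B \<ge> 0" using assms(1) by linarith
  have "a ^ Suc m - b ^ Suc m = a * (a ^ m - b ^ m) + (a - b) * b ^ m" by (simp add: algebra_simps)
  also have "\<bar>\<dots>\<bar> \<le> \<bar>a\<bar> * \<bar>a ^ m - b ^ m\<bar> + \<bar>a - b\<bar> * \<bar>b\<bar> ^ m"
    by (rule order.trans[OF abs_triangle_ineq]) (simp add: abs_mult power_abs)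
  also have "\<dots> \<le> B * (real m * B ^ (m - 1) * \<bar>a - b\<bar>) + \<bar>a - b\<bar> * B ^ m"
    using assms B by (intro add_mono mult_mono Suc.IH power_mono mult_left_mono) auto
  also have "\<dots> = real (Suc m) * B ^ (Suc m - 1) * \<bar>a - b\<bar>"
    by (cases m) (simp_all add: algebra_simps)
  finally show ?case .
qed simp

context lattice2
begin

lemma integral_power_diff:
  assumes f: "f \<in> borel_measurable T" "\<And>x. x \<in> cell \<Longrightarrow> \<bar>f x\<bar> \<le> B"
    and g: "g \<in> borel_measurable T" "\<And>x. x \<in> cell \<Longrightarrow> \<bar>g x\<bar> \<le> B"
  shows "\<bar>(\<integral>x. f x ^ m \<partial>T) - (\<integral>x. g x ^ m \<partial>T)\<bar> \<le> real m * B ^ (m - 1) * (\<integral>x. \<bar>f x - g x\<bar> \<partial>T)"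
proof -
  note [measurable] = f(1) g(1)
  have ip: "integrable T (\<lambda>x. h x ^ m)" if [measurable]: "h \<in> borel_measurable T" and h: "\<And>x. x \<in> cell \<Longrightarrow> \<bar>h x\<bar> \<le> B" for h
    by (rule integrable_bounded_T[of _ "B ^ m"]) (use h in \<open>auto simp: power_abs intro: power_mono\<close>)
  have i1: "integrable T f" by (rule integrable_bounded_T[OF f])
  have i2: "integrable T g" by (rule integrable_bounded_T[OF g])
  have f1: "integrable T (\<lambda>x. f x ^ m)" by (rule ip[OF f])
  have g1: "integrable T (\<lambda>x. g x ^ m)" by (rule ip[OF g])
  note i = i1 i2 and fg = f1 g1
  have "(\<integral>x. f x ^ m \<partial>T) - (\<integral>x. g x ^ m \<partial>T) = (\<integral>x. f x ^ m - g x ^ m \<partial>T)" using fg by simp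
  also have "\<bar>\<dots>\<bar> \<le> (\<integral>x. \<bar>f x ^ m - g x ^ m\<bar> \<partial>T)" by (rule integral_abs_bound)
  also have "\<dots> \<le> (\<integral>x. real m * B ^ (m - 1) * \<bar>f x - g x\<bar> \<partial>T)"
    using fg i by (intro integral_mono abs_power_diff_le f g) auto
  finally show ?thesis by simp
qed

lemma integral_power_tendsto:
  fixes f g :: "nat \<Rightarrow> real^2 \<Rightarrow> real"
  assumes f: "\<And>n. f n \<in> borel_measurable T" "\<And>n x. x \<in> cell \<Longrightarrow> \<bar>f n x\<bar> \<le> B"
    and g: "\<And>n. g n \<in> borel_measurable T" "\<And>n x. x \<in> cell \<Longrightarrow> \<bar>g n x\<bar> \<le> B"
    and l: "(\<lambda>n. \<integral>x. \<bar>f n x - g n x\<bar> \<partial>T) \<longlonglongrightarrow> 0"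
  shows "(\<lambda>n. (\<integral>x. f n x ^ m \<partial>T) - (\<integral>x. g n x ^ m \<partial>T)) \<longlonglongrightarrow> 0"
proof (rule Lim_null_comparison[OF always_eventually tendsto_mult_right_zero[OF l, of "real m * B ^ (m - 1)"]], rule allI)
  fix n
  show "norm ((\<integral>x. f n x ^ m \<partial>T) - (\<integral>x. g n x ^ m \<partial>T)) \<le> real m * B ^ (m - 1) * (\<integral>x. \<bar>f n x - g n x\<bar> \<partial>T)"
    unfolding real_norm_def by (rule integral_power_diff[OF f g])
qed

text \<open>Completeness of Lebesgue measure. It gives measurability of a translate of \<omega>,
  which is known only to agree almost everywhere with a continuous function.\<close>

lemma meas_spike:
  assumes f: "f \<in> borel_measurable T" and Y: "negligible Y" "\<And>x. x \<in> cell \<Longrightarrow> x \<notin> Y \<Longrightarrow> f x = (g x :: real)"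
  shows "g \<in> borel_measurable T"
proof -
  have "(\<lambda>x. if x \<in> cell then f x else 0) measurable_on UNIV"
    using f unfolding torus_def measurable_on_UNIV by (subst measurable_on_iff_borel_measurable) auto
  then have "(\<lambda>x. if x \<in> cell then g x else 0) measurable_on UNIV"
    by (rule measurable_on_spike[OF _ Y(1)]) (use Y(2) in auto)
  then show ?thesis unfolding torus_def measurable_on_UNIV by (subst (asm) measurable_on_iff_borel_measurable) auto
qed

lemma lattice_countable: "countable (period_lattice \<xi> \<eta>)"
proof -
  have "period_lattice \<xi> \<eta> = (\<lambda>(m, n). of_int m *\<^sub>R \<xi> + of_int n *\<^sub>R \<eta>) ` (UNIV :: (int \<times> int) set)"
    by (auto simp: period_lattice_def)
  then show ?thesis by simp
qed

text \<open>A statement almost everywhere on the cell says nothing directly about a shifted cell. By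
  periodicity the exceptional set is contained in countably many lattice translates of a negligible
  set, and this union may be shifted by \<open>q\<close>.\<close>

lemma AE_translate:
  fixes f g :: "real^2 \<Rightarrow> real"
  assumes per: "per f" "per g" and ae: "AE x in T. f x = g x"
  shows "\<exists>Z. negligible Z \<and> (\<forall>x. x \<notin> Z \<longrightarrow> f (x - q) = g (x - q))"
proof -
  let ?Y = "{x \<in> cell. f x \<noteq> g x}"
  define Z where "Z = (\<Union>v\<in>period_lattice \<xi> \<eta>. (+) (v + q) ` ?Y)"
  have "negligible ?Y" using AE_T_D[OF ae] by simp
  then have "negligible Z"
    unfolding Z_def using lattice_countable by (intro negligible_countable_Union) (auto intro: negligible_translation)
  moreover have "f (x - q) = g (x - q)" if "x \<notin> Z" for x
  proof (rule ccontr)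
    assume ne: "f (x - q) \<noteq> g (x - q)"
    define y where "y = red (x - q)"
    have "y \<in> ?Y" using ne per_red[OF per(1)] per_red[OF per(2)] by (simp add: y_def red_cell)
    moreover have "x = (((x - q) - y) + q) + y" by simp
    moreover have "(x - q) - y \<in> period_lattice \<xi> \<eta>" unfolding y_def by (rule red_diff)
    ultimately have "x \<in> Z" unfolding Z_def by blast
    then show False using that by simp
  qed
  ultimately show ?thesis by blast
qed

text \<open>Upper half-lines are closed under intersection and generate the Borel sets, so agreement
  of the distribution functions is agreement of the image measures. Every integral of a function of
  the values is then conserved.\<close>

lemma rearrangement_distr:
  assumes f: "f \<in> borel_measurable T" and g: "g \<in> rearrangements \<xi> \<eta> f"
  shows "distr T borel g = distr T borel f"
proof (rule measure_eqI_generator_eq[where \<Omega> = UNIV and E = "range greaterThan" and A = "\<lambda>i. {- real i<..}"])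
  have gm: "g \<in> borel_measurable T" using g by (simp add: rearrangements_def torus_measurable_def)
  note [measurable] = f gm
  show "Int_stable (range greaterThan :: real set set)"
  proof (rule Int_stableI)
    fix X Y :: "real set" assume "X \<in> range greaterThan" "Y \<in> range greaterThan"
    then obtain a b where "X = {a<..}" "Y = {b<..}" by blast
    then have "X \<inter> Y = {max a b<..}" by auto
    then show "X \<inter> Y \<in> range greaterThan" by blast
  qed
  show "emeasure (distr T borel g) X = emeasure (distr T borel f) X" if X: "X \<in> range greaterThan" for X
  proof -
    obtain s where s: "X = {s<..}" using X by auto
    have "measure T {x \<in> space T. g x > s} = measure T {x \<in> space T. f x > s}"
      using g unfolding rearrangements_def by blast
    then have "emeasure T {x \<in> space T. g x > s} = emeasure T {x \<in> space T. f x > s}"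
      by (simp only: T.emeasure_eq_measure)
    moreover have "g -` {s<..} \<inter> space T = {x \<in> space T. g x > s}" "f -` {s<..} \<inter> space T = {x \<in> space T. f x > s}" by auto
    ultimately show ?thesis unfolding s by (subst (1 2) emeasure_distr) (use f gm in \<open>simp_all del: space_T\<close>)
  qed
  show "sets (distr T borel g) = sigma_sets UNIV (range greaterThan)" "sets (distr T borel f) = sigma_sets UNIV (range greaterThan)"
    by (simp_all add: borel_Ioi)
  show "(\<Union>i. {- real i<..}) = UNIV"
  proof -
    have "\<exists>i. - real i < x" for x using reals_Archimedean2[of "- x"] by (metis minus_less_iff)
    then show ?thesis by auto
  qed
  show "emeasure (distr T borel g) {- real i<..} \<noteq> \<infinity>" for i
    using gm by (subst emeasure_distr) (auto simp: T.emeasure_eq_measure)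
qed auto

lemma rearrangement_integral:
  fixes \<phi> :: "real \<Rightarrow> real"
  assumes f: "f \<in> borel_measurable T" and g: "g \<in> rearrangements \<xi> \<eta> f" and \<phi>: "\<phi> \<in> borel_measurable borel"
  shows "(\<integral>x. \<phi> (g x) \<partial>T) = (\<integral>x. \<phi> (f x) \<partial>T)"
proof -
  have gm: "g \<in> borel_measurable T" using g by (simp add: rearrangements_def torus_measurable_def)
  have "(\<integral>x. \<phi> (g x) \<partial>T) = (\<integral>y. \<phi> y \<partial>distr T borel g)" using gm \<phi> by (subst integral_distr) auto
  also have "\<dots> = (\<integral>x. \<phi> (f x) \<partial>T)" unfolding rearrangement_distr[OF f g] using f \<phi> by (subst integral_distr) auto
  finally show ?thesis .
qed

lemma tp0_dense_bounded:
  assumes h: "h \<in> borel_measurable T" "\<And>x. x \<in> cell \<Longrightarrow> \<bar>h x\<bar> \<le> M" and z: "(\<integral>x. h x \<partial>T) = 0"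
  obtains A c where "\<And>n::nat. tp0 (A n) (c n)" "\<And>n x. \<bar>tp (A n) (c n) x\<bar> \<le> 2 * (M + 1)"
    "(\<lambda>n. \<integral>x. \<bar>tp (A n) (c n) x - h x\<bar> \<partial>T) \<longlonglongrightarrow> 0"
proof -
  obtain \<phi> where \<phi>: "\<And>n. \<phi> n \<in> trig" "\<And>n x. \<bar>\<phi> n x\<bar> \<le> M + 1" "AE x in T. (\<lambda>n. \<phi> n x) \<longlonglongrightarrow> h x"
    by (rule bounded_trig_approx[OF h], assumption, rule that)
  have hi: "integrable T h" by (rule integrable_bounded_T[OF h])
  have pc: "continuous_on UNIV (\<phi> n)" for n using trig_cont[OF \<phi>(1)] .
  note [measurable] = h(1) cont_measurable_T[OF pc]
  have M0: "M \<ge> 0" using h(2)[OF red_cell[of 0]] by linarith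
  have "(\<lambda>n. N 1 (\<lambda>x. \<phi> n x - h x)) \<longlonglongrightarrow> 0"
  proof (rule AE_tendsto_N[where g = "\<lambda>x. 2 * M + 1"])
    show "AE x in T. \<bar>\<phi> n x - h x\<bar> \<le> \<bar>2 * M + 1\<bar>" for n
    proof (rule AE_I2)
      fix x assume "x \<in> space T"
      then show "\<bar>\<phi> n x - h x\<bar> \<le> \<bar>2 * M + 1\<bar>" using \<phi>(2)[of n x] h(2)[of x] M0 by simp
    qed
    show "AE x in T. (\<lambda>n. \<phi> n x - h x) \<longlonglongrightarrow> 0"
      using \<phi>(3) by eventually_elim (simp add: LIM_zero)
  qed (auto intro: mLp_cont)
  then have l1: "(\<lambda>n. \<integral>x. \<bar>\<phi> n x - h x\<bar> \<partial>T) \<longlonglongrightarrow> 0" by (simp add: N_def)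
  define r where "r n = (\<integral>x. \<phi> n x \<partial>T) / V" for n
  have "\<forall>n. \<exists>A c. tp0 A c \<and> (\<forall>x. \<phi> n x = tp A c x + r n)"
    unfolding r_def using tp0_strip[OF \<phi>(1)] by blast
  then obtain A c where A: "\<And>n. tp0 (A n) (c n)" "\<And>n x. \<phi> n x = tp (A n) (c n) x + r n" by metis
  have "r \<longlonglongrightarrow> 0" unfolding r_def
    by (rule mean_approx[OF integrable_cont[OF pc] hi z]) (use l1 in \<open>simp add: abs_minus_commute\<close>)
  then have "(\<lambda>n. \<bar>r n\<bar> * V) \<longlonglongrightarrow> 0" by (intro tendsto_mult_left_zero tendsto_rabs_zero)
  from tendsto_add[OF l1 this] have l2: "(\<lambda>n. (\<integral>x. \<bar>\<phi> n x - h x\<bar> \<partial>T) + \<bar>r n\<bar> * V) \<longlonglongrightarrow> 0" by simp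
  have "(\<lambda>n. \<integral>x. \<bar>tp (A n) (c n) x - h x\<bar> \<partial>T) \<longlonglongrightarrow> 0"
  proof (rule Lim_null_comparison[OF always_eventually l2], rule allI)
    fix n
    have "(\<integral>x. \<bar>tp (A n) (c n) x - h x\<bar> \<partial>T) \<le> (\<integral>x. \<bar>\<phi> n x - h x\<bar> + \<bar>r n\<bar> \<partial>T)"
      using hi integrable_cont[OF pc, of n] integrable_cont[OF continuous_tp, of "A n" "c n"] A(2)[of n]
      by (intro integral_mono) auto
    also have "\<dots> = (\<integral>x. \<bar>\<phi> n x - h x\<bar> \<partial>T) + \<bar>r n\<bar> * V"
      using hi integrable_cont[OF pc, of n] by (simp add: V_def)
    finally show "norm (\<integral>x. \<bar>tp (A n) (c n) x - h x\<bar> \<partial>T) \<le> (\<integral>x. \<bar>\<phi> n x - h x\<bar> \<partial>T) + \<bar>r n\<bar> * V"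
      by (simp add: integral_nonneg_AE)
  qed
  \<comment> \<open>Removing the mean, itself at most \<open>M + 1\<close> in absolute value, at
    most doubles the bound.\<close>
  moreover have "\<bar>tp (A n) (c n) x\<bar> \<le> 2 * (M + 1)" for n x
  proof -
    have "\<bar>\<integral>x. \<phi> n x \<partial>T\<bar> \<le> (M + 1) * V" by (rule abs_integral_le_bound[OF integrable_cont[OF pc] \<phi>(2)])
    then have "\<bar>r n\<bar> \<le> M + 1" using V_pos by (simp add: r_def divide_le_eq)
    then show ?thesis using \<phi>(2)[of n x] A(2)[of n x] by simp
  qed
  ultimately show ?thesis using that A(1) by blast
qed

end

context lattice_frame
begin

text \<open>The gap inequality for polynomials, carried over to bounded functions by approximation
  with a uniform bound, under which squares and energies converge. The factor 2 comes from the
  parallelogram-type inequality \<open>ptw\<close>. The triple \<open>v\<close> belongs to one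
  sufficiently good approximant, which explains the slack \<delta>.\<close>

lemma gap_bounded:
  assumes p: "1 < p" and k0: "\<kappa> > 0" and \<kappa>: "\<And>k. k \<in> dl - {0} \<Longrightarrow> k \<notin> shell \<Longrightarrow> \<kappa> \<le> 1 / lam1 - 1 / lam k"
    and h: "h \<in> borel_measurable T" "\<And>x. x \<in> cell \<Longrightarrow> \<bar>h x\<bar> \<le> M" and z: "(\<integral>x. h x \<partial>T) = 0" and d: "\<delta> > 0"
  shows "\<exists>v. (\<integral>x. (h x - tri v x)\<^sup>2 \<partial>T) \<le> 2 / \<kappa> * ((\<integral>x. (h x)\<^sup>2 \<partial>T) / lam1 - 2 * energy \<xi> \<eta> p h) + \<delta>"
proof -
  have p1: "1 \<le> p" using p by simp
  have M0: "M \<ge> 0" using h(2)[OF red_cell[of 0]] by linarith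
  obtain A c where A: "\<And>n::nat. tp0 (A n) (c n)" and b: "\<And>n x. \<bar>tp (A n) (c n) x\<bar> \<le> 2 * (M + 1)"
    and l: "(\<lambda>n. \<integral>x. \<bar>tp (A n) (c n) x - h x\<bar> \<partial>T) \<longlonglongrightarrow> 0"
    by (rule tp0_dense_bounded[OF h z], assumption, rule that)
  let ?f = "\<lambda>n. tp (A n) (c n)"
  have hb: "\<bar>h x\<bar> \<le> 2 * (M + 1)" if "x \<in> cell" for x
    by (rule order.trans[OF h(2)[OF that]]) (use M0 in simp)
  have fm: "?f n \<in> borel_measurable T" for n by (intro cont_measurable_T continuous_tp)
  note [measurable] = h(1) fm
  have hL: "h \<in> mLp p" using h p by (intro mLp_bounded) auto
  have fL: "?f n \<in> mLp p" for n using p by (intro tp_mLp) auto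
  have hi: "integrable T h" by (rule integrable_bounded_T[OF h])
  have fz: "(\<integral>x. ?f n x \<partial>T) = 0" for n using A[of n] by (simp add: tp0_def integral_tp)
  have sq: "(\<lambda>n. \<integral>x. (?f n x)\<^sup>2 \<partial>T) \<longlonglongrightarrow> (\<integral>x. (h x)\<^sup>2 \<partial>T)"
    using integral_power_tendsto[where f = ?f and g = "\<lambda>_. h" and m = 2, OF fm b h(1) hb l] by (simp add: LIM_zero_iff)
  have en: "(\<lambda>n. energy \<xi> \<eta> p (?f n)) \<longlonglongrightarrow> energy \<xi> \<eta> p h"
  proof -
    obtain C where C: "C > 0" "\<And>f g. f \<in> mLp p \<Longrightarrow> (\<integral>x. f x \<partial>T) = 0 \<Longrightarrow> g \<in> mLp p \<Longrightarrow> (\<integral>x. g x \<partial>T) = 0 \<Longrightarrow>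
      \<bar>energy \<xi> \<eta> p f - energy \<xi> \<eta> p g\<bar> \<le> C * (2 + N p f + N p g) * (\<integral>x. \<bar>f x - g x\<bar> \<partial>T)"
      using energy_lipschitz[OF p] by blast
    let ?K = "C * (2 + N p (\<lambda>x. 2 * (M + 1)) + N p h)"
    have "(\<lambda>n. energy \<xi> \<eta> p (?f n) - energy \<xi> \<eta> p h) \<longlonglongrightarrow> 0"
    proof (rule Lim_null_comparison[OF always_eventually tendsto_mult_right_zero[OF l, of ?K]], rule allI)
      fix n
      have Nf: "N p (?f n) \<le> N p (\<lambda>x. 2 * (M + 1))"
        using p by (intro N_mono fm mLp_cont continuous_on_const AE_I2 order.trans[OF b abs_ge_self]) auto
      have "C * (2 + N p (?f n) + N p h) * (\<integral>x. \<bar>?f n x - h x\<bar> \<partial>T) \<le> ?K * (\<integral>x. \<bar>?f n x - h x\<bar> \<partial>T)"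
        using C(1) Nf by (intro mult_right_mono mult_left_mono integral_nonneg_AE) auto
      then show "norm (energy \<xi> \<eta> p (?f n) - energy \<xi> \<eta> p h) \<le> ?K * (\<integral>x. \<bar>?f n x - h x\<bar> \<partial>T)"
        using C(2)[OF fL fz hL z, of n] by simp
    qed
    then show ?thesis by (simp add: LIM_zero_iff)
  qed
  have d2: "(\<lambda>n. \<integral>x. (?f n x - h x)\<^sup>2 \<partial>T) \<longlonglongrightarrow> 0"
  proof -
    have "(\<lambda>n. N 2 (\<lambda>x. ?f n x - h x)) \<longlonglongrightarrow> 0"
    proof (rule L1_tendsto_N[OF _ _ _ l])
      show "\<bar>?f n x - h x\<bar> \<le> 4 * (M + 1)" if "x \<in> cell" for n x using b[of n x] hb[OF that] by linarith
    qed auto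
    then show ?thesis by (simp add: N_def)
  qed
  let ?R = "2 / \<kappa> * ((\<integral>x. (h x)\<^sup>2 \<partial>T) / lam1 - 2 * energy \<xi> \<eta> p h)"
  let ?S = "\<lambda>n. 2 * (\<integral>x. (?f n x - h x)\<^sup>2 \<partial>T) + 2 / \<kappa> * ((\<integral>x. (?f n x)\<^sup>2 \<partial>T) / lam1 - 2 * energy \<xi> \<eta> p (?f n))"
  have "?S \<longlonglongrightarrow> 2 * 0 + ?R" by (intro tendsto_intros d2 sq en) (use lam1_pos in auto)
  then have "?S \<longlonglongrightarrow> ?R" by simp
  then have "eventually (\<lambda>n. ?S n < ?R + \<delta>) sequentially" using d by (intro order_tendstoD(2)) auto
  then obtain n where n: "?S n < ?R + \<delta>" by (auto dest: eventually_happens)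
  have "finite (A n)" using A[of n] by (simp add: tp0_def)
  from shell_part_tri[OF this, of "c n"] obtain v where v: "tp (A n \<inter> shell) (c n) = tri v" by blast
  have g: "\<kappa> * (\<integral>x. (?f n x - tri v x)\<^sup>2 \<partial>T) \<le> (\<integral>x. (?f n x)\<^sup>2 \<partial>T) / lam1 - 2 * energy \<xi> \<eta> p (?f n)"
    using gap_tp0[OF p \<kappa> A[of n]] unfolding v .
  have i2: "integrable T (\<lambda>x. (?f n x - h x)\<^sup>2)"
  proof (rule integrable_bounded_T[of _ "(4 * (M + 1))\<^sup>2"])
    fix x assume "x \<in> cell"
    then have "\<bar>?f n x - h x\<bar> \<le> 4 * (M + 1)" using b[of n x] hb[of x] by linarith
    then show "\<bar>(?f n x - h x)\<^sup>2\<bar> \<le> (4 * (M + 1))\<^sup>2" using power_mono[of "\<bar>?f n x - h x\<bar>" _ 2] by simp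
  qed measurable
  have i3: "integrable T (\<lambda>x. (?f n x - tri v x)\<^sup>2)" by (intro integrable_cont continuous_intros)
  have tm: "tri v \<in> borel_measurable T" by (intro cont_measurable_T continuous_tri)
  have ptw: "(h x - tri v x)\<^sup>2 \<le> 2 * (?f n x - h x)\<^sup>2 + 2 * (?f n x - tri v x)\<^sup>2" for x
  proof -
    have "2 * (?f n x - h x)\<^sup>2 + 2 * (?f n x - tri v x)\<^sup>2 - (h x - tri v x)\<^sup>2 = (2 * ?f n x - h x - tri v x)\<^sup>2"
      by (simp add: power2_eq_square algebra_simps)
    then show ?thesis by (metis diff_ge_0_iff_ge zero_le_power2)
  qed
  have i5: "integrable T (\<lambda>x. 2 * (?f n x - h x)\<^sup>2 + 2 * (?f n x - tri v x)\<^sup>2)" using i2 i3 by simp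
  have i4: "integrable T (\<lambda>x. (h x - tri v x)\<^sup>2)"
    by (rule Bochner_Integration.integrable_bound[OF i5])
      (use tm in \<open>measurable\<close>, simp add: ptw)
  have "(\<integral>x. (h x - tri v x)\<^sup>2 \<partial>T) \<le> (\<integral>x. 2 * (?f n x - h x)\<^sup>2 + 2 * (?f n x - tri v x)\<^sup>2 \<partial>T)"
    by (rule integral_mono[OF i4 i5 ptw])
  also have "\<dots> = 2 * (\<integral>x. (?f n x - h x)\<^sup>2 \<partial>T) + 2 / \<kappa> * (\<kappa> * (\<integral>x. (?f n x - tri v x)\<^sup>2 \<partial>T))"
    using i2 i3 k0 by simp
  also have "\<dots> \<le> ?S n" using g k0 by (intro add_left_mono mult_left_mono) auto
  finally show ?thesis using n by (intro exI[of _ v]) linarith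
qed

lemma tri_diff: "tri v x - tri w x = tri (v - w) x"
proof -
  have "wave (a - b) k x = wave a k x - wave b k x" for a b k by (simp add: wave_def algebra_simps)
  then show ?thesis by (simp add: tri_eq)
qed

lemma abs_tri_le: "\<bar>tri v x\<bar> \<le> 6 * norm v"
proof -
  have "cmod (fst v) \<le> norm v" "cmod (fst (snd v)) \<le> norm v" "cmod (snd (snd v)) \<le> norm v"
    using norm_fst_le[of "fst v" "snd v"] norm_snd_le[of "snd v" "fst v"] norm_fst_le[of "fst (snd v)" "snd (snd v)"] norm_snd_le[of "snd (snd v)" "fst (snd v)"]
    by simp_all
  then have b: "\<bar>wave (fst v) k1 x\<bar> \<le> norm v" "\<bar>wave (fst (snd v)) k2 x\<bar> \<le> norm v" "\<bar>wave (snd (snd v)) k3 x\<bar> \<le> norm v"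
    by (auto intro: order.trans[OF abs_wave_le])
  have "\<bar>wave (fst v) k1 x + wave (fst (snd v)) k2 x + wave (snd (snd v)) k3 x\<bar> \<le> norm v + norm v + norm v"
    by (intro order.trans[OF abs_triangle_ineq] add_mono b)
  then show ?thesis by (simp add: tri_eq abs_mult)
qed

lemma coef_diff: "integrable T g \<Longrightarrow> integrable T h \<Longrightarrow> coef (\<lambda>x. g x - h x) = coef g - coef h"
  by (simp add: coef_def cf_diff)

lemma norm_coef_le: assumes "integrable T h" shows "norm (coef h) \<le> 6 / V * (\<integral>x. \<bar>h x\<bar> \<partial>T)"
proof -
  have "norm (coef h) \<le> cmod (cf k1 h) + (cmod (cf k2 h) + cmod (cf k3 h))"
    unfolding coef_def by (intro order.trans[OF norm_Pair_le] add_left_mono norm_Pair_le)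
  also have "\<dots> \<le> 2 / V * (\<integral>x. \<bar>h x\<bar> \<partial>T) + (2 / V * (\<integral>x. \<bar>h x\<bar> \<partial>T) + 2 / V * (\<integral>x. \<bar>h x\<bar> \<partial>T))"
    by (intro add_mono cf_norm_le assms)
  finally show ?thesis by (simp add: field_simps)
qed

lemma coef_shift: assumes "integrable T h" shows "coef (\<lambda>x. h x - r) = coef h"
proof -
  have "cf k (\<lambda>x. r) = 0" if "k \<in> dl" "k \<noteq> 0" for k
    using integral_wave[OF that(1)] that(2) by (simp add: cf_def complex_eq_iff)
  then have "coef (\<lambda>x. r) = 0" using k1_dl k2_dl k3_dl frame_distinct by (simp add: coef_def zero_prod_def)
  moreover have "coef (\<lambda>x. h x - r) = coef h - coef (\<lambda>x. r)" by (rule coef_diff[OF assms]) simp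
  ultimately show ?thesis by simp
qed

lemma continuous_mom: "continuous_on UNIV (mom l)"
proof -
  have "continuous_on UNIV (\<lambda>v. walk v l m n)" for m n
  proof (induction l arbitrary: m n)
    case (Suc l)
    show ?case unfolding walk.simps by (intro continuous_intros Suc.IH)
  qed simp
  then show ?thesis unfolding mom_walk[abs_def] by (intro continuous_intros)
qed

lemma tri_mean_zero: "(\<integral>x. tri v x \<partial>T) = 0"
  using tri_tp0[of v] by (simp add: tri_def tp0_def integral_tp)

text \<open>
  The energy is continuous in \<open>Lp\<close> and truncation does not increase the distance to \<open>tri w\<close>. Hence
  \<open>\<parallel>h n\<parallel>\<^sup>2 / lam1 - 2 E (h n)\<close> tends to zero, which is its value at \<open>tri w\<close>, and the spectral gap
  forces \<open>h n\<close> towards the first eigenspace.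
\<close>

lemma rearrangement_limit:
  fixes f g :: "nat \<Rightarrow> real^2 \<Rightarrow> real"
  assumes p: "1 < p" and w: "supp w" and M: "\<And>x. \<bar>tri w x\<bar> \<le> M"
    and f: "\<And>n. f n \<in> mLp p" "\<And>n. (\<integral>x. f n x \<partial>T) = 0"
    and g: "\<And>n. g n \<in> mLp p" "\<And>n. (\<integral>x. g n x \<partial>T) = 0"
    and re: "\<And>n. g n \<in> rearrangements \<xi> \<eta> (f n)"
    and en: "\<And>n. energy \<xi> \<eta> p (g n) = energy \<xi> \<eta> p (f n)"
    and lim: "(\<lambda>n. N p (\<lambda>x. f n x - tri w x)) \<longlonglongrightarrow> 0"
  defines "h \<equiv> \<lambda>n x. clamp_abs M (g n x)"
  shows "(\<lambda>n. N p (\<lambda>x. g n x - h n x)) \<longlonglongrightarrow> 0"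
    "(\<lambda>n. \<integral>x. \<bar>h n x - tri (coef (h n)) x\<bar> \<partial>T) \<longlonglongrightarrow> 0"
    "(\<lambda>n. mom l (coef (h n))) \<longlonglongrightarrow> mom l w"
proof -
  have p1: "1 \<le> p" and p0: "0 \<le> p" using p by auto
  have M0: "M \<ge> 0" using M[of 0] by linarith
  define c where "c n x = clamp_abs M (f n x)" for n x
  note fm [measurable] = mLp_measurable[OF f(1)] and gm [measurable] = mLp_measurable[OF g(1)]
  have tc: "continuous_on UNIV (tri v)" for v by (rule continuous_tri)
  note tm [measurable] = cont_measurable_T[OF tc]
  have ti: "integrable T (tri v)" for v using tc by (rule integrable_cont)
  have tL: "tri v \<in> mLp p" for v using tc p0 by (rule mLp_cont)
  have hm [measurable]: "h n \<in> borel_measurable T" and cm [measurable]: "c n \<in> borel_measurable T" for n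
    unfolding h_def c_def by measurable
  have hb: "\<bar>h n x\<bar> \<le> M" and cb: "\<bar>c n x\<bar> \<le> M" for n x unfolding h_def c_def by (intro clamp_abs_bound M0)+
  have hi: "integrable T (h n)" for n by (rule integrable_bounded_T[OF hm hb])
  have ci: "integrable T (c n)" for n by (rule integrable_bounded_T[OF cm cb])
  have fi: "integrable T (f n)" "integrable T (g n)" for n using mLp_L1(1)[OF f(1) p1] mLp_L1(1)[OF g(1) p1] .
  have hL: "h n \<in> mLp p" for n by (rule mLp_bounded[OF hm hb p0])
  have dL: "(\<lambda>x. f n x - tri w x) \<in> mLp p" for n by (intro mLp_diff f tL p0)
  have same: "(\<integral>x. \<phi> (g n x) \<partial>T) = (\<integral>x. \<phi> (f n x) \<partial>T)" if "\<phi> \<in> borel_measurable borel" for \<phi> :: "real \<Rightarrow> real" and n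
    by (rule rearrangement_integral[OF fm re that])
  \<comment> \<open>The removed part is a function of the value alone, so it has the same
    distribution for \<open>g n\<close> as for \<open>f n\<close>, where closeness to
    \<open>tri w\<close> is known.\<close>
  have tail: "N p (\<lambda>x. g n x - h n x) = N p (\<lambda>x. f n x - c n x)" for n
    unfolding N_def h_def c_def by (rule same[of "\<lambda>y. \<bar>y - clamp_abs M y\<bar> powr p"]) measurable
  \<comment> \<open>\<open>tri w\<close> takes its values in \<open>[- M, M]\<close>, and truncation
    projects onto this interval; hence the removed part is no larger than the distance to
    \<open>tri w\<close>.\<close>
  have tail_le: "N p (\<lambda>x. f n x - c n x) \<le> N p (\<lambda>x. f n x - tri w x)" for n
    unfolding c_def by (intro N_mono dL AE_I2 clamp_abs_dist M p0) measurable
  show tl: "(\<lambda>n. N p (\<lambda>x. g n x - h n x)) \<longlonglongrightarrow> 0"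
    by (rule Lim_null_comparison[OF always_eventually lim]) (use tail tail_le in simp)
  have fl: "(\<lambda>n. \<integral>x. \<bar>f n x - tri w x\<bar> \<partial>T) \<longlonglongrightarrow> 0" by (rule N_tendsto_L1[OF dL p1 lim])
  have cl: "(\<lambda>n. \<integral>x. \<bar>c n x - tri w x\<bar> \<partial>T) \<longlonglongrightarrow> 0"
  proof (rule Lim_null_comparison[OF always_eventually fl], rule allI)
    fix n
    have "(\<integral>x. \<bar>c n x - tri w x\<bar> \<partial>T) \<le> (\<integral>x. \<bar>f n x - tri w x\<bar> \<partial>T)"
    proof (rule integral_mono)
      show "\<bar>c n x - tri w x\<bar> \<le> \<bar>f n x - tri w x\<bar>" for x
        using clamp_abs_lipschitz[of M "f n x" "tri w x"] clamp_abs_id[OF M[of x]] by (simp add: c_def)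
    qed (use ci fi ti in auto)
    then show "norm (\<integral>x. \<bar>c n x - tri w x\<bar> \<partial>T) \<le> (\<integral>x. \<bar>f n x - tri w x\<bar> \<partial>T)" by (simp add: integral_nonneg_AE)
  qed
  have hmom: "(\<lambda>n. \<integral>x. h n x ^ m \<partial>T) \<longlonglongrightarrow> mom m w" for m
  proof -
    have "(\<integral>x. h n x ^ m \<partial>T) = (\<integral>x. c n x ^ m \<partial>T)" for n
      unfolding h_def c_def by (rule same[of "\<lambda>y. clamp_abs M y ^ m"]) measurable
    moreover have "(\<lambda>n. (\<integral>x. c n x ^ m \<partial>T) - (\<integral>x. tri w x ^ m \<partial>T)) \<longlonglongrightarrow> 0"
      by (rule integral_power_tendsto[OF cm cb tm M cl])
    ultimately show ?thesis by (simp add: mom_def LIM_zero_iff)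
  qed
  \<comment> \<open>Truncation destroys zero mean, which the energy estimates require. Subtracting
    the mean repairs this, and the correction tends to zero because the first moment of
    \<open>h n\<close> tends to that of \<open>tri w\<close>.\<close>
  define \<mu> where "\<mu> n = (\<integral>x. h n x \<partial>T) / V" for n
  have \<mu>: "\<mu> \<longlonglongrightarrow> 0"
  proof -
    have "(\<lambda>n. \<integral>x. h n x \<partial>T) \<longlonglongrightarrow> 0" using hmom[of 1] tri_mean_zero[of w] by (simp add: mom_def)
    from tendsto_divide[OF this tendsto_const[of V]] show ?thesis by (simp add: \<mu>_def[abs_def])
  qed
  have \<mu>b: "\<bar>\<mu> n\<bar> \<le> M" for n
  proof -
    have "\<bar>\<integral>x. h n x \<partial>T\<bar> \<le> M * V" by (rule abs_integral_le_bound[OF hi hb])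
    then show ?thesis using V_pos by (simp add: \<mu>_def divide_le_eq)
  qed
  have \<mu>V: "(\<lambda>n. \<bar>\<mu> n\<bar> * V) \<longlonglongrightarrow> 0" by (intro tendsto_mult_left_zero tendsto_rabs_zero \<mu>)
  define k where "k n x = h n x - \<mu> n" for n x
  have km [measurable]: "k n \<in> borel_measurable T" for n unfolding k_def by measurable
  have kb: "\<bar>k n x\<bar> \<le> 2 * M" for n x using hb[of n x] \<mu>b[of n] by (simp add: k_def)
  have ki: "integrable T (k n)" for n by (rule integrable_bounded_T[OF km kb])
  have kL: "k n \<in> mLp p" for n by (rule mLp_bounded[OF km kb p0])
  have kz: "(\<integral>x. k n x \<partial>T) = 0" for n using hi[of n] by (simp add: k_def \<mu>_def V_def[symmetric])
  have k2: "(\<lambda>n. \<integral>x. (k n x)\<^sup>2 \<partial>T) \<longlonglongrightarrow> mom 2 w"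
  proof -
    have "(\<integral>x. (k n x)\<^sup>2 \<partial>T) = (\<integral>x. (h n x)\<^sup>2 \<partial>T) - (\<mu> n)\<^sup>2 * V" for n
    proof -
      have i2: "integrable T (\<lambda>x. (h n x)\<^sup>2)"
      proof (rule integrable_bounded_T[of _ "M\<^sup>2"])
        show "\<bar>(h n x)\<^sup>2\<bar> \<le> M\<^sup>2" for x using power_mono[OF hb[of n x], of 2] by simp
      qed measurable
      have "(\<integral>x. (k n x)\<^sup>2 \<partial>T) = (\<integral>x. (h n x)\<^sup>2 - 2 * \<mu> n * h n x + (\<mu> n)\<^sup>2 \<partial>T)"
        by (simp add: k_def power2_eq_square algebra_simps)
      also have "\<dots> = (\<integral>x. (h n x)\<^sup>2 \<partial>T) - 2 * \<mu> n * (\<integral>x. h n x \<partial>T) + (\<mu> n)\<^sup>2 * V"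
        using i2 hi[of n] by (simp add: V_def)
      also have "(\<integral>x. h n x \<partial>T) = \<mu> n * V" by (simp add: \<mu>_def)
      finally show ?thesis by (simp add: power2_eq_square)
    qed
    moreover have "(\<lambda>n. (\<integral>x. (h n x)\<^sup>2 \<partial>T) - (\<mu> n)\<^sup>2 * V) \<longlonglongrightarrow> mom 2 w - 0\<^sup>2 * V"
      by (intro tendsto_intros hmom \<mu>)
    ultimately show ?thesis by simp
  qed
  obtain C where C: "C > 0" "\<And>f g. f \<in> mLp p \<Longrightarrow> (\<integral>x. f x \<partial>T) = 0 \<Longrightarrow> g \<in> mLp p \<Longrightarrow> (\<integral>x. g x \<partial>T) = 0 \<Longrightarrow>
      \<bar>energy \<xi> \<eta> p f - energy \<xi> \<eta> p g\<bar> \<le> C * (2 + N p f + N p g) * (\<integral>x. \<bar>f x - g x\<bar> \<partial>T)"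
    using energy_lipschitz[OF p] by blast
  have Nf: "N p (f n) \<le> 2 powr p * (N p (\<lambda>x. f n x - tri w x) + N p (tri w))" for n
    using mLp_add(2)[OF dL[of n] tL[of w] p0] by simp
  have Ng: "N p (g n) = N p (f n)" for n
    unfolding N_def by (rule same[of "\<lambda>y. \<bar>y\<bar> powr p"]) measurable
  define B where "B n = 2 powr p * (N p (\<lambda>x. f n x - tri w x) + N p (tri w))" for n
  have Bl: "B \<longlonglongrightarrow> 2 powr p * (0 + N p (tri w))" unfolding B_def by (intro tendsto_intros lim)
  have e1: "(\<lambda>n. energy \<xi> \<eta> p (f n) - energy \<xi> \<eta> p (tri w)) \<longlonglongrightarrow> 0"
  proof (rule Lim_null_comparison[OF always_eventually])
    have "(\<lambda>n. C * (2 + B n + N p (tri w)) * (\<integral>x. \<bar>f n x - tri w x\<bar> \<partial>T)) \<longlonglongrightarrow> C * (2 + 2 powr p * (0 + N p (tri w)) + N p (tri w)) * 0"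
      by (intro tendsto_intros Bl fl)
    then show "(\<lambda>n. C * (2 + B n + N p (tri w)) * (\<integral>x. \<bar>f n x - tri w x\<bar> \<partial>T)) \<longlonglongrightarrow> 0" by simp
    show "\<forall>n. norm (energy \<xi> \<eta> p (f n) - energy \<xi> \<eta> p (tri w)) \<le> C * (2 + B n + N p (tri w)) * (\<integral>x. \<bar>f n x - tri w x\<bar> \<partial>T)"
    proof
      fix n
      have "C * (2 + N p (f n) + N p (tri w)) * (\<integral>x. \<bar>f n x - tri w x\<bar> \<partial>T) \<le> C * (2 + B n + N p (tri w)) * (\<integral>x. \<bar>f n x - tri w x\<bar> \<partial>T)"
        unfolding B_def using C(1) Nf[of n] by (intro mult_right_mono mult_left_mono integral_nonneg_AE) auto
      then show "norm (energy \<xi> \<eta> p (f n) - energy \<xi> \<eta> p (tri w)) \<le> C * (2 + B n + N p (tri w)) * (\<integral>x. \<bar>f n x - tri w x\<bar> \<partial>T)"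
        using C(2)[OF f(1)[of n] f(2)[of n] tL tri_mean_zero, of w] by simp
    qed
  qed
  have ghl: "(\<lambda>n. \<integral>x. \<bar>g n x - h n x\<bar> \<partial>T) \<longlonglongrightarrow> 0"
    by (rule N_tendsto_L1[OF mLp_diff(1)[OF g(1) hL p0] p1 tl])
  have gkl: "(\<lambda>n. \<integral>x. \<bar>k n x - g n x\<bar> \<partial>T) \<longlonglongrightarrow> 0"
  proof (rule Lim_null_comparison[OF always_eventually])
    show "(\<lambda>n. (\<integral>x. \<bar>g n x - h n x\<bar> \<partial>T) + \<bar>\<mu> n\<bar> * V) \<longlonglongrightarrow> 0" by (intro tendsto_add_zero ghl \<mu>V)
    show "\<forall>n. norm (\<integral>x. \<bar>k n x - g n x\<bar> \<partial>T) \<le> (\<integral>x. \<bar>g n x - h n x\<bar> \<partial>T) + \<bar>\<mu> n\<bar> * V"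
    proof
      fix n
      have "(\<integral>x. \<bar>k n x - g n x\<bar> \<partial>T) \<le> (\<integral>x. \<bar>g n x - h n x\<bar> + \<bar>\<mu> n\<bar> \<partial>T)"
        using ki fi hi by (intro integral_mono) (auto simp: k_def)
      also have "\<dots> = (\<integral>x. \<bar>g n x - h n x\<bar> \<partial>T) + \<bar>\<mu> n\<bar> * V" using fi hi by (simp add: V_def)
      finally show "norm (\<integral>x. \<bar>k n x - g n x\<bar> \<partial>T) \<le> (\<integral>x. \<bar>g n x - h n x\<bar> \<partial>T) + \<bar>\<mu> n\<bar> * V"
        by (simp add: integral_nonneg_AE)
    qed
  qed
  have e2: "(\<lambda>n. energy \<xi> \<eta> p (k n) - energy \<xi> \<eta> p (g n)) \<longlonglongrightarrow> 0"
  proof (rule Lim_null_comparison[OF always_eventually])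
    let ?K = "N p (\<lambda>x. 2 * M)"
    have "(\<lambda>n. C * (2 + ?K + B n) * (\<integral>x. \<bar>k n x - g n x\<bar> \<partial>T)) \<longlonglongrightarrow> C * (2 + ?K + 2 powr p * (0 + N p (tri w))) * 0"
      by (intro tendsto_intros Bl gkl)
    then show "(\<lambda>n. C * (2 + ?K + B n) * (\<integral>x. \<bar>k n x - g n x\<bar> \<partial>T)) \<longlonglongrightarrow> 0" by simp
    show "\<forall>n. norm (energy \<xi> \<eta> p (k n) - energy \<xi> \<eta> p (g n)) \<le> C * (2 + ?K + B n) * (\<integral>x. \<bar>k n x - g n x\<bar> \<partial>T)"
    proof
      fix n
      have "N p (k n) \<le> ?K"
        by (intro N_mono mLp_cont continuous_on_const km AE_I2 p0 order.trans[OF kb abs_ge_self])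
      moreover have "N p (g n) \<le> B n" unfolding B_def Ng by (rule Nf)
      ultimately have "C * (2 + N p (k n) + N p (g n)) * (\<integral>x. \<bar>k n x - g n x\<bar> \<partial>T) \<le> C * (2 + ?K + B n) * (\<integral>x. \<bar>k n x - g n x\<bar> \<partial>T)"
        using C(1) by (intro mult_right_mono mult_left_mono integral_nonneg_AE) auto
      then show "norm (energy \<xi> \<eta> p (k n) - energy \<xi> \<eta> p (g n)) \<le> C * (2 + ?K + B n) * (\<integral>x. \<bar>k n x - g n x\<bar> \<partial>T)"
        using C(2)[OF kL kz g, of n n] by simp
    qed
  qed
  \<comment> \<open>The chain runs from \<open>tri w\<close> to \<open>f n\<close> by closeness, to
    \<open>g n\<close> by conservation of energy, and to \<open>k n\<close> because truncation and
    removal of the mean are small in L1.\<close>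
  have ek: "(\<lambda>n. energy \<xi> \<eta> p (k n)) \<longlonglongrightarrow> mom 2 w / (2 * lam1)"
  proof -
    have "(\<lambda>n. energy \<xi> \<eta> p (k n) - energy \<xi> \<eta> p (tri w)) \<longlonglongrightarrow> 0"
      using tendsto_add[OF e1 e2] by (simp add: en)
    then show ?thesis using energy_tri[OF p w] by (simp add: LIM_zero_iff mom_def)
  qed
  obtain \<kappa> where \<kappa>: "\<kappa> > 0" "\<And>k. k \<in> dl - {0} \<Longrightarrow> k \<notin> shell \<Longrightarrow> \<kappa> \<le> 1 / lam1 - 1 / lam k"
    using gap_exists by blast
  have "\<forall>n. \<exists>v. (\<integral>x. (k n x - tri v x)\<^sup>2 \<partial>T) \<le> 2 / \<kappa> * ((\<integral>x. (k n x)\<^sup>2 \<partial>T) / lam1 - 2 * energy \<xi> \<eta> p (k n)) + 1 / Suc n"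
  proof
    fix n show "\<exists>v. (\<integral>x. (k n x - tri v x)\<^sup>2 \<partial>T) \<le> 2 / \<kappa> * ((\<integral>x. (k n x)\<^sup>2 \<partial>T) / lam1 - 2 * energy \<xi> \<eta> p (k n)) + 1 / Suc n"
      by (rule gap_bounded[OF p \<kappa> km kb kz]) auto
  qed
  from choice[OF this] obtain e where e: "\<And>n. (\<integral>x. (k n x - tri (e n) x)\<^sup>2 \<partial>T) \<le> 2 / \<kappa> * ((\<integral>x. (k n x)\<^sup>2 \<partial>T) / lam1 - 2 * energy \<xi> \<eta> p (k n)) + 1 / Suc n"
    by blast
  have "(\<lambda>n. 2 / \<kappa> * ((\<integral>x. (k n x)\<^sup>2 \<partial>T) / lam1 - 2 * energy \<xi> \<eta> p (k n)) + 1 / Suc n) \<longlonglongrightarrow> 2 / \<kappa> * (mom 2 w / lam1 - 2 * (mom 2 w / (2 * lam1))) + 0"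
    by (intro tendsto_intros k2 ek LIMSEQ_Suc[OF lim_1_over_n]) (use lam1_pos in auto)
  then have "(\<lambda>n. 2 / \<kappa> * ((\<integral>x. (k n x)\<^sup>2 \<partial>T) / lam1 - 2 * energy \<xi> \<eta> p (k n)) + 1 / Suc n) \<longlonglongrightarrow> 0" by simp
  then have "(\<lambda>n. \<integral>x. (k n x - tri (e n) x)\<^sup>2 \<partial>T) \<longlonglongrightarrow> 0"
    by (rule Lim_null_comparison[OF always_eventually, rotated]) (use e in \<open>auto simp: integral_nonneg_AE\<close>)
  then have "(\<lambda>n. N 2 (\<lambda>x. k n x - tri (e n) x)) \<longlonglongrightarrow> 0" by (simp add: N_def)
  then have kel: "(\<lambda>n. \<integral>x. \<bar>k n x - tri (e n) x\<bar> \<partial>T) \<longlonglongrightarrow> 0"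
    by (rule N_tendsto_L1[rotated 2]) (intro mLp_diff mLp_bounded[OF km kb] mLp_cont[OF tc], simp_all)
  \<comment> \<open>The triple \<open>e n\<close> provided by the gap is merely some choice. It is
    replaced by the coefficients of \<open>h n\<close>, which are canonical and depend continuously
    on the function, as needed for following a path in time.\<close>
  define v where "v n = coef (h n)" for n
  have vk: "v n = coef (k n)" for n unfolding v_def k_def by (rule coef_shift[OF hi, symmetric])
  have ve: "norm (v n - e n) \<le> 6 / V * (\<integral>x. \<bar>k n x - tri (e n) x\<bar> \<partial>T)" for n
  proof -
    have "v n - e n = coef (\<lambda>x. k n x - tri (e n) x)"
      unfolding vk coef_diff[OF ki ti] coef_tri ..
    then show ?thesis using norm_coef_le[of "\<lambda>x. k n x - tri (e n) x"] ki ti by simp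
  qed
  \<comment> \<open>36 is the product of the constants 6 in \<open>abs_tri_le\<close> and 6 in
    \<open>norm_coef_le\<close>; together with the direct term this makes 37.\<close>
  have hv: "(\<integral>x. \<bar>h n x - tri (v n) x\<bar> \<partial>T) \<le> \<bar>\<mu> n\<bar> * V + 37 * (\<integral>x. \<bar>k n x - tri (e n) x\<bar> \<partial>T)" for n
  proof -
    let ?I = "\<integral>x. \<bar>k n x - tri (e n) x\<bar> \<partial>T"
    have pt: "\<bar>h n x - tri (v n) x\<bar> \<le> \<bar>\<mu> n\<bar> + \<bar>k n x - tri (e n) x\<bar> + 36 / V * ?I" for x
    proof -
      have "\<bar>tri (e n) x - tri (v n) x\<bar> \<le> 6 * norm (v n - e n)"
        using abs_tri_le[of "e n - v n" x] by (simp add: tri_diff norm_minus_commute)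
      also have "\<dots> \<le> 36 / V * ?I" using ve[of n] by simp
      finally have 1: "\<bar>tri (e n) x - tri (v n) x\<bar> \<le> 36 / V * ?I" .
      have "h n x - tri (v n) x = \<mu> n + (k n x - tri (e n) x) + (tri (e n) x - tri (v n) x)" by (simp add: k_def)
      then show ?thesis using 1 by linarith
    qed
    have ir: "integrable T (\<lambda>x. \<bar>\<mu> n\<bar> + \<bar>k n x - tri (e n) x\<bar> + 36 / V * ?I)" using ki ti by auto
    have "(\<integral>x. \<bar>h n x - tri (v n) x\<bar> \<partial>T) \<le> (\<integral>x. \<bar>\<mu> n\<bar> + \<bar>k n x - tri (e n) x\<bar> + 36 / V * ?I \<partial>T)"
      using hi ti by (intro integral_mono ir pt) auto
    also have "\<dots> = \<bar>\<mu> n\<bar> * V + ?I + 36 / V * ?I * V" using ki[of n] ti[of "e n"] by (simp add: V_def[symmetric])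
    also have "36 / V * ?I * V = 36 * ?I" by simp
    finally show ?thesis by simp
  qed
  have "(\<lambda>n. \<bar>\<mu> n\<bar> * V + 37 * (\<integral>x. \<bar>k n x - tri (e n) x\<bar> \<partial>T)) \<longlonglongrightarrow> 0"
    by (intro tendsto_add_zero \<mu>V tendsto_mult_right_zero kel)
  then have hvl: "(\<lambda>n. \<integral>x. \<bar>h n x - tri (v n) x\<bar> \<partial>T) \<longlonglongrightarrow> 0"
    by (rule Lim_null_comparison[OF always_eventually, rotated]) (use hv in \<open>auto simp: integral_nonneg_AE\<close>)
  then show "(\<lambda>n. \<integral>x. \<bar>h n x - tri (coef (h n)) x\<bar> \<partial>T) \<longlonglongrightarrow> 0" by (simp add: v_def)
  have vb: "\<bar>tri (v n) x\<bar> \<le> 36 * M" for n x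
  proof -
    have "(\<integral>x. \<bar>h n x\<bar> \<partial>T) \<le> M * V"
      using abs_integral_le_bound[of "\<lambda>x. \<bar>h n x\<bar>" M] hi[of n] hb[of n] by (simp add: integral_nonneg_AE)
    then have "6 / V * (\<integral>x. \<bar>h n x\<bar> \<partial>T) \<le> 6 / V * (M * V)" using V_pos by (intro mult_left_mono) auto
    then have "norm (v n) \<le> 6 * M" using norm_coef_le[OF hi, of n] by (simp add: v_def)
    then show ?thesis using abs_tri_le[of "v n" x] by linarith
  qed
  have "(\<lambda>n. (\<integral>x. h n x ^ l \<partial>T) - (\<integral>x. tri (v n) x ^ l \<partial>T)) \<longlonglongrightarrow> 0"
  proof (rule integral_power_tendsto[OF hm _ tm vb hvl])
    show "\<bar>h n x\<bar> \<le> 36 * M" for n x using hb[of n x] M0 by simp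
  qed
  from tendsto_diff[OF hmom[of l] this] show "(\<lambda>n. mom l (coef (h n))) \<longlonglongrightarrow> mom l w"
    by (simp add: mom_def v_def)
qed

section \<open>Stability\<close>

lemma Lp_norm_N: "Lp_norm \<xi> \<eta> p f = N p f powr (1 / p)"
  by (simp add: Lp_norm_def N_def)

lemma N_Lp_norm: "0 < p \<Longrightarrow> N p f = Lp_norm \<xi> \<eta> p f powr p"
  by (simp add: Lp_norm_N powr_powr)

lemma Lp_norm_tendsto_N: "0 < p \<Longrightarrow> ((\<lambda>n. Lp_norm \<xi> \<eta> p (f n)) \<longlongrightarrow> 0) F \<Longrightarrow> ((\<lambda>n. N p (f n)) \<longlongrightarrow> 0) F"
  unfolding N_Lp_norm by (rule tendsto_zero_powrI[where b = p]) (auto simp: Lp_norm_N)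

lemma bounded_coef_subseq:
  fixes x :: "nat \<Rightarrow> complex \<times> complex \<times> complex"
  assumes "\<And>n. norm (x n) \<le> R"
  obtains l r where "strict_mono r" "(\<lambda>n. x (r n)) \<longlonglongrightarrow> l"
proof -
  have "seq_compact (cball (0 :: complex \<times> complex \<times> complex) R)" by (intro compact_imp_seq_compact compact_cball)
  moreover have "\<forall>n. x n \<in> cball 0 R" using assms by simp
  ultimately show ?thesis using that unfolding seq_compact_def o_def by blast
qed

text \<open>A counterexample gives maps that start ever closer to \<omega> and times at which they
  are far from its orbit. The distance of invariants is continuous in time and starts near zero; if
  it failed to vanish in the limit at the bad times, it would pass through a fixed level below the
  isolation distance, and a limit point at that level would contradict isolation. At vanishing
  distance a limit point is a translate of \<omega>.\<close>

theorem eigenfunction_stable: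
  assumes p: "1 < p" and \<omega>: "\<omega> \<in> first_eigenspace \<xi> \<eta>" and \<epsilon>: "\<epsilon> > 0"
  shows "\<exists>\<delta>>0. \<forall>\<zeta>. admissible_map \<xi> \<eta> p \<zeta> \<longrightarrow> Lp_norm \<xi> \<eta> p (\<lambda>x. \<zeta> 0 x - \<omega> x) < \<delta> \<longrightarrow>
           (\<forall>t. \<exists>q. Lp_norm \<xi> \<eta> p (\<lambda>x. \<zeta> t x - \<omega> (x - q)) < \<epsilon>)"
proof (rule ccontr)
  assume neg: "\<not> ?thesis"
  have p1: "1 \<le> p" and p0: "0 \<le> p" and pp: "0 < p" using p by auto
  obtain w where w: "supp w" and \<omega>w: "AE x in T. \<omega> x = tri w x" using first_eigenspace_tri(3)[OF \<omega>] by blast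
  note \<omega>per = first_eigenspace_tri(1)[OF \<omega>] and \<omega>m = first_eigenspace_tri(2)[OF \<omega>]
  define M where "M = 6 * norm w"
  have M: "\<bar>tri w x\<bar> \<le> M" for x unfolding M_def by (rule abs_tri_le)
  have M0: "M \<ge> 0" by (simp add: M_def)
  \<comment> \<open>Map and bad time are packed into one pair so that a single use of choice yields
    both sequences.\<close>
  have "\<forall>n::nat. \<exists>\<zeta>t. admissible_map \<xi> \<eta> p (fst \<zeta>t) \<and> Lp_norm \<xi> \<eta> p (\<lambda>x. fst \<zeta>t 0 x - \<omega> x) < 1 / Suc n \<and>
     (\<forall>q. \<not> Lp_norm \<xi> \<eta> p (\<lambda>x. fst \<zeta>t (snd \<zeta>t) x - \<omega> (x - q)) < \<epsilon>)"
  proof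
    fix n :: nat
    have "1 / real (Suc n) > 0" by simp
    then obtain \<zeta> t where "admissible_map \<xi> \<eta> p \<zeta>" "Lp_norm \<xi> \<eta> p (\<lambda>x. \<zeta> 0 x - \<omega> x) < 1 / Suc n"
      "\<forall>q. \<not> Lp_norm \<xi> \<eta> p (\<lambda>x. \<zeta> t x - \<omega> (x - q)) < \<epsilon>" using neg by blast
    then show "\<exists>\<zeta>t. admissible_map \<xi> \<eta> p (fst \<zeta>t) \<and> Lp_norm \<xi> \<eta> p (\<lambda>x. fst \<zeta>t 0 x - \<omega> x) < 1 / Suc n \<and>
     (\<forall>q. \<not> Lp_norm \<xi> \<eta> p (\<lambda>x. fst \<zeta>t (snd \<zeta>t) x - \<omega> (x - q)) < \<epsilon>)" by (intro exI[of _ "(\<zeta>, t)"]) simp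
  qed
  from choice[OF this] obtain Zt where Zt: "\<And>n. admissible_map \<xi> \<eta> p (fst (Zt n))"
    "\<And>n. Lp_norm \<xi> \<eta> p (\<lambda>x. fst (Zt n) 0 x - \<omega> x) < 1 / Suc n"
    "\<And>n q. \<not> Lp_norm \<xi> \<eta> p (\<lambda>x. fst (Zt n) (snd (Zt n)) x - \<omega> (x - q)) < \<epsilon>" by blast
  define Z where "Z n = fst (Zt n)" for n
  define \<tau> where "\<tau> n = snd (Zt n)" for n
  have adm: "admissible_map \<xi> \<eta> p (Z n)" and near: "Lp_norm \<xi> \<eta> p (\<lambda>x. Z n 0 x - \<omega> x) < 1 / Suc n"
    and far: "\<not> Lp_norm \<xi> \<eta> p (\<lambda>x. Z n (\<tau> n) x - \<omega> (x - q)) < \<epsilon>" for n q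
    using Zt by (simp_all add: Z_def \<tau>_def)
  have ZL: "Z n t \<in> mLp p" and Zz: "(\<integral>x. Z n t x \<partial>T) = 0" for n t
    using adm[of n] by (auto simp: admissible_map_def Lp0_def Lp_iff mean_zero_def)
  have Zre: "Z n t \<in> rearrangements \<xi> \<eta> (Z n 0)" and Zen: "energy \<xi> \<eta> p (Z n t) = energy \<xi> \<eta> p (Z n 0)" for n t
    using adm[of n] unfolding admissible_map_def by blast+
  have Zc: "((\<lambda>t. Lp_norm \<xi> \<eta> p (\<lambda>x. Z n t x - Z n t0 x)) \<longlongrightarrow> 0) (at t0)" for n t0
    using adm[of n] unfolding admissible_map_def Lp_continuous_def by blast
  have Zi: "integrable T (Z n t)" for n t by (rule mLp_L1(1)[OF ZL p1])
  note Zm [measurable] = mLp_measurable[OF ZL]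
  have tc: "continuous_on UNIV (tri v)" for v by (rule continuous_tri)
  note tm [measurable] = cont_measurable_T[OF tc]
  have ti: "integrable T (tri v)" for v using tc by (rule integrable_cont)
  have tL: "tri v \<in> mLp p" for v using tc p0 by (rule mLp_cont)

  have "(\<lambda>n. Lp_norm \<xi> \<eta> p (\<lambda>x. Z n 0 x - \<omega> x)) \<longlonglongrightarrow> 0"
  proof (rule Lim_null_comparison[OF always_eventually])
    show "(\<lambda>n. 1 / real (Suc n)) \<longlonglongrightarrow> 0" using LIMSEQ_Suc[OF lim_1_over_n] by simp
    show "\<forall>n. norm (Lp_norm \<xi> \<eta> p (\<lambda>x. Z n 0 x - \<omega> x)) \<le> 1 / real (Suc n)"
    proof
      fix n
      have "Lp_norm \<xi> \<eta> p (\<lambda>x. Z n 0 x - \<omega> x) \<ge> 0" by (simp add: Lp_norm_N)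
      then show "norm (Lp_norm \<xi> \<eta> p (\<lambda>x. Z n 0 x - \<omega> x)) \<le> 1 / real (Suc n)" using near[of n] by simp
    qed
  qed
  then have "(\<lambda>n. N p (\<lambda>x. Z n 0 x - \<omega> x)) \<longlonglongrightarrow> 0" by (rule Lp_norm_tendsto_N[OF pp])
  moreover have "N p (\<lambda>x. Z n 0 x - \<omega> x) = N p (\<lambda>x. Z n 0 x - tri w x)" for n
    unfolding N_def
  proof (rule integral_cong_AE)
    show "AE x in T. \<bar>Z n 0 x - \<omega> x\<bar> powr p = \<bar>Z n 0 x - tri w x\<bar> powr p" using \<omega>w by eventually_elim simp
  qed (use \<omega>m in measurable)
  ultimately have N0: "(\<lambda>n. N p (\<lambda>x. Z n 0 x - tri w x)) \<longlonglongrightarrow> 0" by simp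

  define h where "h n t x = clamp_abs M (Z n t x)" for n t x
  define u where "u n t = coef (h n t)" for n t
  have hm [measurable]: "h n t \<in> borel_measurable T" for n t unfolding h_def by measurable
  have hb: "\<bar>h n t x\<bar> \<le> M" for n t x unfolding h_def by (rule clamp_abs_bound[OF M0])
  have hi: "integrable T (h n t)" for n t by (rule integrable_bounded_T[OF hm hb])
  have hL: "h n t \<in> mLp p" for n t by (rule mLp_bounded[OF hm hb p0])
  have ub: "norm (u n t) \<le> 6 * M" for n t
  proof -
    have "(\<integral>x. \<bar>h n t x\<bar> \<partial>T) \<le> M * V"
      using abs_integral_le_bound[of "\<lambda>x. \<bar>h n t x\<bar>" M] hi[of n t] hb[of n t] by (simp add: integral_nonneg_AE)
    then have "6 / V * (\<integral>x. \<bar>h n t x\<bar> \<partial>T) \<le> 6 / V * (M * V)" using V_pos by (intro mult_left_mono) auto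
    then show ?thesis using norm_coef_le[OF hi, of n t] by (simp add: u_def)
  qed
  \<comment> \<open>The times \<open>s n\<close> are arbitrary: this is applied at the bad times and
    also at the crossing times found below.\<close>
  have core: "(\<lambda>n. N p (\<lambda>x. Z (r n) (s n) x - h (r n) (s n) x)) \<longlonglongrightarrow> 0"
    "(\<lambda>n. \<integral>x. \<bar>h (r n) (s n) x - tri (u (r n) (s n)) x\<bar> \<partial>T) \<longlonglongrightarrow> 0"
    "(\<lambda>n. mom l (u (r n) (s n))) \<longlonglongrightarrow> mom l w" if r: "strict_mono r" for r s l
  proof -
    have "(\<lambda>n. N p (\<lambda>x. Z (r n) 0 x - tri w x)) \<longlonglongrightarrow> 0" using LIMSEQ_subseq_LIMSEQ[OF N0 r] by (simp add: o_def)
    note R = rearrangement_limit[where f = "\<lambda>n. Z (r n) 0" and g = "\<lambda>n. Z (r n) (s n)", OF p w M ZL Zz ZL Zz Zre Zen this, folded h_def u_def]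
    show "(\<lambda>n. N p (\<lambda>x. Z (r n) (s n) x - h (r n) (s n) x)) \<longlonglongrightarrow> 0"
      "(\<lambda>n. \<integral>x. \<bar>h (r n) (s n) x - tri (u (r n) (s n)) x\<bar> \<partial>T) \<longlonglongrightarrow> 0"
      "(\<lambda>n. mom l (u (r n) (s n))) \<longlonglongrightarrow> mom l w"
      using R unfolding u_def h_def by blast+
  qed
  have u_dist: "norm (u n t - coef k) \<le> 6 / V * (\<integral>x. \<bar>h n t x - k x\<bar> \<partial>T)" if "integrable T k" for n t k
    unfolding u_def coef_diff[OF hi that, symmetric]
    by (rule norm_coef_le) (intro Bochner_Integration.integrable_diff hi that)
  \<comment> \<open>Truncation is a contraction and coefficients are bounded by the L1 norm, so
    continuity in Lp descends to the coefficients of the truncated functions.\<close>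
  have uc: "continuous_on UNIV (u n)" for n
  proof -
    have "(u n \<longlongrightarrow> u n t0) (at t0)" for t0
    proof -
      have "((\<lambda>t. N p (\<lambda>x. Z n t x - Z n t0 x)) \<longlongrightarrow> 0) (at t0)" by (rule Lp_norm_tendsto_N[OF pp Zc])
      then have l: "((\<lambda>t. \<integral>x. \<bar>Z n t x - Z n t0 x\<bar> \<partial>T) \<longlongrightarrow> 0) (at t0)"
        by (rule N_tendsto_L1[OF mLp_diff(1)[OF ZL ZL p0] p1])
      have "((\<lambda>t. u n t - u n t0) \<longlongrightarrow> 0) (at t0)"
      proof (rule Lim_null_comparison[OF always_eventually tendsto_mult_right_zero[OF l, of "6 / V"]], rule allI)
        fix t
        have "norm (u n t - u n t0) \<le> 6 / V * (\<integral>x. \<bar>h n t x - h n t0 x\<bar> \<partial>T)"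
          using u_dist[OF hi[of n t0]] by (simp add: u_def)
        also have "\<dots> \<le> 6 / V * (\<integral>x. \<bar>Z n t x - Z n t0 x\<bar> \<partial>T)"
        proof (rule mult_left_mono)
          show "(\<integral>x. \<bar>h n t x - h n t0 x\<bar> \<partial>T) \<le> (\<integral>x. \<bar>Z n t x - Z n t0 x\<bar> \<partial>T)"
          proof (rule integral_mono)
            show "\<bar>h n t x - h n t0 x\<bar> \<le> \<bar>Z n t x - Z n t0 x\<bar>" for x
              unfolding h_def by (rule clamp_abs_lipschitz)
          qed (use hi Zi in auto)
        qed (use V_pos in auto)
        finally show "norm (u n t - u n t0) \<le> 6 / V * (\<integral>x. \<bar>Z n t x - Z n t0 x\<bar> \<partial>T)" .
      qed
      then show ?thesis by (simp add: LIM_zero_iff)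
    qed
    then show ?thesis by (simp add: continuous_on_eq_continuous_at isCont_def)
  qed
  have u0: "(\<lambda>n. u n 0) \<longlonglongrightarrow> w"
  proof -
    have l: "(\<lambda>n. \<integral>x. \<bar>Z n 0 x - tri w x\<bar> \<partial>T) \<longlonglongrightarrow> 0"
      by (rule N_tendsto_L1[OF mLp_diff(1)[OF ZL tL p0] p1 N0])
    have "(\<lambda>n. u n 0 - w) \<longlonglongrightarrow> 0"
    proof (rule Lim_null_comparison[OF always_eventually tendsto_mult_right_zero[OF l, of "6 / V"]], rule allI)
      fix n
      have "norm (u n 0 - w) \<le> 6 / V * (\<integral>x. \<bar>h n 0 x - tri w x\<bar> \<partial>T)"
        using u_dist[OF ti[of w]] by (simp add: coef_tri)
      also have "\<dots> \<le> 6 / V * (\<integral>x. \<bar>Z n 0 x - tri w x\<bar> \<partial>T)"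
      proof (rule mult_left_mono)
        have "\<bar>h n 0 x - tri w x\<bar> \<le> \<bar>Z n 0 x - tri w x\<bar>" for x
          using clamp_abs_lipschitz[of M "Z n 0 x" "tri w x"] clamp_abs_id[OF M[of x]] by (simp add: h_def)
        then show "(\<integral>x. \<bar>h n 0 x - tri w x\<bar> \<partial>T) \<le> (\<integral>x. \<bar>Z n 0 x - tri w x\<bar> \<partial>T)"
          by (intro integral_mono) (use hi Zi ti in auto)
      qed (use V_pos in auto)
      finally show "norm (u n 0 - w) \<le> 6 / V * (\<integral>x. \<bar>Z n 0 x - tri w x\<bar> \<partial>T)" .
    qed
    then show ?thesis by (simp add: LIM_zero_iff)
  qed
  define J where "J n t = inv_dist (u n t) w" for n t
  have invc: "(\<lambda>n. inv_dist (x n) w) \<longlonglongrightarrow> inv_dist l w" if "x \<longlonglongrightarrow> l" for x l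
    using continuous_on_tendsto_compose[OF continuous_inv_dist that] by simp
  have J0: "(\<lambda>n. J n 0) \<longlonglongrightarrow> 0" using invc[OF u0] by (simp add: J_def inv_dist_def)
  have Jnn: "J n t \<ge> 0" for n t by (simp add: J_def inv_dist_def)
  obtain \<sigma> where \<sigma>: "\<sigma> > 0" "\<And>v. same_moments v w \<Longrightarrow> inv_dist v w = 0 \<or> \<sigma> \<le> inv_dist v w"
    using inv_dist_isolated by blast

  have J\<tau>: "(\<lambda>n. J n (\<tau> n)) \<longlonglongrightarrow> 0"
  proof (rule ccontr)
    assume "\<not> ?thesis"
    then obtain d where d: "d > 0" and "\<forall>n0. \<exists>n\<ge>n0. J n (\<tau> n) \<ge> d"
      unfolding lim_sequentially using Jnn by (auto simp: not_less dist_real_def)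
    then have inf: "infinite {n. J n (\<tau> n) \<ge> d}" by (auto simp: infinite_nat_iff_unbounded_le)
    \<comment> \<open>A level strictly between zero and both \<open>d\<close> and the isolation
      distance \<sigma>. By the intermediate value theorem the paths with late index cross it
      between time 0 and the bad time.\<close>
    define s where "s = min d \<sigma> / 2"
    have s: "0 < s" "s < d" "s < \<sigma>" using d \<sigma>(1) by (auto simp: s_def)
    obtain n0 where n0: "\<And>n. n \<ge> n0 \<Longrightarrow> J n 0 < s" using order_tendstoD(2)[OF J0 s(1)] by (auto simp: eventually_sequentially)
    have "infinite ({n. J n (\<tau> n) \<ge> d} - {..<n0})" using inf by (intro Diff_infinite_finite) auto
    then obtain r :: "nat \<Rightarrow> nat" where r: "strict_mono r" "\<And>n. r n \<in> {n. J n (\<tau> n) \<ge> d} - {..<n0}"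
      using infinite_enumerate by blast
    have "\<forall>n. \<exists>a. J (r n) a = s"
    proof
      fix n
      have "connected (J (r n) ` UNIV)"
        unfolding J_def[abs_def]
        by (intro connected_continuous_image continuous_on_compose2[OF continuous_inv_dist uc]) auto
      then have "{J (r n) 0..J (r n) (\<tau> (r n))} \<subseteq> J (r n) ` UNIV" by (rule connected_contains_Icc) auto
      moreover have "s \<in> {J (r n) 0..J (r n) (\<tau> (r n))}" using r(2)[of n] n0[of "r n"] s(2) by auto
      ultimately show "\<exists>a. J (r n) a = s" by auto
    qed
    from choice[OF this] obtain a where a: "\<And>n. J (r n) (a n) = s" by blast
    obtain v r2 where r2: "strict_mono r2" "(\<lambda>n. u (r (r2 n)) (a (r2 n))) \<longlonglongrightarrow> v"
      by (rule bounded_coef_subseq[of "\<lambda>n. u (r n) (a n)"]) (rule ub, rule that)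
    \<comment> \<open>The limit at the crossing times inherits all moments of \<open>w\<close> by
      \<open>core\<close>, while its distance of invariants to \<open>w\<close> equals
      \<open>s\<close>, a value that isolation forbids.\<close>
    have "mom l v = mom l w" for l
    proof -
      have "(\<lambda>n. mom l (u (r (r2 n)) (a (r2 n)))) \<longlonglongrightarrow> mom l v"
        using continuous_on_tendsto_compose[OF continuous_mom r2(2)] by simp
      moreover have "(\<lambda>n. mom l (u (r (r2 n)) (a (r2 n)))) \<longlonglongrightarrow> mom l w"
        using LIMSEQ_subseq_LIMSEQ[OF core(3)[OF r(1), of l a] r2(1)] by (simp add: o_def)
      ultimately show ?thesis by (rule LIMSEQ_unique)
    qed
    then have "same_moments v w" by (simp add: same_moments_def)
    moreover have "inv_dist v w = s"
    proof -
      have "(\<lambda>n. J (r (r2 n)) (a (r2 n))) \<longlonglongrightarrow> inv_dist v w" unfolding J_def by (rule invc[OF r2(2)])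
      then show ?thesis by (simp add: a LIMSEQ_const_iff)
    qed
    ultimately show False using \<sigma>(2)[of v] s by auto
  qed

  obtain v r where r: "strict_mono r" "(\<lambda>n. u (r n) (\<tau> (r n))) \<longlonglongrightarrow> v"
    by (rule bounded_coef_subseq[of "\<lambda>n. u n (\<tau> n)"]) (rule ub, rule that)
  have "(\<lambda>n. J (r n) (\<tau> (r n))) \<longlonglongrightarrow> inv_dist v w" unfolding J_def by (rule invc[OF r(2)])
  moreover have "(\<lambda>n. J (r n) (\<tau> (r n))) \<longlonglongrightarrow> 0" using LIMSEQ_subseq_LIMSEQ[OF J\<tau> r(1)] by (simp add: o_def)
  ultimately have "inv_dist v w = 0" by (rule LIMSEQ_unique)
  then obtain q where q: "v = rot q w" using inv_dist_zero_orbit by blast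
  define H where "H n = h (r n) (\<tau> (r n))" for n
  define U where "U n = u (r n) (\<tau> (r n))" for n
  have c1: "(\<lambda>n. N p (\<lambda>x. Z (r n) (\<tau> (r n)) x - H n x)) \<longlonglongrightarrow> 0" and c2: "(\<lambda>n. \<integral>x. \<bar>H n x - tri (U n) x\<bar> \<partial>T) \<longlonglongrightarrow> 0"
    using core(1,2)[OF r(1), of "\<lambda>n. \<tau> (r n)"] by (simp_all add: H_def U_def)
  have c3: "(\<lambda>n. norm (U n - v)) \<longlonglongrightarrow> 0" using r(2) by (simp add: U_def LIM_zero tendsto_norm_zero)
  have c4: "(\<lambda>n. \<integral>x. \<bar>H n x - tri v x\<bar> \<partial>T) \<longlonglongrightarrow> 0"
  proof (rule Lim_null_comparison[OF always_eventually])
    show "(\<lambda>n. (\<integral>x. \<bar>H n x - tri (U n) x\<bar> \<partial>T) + 6 * V * norm (U n - v)) \<longlonglongrightarrow> 0"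
      by (intro tendsto_add_zero c2 tendsto_mult_right_zero c3)
    show "\<forall>n. norm (\<integral>x. \<bar>H n x - tri v x\<bar> \<partial>T) \<le> (\<integral>x. \<bar>H n x - tri (U n) x\<bar> \<partial>T) + 6 * V * norm (U n - v)"
    proof
      fix n
      have Hi: "integrable T (H n)" unfolding H_def by (rule hi)
      have "(\<integral>x. \<bar>H n x - tri v x\<bar> \<partial>T) \<le> (\<integral>x. \<bar>H n x - tri (U n) x\<bar> + 6 * norm (U n - v) \<partial>T)"
      proof (rule integral_mono)
        show "\<bar>H n x - tri v x\<bar> \<le> \<bar>H n x - tri (U n) x\<bar> + 6 * norm (U n - v)" for x
          using abs_tri_le[of "U n - v" x] unfolding tri_diff[symmetric] by linarith
      qed (use Hi ti in auto)
      also have "\<dots> = (\<integral>x. \<bar>H n x - tri (U n) x\<bar> \<partial>T) + 6 * V * norm (U n - v)"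
        using Hi ti[of "U n"] by (simp add: V_def)
      finally show "norm (\<integral>x. \<bar>H n x - tri v x\<bar> \<partial>T) \<le> (\<integral>x. \<bar>H n x - tri (U n) x\<bar> \<partial>T) + 6 * V * norm (U n - v)"
        by (simp add: integral_nonneg_AE)
    qed
  qed
  have HL: "H n \<in> mLp p" for n unfolding H_def by (rule hL)
  have c5: "(\<lambda>n. N p (\<lambda>x. H n x - tri v x)) \<longlonglongrightarrow> 0"
  proof (rule L1_tendsto_N[OF _ _ p1 c4])
    show "(\<lambda>x. H n x - tri v x) \<in> borel_measurable T" for n unfolding H_def by measurable
    show "\<bar>H n x - tri v x\<bar> \<le> M + 6 * norm v" for n x
      using hb[of "r n" "\<tau> (r n)" x] abs_tri_le[of v x] unfolding H_def by linarith
  qed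
  have "(\<lambda>n. N p (\<lambda>x. (Z (r n) (\<tau> (r n)) x - H n x) + (H n x - tri v x))) \<longlonglongrightarrow> 0"
    by (intro N_triangle_tendsto p0 mLp_diff ZL HL tL c1 c5)
  then have c6: "(\<lambda>n. N p (\<lambda>x. Z (r n) (\<tau> (r n)) x - tri v x)) \<longlonglongrightarrow> 0" by simp
  \<comment> \<open>\<omega> is only almost everywhere equal to \<open>tri w\<close>; after
    translation the exceptional set is still negligible, so the convergence to \<open>tri v\<close>
    is convergence to a translate of \<omega>.\<close>
  obtain Y where Y: "negligible Y" "\<And>x. x \<notin> Y \<Longrightarrow> \<omega> (x - q) = tri w (x - q)"
    using AE_translate[OF \<omega>per per_tri \<omega>w, of q] by blast
  have \<omega>qm: "(\<lambda>x. \<omega> (x - q)) \<in> borel_measurable T"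
    by (rule meas_spike[OF tm[of v] Y(1)]) (simp add: Y(2) q tri_rot)
  have "N p (\<lambda>x. Z n t x - \<omega> (x - q)) = N p (\<lambda>x. Z n t x - tri v x)" for n t
    unfolding N_def
  proof (rule integral_cong_AE)
    show "AE x in T. \<bar>Z n t x - \<omega> (x - q)\<bar> powr p = \<bar>Z n t x - tri v x\<bar> powr p"
      by (rule AE_T_I[OF Y(1)]) (simp add: Y(2) q tri_rot)
  qed (use \<omega>qm in measurable)
  then have "(\<lambda>n. N p (\<lambda>x. Z (r n) (\<tau> (r n)) x - \<omega> (x - q))) \<longlonglongrightarrow> 0" using c6 by simp
  then have "(\<lambda>n. Lp_norm \<xi> \<eta> p (\<lambda>x. Z (r n) (\<tau> (r n)) x - \<omega> (x - q))) \<longlonglongrightarrow> 0"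
    unfolding Lp_norm_N using pp by (intro tendsto_zero_powrI[where b = "1 / p"]) auto
  from order_tendstoD(2)[OF this \<epsilon>] obtain n where "Lp_norm \<xi> \<eta> p (\<lambda>x. Z (r n) (\<tau> (r n)) x - \<omega> (x - q)) < \<epsilon>"
    by (auto simp: eventually_sequentially)
  then show False using far by blast
qed

end

theorem theorem1p6:
  fixes \<xi> \<eta> :: "real^2" and p :: real and \<omega> :: "real^2 \<Rightarrow> real"
  assumes "\<xi> \<noteq> \<eta>" and "independent {\<xi>, \<eta>}"
    and "1 < p"
    and "\<omega> \<in> first_eigenspace \<xi> \<eta>"
  shows "\<forall>\<epsilon>>0. \<exists>\<delta>>0. \<forall>\<zeta>. admissible_map \<xi> \<eta> p \<zeta> \<longrightarrow>
           Lp_norm \<xi> \<eta> p (\<lambda>x. \<zeta> 0 x - \<omega> x) < \<delta> \<longrightarrow>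
           (\<forall>t. \<exists>q :: real^2. Lp_norm \<xi> \<eta> p (\<lambda>x. \<zeta> t x - \<omega> (x - q)) < \<epsilon>)"
proof -
  interpret lattice2 \<xi> \<eta> using assms(1,2) by unfold_locales
  obtain k1 k2 where k: "k1 \<in> dl" "k2 \<in> dl" "cross k1 k2 \<noteq> 0"
    "shell \<subseteq> {k1, k2, - (k1 + k2), - k1, - k2, k1 + k2}" by (rule shell_frame)
  interpret lattice_frame \<xi> \<eta> k1 k2 using k by unfold_locales
  show ?thesis using eigenfunction_stable[OF assms(3,4)] by blast
qed

end
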